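(* $\mathsf{ITT} + \mathsf{FamCUA}_{\mathcal{U}} \nvdash \mathsf{FE}_{\mathcal{U}}$; that is, function extensionality for the universe is not derivable in $\mathsf{ITT}$ extended with familial categorical univalence.
   Context: $\mathsf{ITT}$ is intensional Martin-Löf type theory with $\Sigma$-types, $\Pi$-types, intensional identity types, binary coproducts, empty and unit types, and one universe $\mathcal{U}$ closed under these, with strict $\beta$-rules for all type formers and strict $\eta$-rules for $\Sigma$, $\Pi$ and unit types. For $f,g:\prod_{a:A}B(a)$, $f\sim g:=\prod_{a:A} f a = g a$. A map is an equivalence if it has a section and a retraction up to homotopy. $\mathsf{FE}_{\mathcal U}$: for every $A:\mathcal U$, $B:A\to\mathcal U$ and $f,g:\prod_{a:A}B(a)$, the canonical map $(f=g)\to(f\sim g)$ is an equivalence. For $I:\mathcal U$, $\mathcal U^I$ is the wild category with objects $A:I\to\mathcal U$, morphisms $\prod_{i:I}A(i)\to B(i)$, pointwise composition and identities; $A\cong_{\mathcal U^I}B$ is the type of morphisms $f$ together with $s$, a path $f\circ s=\mathrm{id}$, $r$, and a path $r\circ f=\mathrm{id}$. $\mathsf{FamCUA}_{\mathcal U}$: for all $I:\mathcal U$ and $A,B:I\to\mathcal U$, the map $(A=B)\to(A\cong_{\mathcal U^I}B)$ sending $\mathrm{refl}$ to the identity isomorphism is an equivalence. *)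

theory Defs
  imports Main
begin

section \<open>Raw syntax\<close>

text \<open>
  Raw types and terms share one syntax, since the universe is a la Russell: an element
  of \<^verbatim>\<open>Univ\<close> is itself a type. Variables are de Bruijn indices. Terms carry all
  their type annotations, so \<^verbatim>\<open>App A B f a\<close> is the application of
  \<open>f : \<Prod>(x:A). B x\<close> to \<open>a : A\<close>. The following arguments bind variables:

  \<^item> \<open>B\<close> in \<^verbatim>\<open>Pi A B\<close>, \<^verbatim>\<open>Sig A B\<close> and in every annotation \<open>A B\<close>
    of \<^verbatim>\<open>Lam\<close>, \<^verbatim>\<open>App\<close>, \<^verbatim>\<open>MkPair\<close>, \<^verbatim>\<open>Proj1\<close>, \<^verbatim>\<open>Proj2\<close>: one variable;
    \<open>t\<close> in \<^verbatim>\<open>Lam A B t\<close>: one variable;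
  \<^item> \<open>C\<close> in \<^verbatim>\<open>Abort C t\<close>, and \<open>C\<close>, \<open>l\<close>, \<open>r\<close> in
    \<^verbatim>\<open>Cases A B C l r s\<close>: one variable (\<open>A\<close> and \<open>B\<close> are the two summands);
  \<^item> in \<^verbatim>\<open>J A C d a b p\<close>, the motive \<open>C\<close> binds \<open>x : A\<close>, \<open>y : A\<close>,
    \<open>q : x = y\<close> (indices 2, 1, 0), and \<open>d\<close> binds \<open>x : A\<close>.

  \<^verbatim>\<open>Axm A\<close> is a constant postulated to inhabit the closed type \<open>A\<close>.
\<close>

datatype tm =
    Var nat
  | Axm tm
  | Univ
  | Pi tm tm | Lam tm tm tm | App tm tm tm tm
  | Sig tm tm | MkPair tm tm tm tm | Proj1 tm tm tm | Proj2 tm tm tm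
  | One | Star
  | Zero | Abort tm tm
  | Plus tm tm | InL tm tm tm | InR tm tm tm | Cases tm tm tm tm tm tm
  | Eq tm tm tm | Refl tm tm | J tm tm tm tm tm tm

definition upr :: "(nat \<Rightarrow> nat) \<Rightarrow> nat \<Rightarrow> nat" where
  "upr r = case_nat 0 (\<lambda>n. Suc (r n))"

primrec ren :: "(nat \<Rightarrow> nat) \<Rightarrow> tm \<Rightarrow> tm" where
  "ren r (Var n) = Var (r n)"
| "ren r (Axm A) = Axm A"
| "ren r Univ = Univ"
| "ren r (Pi A B) = Pi (ren r A) (ren (upr r) B)"
| "ren r (Lam A B t) = Lam (ren r A) (ren (upr r) B) (ren (upr r) t)"
| "ren r (App A B f a) = App (ren r A) (ren (upr r) B) (ren r f) (ren r a)"
| "ren r (Sig A B) = Sig (ren r A) (ren (upr r) B)"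
| "ren r (MkPair A B a b) = MkPair (ren r A) (ren (upr r) B) (ren r a) (ren r b)"
| "ren r (Proj1 A B p) = Proj1 (ren r A) (ren (upr r) B) (ren r p)"
| "ren r (Proj2 A B p) = Proj2 (ren r A) (ren (upr r) B) (ren r p)"
| "ren r One = One"
| "ren r Star = Star"
| "ren r Zero = Zero"
| "ren r (Abort C t) = Abort (ren (upr r) C) (ren r t)"
| "ren r (Plus A B) = Plus (ren r A) (ren r B)"
| "ren r (InL A B a) = InL (ren r A) (ren r B) (ren r a)"
| "ren r (InR A B b) = InR (ren r A) (ren r B) (ren r b)"
| "ren r (Cases A B C c d s) =
     Cases (ren r A) (ren r B) (ren (upr r) C) (ren (upr r) c) (ren (upr r) d) (ren r s)"
| "ren r (Eq A a b) = Eq (ren r A) (ren r a) (ren r b)"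
| "ren r (Refl A a) = Refl (ren r A) (ren r a)"
| "ren r (J A C d a b p) =
     J (ren r A) (ren (upr (upr (upr r))) C) (ren (upr r) d) (ren r a) (ren r b) (ren r p)"

text \<open>Weakening; \<open>wk1\<close> weakens underneath one bound variable.\<close>

abbreviation wk :: "tm \<Rightarrow> tm" where "wk \<equiv> ren Suc"
abbreviation wk1 :: "tm \<Rightarrow> tm" where "wk1 \<equiv> ren (upr Suc)"

definition ups :: "(nat \<Rightarrow> tm) \<Rightarrow> nat \<Rightarrow> tm" where
  "ups s = case_nat (Var 0) (\<lambda>n. wk (s n))"

primrec sub :: "(nat \<Rightarrow> tm) \<Rightarrow> tm \<Rightarrow> tm" where
  "sub s (Var n) = s n"
| "sub s (Axm A) = Axm A"
| "sub s Univ = Univ"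
| "sub s (Pi A B) = Pi (sub s A) (sub (ups s) B)"
| "sub s (Lam A B t) = Lam (sub s A) (sub (ups s) B) (sub (ups s) t)"
| "sub s (App A B f a) = App (sub s A) (sub (ups s) B) (sub s f) (sub s a)"
| "sub s (Sig A B) = Sig (sub s A) (sub (ups s) B)"
| "sub s (MkPair A B a b) = MkPair (sub s A) (sub (ups s) B) (sub s a) (sub s b)"
| "sub s (Proj1 A B p) = Proj1 (sub s A) (sub (ups s) B) (sub s p)"
| "sub s (Proj2 A B p) = Proj2 (sub s A) (sub (ups s) B) (sub s p)"
| "sub s One = One"
| "sub s Star = Star"
| "sub s Zero = Zero"
| "sub s (Abort C t) = Abort (sub (ups s) C) (sub s t)"
| "sub s (Plus A B) = Plus (sub s A) (sub s B)"
| "sub s (InL A B a) = InL (sub s A) (sub s B) (sub s a)"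
| "sub s (InR A B b) = InR (sub s A) (sub s B) (sub s b)"
| "sub s (Cases A B C c d u) =
     Cases (sub s A) (sub s B) (sub (ups s) C) (sub (ups s) c) (sub (ups s) d) (sub s u)"
| "sub s (Eq A a b) = Eq (sub s A) (sub s a) (sub s b)"
| "sub s (Refl A a) = Refl (sub s A) (sub s a)"
| "sub s (J A C d a b p) =
     J (sub s A) (sub (ups (ups (ups s))) C) (sub (ups s) d) (sub s a) (sub s b) (sub s p)"

text \<open>
  \<open>inst t a\<close> is \<open>t[a/x]\<close> in the ambient context. \<open>inst' t a\<close> replaces the last
  variable \<open>z\<close> of \<open>t\<close> by a term \<open>a\<close> that may use a new last variable \<open>x\<close>.
  \<open>inst3\<close> and \<open>instd\<close> give the types \<open>C[a,b,p/x,y,q]\<close> and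
  \<open>C[x,x,refl x/x,y,q]\<close> of \<open>J\<close> and of its base case.
\<close>

definition inst :: "tm \<Rightarrow> tm \<Rightarrow> tm" where
  "inst t a = sub (case_nat a Var) t"

definition inst' :: "tm \<Rightarrow> tm \<Rightarrow> tm" where
  "inst' t a = sub (case_nat a (\<lambda>n. Var (Suc n))) t"

definition inst3 :: "tm \<Rightarrow> tm \<Rightarrow> tm \<Rightarrow> tm \<Rightarrow> tm" where
  "inst3 C a b p = sub (case_nat p (case_nat b (case_nat a Var))) C"

definition instd :: "tm \<Rightarrow> tm \<Rightarrow> tm" where
  "instd A C = sub (case_nat (Refl (wk A) (Var 0))
     (case_nat (Var 0) (case_nat (Var 0) (\<lambda>n. Var (Suc n))))) C"

section \<open>The theory ITT, extended by a set of axioms\<close>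

text \<open>
  Contexts are lists of types, last declared variable first. The parameter \<open>T\<close> is the set
  of closed types that are postulated to be inhabited; ITT itself is the case \<open>T = {}\<close>.
  Some rules have redundant presuppositions among their premises.
\<close>

inductive
  is_ctx :: "tm set \<Rightarrow> tm list \<Rightarrow> bool"  ("(_ \<rhd> _ \<turnstile> ctx)" [51,51] 50) and
  is_ty :: "tm set \<Rightarrow> tm list \<Rightarrow> tm \<Rightarrow> bool"  ("(_ \<rhd> _ \<turnstile> _ type)" [51,51,51] 50) and
  eq_ty :: "tm set \<Rightarrow> tm list \<Rightarrow> tm \<Rightarrow> tm \<Rightarrow> bool"
    ("(_ \<rhd> _ \<turnstile> _ \<doteq> _ type)" [51,51,51,51] 50) and
  has_ty :: "tm set \<Rightarrow> tm list \<Rightarrow> tm \<Rightarrow> tm \<Rightarrow> bool"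
    ("(_ \<rhd> _ \<turnstile> _ \<Colon> _)" [51,51,51,51] 50) and
  eq_tm :: "tm set \<Rightarrow> tm list \<Rightarrow> tm \<Rightarrow> tm \<Rightarrow> tm \<Rightarrow> bool"
    ("(_ \<rhd> _ \<turnstile> _ \<doteq> _ \<Colon> _)" [51,51,51,51,51] 50)
  for T :: "tm set"
where
  ctx_nil: "T \<rhd> [] \<turnstile> ctx"
| ctx_cons: "T \<rhd> G \<turnstile> ctx \<Longrightarrow> T \<rhd> G \<turnstile> A type \<Longrightarrow> T \<rhd> A # G \<turnstile> ctx"
| var: "T \<rhd> G \<turnstile> ctx \<Longrightarrow> i < length G \<Longrightarrow>
    T \<rhd> G \<turnstile> Var i \<Colon> ren (\<lambda>n. n + Suc i) (G ! i)"
| axm: "T \<rhd> G \<turnstile> ctx \<Longrightarrow> A \<in> T \<Longrightarrow> T \<rhd> [] \<turnstile> A type \<Longrightarrow> T \<rhd> G \<turnstile> Axm A \<Colon> A"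
| ty_refl: "T \<rhd> G \<turnstile> A type \<Longrightarrow> T \<rhd> G \<turnstile> A \<doteq> A type"
| ty_sym: "T \<rhd> G \<turnstile> A \<doteq> B type \<Longrightarrow> T \<rhd> G \<turnstile> B \<doteq> A type"
| ty_trans: "T \<rhd> G \<turnstile> A \<doteq> B type \<Longrightarrow> T \<rhd> G \<turnstile> B \<doteq> C type \<Longrightarrow> T \<rhd> G \<turnstile> A \<doteq> C type"
| tm_refl: "T \<rhd> G \<turnstile> a \<Colon> A \<Longrightarrow> T \<rhd> G \<turnstile> a \<doteq> a \<Colon> A"
| tm_sym: "T \<rhd> G \<turnstile> a \<doteq> b \<Colon> A \<Longrightarrow> T \<rhd> G \<turnstile> b \<doteq> a \<Colon> A"
| tm_trans: "T \<rhd> G \<turnstile> a \<doteq> b \<Colon> A \<Longrightarrow> T \<rhd> G \<turnstile> b \<doteq> c \<Colon> A \<Longrightarrow> T \<rhd> G \<turnstile> a \<doteq> c \<Colon> A"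
| conv: "T \<rhd> G \<turnstile> a \<Colon> A \<Longrightarrow> T \<rhd> G \<turnstile> A \<doteq> B type \<Longrightarrow> T \<rhd> G \<turnstile> a \<Colon> B"
| eq_conv: "T \<rhd> G \<turnstile> a \<doteq> b \<Colon> A \<Longrightarrow> T \<rhd> G \<turnstile> A \<doteq> B type \<Longrightarrow> T \<rhd> G \<turnstile> a \<doteq> b \<Colon> B"
| univ_ty: "T \<rhd> G \<turnstile> ctx \<Longrightarrow> T \<rhd> G \<turnstile> Univ type"
| el_ty: "T \<rhd> G \<turnstile> A \<Colon> Univ \<Longrightarrow> T \<rhd> G \<turnstile> A type"
| el_eq: "T \<rhd> G \<turnstile> A \<doteq> B \<Colon> Univ \<Longrightarrow> T \<rhd> G \<turnstile> A \<doteq> B type"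
| pi_ty: "T \<rhd> G \<turnstile> A type \<Longrightarrow> T \<rhd> A # G \<turnstile> B type \<Longrightarrow> T \<rhd> G \<turnstile> Pi A B type"
| pi_u: "T \<rhd> G \<turnstile> A \<Colon> Univ \<Longrightarrow> T \<rhd> A # G \<turnstile> B \<Colon> Univ \<Longrightarrow> T \<rhd> G \<turnstile> Pi A B \<Colon> Univ"
| lam: "T \<rhd> G \<turnstile> A type \<Longrightarrow> T \<rhd> A # G \<turnstile> B type \<Longrightarrow> T \<rhd> A # G \<turnstile> t \<Colon> B \<Longrightarrow>
    T \<rhd> G \<turnstile> Lam A B t \<Colon> Pi A B"
| app: "T \<rhd> G \<turnstile> A type \<Longrightarrow> T \<rhd> A # G \<turnstile> B type \<Longrightarrow> T \<rhd> G \<turnstile> f \<Colon> Pi A B \<Longrightarrow>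
    T \<rhd> G \<turnstile> a \<Colon> A \<Longrightarrow> T \<rhd> G \<turnstile> App A B f a \<Colon> inst B a"
| pi_ty_cong: "T \<rhd> G \<turnstile> A type \<Longrightarrow> T \<rhd> G \<turnstile> A \<doteq> A' type \<Longrightarrow> T \<rhd> A # G \<turnstile> B \<doteq> B' type \<Longrightarrow>
    T \<rhd> G \<turnstile> Pi A B \<doteq> Pi A' B' type"
| pi_u_cong: "T \<rhd> G \<turnstile> A \<Colon> Univ \<Longrightarrow> T \<rhd> G \<turnstile> A \<doteq> A' \<Colon> Univ \<Longrightarrow> T \<rhd> A # G \<turnstile> B \<doteq> B' \<Colon> Univ \<Longrightarrow>
    T \<rhd> G \<turnstile> Pi A B \<doteq> Pi A' B' \<Colon> Univ"
| lam_cong: "T \<rhd> G \<turnstile> A type \<Longrightarrow> T \<rhd> G \<turnstile> A \<doteq> A' type \<Longrightarrow> T \<rhd> A # G \<turnstile> B \<doteq> B' type \<Longrightarrow>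
    T \<rhd> A # G \<turnstile> t \<doteq> t' \<Colon> B \<Longrightarrow> T \<rhd> G \<turnstile> Lam A B t \<doteq> Lam A' B' t' \<Colon> Pi A B"
| app_cong: "T \<rhd> G \<turnstile> A type \<Longrightarrow> T \<rhd> G \<turnstile> A \<doteq> A' type \<Longrightarrow> T \<rhd> A # G \<turnstile> B \<doteq> B' type \<Longrightarrow>
    T \<rhd> G \<turnstile> f \<doteq> f' \<Colon> Pi A B \<Longrightarrow> T \<rhd> G \<turnstile> a \<doteq> a' \<Colon> A \<Longrightarrow>
    T \<rhd> G \<turnstile> App A B f a \<doteq> App A' B' f' a' \<Colon> inst B a"
| pi_beta: "T \<rhd> G \<turnstile> A type \<Longrightarrow> T \<rhd> A # G \<turnstile> B type \<Longrightarrow> T \<rhd> A # G \<turnstile> t \<Colon> B \<Longrightarrow> T \<rhd> G \<turnstile> a \<Colon> A \<Longrightarrow>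
    T \<rhd> G \<turnstile> App A B (Lam A B t) a \<doteq> inst t a \<Colon> inst B a"
| pi_eta: "T \<rhd> G \<turnstile> A type \<Longrightarrow> T \<rhd> A # G \<turnstile> B type \<Longrightarrow> T \<rhd> G \<turnstile> f \<Colon> Pi A B \<Longrightarrow>
    T \<rhd> G \<turnstile> f \<doteq> Lam A B (App (wk A) (wk1 B) (wk f) (Var 0)) \<Colon> Pi A B"
| sig_ty: "T \<rhd> G \<turnstile> A type \<Longrightarrow> T \<rhd> A # G \<turnstile> B type \<Longrightarrow> T \<rhd> G \<turnstile> Sig A B type"
| sig_u: "T \<rhd> G \<turnstile> A \<Colon> Univ \<Longrightarrow> T \<rhd> A # G \<turnstile> B \<Colon> Univ \<Longrightarrow> T \<rhd> G \<turnstile> Sig A B \<Colon> Univ"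
| mkpair: "T \<rhd> G \<turnstile> A type \<Longrightarrow> T \<rhd> A # G \<turnstile> B type \<Longrightarrow> T \<rhd> G \<turnstile> a \<Colon> A \<Longrightarrow> T \<rhd> G \<turnstile> b \<Colon> inst B a \<Longrightarrow>
    T \<rhd> G \<turnstile> MkPair A B a b \<Colon> Sig A B"
| proj1: "T \<rhd> G \<turnstile> A type \<Longrightarrow> T \<rhd> A # G \<turnstile> B type \<Longrightarrow> T \<rhd> G \<turnstile> p \<Colon> Sig A B \<Longrightarrow>
    T \<rhd> G \<turnstile> Proj1 A B p \<Colon> A"
| proj2: "T \<rhd> G \<turnstile> A type \<Longrightarrow> T \<rhd> A # G \<turnstile> B type \<Longrightarrow> T \<rhd> G \<turnstile> p \<Colon> Sig A B \<Longrightarrow>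
    T \<rhd> G \<turnstile> Proj2 A B p \<Colon> inst B (Proj1 A B p)"
| sig_ty_cong: "T \<rhd> G \<turnstile> A type \<Longrightarrow> T \<rhd> G \<turnstile> A \<doteq> A' type \<Longrightarrow> T \<rhd> A # G \<turnstile> B \<doteq> B' type \<Longrightarrow>
    T \<rhd> G \<turnstile> Sig A B \<doteq> Sig A' B' type"
| sig_u_cong: "T \<rhd> G \<turnstile> A \<Colon> Univ \<Longrightarrow> T \<rhd> G \<turnstile> A \<doteq> A' \<Colon> Univ \<Longrightarrow> T \<rhd> A # G \<turnstile> B \<doteq> B' \<Colon> Univ \<Longrightarrow>
    T \<rhd> G \<turnstile> Sig A B \<doteq> Sig A' B' \<Colon> Univ"
| mkpair_cong: "T \<rhd> G \<turnstile> A type \<Longrightarrow> T \<rhd> G \<turnstile> A \<doteq> A' type \<Longrightarrow> T \<rhd> A # G \<turnstile> B \<doteq> B' type \<Longrightarrow>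
    T \<rhd> G \<turnstile> a \<doteq> a' \<Colon> A \<Longrightarrow> T \<rhd> G \<turnstile> b \<doteq> b' \<Colon> inst B a \<Longrightarrow>
    T \<rhd> G \<turnstile> MkPair A B a b \<doteq> MkPair A' B' a' b' \<Colon> Sig A B"
| proj1_cong: "T \<rhd> G \<turnstile> A type \<Longrightarrow> T \<rhd> G \<turnstile> A \<doteq> A' type \<Longrightarrow> T \<rhd> A # G \<turnstile> B \<doteq> B' type \<Longrightarrow>
    T \<rhd> G \<turnstile> p \<doteq> p' \<Colon> Sig A B \<Longrightarrow> T \<rhd> G \<turnstile> Proj1 A B p \<doteq> Proj1 A' B' p' \<Colon> A"
| proj2_cong: "T \<rhd> G \<turnstile> A type \<Longrightarrow> T \<rhd> G \<turnstile> A \<doteq> A' type \<Longrightarrow> T \<rhd> A # G \<turnstile> B \<doteq> B' type \<Longrightarrow>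
    T \<rhd> G \<turnstile> p \<doteq> p' \<Colon> Sig A B \<Longrightarrow>
    T \<rhd> G \<turnstile> Proj2 A B p \<doteq> Proj2 A' B' p' \<Colon> inst B (Proj1 A B p)"
| sig_beta1: "T \<rhd> G \<turnstile> A type \<Longrightarrow> T \<rhd> A # G \<turnstile> B type \<Longrightarrow> T \<rhd> G \<turnstile> a \<Colon> A \<Longrightarrow> T \<rhd> G \<turnstile> b \<Colon> inst B a \<Longrightarrow>
    T \<rhd> G \<turnstile> Proj1 A B (MkPair A B a b) \<doteq> a \<Colon> A"
| sig_beta2: "T \<rhd> G \<turnstile> A type \<Longrightarrow> T \<rhd> A # G \<turnstile> B type \<Longrightarrow> T \<rhd> G \<turnstile> a \<Colon> A \<Longrightarrow> T \<rhd> G \<turnstile> b \<Colon> inst B a \<Longrightarrow>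
    T \<rhd> G \<turnstile> Proj2 A B (MkPair A B a b) \<doteq> b \<Colon> inst B a"
| sig_eta: "T \<rhd> G \<turnstile> A type \<Longrightarrow> T \<rhd> A # G \<turnstile> B type \<Longrightarrow> T \<rhd> G \<turnstile> p \<Colon> Sig A B \<Longrightarrow>
    T \<rhd> G \<turnstile> p \<doteq> MkPair A B (Proj1 A B p) (Proj2 A B p) \<Colon> Sig A B"
| one_ty: "T \<rhd> G \<turnstile> ctx \<Longrightarrow> T \<rhd> G \<turnstile> One type"
| one_u: "T \<rhd> G \<turnstile> ctx \<Longrightarrow> T \<rhd> G \<turnstile> One \<Colon> Univ"
| star: "T \<rhd> G \<turnstile> ctx \<Longrightarrow> T \<rhd> G \<turnstile> Star \<Colon> One"
| one_eta: "T \<rhd> G \<turnstile> t \<Colon> One \<Longrightarrow> T \<rhd> G \<turnstile> t \<doteq> Star \<Colon> One"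
| zero_ty: "T \<rhd> G \<turnstile> ctx \<Longrightarrow> T \<rhd> G \<turnstile> Zero type"
| zero_u: "T \<rhd> G \<turnstile> ctx \<Longrightarrow> T \<rhd> G \<turnstile> Zero \<Colon> Univ"
| abort: "T \<rhd> Zero # G \<turnstile> C type \<Longrightarrow> T \<rhd> G \<turnstile> t \<Colon> Zero \<Longrightarrow> T \<rhd> G \<turnstile> Abort C t \<Colon> inst C t"
| abort_cong: "T \<rhd> Zero # G \<turnstile> C \<doteq> C' type \<Longrightarrow> T \<rhd> G \<turnstile> t \<doteq> t' \<Colon> Zero \<Longrightarrow>
    T \<rhd> G \<turnstile> Abort C t \<doteq> Abort C' t' \<Colon> inst C t"
| plus_ty: "T \<rhd> G \<turnstile> A type \<Longrightarrow> T \<rhd> G \<turnstile> B type \<Longrightarrow> T \<rhd> G \<turnstile> Plus A B type"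
| plus_u: "T \<rhd> G \<turnstile> A \<Colon> Univ \<Longrightarrow> T \<rhd> G \<turnstile> B \<Colon> Univ \<Longrightarrow> T \<rhd> G \<turnstile> Plus A B \<Colon> Univ"
| inl: "T \<rhd> G \<turnstile> A type \<Longrightarrow> T \<rhd> G \<turnstile> B type \<Longrightarrow> T \<rhd> G \<turnstile> a \<Colon> A \<Longrightarrow> T \<rhd> G \<turnstile> InL A B a \<Colon> Plus A B"
| inr: "T \<rhd> G \<turnstile> A type \<Longrightarrow> T \<rhd> G \<turnstile> B type \<Longrightarrow> T \<rhd> G \<turnstile> b \<Colon> B \<Longrightarrow> T \<rhd> G \<turnstile> InR A B b \<Colon> Plus A B"
| cases: "T \<rhd> G \<turnstile> A type \<Longrightarrow> T \<rhd> G \<turnstile> B type \<Longrightarrow> T \<rhd> Plus A B # G \<turnstile> C type \<Longrightarrow>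
    T \<rhd> A # G \<turnstile> l \<Colon> inst' C (InL (wk A) (wk B) (Var 0)) \<Longrightarrow>
    T \<rhd> B # G \<turnstile> r \<Colon> inst' C (InR (wk A) (wk B) (Var 0)) \<Longrightarrow>
    T \<rhd> G \<turnstile> s \<Colon> Plus A B \<Longrightarrow> T \<rhd> G \<turnstile> Cases A B C l r s \<Colon> inst C s"
| plus_ty_cong: "T \<rhd> G \<turnstile> A \<doteq> A' type \<Longrightarrow> T \<rhd> G \<turnstile> B \<doteq> B' type \<Longrightarrow>
    T \<rhd> G \<turnstile> Plus A B \<doteq> Plus A' B' type"
| plus_u_cong: "T \<rhd> G \<turnstile> A \<doteq> A' \<Colon> Univ \<Longrightarrow> T \<rhd> G \<turnstile> B \<doteq> B' \<Colon> Univ \<Longrightarrow>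
    T \<rhd> G \<turnstile> Plus A B \<doteq> Plus A' B' \<Colon> Univ"
| inl_cong: "T \<rhd> G \<turnstile> A \<doteq> A' type \<Longrightarrow> T \<rhd> G \<turnstile> B \<doteq> B' type \<Longrightarrow> T \<rhd> G \<turnstile> a \<doteq> a' \<Colon> A \<Longrightarrow>
    T \<rhd> G \<turnstile> InL A B a \<doteq> InL A' B' a' \<Colon> Plus A B"
| inr_cong: "T \<rhd> G \<turnstile> A \<doteq> A' type \<Longrightarrow> T \<rhd> G \<turnstile> B \<doteq> B' type \<Longrightarrow> T \<rhd> G \<turnstile> b \<doteq> b' \<Colon> B \<Longrightarrow>
    T \<rhd> G \<turnstile> InR A B b \<doteq> InR A' B' b' \<Colon> Plus A B"
| cases_cong: "T \<rhd> G \<turnstile> A type \<Longrightarrow> T \<rhd> G \<turnstile> B type \<Longrightarrow>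
    T \<rhd> G \<turnstile> A \<doteq> A' type \<Longrightarrow> T \<rhd> G \<turnstile> B \<doteq> B' type \<Longrightarrow> T \<rhd> Plus A B # G \<turnstile> C \<doteq> C' type \<Longrightarrow>
    T \<rhd> A # G \<turnstile> l \<doteq> l' \<Colon> inst' C (InL (wk A) (wk B) (Var 0)) \<Longrightarrow>
    T \<rhd> B # G \<turnstile> r \<doteq> r' \<Colon> inst' C (InR (wk A) (wk B) (Var 0)) \<Longrightarrow>
    T \<rhd> G \<turnstile> s \<doteq> s' \<Colon> Plus A B \<Longrightarrow>
    T \<rhd> G \<turnstile> Cases A B C l r s \<doteq> Cases A' B' C' l' r' s' \<Colon> inst C s"
| plus_beta1: "T \<rhd> G \<turnstile> A type \<Longrightarrow> T \<rhd> G \<turnstile> B type \<Longrightarrow> T \<rhd> Plus A B # G \<turnstile> C type \<Longrightarrow>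
    T \<rhd> A # G \<turnstile> l \<Colon> inst' C (InL (wk A) (wk B) (Var 0)) \<Longrightarrow>
    T \<rhd> B # G \<turnstile> r \<Colon> inst' C (InR (wk A) (wk B) (Var 0)) \<Longrightarrow> T \<rhd> G \<turnstile> a \<Colon> A \<Longrightarrow>
    T \<rhd> G \<turnstile> Cases A B C l r (InL A B a) \<doteq> inst l a \<Colon> inst C (InL A B a)"
| plus_beta2: "T \<rhd> G \<turnstile> A type \<Longrightarrow> T \<rhd> G \<turnstile> B type \<Longrightarrow> T \<rhd> Plus A B # G \<turnstile> C type \<Longrightarrow>
    T \<rhd> A # G \<turnstile> l \<Colon> inst' C (InL (wk A) (wk B) (Var 0)) \<Longrightarrow>
    T \<rhd> B # G \<turnstile> r \<Colon> inst' C (InR (wk A) (wk B) (Var 0)) \<Longrightarrow> T \<rhd> G \<turnstile> b \<Colon> B \<Longrightarrow>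
    T \<rhd> G \<turnstile> Cases A B C l r (InR A B b) \<doteq> inst r b \<Colon> inst C (InR A B b)"
| id_ty: "T \<rhd> G \<turnstile> A type \<Longrightarrow> T \<rhd> G \<turnstile> a \<Colon> A \<Longrightarrow> T \<rhd> G \<turnstile> b \<Colon> A \<Longrightarrow> T \<rhd> G \<turnstile> Eq A a b type"
| id_u: "T \<rhd> G \<turnstile> A \<Colon> Univ \<Longrightarrow> T \<rhd> G \<turnstile> a \<Colon> A \<Longrightarrow> T \<rhd> G \<turnstile> b \<Colon> A \<Longrightarrow> T \<rhd> G \<turnstile> Eq A a b \<Colon> Univ"
| rfl: "T \<rhd> G \<turnstile> A type \<Longrightarrow> T \<rhd> G \<turnstile> a \<Colon> A \<Longrightarrow> T \<rhd> G \<turnstile> Refl A a \<Colon> Eq A a a"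
| jay: "T \<rhd> G \<turnstile> A type \<Longrightarrow>
    T \<rhd> Eq (wk (wk A)) (Var 1) (Var 0) # wk A # A # G \<turnstile> C type \<Longrightarrow>
    T \<rhd> A # G \<turnstile> d \<Colon> instd A C \<Longrightarrow>
    T \<rhd> G \<turnstile> a \<Colon> A \<Longrightarrow> T \<rhd> G \<turnstile> b \<Colon> A \<Longrightarrow> T \<rhd> G \<turnstile> p \<Colon> Eq A a b \<Longrightarrow>
    T \<rhd> G \<turnstile> J A C d a b p \<Colon> inst3 C a b p"
| id_ty_cong: "T \<rhd> G \<turnstile> A \<doteq> A' type \<Longrightarrow> T \<rhd> G \<turnstile> a \<doteq> a' \<Colon> A \<Longrightarrow> T \<rhd> G \<turnstile> b \<doteq> b' \<Colon> A \<Longrightarrow>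
    T \<rhd> G \<turnstile> Eq A a b \<doteq> Eq A' a' b' type"
| id_u_cong: "T \<rhd> G \<turnstile> A \<doteq> A' \<Colon> Univ \<Longrightarrow> T \<rhd> G \<turnstile> a \<doteq> a' \<Colon> A \<Longrightarrow> T \<rhd> G \<turnstile> b \<doteq> b' \<Colon> A \<Longrightarrow>
    T \<rhd> G \<turnstile> Eq A a b \<doteq> Eq A' a' b' \<Colon> Univ"
| rfl_cong: "T \<rhd> G \<turnstile> A \<doteq> A' type \<Longrightarrow> T \<rhd> G \<turnstile> a \<doteq> a' \<Colon> A \<Longrightarrow>
    T \<rhd> G \<turnstile> Refl A a \<doteq> Refl A' a' \<Colon> Eq A a a"
| jay_cong: "T \<rhd> G \<turnstile> A type \<Longrightarrow> T \<rhd> G \<turnstile> A \<doteq> A' type \<Longrightarrow>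
    T \<rhd> Eq (wk (wk A)) (Var 1) (Var 0) # wk A # A # G \<turnstile> C \<doteq> C' type \<Longrightarrow>
    T \<rhd> A # G \<turnstile> d \<doteq> d' \<Colon> instd A C \<Longrightarrow>
    T \<rhd> G \<turnstile> a \<doteq> a' \<Colon> A \<Longrightarrow> T \<rhd> G \<turnstile> b \<doteq> b' \<Colon> A \<Longrightarrow> T \<rhd> G \<turnstile> p \<doteq> p' \<Colon> Eq A a b \<Longrightarrow>
    T \<rhd> G \<turnstile> J A C d a b p \<doteq> J A' C' d' a' b' p' \<Colon> inst3 C a b p"
| jay_beta: "T \<rhd> G \<turnstile> A type \<Longrightarrow>
    T \<rhd> Eq (wk (wk A)) (Var 1) (Var 0) # wk A # A # G \<turnstile> C type \<Longrightarrow>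
    T \<rhd> A # G \<turnstile> d \<Colon> instd A C \<Longrightarrow> T \<rhd> G \<turnstile> a \<Colon> A \<Longrightarrow>
    T \<rhd> G \<turnstile> J A C d a a (Refl A a) \<doteq> inst d a \<Colon> inst3 C a a (Refl A a)"

definition provable :: "tm set \<Rightarrow> tm \<Rightarrow> bool" where
  "provable T A \<longleftrightarrow> (\<exists>t. T \<rhd> [] \<turnstile> t \<Colon> A)"

section \<open>Functions, homotopies and equivalences\<close>

abbreviation arr :: "tm \<Rightarrow> tm \<Rightarrow> tm" where "arr A B \<equiv> Pi A (wk B)"
abbreviation ap :: "tm \<Rightarrow> tm \<Rightarrow> tm \<Rightarrow> tm \<Rightarrow> tm" where "ap A B f a \<equiv> App A (wk B) f a"
abbreviation times :: "tm \<Rightarrow> tm \<Rightarrow> tm" where "times A B \<equiv> Sig A (wk B)"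

definition idfun :: "tm \<Rightarrow> tm" where
  "idfun A = Lam A (wk A) (Var 0)"

text \<open>\<open>comp A B C g f\<close> is \<open>g \<circ> f\<close> for \<open>f : A \<rightarrow> B\<close> and \<open>g : B \<rightarrow> C\<close>.\<close>

definition comp :: "tm \<Rightarrow> tm \<Rightarrow> tm \<Rightarrow> tm \<Rightarrow> tm \<Rightarrow> tm" where
  "comp A B C g f = Lam A (wk C) (ap (wk B) (wk C) (wk g) (ap (wk A) (wk B) (wk f) (Var 0)))"

text \<open>
  \<open>htpy A B f g\<close> is \<open>f \<sim> g\<close> for \<open>f, g : \<Prod>(a:A). B a\<close>, where \<open>B\<close> is a type in one
  more variable. The type \<open>B\<close> in the body is \<open>inst (wk1 B) (Var 0)\<close>, the type of
  \<open>f a\<close> for the bound variable \<open>a\<close>.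
\<close>

definition htpy :: "tm \<Rightarrow> tm \<Rightarrow> tm \<Rightarrow> tm \<Rightarrow> tm" where
  "htpy A B f g =
     Pi A (Eq B (App (wk A) (wk1 B) (wk f) (Var 0)) (App (wk A) (wk1 B) (wk g) (Var 0)))"

text \<open>\<open>f : A \<rightarrow> B\<close> is an equivalence if \<open>(\<Sum>s. f \<circ> s \<sim> id) \<times> (\<Sum>r. r \<circ> f \<sim> id)\<close>.\<close>

definition is_equiv :: "tm \<Rightarrow> tm \<Rightarrow> tm \<Rightarrow> tm" where
  "is_equiv A B f = times
     (Sig (arr B A)
        (htpy (wk B) (wk (wk B)) (comp (wk B) (wk A) (wk B) (wk f) (Var 0)) (idfun (wk B))))
     (Sig (arr B A)
        (htpy (wk A) (wk (wk A)) (comp (wk A) (wk B) (wk A) (Var 0) (wk f)) (idfun (wk A))))"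

section \<open>Function extensionality for the universe\<close>

text \<open>
  The canonical map \<open>(f = g) \<rightarrow> (f \<sim> g)\<close>, by path induction from
  \<open>\<lambda>a. refl (f a) : f \<sim> f\<close>. The motive lives in a context with four further variables
  (the path that is bound by the \<open>\<lambda>\<close>, then \<open>x\<close>, \<open>y\<close>, \<open>q\<close>).
\<close>

definition happly :: "tm \<Rightarrow> tm \<Rightarrow> tm \<Rightarrow> tm \<Rightarrow> tm" where
  "happly A B f g = Lam (Eq (Pi A B) f g) (wk (htpy A B f g))
     (J (wk (Pi A B))
        (htpy (wk (wk (wk (wk A)))) (wk1 (wk1 (wk1 (wk1 B)))) (Var 2) (Var 1))
        (Lam (wk (wk A))
           (Eq (wk1 (wk1 B))
              (App (wk (wk (wk A))) (wk1 (wk1 (wk1 B))) (Var 1) (Var 0))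
              (App (wk (wk (wk A))) (wk1 (wk1 (wk1 B))) (Var 1) (Var 0)))
           (Refl (wk1 (wk1 B)) (App (wk (wk (wk A))) (wk1 (wk1 (wk1 B))) (Var 1) (Var 0))))
        (wk f) (wk g) (Var 0))"

text \<open>For a family \<open>F : I \<rightarrow> Univ\<close>, the type \<open>F i\<close> in one more variable \<open>i : I\<close>.\<close>

abbreviation fam :: "tm \<Rightarrow> tm \<Rightarrow> tm" where
  "fam I F \<equiv> ap (wk I) Univ (wk F) (Var 0)"

definition FE_U :: tm where
  "FE_U = Pi Univ (Pi (arr (Var 0) Univ)
     (Pi (Pi (Var 1) (fam (Var 1) (Var 0))) (Pi (Pi (Var 2) (fam (Var 2) (Var 1)))
        (let A = Var 3; B = fam (Var 3) (Var 2); f = Var 1; g = Var 0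
         in is_equiv (Eq (Pi A B) f g) (htpy A B f g) (happly A B f g)))))"

section \<open>The wild category of families, and familial categorical univalence\<close>

definition hom :: "tm \<Rightarrow> tm \<Rightarrow> tm \<Rightarrow> tm" where
  "hom I A B = Pi I (arr (fam I A) (fam I B))"

text \<open>The component at \<open>i\<close> of \<open>f : hom I A B\<close>, in one more variable \<open>i : I\<close>.\<close>

abbreviation component :: "tm \<Rightarrow> tm \<Rightarrow> tm \<Rightarrow> tm \<Rightarrow> tm" where
  "component I A B f \<equiv> App (wk I) (wk1 (arr (fam I A) (fam I B))) (wk f) (Var 0)"

definition hom_id :: "tm \<Rightarrow> tm \<Rightarrow> tm" where
  "hom_id I A = Lam I (arr (fam I A) (fam I A)) (idfun (fam I A))"

definition hom_comp :: "tm \<Rightarrow> tm \<Rightarrow> tm \<Rightarrow> tm \<Rightarrow> tm \<Rightarrow> tm \<Rightarrow> tm" where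
  "hom_comp I A B C g f = Lam I (arr (fam I A) (fam I C))
     (comp (fam I A) (fam I B) (fam I C) (component I B C g) (component I A B f))"

text \<open>The type of sections (retractions) of \<open>f : hom I A B\<close>, up to a path.\<close>

definition hom_sec :: "tm \<Rightarrow> tm \<Rightarrow> tm \<Rightarrow> tm \<Rightarrow> tm" where
  "hom_sec I A B f = Sig (hom I B A)
     (Eq (hom (wk I) (wk B) (wk B))
        (hom_comp (wk I) (wk B) (wk A) (wk B) (wk f) (Var 0)) (hom_id (wk I) (wk B)))"

definition hom_ret :: "tm \<Rightarrow> tm \<Rightarrow> tm \<Rightarrow> tm \<Rightarrow> tm" where
  "hom_ret I A B f = Sig (hom I B A)
     (Eq (hom (wk I) (wk A) (wk A))
        (hom_comp (wk I) (wk A) (wk B) (wk A) (Var 0) (wk f)) (hom_id (wk I) (wk A)))"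

definition iso :: "tm \<Rightarrow> tm \<Rightarrow> tm \<Rightarrow> tm" where
  "iso I A B = Sig (hom I A B)
     (times (hom_sec (wk I) (wk A) (wk B) (Var 0)) (hom_ret (wk I) (wk A) (wk B) (Var 0)))"

text \<open>
  The identity isomorphism. Both paths are \<open>refl id\<close>, since \<open>id \<circ> id\<close> is judgmentally
  equal to \<open>id\<close>.
\<close>

definition id_iso :: "tm \<Rightarrow> tm \<Rightarrow> tm" where
  "id_iso I A = (let H = hom I A A; e = hom_id I A; H' = hom (wk I) (wk A) (wk A);
        e' = hom_id (wk I) (wk A)
      in MkPair H
           (times (hom_sec (wk I) (wk A) (wk A) (Var 0)) (hom_ret (wk I) (wk A) (wk A) (Var 0)))
           e
           (MkPair (hom_sec I A A e) (wk (hom_ret I A A e))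
              (MkPair H (Eq H' (hom_comp (wk I) (wk A) (wk A) (wk A) (wk e) (Var 0)) e') e (Refl H e))
              (MkPair H (Eq H' (hom_comp (wk I) (wk A) (wk A) (wk A) (Var 0) (wk e)) e') e (Refl H e))))"

text \<open>The map \<open>(A = B) \<rightarrow> iso I A B\<close> that sends \<open>refl\<close> to the identity isomorphism.\<close>

definition id_to_iso :: "tm \<Rightarrow> tm \<Rightarrow> tm \<Rightarrow> tm" where
  "id_to_iso I A B = Lam (Eq (arr I Univ) A B) (wk (iso I A B))
     (J (wk (arr I Univ))
        (iso (wk (wk (wk (wk I)))) (Var 2) (Var 1))
        (id_iso (wk (wk I)) (Var 0))
        (wk A) (wk B) (Var 0))"

definition FamCUA_U :: tm where
  "FamCUA_U = Pi Univ (Pi (arr (Var 0) Univ) (Pi (arr (Var 1) Univ)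
     (let I = Var 2; A = Var 1; B = Var 0
      in is_equiv (Eq (arr I Univ) A B) (iso I A B) (id_to_iso I A B))))"

end

theory Submission
  imports Defs "HOL-Library.Nat_Bijection"
begin

text \<open>
  The theory is interpreted in a groupoid-like realizability model over the graph model of the untyped
  lambda calculus. A term denotes a pair of an actual value and a dual value, and types and identity
  types depend on actual values only: a path from \<open>f\<close> to \<open>g\<close> is a connection of the actual values.
  Functions, however, act on dual values too, so pointwise paths between \<open>f\<close> and \<open>g\<close> say nothing about how
  the actual part of a function acts on the dual part of its argument. A small type with one actual
  but two dual elements separates the identity from a constant function that is homotopic to it, and
  thereby refutes function extensionality.

  Every small type carries a frame, which is an isomorphism from a type that determines its transport.
  An isomorphism between two families of small types in the wild category, where the composites are
  identities by paths and not by homotopies, is invertible also on dual values. Composing the frame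
  with it yields a path between the families, uniformly in the index; hence familial categorical
  univalence holds.
\<close>

section \<open>A graph model\<close>

text \<open>No isomorphism between types is ever stored. The entries of a clique are linked by
  transport, which a single recursion \<open>ops\<close> computes from the codes alone; a path is
  realized by a clique with two entries, each equal to one of the ends. What has to be built is
  composition: given \<open>a\<close> connected to \<open>b\<close>, and a third object equal to
  \<open>a\<close>, find one that is equal to \<open>b\<close> and connected to the third. In the
  universe this means giving a type the elements of \<open>b\<close> and the transport of another
  type, which is what frames are for. They ask for isomorphisms entry by entry, so the links between
  \<open>a\<close> and \<open>b\<close> may be used even where they do not fit together.

  On the side of univalence the obstacle is the index. A path of families consists of codes, so it
  can only use how an isomorphism acts at indices with trivial dual part, whereas an isomorphism
  acts at all indices. The gap is closed by an order: actual parts lie below dual parts, all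
  operations are monotone, and small types are convex. An ordered model of the lambda calculus
  supplies this monotonicity.\<close>

type_synonym dom = "nat set"

text \<open>Scott continuity for the inclusion order, as approximation by finite sets. Monotonicity
  is contained in it, since a finite witness below \<open>X\<close> also serves every superset of
  \<open>X\<close>.\<close>

definition cont :: "(dom \<Rightarrow> dom) \<Rightarrow> bool" where
  "cont F \<longleftrightarrow> (\<forall>X n. n \<in> F X \<longleftrightarrow> (\<exists>Y. finite Y \<and> Y \<subseteq> X \<and> n \<in> F Y))"

lemma contI:
  assumes "\<And>X Y. X \<subseteq> Y \<Longrightarrow> F X \<subseteq> F Y"
    and "\<And>X n. n \<in> F X \<Longrightarrow> \<exists>Y. finite Y \<and> Y \<subseteq> X \<and> n \<in> F Y"
  shows "cont F"
  unfolding cont_def using assms by blast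

lemma cont_mono: "cont F \<Longrightarrow> X \<subseteq> Y \<Longrightarrow> F X \<subseteq> F Y"
  unfolding cont_def by (meson subset_iff subset_trans)

lemma cont_fin: "cont F \<Longrightarrow> n \<in> F X \<Longrightarrow> \<exists>Y. finite Y \<and> Y \<subseteq> X \<and> n \<in> F Y"
  unfolding cont_def by blast

lemma cont_finE:
  assumes "cont F" "n \<in> F X"
  obtains Y where "finite Y" "Y \<subseteq> X" "n \<in> F Y"
  using cont_fin[OF assms] by (elim exE conjE)

lemma cont_id: "cont (\<lambda>x. x)"
  by (rule contI) (auto intro: exI[of _ "{_}"])

lemma cont_const: "cont (\<lambda>x. c)"
  by (rule contI) auto

lemma cont_comp:
  assumes "cont f" "cont g"
  shows "cont (\<lambda>x. f (g x))"
proof (rule contI)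
  show "f (g X) \<subseteq> f (g Y)" if "X \<subseteq> Y" for X Y
    using cont_mono[OF assms(1) cont_mono[OF assms(2) that]] .
next
  fix X n assume "n \<in> f (g X)"
  then obtain Y where Y: "finite Y" "Y \<subseteq> g X" "n \<in> f Y" by (rule cont_finE[OF assms(1)])
  have "\<exists>Z. finite Z \<and> Z \<subseteq> X \<and> Y \<subseteq> g Z" using Y(1,2)
  proof (induction Y rule: finite_induct)
    case (insert y Y)
    then obtain Z where Z: "finite Z" "Z \<subseteq> X" "Y \<subseteq> g Z" by auto
    obtain Z' where Z': "finite Z'" "Z' \<subseteq> X" "y \<in> g Z'" using insert.prems by (auto elim: cont_finE[OF assms(2)])
    have "finite (Z \<union> Z') \<and> Z \<union> Z' \<subseteq> X \<and> insert y Y \<subseteq> g (Z \<union> Z')"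
      using Z Z' subset_trans[OF Z(3) cont_mono[OF assms(2), of Z "Z \<union> Z'"]]
        subsetD[OF cont_mono[OF assms(2), of Z' "Z \<union> Z'"] Z'(3)] by simp
    then show ?case by blast
  qed auto
  then obtain Z where "finite Z" "Z \<subseteq> X" "Y \<subseteq> g Z" by blast
  then show "\<exists>Y. finite Y \<and> Y \<subseteq> X \<and> n \<in> f (g Y)"
    using subsetD[OF cont_mono[OF assms(1)] Y(3)] by (intro exI[of _ Z]) simp
qed

text \<open>Separate continuity gives joint continuity, as for all Scott continuous maps: the finite
  witnesses of the two arguments are united. Each binary operation can thus be treated one argument
  at a time.\<close>

lemma cont_comp2:
  assumes 1: "\<And>y. cont (\<lambda>x. f x y)" and 2: "\<And>x. cont (\<lambda>y. f x y)" and g: "cont g" and h: "cont h"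
  shows "cont (\<lambda>x. f (g x) (h x))"
proof (rule contI)
  fix X Y :: dom assume "X \<subseteq> Y"
  then show "f (g X) (h X) \<subseteq> f (g Y) (h Y)"
    by (intro subset_trans[OF cont_mono[OF 1] cont_mono[OF 2]] cont_mono[OF g] cont_mono[OF h])
next
  fix X n assume "n \<in> f (g X) (h X)"
  then obtain Y where Y: "finite Y" "Y \<subseteq> X" "n \<in> f (g Y) (h X)"
    by (rule cont_finE[OF cont_comp[OF 1 g]])
  obtain Z where Z: "finite Z" "Z \<subseteq> X" "n \<in> f (g Y) (h Z)"
    by (rule cont_finE[OF cont_comp[OF 2 h] Y(3)])
  have "f (g Y) (h Z) \<subseteq> f (g (Y \<union> Z)) (h Z)"
    by (intro cont_mono[OF 1] cont_mono[OF g]) simp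
  also have "\<dots> \<subseteq> f (g (Y \<union> Z)) (h (Y \<union> Z))"
    by (intro cont_mono[OF 2] cont_mono[OF h]) simp
  finally have "f (g Y) (h Z) \<subseteq> f (g (Y \<union> Z)) (h (Y \<union> Z))" .
  then show "\<exists>Y. finite Y \<and> Y \<subseteq> X \<and> n \<in> f (g Y) (h Y)"
    using Y Z by (intro exI[of _ "Y \<union> Z"]) auto
qed

section \<open>Pairing on sets of numbers\<close>

definition pr :: "dom \<Rightarrow> dom \<Rightarrow> dom" where
  "pr a b = (\<lambda>n. 2 * n) ` a \<union> (\<lambda>n. 2 * n + 1) ` b"
definition p1 :: "dom \<Rightarrow> dom" where "p1 z = {n. 2 * n \<in> z}"
definition p2 :: "dom \<Rightarrow> dom" where "p2 z = {n. 2 * n + 1 \<in> z}"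

lemma p1_pr [simp]: "p1 (pr a b) = a" 
  unfolding p1_def pr_def by (auto simp: image_iff) presburger
lemma p2_pr [simp]: "p2 (pr a b) = b" 
  unfolding p2_def pr_def by (auto simp: image_iff) presburger
text \<open>Every number is even or odd, so pairing is surjective. The strict eta rule for dependent
  sums rests on this, and it allows any set to be read as an actual part with a dual part.\<close>

lemma pr_p [simp]: "pr (p1 z) (p2 z) = z"
proof -
  have "n \<in> pr (p1 z) (p2 z) \<longleftrightarrow> n \<in> z" for n
    unfolding p1_def p2_def pr_def by (cases "even n") (auto elim!: evenE oddE)
  then show ?thesis by blast
qed

lemma pr_inject [simp]: "pr a b = pr c d \<longleftrightarrow> a = c \<and> b = d"
  by (metis p1_pr p2_pr)
lemma dom_eqI: "p1 x = p1 y \<Longrightarrow> p2 x = p2 y \<Longrightarrow> x = y" by (metis pr_p)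
lemma pr_empty [simp]: "pr {} {} = {}" "p1 {} = {}" "p2 {} = {}"
  by (auto simp: pr_def p1_def p2_def)
lemma p_mono: "x \<subseteq> y \<Longrightarrow> p1 x \<subseteq> p1 y" "x \<subseteq> y \<Longrightarrow> p2 x \<subseteq> p2 y"
  by (auto simp: p1_def p2_def)
lemma pr_mono: "a \<subseteq> c \<Longrightarrow> b \<subseteq> d \<Longrightarrow> pr a b \<subseteq> pr c d" by (auto simp: pr_def)
lemma dom_leI: "p1 x \<subseteq> p1 y \<Longrightarrow> p2 x \<subseteq> p2 y \<Longrightarrow> x \<subseteq> y" by (metis pr_p pr_mono)

lemma cont_ptwise: 
  assumes "\<And>X n. n \<in> F X \<longleftrightarrow> k n \<in> X" shows "cont F"
  by (rule contI) (use assms in \<open>auto intro: exI[of _ "{_}"]\<close>)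

lemma cont_p1: "cont g \<Longrightarrow> cont (\<lambda>x. p1 (g x))"
  by (rule cont_comp[of p1], rule cont_ptwise[of _ "\<lambda>n. 2 * n"]) (auto simp: p1_def)
lemma cont_p2: "cont g \<Longrightarrow> cont (\<lambda>x. p2 (g x))"
  by (rule cont_comp[of p2], rule cont_ptwise[of _ "\<lambda>n. 2 * n + 1"]) (auto simp: p2_def)

lemma cont_pr: "cont g \<Longrightarrow> cont h \<Longrightarrow> cont (\<lambda>x. pr (g x) (h x))"
proof (rule cont_comp2[of pr])
  show "cont (\<lambda>x. pr x y)" for y
  proof (rule contI)
    fix X n assume "n \<in> pr X y"
    then consider m where "n = 2 * m" "m \<in> X" | "n \<in> pr {} y" by (auto simp: pr_def)
    then show "\<exists>Y. finite Y \<and> Y \<subseteq> X \<and> n \<in> pr Y y"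
    proof cases
      case 1 then show ?thesis by (intro exI[of _ "{m}"]) (auto simp: pr_def)
    qed (auto intro!: exI[of _ "{}"] simp: pr_def)
  qed (simp add: pr_mono)
  show "cont (\<lambda>y. pr x y)" for x
  proof (rule contI)
    fix X n assume "n \<in> pr x X"
    then consider m where "n = 2 * m + 1" "m \<in> X" | "n \<in> pr x {}" by (auto simp: pr_def)
    then show "\<exists>Y. finite Y \<and> Y \<subseteq> X \<and> n \<in> pr x Y"
    proof cases
      case 1 then show ?thesis by (intro exI[of _ "{m}"]) (auto simp: pr_def)
    qed (auto intro!: exI[of _ "{}"] simp: pr_def)
  qed (simp add: pr_mono)
qed

lemma cont_Un: "cont g \<Longrightarrow> cont h \<Longrightarrow> cont (\<lambda>x. g x \<union> h x)"
proof (rule cont_comp2[of "(\<union>)"])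
  have *: "cont (\<lambda>x. x \<union> y)" for y
  proof (rule contI)
    fix X n assume "n \<in> X \<union> y"
    then show "\<exists>Y. finite Y \<and> Y \<subseteq> X \<and> n \<in> Y \<union> y"
      by (intro exI[of _ "if n \<in> X then {n} else {}"]) auto
  qed auto
  show "cont (\<lambda>x. x \<union> y)" for y by (rule *)
  show "cont (\<lambda>y. x \<union> y)" for x using *[of x] by (simp add: Un_commute)
qed

text \<open>A case distinction has to be monotone. It can therefore only test that a token is
  present, and a failed test contributes nothing; a union of guarded branches then acts as a case
  distinction on tags.\<close>

definition guard :: "nat \<Rightarrow> dom \<Rightarrow> dom \<Rightarrow> dom" where
  "guard t v y = (if t \<in> v then y else {})"

lemma cont_guard: "cont g \<Longrightarrow> cont h \<Longrightarrow> cont (\<lambda>x. guard t (g x) (h x))"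
proof (rule cont_comp2[of "guard t"])
  show "cont (\<lambda>x. guard t x y)" for y
    by (rule contI) (auto simp: guard_def split: if_splits intro: exI[of _ "{t}"])
  show "cont (\<lambda>y. guard t x y)" for x
    by (cases "t \<in> x") (simp_all add: guard_def cont_id cont_const)
qed

text \<open>The graph of \<open>F\<close> at finite sets, each element being a coded pair of a
  finite set and a number in its image. \<open>beta\<close> holds strictly for continuous
  \<open>F\<close>. Extensionality is not a property of these graphs; it comes from the relations
  that interpret the types.\<close>

definition lam :: "(dom \<Rightarrow> dom) \<Rightarrow> dom" where
  "lam F = {n. snd (prod_decode n) \<in> F (set_decode (fst (prod_decode n)))}"
definition app :: "dom \<Rightarrow> dom \<Rightarrow> dom" where
  "app u v = {m. \<exists>k. set_decode k \<subseteq> v \<and> prod_encode (k, m) \<in> u}"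

lemma beta: assumes "cont F" shows "app (lam F) x = F x"
proof -
  have "m \<in> app (lam F) x \<longleftrightarrow> m \<in> F x" for m
  proof -
    have "m \<in> app (lam F) x \<longleftrightarrow> (\<exists>k. set_decode k \<subseteq> x \<and> m \<in> F (set_decode k))"
      by (simp add: app_def lam_def)
    also have "\<dots> \<longleftrightarrow> (\<exists>Y. finite Y \<and> Y \<subseteq> x \<and> m \<in> F Y)"
      by (metis finite_set_decode set_encode_inverse)
    also have "\<dots> \<longleftrightarrow> m \<in> F x" using assms unfolding cont_def by blast
    finally show ?thesis .
  qed
  then show ?thesis by blast
qed

lemma cont_lam: 
  assumes "\<And>y. cont (\<lambda>x. F x y)" shows "cont (\<lambda>x. lam (F x))"
proof (rule contI)
  show "lam (F X) \<subseteq> lam (F Y)" if "X \<subseteq> Y" for X Y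
    using cont_mono[OF assms that] by (auto simp: lam_def)
  show "\<exists>Y. finite Y \<and> Y \<subseteq> X \<and> n \<in> lam (F Y)" if "n \<in> lam (F X)" for X n
    using that cont_fin[OF assms] by (simp add: lam_def)
qed

lemma cont_app: "cont g \<Longrightarrow> cont h \<Longrightarrow> cont (\<lambda>x. app (g x) (h x))"
proof (rule cont_comp2[of app])
  show "cont (\<lambda>x. app x y)" for y
  proof (rule contI)
    fix X n assume "n \<in> app X y"
    then obtain k where "set_decode k \<subseteq> y" "prod_encode (k, n) \<in> X" by (auto simp: app_def)
    then show "\<exists>Y. finite Y \<and> Y \<subseteq> X \<and> n \<in> app Y y"
      by (intro exI[of _ "{prod_encode (k, n)}"]) (auto simp: app_def)
  qed (auto simp: app_def)
  show "cont (\<lambda>y. app x y)" for x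
  proof (rule contI)
    fix X n assume "n \<in> app x X"
    then obtain k where "set_decode k \<subseteq> X" "prod_encode (k, n) \<in> x" by (auto simp: app_def)
    then show "\<exists>Y. finite Y \<and> Y \<subseteq> X \<and> n \<in> app x Y"
      by (intro exI[of _ "set_decode k"]) (auto simp: app_def)
  qed (auto simp: app_def)
qed

lemmas cont_intros = cont_id cont_const cont_p1 cont_p2 cont_pr cont_Un cont_guard cont_app cont_lam

lemma app_mono: "u \<subseteq> u' \<Longrightarrow> v \<subseteq> v' \<Longrightarrow> app u v \<subseteq> app u' v'" by (fastforce simp: app_def)

text \<open>Kleene iteration from the empty set. It provides the transport operations by
  unrestricted recursion, at a stage where it has not yet been said which codes are well
  formed.\<close>

definition fixp :: "(dom \<Rightarrow> dom) \<Rightarrow> dom" where "fixp F = (\<Union>n. (F ^^ n) {})"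

lemma fixp: assumes "cont F" shows "F (fixp F) = fixp F"
proof
  have inc: "(F ^^ m) {} \<subseteq> (F ^^ n) {}" if "m \<le> n" for m n
    using that
  proof (induction m arbitrary: n)
    case (Suc m)
    then obtain k where "n = Suc k" "m \<le> k" by (cases n) auto
    then show ?case using Suc.IH[of k] cont_mono[OF assms] by simp
  qed simp
  show "F (fixp F) \<subseteq> fixp F"
  proof
    fix x assume "x \<in> F (fixp F)"
    then obtain Y where Y: "finite Y" "Y \<subseteq> fixp F" "x \<in> F Y" by (rule cont_finE[OF assms])
    have "\<exists>n. Y \<subseteq> (F ^^ n) {}" using Y(1,2)
    proof (induction Y rule: finite_induct)
      case (insert y Y)
      then obtain n m where "Y \<subseteq> (F ^^ n) {}" "y \<in> (F ^^ m) {}" unfolding fixp_def by auto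
      then have "insert y Y \<subseteq> (F ^^ (max n m)) {}"
        using inc[of n "max n m"] inc[of m "max n m"] by auto
      then show ?case by blast
    qed auto
    then obtain n where "Y \<subseteq> (F ^^ n) {}" by blast
    then have "F Y \<subseteq> (F ^^ Suc n) {}" using cont_mono[OF assms] by simp
    with Y(3) show "x \<in> fixp F" unfolding fixp_def by blast
  qed
  show "fixp F \<subseteq> F (fixp F)"
  proof
    fix x assume "x \<in> fixp F"
    then obtain n where n: "x \<in> (F ^^ n) {}" unfolding fixp_def by blast
    have "(F ^^ n) {} \<subseteq> F (fixp F)"
    proof (cases n)
      case (Suc m)
      have "(F ^^ m) {} \<subseteq> fixp F" unfolding fixp_def by blast
      then show ?thesis using Suc cont_mono[OF assms] by simp
    qed simp
    with n show "x \<in> F (fixp F)" by blast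
  qed
qed

section \<open>Coded types and their transport operations\<close>

text \<open>A value \<open>z\<close> has an actual part \<open>p1 z\<close> and a dual part \<open>p2 z\<close> above it. Only the actual part of
  a value matters for types and for the end points of paths, and \<open>deg z\<close> forgets the dual part.\<close>

definition deg :: "dom \<Rightarrow> dom" where "deg z = pr (p1 z) (p1 z)"
definition dbl :: "dom \<Rightarrow> dom" where "dbl x = pr x x"
text \<open>The actual part of the result is computed from actual parts, but it is the dual part of
  the function that meets the dual part of the argument. For a degenerate function both parts are
  the same graph, so its actual part also acts on dual arguments. \<open>fap u\<close> is
  \<open>apW (dbl u)\<close>: the maps of a frame have a trivial dual part.\<close>

definition apW :: "dom \<Rightarrow> dom \<Rightarrow> dom" where "apW F z = pr (app (p1 F) (deg z)) (app (p2 F) z)"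
definition fap :: "dom \<Rightarrow> dom \<Rightarrow> dom" where "fap u z = pr (app u (deg z)) (app u z)"
definition fstW :: "dom \<Rightarrow> dom" where "fstW z = pr (p1 (p1 z)) (p1 (p2 z))"
definition sndW :: "dom \<Rightarrow> dom" where "sndW z = pr (p2 (p1 z)) (p2 (p2 z))"
definition mk :: "nat \<Rightarrow> dom \<Rightarrow> dom" where "mk t x = pr {t} x"
definition mkW :: "nat \<Rightarrow> dom \<Rightarrow> dom" where "mkW t z = pr (mk t (p1 z)) (mk t (p2 z))"
definition pairW :: "dom \<Rightarrow> dom \<Rightarrow> dom" where "pairW a b = pr (pr (p1 a) (p1 b)) (pr (p2 a) (p2 b))"

text \<open>\<open>Fr Y X u v\<close> is the type with the elements of \<open>Y\<close> and the transport of \<open>X\<close>, where \<open>u : X \<rightarrow> Y\<close> and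
  \<open>v : Y \<rightarrow> X\<close> are inverse to each other. All type formers produce codes of this form.\<close>

definition Fr :: "dom \<Rightarrow> dom \<Rightarrow> dom \<Rightarrow> dom \<Rightarrow> dom" where "Fr Y X u v = mk 0 (pr Y (pr X (pr u v)))"
definition frY :: "dom \<Rightarrow> dom" where "frY c = p1 (p2 c)"
definition frX :: "dom \<Rightarrow> dom" where "frX c = p1 (p2 (p2 c))"
definition frU :: "dom \<Rightarrow> dom" where "frU c = p1 (p2 (p2 (p2 c)))"
definition frV :: "dom \<Rightarrow> dom" where "frV c = p2 (p2 (p2 (p2 c)))"

definition OneC :: dom where "OneC = mk 1 {}"
definition ZeroC :: dom where "ZeroC = mk 2 {}"
definition UnivC :: dom where "UnivC = mk 3 {}"
definition HidC :: dom where "HidC = mk 4 {}"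
definition PlusC :: "dom \<Rightarrow> dom \<Rightarrow> dom" where "PlusC A B = mk 5 (pr A B)"
definition SigC :: "dom \<Rightarrow> dom \<Rightarrow> dom" where "SigC A B = mk 6 (pr A B)"
definition PiC :: "dom \<Rightarrow> dom \<Rightarrow> dom" where "PiC A B = mk 7 (pr A B)"
definition EqC :: "dom \<Rightarrow> dom \<Rightarrow> dom \<Rightarrow> dom" where "EqC A a b = mk 8 (pr A (pr a b))"

definition argA :: "dom \<Rightarrow> dom" where "argA S = p1 (p2 S)"
definition argB :: "dom \<Rightarrow> dom" where "argB S = p2 (p2 S)"

text \<open>Transport and composition call each other and share one fixed point: a query to
  \<open>r\<close> starts with tag 0 for transport and tag 1 for composition. A query returns a dual
  part only; the variants with \<open>W\<close> add the actual part by repeating the query on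
  degenerate values.\<close>

definition TRr :: "dom \<Rightarrow> dom \<Rightarrow> dom \<Rightarrow> dom \<Rightarrow> dom" where
  "TRr r S T z = app r (mk 0 (pr S (pr T z)))"
definition TRWr :: "dom \<Rightarrow> dom \<Rightarrow> dom \<Rightarrow> dom \<Rightarrow> dom" where
  "TRWr r S T z = pr (TRr r S T (deg z)) (TRr r S T z)"
definition CMr :: "dom \<Rightarrow> dom \<Rightarrow> dom \<Rightarrow> dom \<Rightarrow> dom \<Rightarrow> dom \<Rightarrow> dom" where
  "CMr r S T a b P = app r (mk 1 (pr S (pr T (pr a (pr b P)))))"
definition CMWr :: "dom \<Rightarrow> dom \<Rightarrow> dom \<Rightarrow> dom \<Rightarrow> dom \<Rightarrow> dom \<Rightarrow> dom" where
  "CMWr r S T a b P = pr (CMr r S T (deg a) (deg b) (deg P)) (CMr r S T a b P)"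

text \<open>The tag of \<open>S\<close> selects the clause; within a clique of codes
  \<open>T\<close> has the same shape. A frame pulls back along \<open>frV S\<close>, transports in
  the inner type and pushes along \<open>frU T\<close>. Functions are conjugated, with the argument
  moved backwards. A path is moved by composing each of its two entries with the passage from the
  old to the new end point.\<close>

definition TRb :: "dom \<Rightarrow> dom \<Rightarrow> dom \<Rightarrow> dom \<Rightarrow> dom" where
  "TRb r S T z =
     guard 0 (p1 S) (app (frU T) (TRWr r (frX S) (frX T) (fap (frV S) z))) \<union>
     guard 1 (p1 S) (p2 z) \<union> guard 2 (p1 S) (p2 z) \<union> guard 3 (p1 S) (p2 z) \<union> guard 4 (p1 S) (p2 z) \<union>
     guard 5 (p1 S) (guard 0 (p1 (p2 z)) (mk 0 (TRr r (argA S) (argA T) (sndW z))) \<union>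
                     guard 1 (p1 (p2 z)) (mk 1 (TRr r (argB S) (argB T) (sndW z)))) \<union>
     guard 6 (p1 S) (pr (TRr r (argA S) (argA T) (fstW z))
        (TRr r (app (argB S) (deg (fstW z)))
           (app (argB T) (deg (TRWr r (argA S) (argA T) (fstW z)))) (sndW z))) \<union>
     guard 7 (p1 S) (lam (\<lambda>x. TRr r (app (argB S) (deg (TRWr r (argA T) (argA S) x)))
        (app (argB T) (deg x)) (apW z (TRWr r (argA T) (argA S) x)))) \<union>
     guard 8 (p1 S) (pr
        (CMr r (argA S) (argA T) (dbl (p1 (argB S))) (dbl (p1 (argB T))) (dbl (p1 (p1 z))))
        (CMr r (argA S) (argA T) (dbl (p2 (argB S))) (dbl (p2 (argB T))) (dbl (p2 (p1 z)))))"

text \<open>At the universe, tag 3, the result has the elements of \<open>b\<close>, the inner type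
  of \<open>P\<close>, and the frame of \<open>P\<close> followed by the transport from
  \<open>a\<close> to \<open>b\<close>. At identity types composition is transport, since paths over
  the new index are determined by those over the old one.\<close>

definition CMb :: "dom \<Rightarrow> dom \<Rightarrow> dom \<Rightarrow> dom \<Rightarrow> dom \<Rightarrow> dom \<Rightarrow> dom" where
  "CMb r S T a b P =
     guard 0 (p1 S) (app (frU T)
       (CMWr r (frX S) (frX T) (fap (frV S) a) (fap (frV T) b) (fap (frV S) P))) \<union>
     guard 1 (p1 S) (p2 P) \<union> guard 2 (p1 S) (p2 P) \<union>
     guard 3 (p1 S) (Fr (frY (p2 b)) (frX (p2 P))
        (lam (\<lambda>z. TRr r (p2 a) (p2 b) (fap (frU (p2 P)) z)))
        (lam (\<lambda>z. app (frV (p2 P)) (TRWr r (p2 b) (p2 a) z)))) \<union>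
     guard 4 (p1 S) (p2 P) \<union>
     guard 5 (p1 S) (guard 0 (p1 (p2 P)) (mk 0 (CMr r (argA S) (argA T) (sndW a) (sndW b) (sndW P))) \<union>
                     guard 1 (p1 (p2 P)) (mk 1 (CMr r (argB S) (argB T) (sndW a) (sndW b) (sndW P)))) \<union>
     guard 6 (p1 S) (pr (CMr r (argA S) (argA T) (fstW a) (fstW b) (fstW P))
        (CMr r (app (argB S) (deg (fstW P)))
           (app (argB T) (deg (CMWr r (argA S) (argA T) (fstW a) (fstW b) (fstW P))))
           (sndW a) (sndW b) (sndW P))) \<union>
     guard 7 (p1 S) (lam (\<lambda>x. CMr r (app (argB S) (deg (TRWr r (argA T) (argA S) x)))
        (app (argB T) (deg x)) (apW a (TRWr r (argA T) (argA S) x)) (apW b x)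
        (apW P (TRWr r (argA T) (argA S) x)))) \<union>
     guard 8 (p1 S) (TRr r S T P)"

definition ops_body :: "dom \<Rightarrow> dom" where
  "ops_body r = lam (\<lambda>q.
     guard 0 (p1 q) (TRb r (p1 (p2 q)) (p1 (p2 (p2 q))) (p2 (p2 (p2 q)))) \<union>
     guard 1 (p1 q) (CMb r (p1 (p2 q)) (p1 (p2 (p2 q))) (p1 (p2 (p2 (p2 q))))
        (p1 (p2 (p2 (p2 (p2 q))))) (p2 (p2 (p2 (p2 (p2 q)))))))"

definition ops :: dom where "ops = fixp ops_body"

definition "TR = TRr ops"
definition "TRW = TRWr ops"
definition "CM = CMr ops"
definition "CMW = CMWr ops"

lemma cont_W1:
  assumes "cont f"
  shows "cont (\<lambda>x. deg (f x))" "cont (\<lambda>x. dbl (f x))" "cont (\<lambda>x. fstW (f x))" "cont (\<lambda>x. sndW (f x))"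
    "cont (\<lambda>x. mk t (f x))" "cont (\<lambda>x. frY (f x))" "cont (\<lambda>x. frX (f x))"
    "cont (\<lambda>x. frU (f x))" "cont (\<lambda>x. frV (f x))" "cont (\<lambda>x. argA (f x))" "cont (\<lambda>x. argB (f x))"
  unfolding deg_def dbl_def fstW_def sndW_def mk_def frY_def frX_def frU_def
    frV_def argA_def argB_def
  by (intro cont_intros assms)+

lemma cont_W2:
  assumes "cont f" "cont g"
  shows "cont (\<lambda>x. apW (f x) (g x))" "cont (\<lambda>x. fap (f x) (g x))" 
    "cont (\<lambda>x. PlusC (f x) (g x))" "cont (\<lambda>x. SigC (f x) (g x))" "cont (\<lambda>x. PiC (f x) (g x))"
  unfolding apW_def fap_def PlusC_def SigC_def PiC_def
  by (intro cont_intros cont_W1 assms)+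

lemmas cont_W = cont_W1 cont_W2

lemma cont_EqC: "cont f \<Longrightarrow> cont g \<Longrightarrow> cont h \<Longrightarrow> cont (\<lambda>x. EqC (f x) (g x) (h x))"
  unfolding EqC_def by (intro cont_intros cont_W)

lemma cont_Fr: "cont f \<Longrightarrow> cont g \<Longrightarrow> cont h \<Longrightarrow> cont k \<Longrightarrow> cont (\<lambda>x. Fr (f x) (g x) (h x) (k x))"
  unfolding Fr_def by (intro cont_intros cont_W)

lemma cont_TRr:
  assumes "cont r" "cont S" "cont T" "cont z"
  shows "cont (\<lambda>x. TRr (r x) (S x) (T x) (z x))" "cont (\<lambda>x. TRWr (r x) (S x) (T x) (z x))"
  unfolding TRr_def TRWr_def by (intro cont_intros cont_W assms)+

lemma cont_CMr:
  assumes "cont r" "cont S" "cont T" "cont a" "cont b" "cont P"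
  shows "cont (\<lambda>x. CMr (r x) (S x) (T x) (a x) (b x) (P x))"
    "cont (\<lambda>x. CMWr (r x) (S x) (T x) (a x) (b x) (P x))"
  unfolding CMr_def CMWr_def by (intro cont_intros cont_W assms)+

lemma cont_TRb:
  assumes "cont r" "cont S" "cont T" "cont z"
  shows "cont (\<lambda>x. TRb (r x) (S x) (T x) (z x))"
  unfolding TRb_def by (intro cont_intros cont_W cont_TRr cont_CMr assms)

lemma cont_CMb:
  assumes "cont r" "cont S" "cont T" "cont a" "cont b" "cont P"
  shows "cont (\<lambda>x. CMb (r x) (S x) (T x) (a x) (b x) (P x))"
  unfolding CMb_def by (intro cont_intros cont_W cont_TRr cont_CMr cont_Fr assms)

lemma cont_TR:
  assumes "cont S" "cont T" "cont z"
  shows "cont (\<lambda>x. TR (S x) (T x) (z x))" "cont (\<lambda>x. TRW (S x) (T x) (z x))"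
  unfolding TR_def TRW_def by (intro cont_TRr cont_const assms)+

lemma cont_CM:
  assumes "cont S" "cont T" "cont a" "cont b" "cont P"
  shows "cont (\<lambda>x. CM (S x) (T x) (a x) (b x) (P x))"
    "cont (\<lambda>x. CMW (S x) (T x) (a x) (b x) (P x))"
  unfolding CM_def CMW_def by (intro cont_CMr cont_const assms)+

lemma ops: "ops = ops_body ops"
proof -
  have "cont ops_body"
    unfolding ops_body_def by (intro cont_intros cont_TRb cont_CMb)
  then show ?thesis unfolding ops_def by (rule fixp[symmetric])
qed

lemma app_ops: "app ops q =
     guard 0 (p1 q) (TRb ops (p1 (p2 q)) (p1 (p2 (p2 q))) (p2 (p2 (p2 q)))) \<union>
     guard 1 (p1 q) (CMb ops (p1 (p2 q)) (p1 (p2 (p2 q))) (p1 (p2 (p2 (p2 q))))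
        (p1 (p2 (p2 (p2 (p2 q))))) (p2 (p2 (p2 (p2 (p2 q))))))"
  by (subst ops, unfold ops_body_def, rule beta) (intro cont_intros cont_TRb cont_CMb)

lemma TR_unfold: "TR S T z = TRb ops S T z"
  unfolding TR_def TRr_def app_ops by (simp add: mk_def guard_def)

lemma CM_unfold: "CM S T a b P = CMb ops S T a b P"
  unfolding CM_def CMr_def app_ops by (simp add: mk_def guard_def)

lemma TRW_eq: "TRW S T z = pr (TR S T (deg z)) (TR S T z)"
  by (simp add: TR_def TRW_def TRWr_def)
lemma CMW_eq: "CMW S T a b P = pr (CM S T (deg a) (deg b) (deg P)) (CM S T a b P)"
  by (simp add: CM_def CMW_def CMWr_def)

lemmas fold_ops = TR_def[symmetric] TRW_def[symmetric] CM_def[symmetric] CMW_def[symmetric]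

lemma deg_simps [simp]: "p1 (deg z) = p1 z" "p2 (deg z) = p1 z" "deg (deg z) = deg z"
  "deg (dbl x) = dbl x" "p1 (dbl x) = x" "p2 (dbl x) = x" "p1 (TRW S T z) = TR S T (deg z)"
  "p2 (TRW S T z) = TR S T z" "p1 (CMW S T a b P) = CM S T (deg a) (deg b) (deg P)" 
  "p2 (CMW S T a b P) = CM S T a b P" "p1 (apW F z) = app (p1 F) (deg z)" "p2 (apW F z) = app (p2 F) z"
  "p1 (fap u z) = app u (deg z)" "p2 (fap u z) = app u z"
  "p1 (fstW z) = p1 (p1 z)" "p2 (fstW z) = p1 (p2 z)" "p1 (sndW z) = p2 (p1 z)" "p2 (sndW z) = p2 (p2 z)"
  "p1 (mkW t z) = mk t (p1 z)" "p2 (mkW t z) = mk t (p2 z)"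
  "p1 (pairW a b) = pr (p1 a) (p1 b)" "p2 (pairW a b) = pr (p2 a) (p2 b)" "dbl (p1 z) = deg z"
  "p1 (mk t z) = {t}" "p2 (mk t z) = z"
  by (auto simp: deg_def dbl_def TRW_eq CMW_eq apW_def fap_def fstW_def sndW_def mkW_def pairW_def mk_def)

lemma W_simps [simp]: "fstW (pairW a b) = a" "sndW (pairW a b) = b" "pairW (fstW z) (sndW z) = z"
  "sndW (mkW t z) = z" "deg (TRW S T z) = TRW S T (deg z)" 
  "deg (CMW S T a b P) = CMW S T (deg a) (deg b) (deg P)" "deg (apW F z) = apW (deg F) (deg z)"
  "deg (fap u z) = fap u (deg z)" "deg (fstW z) = fstW (deg z)" "deg (sndW z) = sndW (deg z)"
  "deg (mkW t z) = mkW t (deg z)" "deg (pairW a b) = pairW (deg a) (deg b)"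
  by (rule dom_eqI; simp)+

lemma mk_inject [simp]: "mk t x = mk t' y \<longleftrightarrow> t = t' \<and> x = y"
  by (simp add: mk_def)
lemma mkW_inject [simp]: "mkW t x = mkW t' y \<longleftrightarrow> t = t' \<and> x = y"
  by (metis W_simps(4) mk_inject deg_simps(19))

lemma frame_simps [simp]: "frY (Fr Y X u v) = Y" "frX (Fr Y X u v) = X" "frU (Fr Y X u v) = u"
  "frV (Fr Y X u v) = v" "Fr Y X u v = Fr Y' X' u' v' \<longleftrightarrow> Y = Y' \<and> X = X' \<and> u = u' \<and> v = v'"
  by (auto simp: Fr_def frY_def frX_def frU_def frV_def)

lemmas code_defs = Fr_def OneC_def ZeroC_def UnivC_def HidC_def PlusC_def SigC_def PiC_def EqC_def

lemma code_inject [simp]: "PlusC A B = PlusC A' B' \<longleftrightarrow> A = A' \<and> B = B'"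
  "SigC A B = SigC A' B' \<longleftrightarrow> A = A' \<and> B = B'" "PiC A B = PiC A' B' \<longleftrightarrow> A = A' \<and> B = B'"
  "EqC A a b = EqC A' a' b' \<longleftrightarrow> A = A' \<and> a = a' \<and> b = b'"
  by (auto simp: code_defs)

lemma TR_simps:
  "TR (Fr Y X u v) (Fr Y' X' u' v') z = app u' (TRW X X' (fap v z))"
  "TR OneC OneC z = p2 z" "TR ZeroC ZeroC z = p2 z" "TR UnivC UnivC z = p2 z" "TR HidC HidC z = p2 z"
  "TR (PlusC A B) (PlusC A' B') (mkW 0 z) = mk 0 (TR A A' z)"
  "TR (PlusC A B) (PlusC A' B') (mkW 1 z) = mk 1 (TR B B' z)"
  "TR (SigC A B) (SigC A' B') z = pr (TR A A' (fstW z))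
     (TR (app B (deg (fstW z))) (app B' (deg (TRW A A' (fstW z)))) (sndW z))"
  "TR (PiC A B) (PiC A' B') z = lam (\<lambda>x. TR (app B (deg (TRW A' A x))) (app B' (deg x)) (apW z (TRW A' A x)))"
  "TR (EqC A a b) (EqC A' a' b') z = pr (CM A A' (dbl a) (dbl a') (dbl (p1 (p1 z))))
     (CM A A' (dbl b) (dbl b') (dbl (p2 (p1 z))))"
  by (subst TR_unfold, simp add: TRb_def fold_ops code_defs guard_def argA_def argB_def frX_def frU_def frV_def)+

lemma CM_simps:
  "CM (Fr Y X u v) (Fr Y' X' u' v') a b P = app u' (CMW X X' (fap v a) (fap v' b) (fap v P))"
  "CM OneC OneC a b P = p2 P" "CM ZeroC ZeroC a b P = p2 P" "CM HidC HidC a b P = p2 P"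
  "CM UnivC UnivC a b P = Fr (frY (p2 b)) (frX (p2 P))
        (lam (\<lambda>z. TR (p2 a) (p2 b) (fap (frU (p2 P)) z)))
        (lam (\<lambda>z. app (frV (p2 P)) (TRW (p2 b) (p2 a) z)))"
  "CM (PlusC A B) (PlusC A' B') a b (mkW 0 P) = mk 0 (CM A A' (sndW a) (sndW b) P)"
  "CM (PlusC A B) (PlusC A' B') a b (mkW 1 P) = mk 1 (CM B B' (sndW a) (sndW b) P)"
  "CM (SigC A B) (SigC A' B') a b P = pr (CM A A' (fstW a) (fstW b) (fstW P))
     (CM (app B (deg (fstW P))) (app B' (deg (CMW A A' (fstW a) (fstW b) (fstW P))))
       (sndW a) (sndW b) (sndW P))"
  "CM (PiC A B) (PiC A' B') a b P = lam (\<lambda>x. CM (app B (deg (TRW A' A x))) (app B' (deg x))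
     (apW a (TRW A' A x)) (apW b x) (apW P (TRW A' A x)))"
  "CM (EqC A c d) (EqC A' c' d') a b P = TR (EqC A c d) (EqC A' c' d') P"
  by (subst CM_unfold, simp add: CMb_def fold_ops code_defs guard_def argA_def argB_def frX_def frU_def frV_def)+

section \<open>The order between actual and dual parts\<close>

definition ord :: "dom \<Rightarrow> bool" where "ord z \<longleftrightarrow> p1 z \<subseteq> p2 z"

lemma ord_deg [simp]: "ord (deg z)" "ord (dbl z)" by (auto simp: ord_def)
lemma ord_iff: "ord z \<longleftrightarrow> deg z \<subseteq> z"
  by (metis deg_def deg_simps(2) ord_def p_mono(2) pr_mono pr_p subset_refl)

lemma TR_mono: "z \<subseteq> z' \<Longrightarrow> TR S T z \<subseteq> TR S T z'"
  by (rule cont_mono[of "TR S T"]) (intro cont_TR cont_intros)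
lemma CM_mono: assumes "a \<subseteq> a'" "b \<subseteq> b'" "P \<subseteq> P'" shows "CM S T a b P \<subseteq> CM S T a' b' P'"
proof -
  have "CM S T a b P \<subseteq> CM S T a' b P"
    by (rule cont_mono[of "\<lambda>a. CM S T a b P"]) (intro assms cont_CM cont_intros)+
  also have "\<dots> \<subseteq> CM S T a' b' P"
    by (rule cont_mono[of "\<lambda>b. CM S T a' b P"]) (intro assms cont_CM cont_intros)+
  also have "\<dots> \<subseteq> CM S T a' b' P'"
    by (rule cont_mono[of "\<lambda>P. CM S T a' b' P"]) (intro assms cont_CM cont_intros)+
  finally show ?thesis .
qed

lemma ord_p: "ord z \<Longrightarrow> p1 z \<subseteq> p2 z" "ord z \<Longrightarrow> deg z \<subseteq> z"
  by (simp_all add: ord_iff[symmetric]) (simp add: ord_def)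

text \<open>By monotonicity: the actual part of each result is the operation at degenerate
  arguments, and \<open>deg z\<close> lies below \<open>z\<close>.\<close>

lemma ord_W: "ord z \<Longrightarrow> ord (TRW S T z)" "ord a \<Longrightarrow> ord b \<Longrightarrow> ord P \<Longrightarrow> ord (CMW S T a b P)"
  "ord F \<Longrightarrow> ord z \<Longrightarrow> ord (apW F z)" "ord z \<Longrightarrow> ord (fap u z)" "ord z \<Longrightarrow> ord (fstW z)" "ord z \<Longrightarrow> ord (sndW z)"
  "ord z \<Longrightarrow> ord (mkW t z)" "ord a \<Longrightarrow> ord b \<Longrightarrow> ord (pairW a b)"
  unfolding ord_def[of "TRW S T z"] ord_def[of "CMW S T a b P"] ord_def[of "apW F z"] 
    ord_def[of "fap u z"] ord_def[of "fstW z"] ord_def[of "sndW z"] ord_def[of "mkW t z"] ord_def[of "pairW a b"]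
  by (simp_all add: TR_mono CM_mono app_mono p_mono pr_mono ord_p mk_def)

section \<open>Interpretation of raw terms\<close>

definition ec :: "dom \<Rightarrow> (nat \<Rightarrow> dom) \<Rightarrow> nat \<Rightarrow> dom" where "ec z \<rho> = case_nat z \<rho>"
definition edeg :: "(nat \<Rightarrow> dom) \<Rightarrow> nat \<Rightarrow> dom" where "edeg \<rho> = (\<lambda>n. deg (\<rho> n))"

lemma ec_simps [simp]: "ec z \<rho> 0 = z" "ec z \<rho> (Suc n) = \<rho> n" by (simp_all add: ec_def)
lemma edeg_simps [simp]: "edeg \<rho> n = deg (\<rho> n)" "edeg (edeg \<rho>) = edeg \<rho>" "edeg (ec z \<rho>) = ec (deg z) (edeg \<rho>)"
  by (auto simp: edeg_def ec_def fun_eq_iff split: nat.split)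

definition idD :: dom where "idD = lam (\<lambda>z. p2 z)"
text \<open>The trivial frame. Members of the universe must carry a frame on the outside, so every
  type former puts one around its raw code.\<close>

definition wrap :: "dom \<Rightarrow> dom" where "wrap c = Fr c c idD idD"

text \<open>Realizes \<^term>\<open>FamCUA_U\<close>: an isomorphism \<open>A \<cong> B\<close> becomes the path from \<open>A\<close> to a copy of \<open>B\<close>
  that is transported like \<open>A\<close>.\<close>

definition iso_path :: "dom \<Rightarrow> dom \<Rightarrow> dom \<Rightarrow> dom" where
  "iso_path A B w = pr (p2 A) (lam (\<lambda>i.
     Fr (frY (app (p2 B) i)) (frX (app (p2 A) i))
      (lam (\<lambda>z. app (app (p1 (p2 w)) i) (fap (frU (app (p2 A) i)) z)))
      (lam (\<lambda>z. app (frV (app (p2 A) i)) (fap (app (p1 (p1 (p2 (p2 w)))) i) z)))))"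

text \<open>The constant path at the actual part of \<open>w\<close>. It realizes both homotopies of
  the equivalence in \<open>axD\<close>, because the round trips agree with the identity on actual
  parts up to the relation of the type.\<close>

definition reflD :: dom where "reflD = lam (\<lambda>w. dbl (p1 w))"
definition axD :: dom where
  "axD = lam (\<lambda>I. lam (\<lambda>A. lam (\<lambda>B. pr (pr (lam (iso_path A B)) reflD) (pr (lam (iso_path A B)) reflD))))"

text \<open>Dual parts of the values of raw terms; the environment holds pairs of actual and dual
  parts. The clause for \<open>J\<close> transports the base case from the motive at the constant
  path on the first entry of \<open>p\<close> to the motive at \<open>p\<close> itself. Both motives
  are read in degenerate environments, since types depend on actual parts only.\<close>

primrec cl :: "tm \<Rightarrow> (nat \<Rightarrow> dom) \<Rightarrow> dom" where
  "cl (Var n) \<rho> = p2 (\<rho> n)"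
| "cl (Axm A) \<rho> = axD"
| "cl Univ \<rho> = wrap UnivC"
| "cl (Pi A B) \<rho> = wrap (PiC (cl A \<rho>) (lam (\<lambda>z. cl B (ec z \<rho>))))"
| "cl (Lam A B t) \<rho> = lam (\<lambda>z. cl t (ec z \<rho>))"
| "cl (App A B f a) \<rho> = app (cl f \<rho>) (pr (cl a (edeg \<rho>)) (cl a \<rho>))"
| "cl (Sig A B) \<rho> = wrap (SigC (cl A \<rho>) (lam (\<lambda>z. cl B (ec z \<rho>))))"
| "cl (MkPair A B a b) \<rho> = pr (cl a \<rho>) (cl b \<rho>)"
| "cl (Proj1 A B p) \<rho> = p1 (cl p \<rho>)"
| "cl (Proj2 A B p) \<rho> = p2 (cl p \<rho>)"
| "cl One \<rho> = wrap OneC"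
| "cl Star \<rho> = {}"
| "cl Zero \<rho> = wrap ZeroC"
| "cl (Abort C t) \<rho> = {}"
| "cl (Plus A B) \<rho> = wrap (PlusC (cl A \<rho>) (cl B \<rho>))"
| "cl (InL A B a) \<rho> = mk 0 (cl a \<rho>)"
| "cl (InR A B b) \<rho> = mk 1 (cl b \<rho>)"
| "cl (Cases A B C l r s) \<rho> =
     guard 0 (p1 (cl s \<rho>)) (cl l (ec (sndW (pr (cl s (edeg \<rho>)) (cl s \<rho>))) \<rho>)) \<union>
     guard 1 (p1 (cl s \<rho>)) (cl r (ec (sndW (pr (cl s (edeg \<rho>)) (cl s \<rho>))) \<rho>))"
| "cl (Eq A a b) \<rho> = wrap (EqC (cl A \<rho>) (cl a \<rho>) (cl b \<rho>))"
| "cl (Refl A a) \<rho> = dbl (cl a \<rho>)"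
| "cl (J A C d a b p) \<rho> =
     TR (cl C (ec (dbl (dbl (p1 (cl p (edeg \<rho>))))) (ec (dbl (p1 (cl p (edeg \<rho>)))) (ec (dbl (cl a (edeg \<rho>))) (edeg \<rho>)))))
        (cl C (ec (dbl (cl p (edeg \<rho>))) (ec (dbl (p2 (cl p (edeg \<rho>)))) (ec (dbl (cl a (edeg \<rho>))) (edeg \<rho>)))))
        (pr (cl d (ec (dbl (cl a (edeg \<rho>))) (edeg \<rho>))) (cl d (ec (pr (cl a (edeg \<rho>)) (cl a \<rho>)) \<rho>)))"

text \<open>The actual part is the same interpretation in the degenerate environment, which keeps
  actual parts independent of dual ones.\<close>

definition val :: "tm \<Rightarrow> (nat \<Rightarrow> dom) \<Rightarrow> dom" where
  "val t \<rho> = pr (cl t (edeg \<rho>)) (cl t \<rho>)"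

lemma cont_ec: "(\<And>n. cont (\<lambda>x. G x n)) \<Longrightarrow> cont g \<Longrightarrow> cont (\<lambda>x. ec (g x) (G x) n)"
  by (cases n) simp_all
lemma cont_edeg: "(\<And>n. cont (\<lambda>x. G x n)) \<Longrightarrow> cont (\<lambda>x. edeg (G x) n)"
  by (simp add: cont_W1)

lemma cont_cl: "(\<And>n. cont (\<lambda>x. G x n)) \<Longrightarrow> cont (\<lambda>x. cl t (G x))"
  apply (induction t arbitrary: G)
  subgoal premises p by (simp only: cl.simps wrap_def, intro p cont_intros cont_W cont_TR cont_Fr cont_EqC cont_ec cont_edeg)
  subgoal premises p by (simp only: cl.simps wrap_def, intro p cont_intros cont_W cont_TR cont_Fr cont_EqC cont_ec cont_edeg)
  subgoal premises p by (simp only: cl.simps wrap_def, intro p cont_intros cont_W cont_TR cont_Fr cont_EqC cont_ec cont_edeg)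
  subgoal premises p by (simp only: cl.simps wrap_def, intro p cont_intros cont_W cont_TR cont_Fr cont_EqC cont_ec cont_edeg)
  subgoal premises p by (simp only: cl.simps wrap_def, intro p cont_intros cont_W cont_TR cont_Fr cont_EqC cont_ec cont_edeg)
  subgoal premises p by (simp only: cl.simps wrap_def, intro p cont_intros cont_W cont_TR cont_Fr cont_EqC cont_ec cont_edeg)
  subgoal premises p by (simp only: cl.simps wrap_def, intro p cont_intros cont_W cont_TR cont_Fr cont_EqC cont_ec cont_edeg)
  subgoal premises p by (simp only: cl.simps wrap_def, intro p cont_intros cont_W cont_TR cont_Fr cont_EqC cont_ec cont_edeg)
  subgoal premises p by (simp only: cl.simps wrap_def, intro p cont_intros cont_W cont_TR cont_Fr cont_EqC cont_ec cont_edeg)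
  subgoal premises p by (simp only: cl.simps wrap_def, intro p cont_intros cont_W cont_TR cont_Fr cont_EqC cont_ec cont_edeg)
  subgoal premises p by (simp only: cl.simps wrap_def, intro p cont_intros cont_W cont_TR cont_Fr cont_EqC cont_ec cont_edeg)
  subgoal premises p by (simp only: cl.simps wrap_def, intro p cont_intros cont_W cont_TR cont_Fr cont_EqC cont_ec cont_edeg)
  subgoal premises p by (simp only: cl.simps wrap_def, intro p cont_intros cont_W cont_TR cont_Fr cont_EqC cont_ec cont_edeg)
  subgoal premises p by (simp only: cl.simps wrap_def, intro p cont_intros cont_W cont_TR cont_Fr cont_EqC cont_ec cont_edeg)
  subgoal premises p by (simp only: cl.simps wrap_def, intro p cont_intros cont_W cont_TR cont_Fr cont_EqC cont_ec cont_edeg)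
  subgoal premises p by (simp only: cl.simps wrap_def, intro p cont_intros cont_W cont_TR cont_Fr cont_EqC cont_ec cont_edeg)
  subgoal premises p by (simp only: cl.simps wrap_def, intro p cont_intros cont_W cont_TR cont_Fr cont_EqC cont_ec cont_edeg)
  subgoal premises p by (simp only: cl.simps wrap_def, intro p cont_intros cont_W cont_TR cont_Fr cont_EqC cont_ec cont_edeg)
  subgoal premises p by (simp only: cl.simps wrap_def, intro p cont_intros cont_W cont_TR cont_Fr cont_EqC cont_ec cont_edeg)
  subgoal premises p by (simp only: cl.simps wrap_def, intro p cont_intros cont_W cont_TR cont_Fr cont_EqC cont_ec cont_edeg)
  subgoal premises p by (simp only: cl.simps wrap_def, intro p cont_intros cont_W cont_TR cont_Fr cont_EqC cont_ec cont_edeg)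
  done

lemma cont_cl_ec: "cont (\<lambda>z. cl t (ec z \<rho>))"
  by (intro cont_cl cont_ec cont_intros)

lemma cont_iso_path: "cont f \<Longrightarrow> cont g \<Longrightarrow> cont h \<Longrightarrow> cont (\<lambda>x. iso_path (f x) (g x) (h x))"
  unfolding iso_path_def by (intro cont_intros cont_W cont_Fr)

lemma cl_mono: assumes "\<And>n. \<rho> n \<subseteq> \<rho>' n" shows "cl t \<rho> \<subseteq> cl t \<rho>'"
proof -
  \<comment> \<open>The token 0 switches the whole environment from the smaller to the larger one,
    so that continuity in the single variable \<open>x\<close> yields monotonicity in all variables
    at once.\<close>
  let ?G = "\<lambda>x n. guard 0 x (\<rho>' n) \<union> \<rho> n"
  have "cl t (?G {}) \<subseteq> cl t (?G {0})"
    by (intro cont_mono[of "\<lambda>x. cl t (?G x)"] cont_cl cont_intros) simp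
  moreover have "?G {} = \<rho>" "?G {0} = \<rho>'" using assms by (auto simp: guard_def)
  ultimately show ?thesis by simp
qed

lemma val_simps [simp]: "p1 (val t \<rho>) = cl t (edeg \<rho>)" "p2 (val t \<rho>) = cl t \<rho>"
  "deg (val t \<rho>) = val t (edeg \<rho>)"
  by (simp_all add: val_def deg_def)

lemma ord_val: "(\<And>n. ord (\<rho> n)) \<Longrightarrow> ord (val t \<rho>)"
  unfolding ord_def[of "val t \<rho>"] by (simp, rule cl_mono, simp add: ord_p)

lemma val_eqs:
  "val (Var n) \<rho> = \<rho> n"
  "val (App A B f a) \<rho> = apW (val f \<rho>) (val a \<rho>)"
  "val (MkPair A B a b) \<rho> = pairW (val a \<rho>) (val b \<rho>)"
  "val (Proj1 A B p) \<rho> = fstW (val p \<rho>)"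
  "val (Proj2 A B p) \<rho> = sndW (val p \<rho>)"
  "val (InL A B a) \<rho> = mkW 0 (val a \<rho>)"
  "val (InR A B b) \<rho> = mkW 1 (val b \<rho>)"
  by (rule dom_eqI; simp; simp add: val_def)+

lemma apW_val_Lam: "apW (val (Lam A B t) \<rho>) z = val t (ec z \<rho>)"
  by (rule dom_eqI) (simp_all add: beta cont_cl_ec)

lemma val_Cases:
  assumes "val s \<rho> = mkW k z"
  shows "k = 0 \<Longrightarrow> val (Cases A B C l r s) \<rho> = val l (ec z \<rho>)"
    "k = 1 \<Longrightarrow> val (Cases A B C l r s) \<rho> = val r (ec z \<rho>)"
proof -
  have [simp]: "cl s (edeg \<rho>) = mk k (p1 z)" "cl s \<rho> = mk k (p2 z)"
    using arg_cong[OF assms, of p1] arg_cong[OF assms, of p2] by simp_all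
  have [simp]: "sndW (pr (mk j a) (mk j b)) = pr a b" for j a b
    by (rule dom_eqI; simp)
  show "k = 0 \<Longrightarrow> val (Cases A B C l r s) \<rho> = val l (ec z \<rho>)"
    "k = 1 \<Longrightarrow> val (Cases A B C l r s) \<rho> = val r (ec z \<rho>)"
    by (rule dom_eqI; simp add: guard_def flip: deg_def)+
qed

lemma ec_upr: "(\<lambda>n. ec z \<rho> (upr r n)) = ec z (\<lambda>n. \<rho> (r n))"
  by (auto simp: upr_def ec_def fun_eq_iff split: nat.split)

lemma cl_ren: "cl (ren r t) \<rho> = cl t (\<lambda>n. \<rho> (r n))"
proof (induction t arbitrary: r \<rho>)
qed (simp_all add: ec_upr edeg_def)

lemma val_ren: "val (ren r t) \<rho> = val t (\<lambda>n. \<rho> (r n))"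
  by (simp add: val_def cl_ren edeg_def)

lemma ec_ups: "(\<lambda>n. val (ups s n) (ec z \<rho>)) = ec z (\<lambda>n. val (s n) \<rho>)"
  by (auto simp: ups_def ec_def val_ren val_eqs fun_eq_iff split: nat.split)

lemma edeg_val: "edeg (\<lambda>n. val (s n) \<rho>) = (\<lambda>n. val (s n) (edeg \<rho>))"
  by (simp add: edeg_def[of "\<lambda>n. val (s n) \<rho>"])

lemma cl_sub: "cl (sub s t) \<rho> = cl t (\<lambda>n. val (s n) \<rho>)"
  by (induction t arbitrary: s \<rho>) (simp_all add: ec_ups edeg_val)

lemma val_sub: "val (sub s t) \<rho> = val t (\<lambda>n. val (s n) \<rho>)"
  unfolding val_def[of "sub s t"] val_def[of t] by (simp add: cl_sub edeg_val)

section \<open>Sequences of values\<close>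

text \<open>A sequence \<open>nat \<Rightarrow> dom\<close> is a clique in a groupoid: its entries are objects with a coherent
  choice of isomorphisms between them, which is implicit in the transport operations. Cliques can be
  reindexed along any function; \<open>jn x y\<close> interleaves two cliques, and is again a clique
  only if \<open>x\<close> and \<open>y\<close> are connected.\<close>

type_synonym sq = "nat \<Rightarrow> dom"
text \<open>\<open>R h w w'\<close> is to mean that \<open>w\<close> and \<open>w'\<close> are equal
  cliques of elements over the codes reindexed by \<open>h\<close>. These are partial equivalence
  relations: \<open>R h w w\<close> says that \<open>w\<close> is a clique.\<close>

type_synonym krel = "(nat \<Rightarrow> nat) \<Rightarrow> sq \<Rightarrow> sq \<Rightarrow> bool"

definition jn :: "(nat \<Rightarrow> 'a) \<Rightarrow> (nat \<Rightarrow> 'a) \<Rightarrow> nat \<Rightarrow> 'a" where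
  "jn x y n = (if even n then x (n div 2) else y (n div 2))"

definition sdeg :: "sq \<Rightarrow> sq" where "sdeg w = (\<lambda>n. deg (w n))"
definition sap :: "sq \<Rightarrow> sq \<Rightarrow> sq" where "sap F w = (\<lambda>n. apW (F n) (w n))"
definition sfst :: "sq \<Rightarrow> sq" where "sfst w = (\<lambda>n. fstW (w n))"
definition ssnd :: "sq \<Rightarrow> sq" where "ssnd w = (\<lambda>n. sndW (w n))"
definition smk :: "nat \<Rightarrow> sq \<Rightarrow> sq" where "smk k w = (\<lambda>n. mkW k (w n))"
definition sTR :: "sq \<Rightarrow> (nat \<Rightarrow> nat) \<Rightarrow> (nat \<Rightarrow> nat) \<Rightarrow> sq \<Rightarrow> sq" where
  "sTR T f g x = (\<lambda>n. TRW (T (f n)) (T (g n)) (x n))"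
definition sCM :: "sq \<Rightarrow> (nat \<Rightarrow> nat) \<Rightarrow> (nat \<Rightarrow> nat) \<Rightarrow> sq \<Rightarrow> sq \<Rightarrow> sq \<Rightarrow> sq" where
  "sCM T f g a b P = (\<lambda>n. CMW (T (f n)) (T (g n)) (a n) (b n) (P n))"
definition fib :: "sq \<Rightarrow> (nat \<Rightarrow> nat) \<Rightarrow> sq \<Rightarrow> sq" where
  "fib B k w = (\<lambda>n. app (B (k n)) (deg (w n)))"
text \<open>The value of a path is a pair of objects of which only the actual part counts;
  \<open>e0\<close> and \<open>e1\<close> read off the two objects as degenerate values.\<close>

definition e0 :: "sq \<Rightarrow> sq" where "e0 w = (\<lambda>n. dbl (p1 (p1 (w n))))"
definition e1 :: "sq \<Rightarrow> sq" where "e1 w = (\<lambda>n. dbl (p2 (p1 (w n))))"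

lemmas seq_defs = jn_def sdeg_def sap_def sfst_def ssnd_def smk_def sTR_def sCM_def fib_def e0_def e1_def

lemma jn_simps [simp]: "jn x y (2 * n) = x n" "jn x y (Suc (2 * n)) = y n"
  by (simp_all add: jn_def)

lemma jn_id: "jn (\<lambda>n. 2 * n) (\<lambda>n. Suc (2 * n)) = (\<lambda>n. n)"
  by (auto simp: jn_def fun_eq_iff)

section \<open>The relation denoted by a sequence of codes\<close>

definition oneR :: krel where "oneR h w w' \<longleftrightarrow> (\<forall>n. ord (w n) \<and> ord (w' n))"
definition zeroR :: krel where "zeroR h w w' \<longleftrightarrow> False"

text \<open>The type with one element but two dual elements; it refutes function extensionality.\<close>

definition hidR :: krel where
  "hidR h w w' \<longleftrightarrow> (\<forall>n. ord (w n) \<and> ord (w' n) \<and> 0 \<notin> p1 (w n) \<and> 0 \<notin> p1 (w' n)) \<and>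
     (\<exists>b. \<forall>n. (0 \<in> p2 (w n)) = b \<and> (0 \<in> p2 (w' n)) = b)"
definition plusR :: "krel \<Rightarrow> krel \<Rightarrow> krel" where
  "plusR RA RB h w w' \<longleftrightarrow> (\<exists>a a'. w = smk 0 a \<and> w' = smk 0 a' \<and> RA h a a') \<or>
     (\<exists>b b'. w = smk 1 b \<and> w' = smk 1 b' \<and> RB h b b')"
definition sigR :: "krel \<Rightarrow> ((nat \<Rightarrow> nat) \<Rightarrow> sq \<Rightarrow> krel) \<Rightarrow> krel" where
  "sigR RA S h w w' \<longleftrightarrow> RA h (sfst w) (sfst w') \<and> S h (sfst w) (\<lambda>n. n) (ssnd w) (ssnd w')"
text \<open>Kripke style: the argument may be a clique over any further reindexing, since new
  entries can enter when a clique of functions is applied.\<close>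

definition piH :: "krel \<Rightarrow> ((nat \<Rightarrow> nat) \<Rightarrow> sq \<Rightarrow> krel) \<Rightarrow> krel" where
  "piH RA S h F F' \<longleftrightarrow> (\<forall>k w w'. RA (h \<circ> k) w w' \<longrightarrow>
     S (h \<circ> k) w (\<lambda>n. n) (sap (F \<circ> k) w) (sap (F' \<circ> k) w'))"
text \<open>The last condition concerns the actual part of \<open>F\<close> as it acts on dual
  arguments. Equality of actual parts in a function type includes this action, and a homotopy does
  not see it.\<close>

definition piR :: "krel \<Rightarrow> ((nat \<Rightarrow> nat) \<Rightarrow> sq \<Rightarrow> krel) \<Rightarrow> krel" where
  "piR RA S h F F' \<longleftrightarrow> (\<forall>n. ord (F n) \<and> ord (F' n)) \<and> piH RA S h F F' \<and> piH RA S h (sdeg F) (sdeg F')"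
text \<open>A path is a clique with two entries, the first equal to \<open>a\<close> and the second
  to \<open>b\<close>. The link between them is that \<open>jn (e0 w) (e1 w)\<close> is a clique
  over the doubled index, as \<open>eqR\<close> requires; \<open>a\<close> and \<open>b\<close>
  themselves need not be interleaved.\<close>

definition eqH :: "krel \<Rightarrow> sq \<Rightarrow> sq \<Rightarrow> (nat \<Rightarrow> nat) \<Rightarrow> sq \<Rightarrow> bool" where
  "eqH RA a b h w \<longleftrightarrow> (\<forall>n. ord (w n)) \<and> RA h (e0 w) (\<lambda>n. dbl (a (h n))) \<and> RA h (e1 w) (\<lambda>n. dbl (b (h n)))"
definition eqR :: "krel \<Rightarrow> sq \<Rightarrow> sq \<Rightarrow> krel" where
  "eqR RA a b h w w' \<longleftrightarrow> eqH RA a b h w \<and> eqH RA a b h w' \<and>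
     RA (jn h h) (jn (e0 w) (e1 w)) (jn (e0 w') (e1 w'))"
text \<open>Elements come from \<open>Y\<close>, links between them from \<open>X\<close>: each
  entry is an element of its own \<open>Y\<close> in isolation, and only the sequence pulled back
  along \<open>v\<close> has to be a clique.\<close>

definition frR :: "krel \<Rightarrow> (nat \<Rightarrow> krel) \<Rightarrow> sq \<Rightarrow> krel" where
  "frR RX RY v h w w' \<longleftrightarrow> RX h (\<lambda>n. fap (v (h n)) (w n)) (\<lambda>n. fap (v (h n)) (w' n)) \<and>
     (\<forall>n. RY (h n) (\<lambda>n. n) (\<lambda>_. w n) (\<lambda>_. w' n))"

text \<open>An inductive-recursive definition of types and their relations, rendered as an inductive
  relation whose functionality is \<open>den_det\<close>. The parameter interprets the code of the
  universe, so that types without a universe can be treated first and then serve to define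
  it.\<close>

inductive den :: "(sq \<Rightarrow> krel \<Rightarrow> bool) \<Rightarrow> sq \<Rightarrow> krel \<Rightarrow> bool" for uu where
  den_base: "uu T R \<Longrightarrow> (\<And>e. T e = UnivC) \<Longrightarrow> den uu T R"
| den_One: "(\<And>e. T e = OneC) \<Longrightarrow> den uu T oneR"
| den_Zero: "(\<And>e. T e = ZeroC) \<Longrightarrow> den uu T zeroR"
| den_Hid: "(\<And>e. T e = HidC) \<Longrightarrow> den uu T hidR"
| den_Plus: "(\<And>e. T e = PlusC (A e) (B e)) \<Longrightarrow> den uu A RA \<Longrightarrow> den uu B RB \<Longrightarrow> den uu T (plusR RA RB)"
| den_Sig: "(\<And>e. T e = SigC (A e) (B e)) \<Longrightarrow> den uu A RA \<Longrightarrow>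
    (\<And>k w w'. RA k w w' \<Longrightarrow> den uu (fib B k w) (S k w)) \<Longrightarrow> den uu T (sigR RA S)"
| den_Pi: "(\<And>e. T e = PiC (A e) (B e)) \<Longrightarrow> den uu A RA \<Longrightarrow>
    (\<And>k w w'. RA k w w' \<Longrightarrow> den uu (fib B k w) (S k w)) \<Longrightarrow> den uu T (piR RA S)"
| den_Eq: "(\<And>e. T e = EqC (A e) (a e) (b e)) \<Longrightarrow> den uu A RA \<Longrightarrow> den uu T (eqR RA a b)"
| den_Fr: "(\<And>e. T e = Fr (Y e) (X e) (u e) (v e)) \<Longrightarrow> den uu X RX \<Longrightarrow>
    (\<And>e. den uu (\<lambda>_. Y e) (RY e)) \<Longrightarrow> den uu T (frR RX RY v)"

lemma den_mono:
  assumes "den uu T R" "\<And>T R. uu T R \<Longrightarrow> vv T R"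
  shows "den vv T R"
  using assms(1) by induction (rule den.intros; (rule assms(2))?; assumption)+

lemma sigR_cong: assumes "\<And>k w w'. RA k w w' \<Longrightarrow> S k w = S' k w" shows "sigR RA S = sigR RA S'"
  unfolding sigR_def fun_eq_iff using assms by metis
lemma piR_cong: assumes "\<And>k w w'. RA k w w' \<Longrightarrow> S k w = S' k w" shows "piR RA S = piR RA S'"
  unfolding piR_def piH_def fun_eq_iff using assms by (metis (no_types, lifting))

lemma den_det:
  assumes "den uu T R" "den uu T R'" and uu: "\<And>T R R'. uu T R \<Longrightarrow> uu T R' \<Longrightarrow> R = R'"
  shows "R = R'"
  using assms(1,2)
proof (induction arbitrary: R' rule: den.induct)
  case (den_base T R)
  from den_base.prems show ?case
    by cases (use den_base.hyps in \<open>auto simp: code_defs dest: uu\<close>)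
next
  case (den_One T)
  from den_One.prems show ?case by cases (use den_One.hyps in \<open>auto simp: code_defs\<close>)
next
  case (den_Zero T)
  from den_Zero.prems show ?case by cases (use den_Zero.hyps in \<open>auto simp: code_defs\<close>)
next
  case (den_Hid T)
  from den_Hid.prems show ?case by cases (use den_Hid.hyps in \<open>auto simp: code_defs\<close>)
next
  case (den_Plus T A B RA RB)
  from den_Plus.prems show ?case
  proof cases
    case (den_Plus A' B' RA' RB')
    then have "A' = A" "B' = B" using den_Plus.hyps(1) by (auto simp: fun_eq_iff)
    then show ?thesis using den_Plus den_Plus.IH by auto
  qed (use den_Plus.hyps(1) in \<open>auto simp: code_defs\<close>)
next
  case (den_Sig T A B RA S)
  note hyp = den_Sig.hyps and IH = den_Sig.IH
  from den_Sig.prems show ?case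
  proof cases
    case (den_Sig A' B' RA' S')
    then have [simp]: "A' = A" "B' = B" using hyp(1) by (auto simp: fun_eq_iff)
    have [simp]: "RA' = RA" using den_Sig IH(1) by auto
    show ?thesis using den_Sig(1,4) IH(2) by (auto intro!: sigR_cong)
  qed (use hyp(1) in \<open>auto simp: code_defs\<close>)
next
  case (den_Pi T A B RA S)
  note hyp = den_Pi.hyps and IH = den_Pi.IH
  from den_Pi.prems show ?case
  proof cases
    case (den_Pi A' B' RA' S')
    then have [simp]: "A' = A" "B' = B" using hyp(1) by (auto simp: fun_eq_iff)
    have [simp]: "RA' = RA" using den_Pi IH(1) by auto
    show ?thesis using den_Pi(1,4) IH(2) by (auto intro!: piR_cong)
  qed (use hyp(1) in \<open>auto simp: code_defs\<close>)
next
  case (den_Eq T A a b RA)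
  note hyp = den_Eq.hyps and IH = den_Eq.IH
  from den_Eq.prems show ?case
  proof cases
    case (den_Eq A' a' b' RA')
    then have "A' = A" "a' = a" "b' = b" using hyp(1) by (auto simp: fun_eq_iff)
    then show ?thesis using den_Eq IH by auto
  qed (use hyp(1) in \<open>auto simp: code_defs\<close>)
next
  case (den_Fr T Y X u v RX RY)
  note hyp = den_Fr.hyps and IH = den_Fr.IH
  from den_Fr.prems show ?case
  proof cases
    case (den_Fr Y' X' u' v' RX' RY')
    then have [simp]: "X' = X" "Y' = Y" "v' = v" using hyp(1) by (auto simp: fun_eq_iff)
    have "RX = RX'" using den_Fr by (auto intro: IH(1))
    moreover have "RY = RY'" using den_Fr by (auto intro!: ext[of RY] IH(2))
    ultimately
    show ?thesis using den_Fr by auto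
  qed (use hyp(1) in \<open>auto simp: code_defs\<close>)
qed

lemma den_reindex:
  assumes "den uu T R" and uu: "\<And>T R h. uu T R \<Longrightarrow> uu (T \<circ> h) (\<lambda>k. R (h \<circ> k))"
  shows "den uu (T \<circ> h) (\<lambda>k. R (h \<circ> k))"
  using assms(1)
proof (induction arbitrary: h)
  case (den_base T R)
  have "uu (T \<circ> h) (\<lambda>k. R (h \<circ> k))" by (rule uu[OF den_base(1)])
  then show ?case by (rule den.den_base[of uu "T \<circ> h"]) (simp add: den_base(2))
next
  case (den_Plus T A B RA RB)
  have *: "(\<lambda>k. plusR RA RB (h \<circ> k)) = plusR (\<lambda>k. RA (h \<circ> k)) (\<lambda>k. RB (h \<circ> k))"
    by (simp add: plusR_def fun_eq_iff)
  show ?case unfolding *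
    by (rule den.den_Plus[OF _ den_Plus.IH]) (simp add: den_Plus.hyps(1))
next
  case (den_Sig T A B RA S)
  have *: "(\<lambda>k. sigR RA S (h \<circ> k)) = sigR (\<lambda>k. RA (h \<circ> k)) (\<lambda>k. S (h \<circ> k))"
    by (simp add: sigR_def fun_eq_iff)
  have fib: "fib (B \<circ> h) k w = fib B (h \<circ> k) w" for k w by (simp add: fib_def)
  show ?case unfolding *
    by (rule den.den_Sig[where B = "B \<circ> h", OF _ den_Sig.IH(1)]) 
      (simp add: den_Sig.hyps(1), unfold fib, rule den_Sig.hyps(3))
next
  case (den_Pi T A B RA S)
  have *: "(\<lambda>k. piR RA S (h \<circ> k)) = piR (\<lambda>k. RA (h \<circ> k)) (\<lambda>k. S (h \<circ> k))"
    by (simp add: piR_def piH_def fun_eq_iff o_assoc)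
  have fib: "fib (B \<circ> h) k w = fib B (h \<circ> k) w" for k w by (simp add: fib_def)
  show ?case unfolding *
    by (rule den.den_Pi[where B = "B \<circ> h", OF _ den_Pi.IH(1)]) 
      (simp add: den_Pi.hyps(1), unfold fib, rule den_Pi.hyps(3))
next
  case (den_Eq T A a b RA)
  have "jn (h \<circ> k) (h \<circ> k) = h \<circ> jn k k" for k by (auto simp: jn_def fun_eq_iff)
  then have *: "(\<lambda>k. eqR RA a b (h \<circ> k)) = eqR (\<lambda>k. RA (h \<circ> k)) (a \<circ> h) (b \<circ> h)"
    by (intro ext) (simp add: eqR_def eqH_def)
  show ?case unfolding *
    by (rule den.den_Eq[OF _ den_Eq.IH]) (simp add: den_Eq.hyps(1))
next
  case (den_Fr T Y X u v RX RY)
  have *: "(\<lambda>k. frR RX RY v (h \<circ> k)) = frR (\<lambda>k. RX (h \<circ> k)) (\<lambda>e. RY (h e)) (v \<circ> h)"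
    by (simp add: frR_def fun_eq_iff)
  show ?case unfolding *
    by (rule den.den_Fr[where Y = "\<lambda>e. Y (h e)" and u = "u \<circ> h", OF _ den_Fr.IH(1)])
      (simp add: den_Fr.hyps(1), rule den_Fr.hyps(3))
next
  case (den_One T)
  have *: "(\<lambda>k. oneR (h \<circ> k)) = oneR" by (simp add: oneR_def fun_eq_iff)
  show ?case unfolding * by (rule den.den_One) (simp add: den_One)
next
  case (den_Zero T)
  have *: "(\<lambda>k. zeroR (h \<circ> k)) = zeroR" by (simp add: zeroR_def fun_eq_iff)
  show ?case unfolding * by (rule den.den_Zero) (simp add: den_Zero)
next
  case (den_Hid T)
  have *: "(\<lambda>k. hidR (h \<circ> k)) = hidR" by (simp add: hidR_def fun_eq_iff)
  show ?case unfolding * by (rule den.den_Hid) (simp add: den_Hid)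
qed

section \<open>Types with transport\<close>

definition rel :: "krel \<Rightarrow> bool" where
  "rel R \<longleftrightarrow> (\<forall>h w w'. R h w w' \<longrightarrow> R h w' w) \<and>
     (\<forall>h w w' w''. R h w w' \<longrightarrow> R h w' w'' \<longrightarrow> R h w w'') \<and>
     (\<forall>h k w w'. R h w w' \<longrightarrow> R (h \<circ> k) (w \<circ> k) (w' \<circ> k)) \<and>
     (\<forall>h w w'. R h w w' \<longrightarrow> R h (sdeg w) (sdeg w')) \<and>
     (\<forall>h w w' n. R h w w' \<longrightarrow> ord (w n))"

text \<open>With equal codes this is the existence of transport: a clique over \<open>f\<close>
  together with its transport to \<open>g\<close> is again a clique. With two codes it also says
  that their transports agree, and in this form it is part of equality of types.\<close>

definition trok :: "sq \<Rightarrow> sq \<Rightarrow> krel \<Rightarrow> bool" where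
  "trok T T' R \<longleftrightarrow> (\<forall>f g x x'. R f x x' \<longrightarrow>
     R (jn f g) (jn x (sTR T f g x)) (jn x' (sTR T' f g x')))"

text \<open>Transport along an unchanged reindexing is the identity up to the relation. The
  computation rule of \<open>J\<close> is derived from this.\<close>

definition trid :: "sq \<Rightarrow> krel \<Rightarrow> bool" where
  "trid T R \<longleftrightarrow> (\<forall>f x. R f x x \<longrightarrow> R (jn f f) (jn x (sTR T f f x)) (jn x x))"

text \<open>\<open>sCM T f g a b P\<close> moves \<open>P\<close>, which agrees with \<open>a\<close> along the reindexings in \<open>Q\<close>, to a clique that agrees
  with \<open>b\<close> along them, where \<open>a\<close> and \<open>b\<close> are connected along the reindexings in \<open>Q\<close>. This is the
  composition of paths that transport in identity types needs.\<close>

definition cmp_hyp :: "krel \<Rightarrow> (nat \<Rightarrow> nat) \<Rightarrow> (nat \<Rightarrow> nat) \<Rightarrow> (nat \<Rightarrow> nat) set \<Rightarrow> sq \<Rightarrow> sq \<Rightarrow> sq \<Rightarrow> bool" where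
  "cmp_hyp R f g Q a b P \<longleftrightarrow> R f P P \<and> (\<forall>r\<in>Q. \<forall>k. r \<circ> k \<in> Q) \<and> (\<forall>n. (\<lambda>_. n) \<in> Q) \<and>
     (\<forall>r\<in>Q. R (jn (f \<circ> r) (g \<circ> r)) (jn (a \<circ> r) (b \<circ> r)) (jn (a \<circ> r) (b \<circ> r)) \<and>
        R (f \<circ> r) (a \<circ> r) (P \<circ> r))"

definition cmpok :: "sq \<Rightarrow> krel \<Rightarrow> bool" where
  "cmpok T R \<longleftrightarrow> (\<forall>f g Q a b P. cmp_hyp R f g Q a b P \<longrightarrow>
     R (jn f g) (jn P (sCM T f g a b P)) (jn P (sCM T f g a b P)) \<and>
     (\<forall>r\<in>Q. R (jn (f \<circ> r) (g \<circ> r)) (jn (P \<circ> r) (sCM T f g a b P \<circ> r)) (jn (a \<circ> r) (b \<circ> r))))"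

text \<open>Equality of interleaved cliques is a local question: it can be tested on the first half
  and on each single edge from \<open>f n\<close> to \<open>g n\<close>. This is what allows
  composites that are known edge by edge to be compared as wholes.\<close>

definition uniq :: "krel \<Rightarrow> bool" where
  "uniq R \<longleftrightarrow> (\<forall>f g x y x' y'. R (jn f g) (jn x y) (jn x y) \<longrightarrow> R (jn f g) (jn x' y') (jn x' y') \<longrightarrow>
     R f x x' \<longrightarrow>
     (\<forall>n. R (jn (\<lambda>_. f n) (\<lambda>_. g n)) (jn (\<lambda>_. x n) (\<lambda>_. y n)) (jn (\<lambda>_. x' n) (\<lambda>_. y' n))) \<longrightarrow>
     R (jn f g) (jn x y) (jn x' y'))"

definition good :: "sq \<Rightarrow> krel \<Rightarrow> bool" where
  "good T R \<longleftrightarrow> rel R \<and> trok T T R \<and> trid T R \<and> cmpok T R \<and> uniq R"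

lemma rel_sym: "rel R \<Longrightarrow> R h w w' \<Longrightarrow> R h w' w" unfolding rel_def by blast
lemma rel_trans: "rel R \<Longrightarrow> R h w w' \<Longrightarrow> R h w' w'' \<Longrightarrow> R h w w''" unfolding rel_def by blast
lemma rel_refl: "rel R \<Longrightarrow> R h w w' \<Longrightarrow> R h w w" "rel R \<Longrightarrow> R h w w' \<Longrightarrow> R h w' w'" 
  unfolding rel_def by blast+
lemma rel_re: "rel R \<Longrightarrow> R h w w' \<Longrightarrow> R (h \<circ> k) (w \<circ> k) (w' \<circ> k)" unfolding rel_def by blast
lemma rel_deg: "rel R \<Longrightarrow> R h w w' \<Longrightarrow> R h (sdeg w) (sdeg w')" unfolding rel_def by blast
lemma rel_ord: "rel R \<Longrightarrow> R h w w' \<Longrightarrow> ord (w n)" "rel R \<Longrightarrow> R h w w' \<Longrightarrow> ord (w' n)"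
  unfolding rel_def by blast+

lemma rel_reI: "rel R \<Longrightarrow> R h w w' \<Longrightarrow> h1 = h \<circ> k \<Longrightarrow> w1 = w \<circ> k \<Longrightarrow> w1' = w' \<circ> k \<Longrightarrow> R h1 w1 w1'"
  using rel_re by blast

lemma jn_comp [simp]: "jn x y \<circ> (*) 2 = x" "jn x y \<circ> (\<lambda>n. Suc (2 * n)) = y" "f \<circ> (\<lambda>n. n) = f"
  "(\<lambda>n. n) \<circ> r = r" "jn x y \<circ> ((*) 2 \<circ> r) = x \<circ> r" "jn x y \<circ> ((\<lambda>n. Suc (2 * n)) \<circ> r) = y \<circ> r"
  "g \<circ> (\<lambda>_. c) = (\<lambda>_. g c)"
  by (simp_all add: fun_eq_iff)

lemma rel_jn:
  assumes "rel R" "R (jn f g) (jn x y) (jn x' y')"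
  shows "R f x x'" "R g y y'"
  using rel_re[OF assms(1), OF assms(2), of "\<lambda>n. 2 * n"] rel_re[OF assms(1), OF assms(2), of "\<lambda>n. Suc (2 * n)"]
  by simp_all

lemma trokD: "trok T T' R \<Longrightarrow> R f x x' \<Longrightarrow> R (jn f g) (jn x (sTR T f g x)) (jn x' (sTR T' f g x'))"
  unfolding trok_def by blast
lemma tridD: "trid T R \<Longrightarrow> R f x x \<Longrightarrow> R (jn f f) (jn x (sTR T f f x)) (jn x x)"
  unfolding trid_def by blast
lemma cmpokD: "cmpok T R \<Longrightarrow> cmp_hyp R f g Q a b P \<Longrightarrow>
     R (jn f g) (jn P (sCM T f g a b P)) (jn P (sCM T f g a b P))"
  "cmpok T R \<Longrightarrow> cmp_hyp R f g Q a b P \<Longrightarrow> r \<in> Q \<Longrightarrow>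
     R (jn (f \<circ> r) (g \<circ> r)) (jn (P \<circ> r) (sCM T f g a b P \<circ> r)) (jn (a \<circ> r) (b \<circ> r))"
  unfolding cmpok_def by blast+
lemma uniqD: "uniq R \<Longrightarrow> R (jn f g) (jn x y) (jn x y) \<Longrightarrow> R (jn f g) (jn x' y') (jn x' y') \<Longrightarrow>
     R f x x' \<Longrightarrow>
     (\<And>n. R (jn (\<lambda>_. f n) (\<lambda>_. g n)) (jn (\<lambda>_. x n) (\<lambda>_. y n)) (jn (\<lambda>_. x' n) (\<lambda>_. y' n))) \<Longrightarrow>
     R (jn f g) (jn x y) (jn x' y')"
  unfolding uniq_def by blast

lemma goodD: "good T R \<Longrightarrow> rel R" "good T R \<Longrightarrow> trok T T R" "good T R \<Longrightarrow> trid T R" 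
  "good T R \<Longrightarrow> cmpok T R" "good T R \<Longrightarrow> uniq R"
  unfolding good_def by auto

lemma cmp_hyp_ord:
  assumes "rel R" "cmp_hyp R f g Q a b P"
  shows "ord (a n)" "ord (b n)" "ord (P n)"
proof -
  have "R (jn (f \<circ> (\<lambda>_. n)) (g \<circ> (\<lambda>_. n))) (jn (a \<circ> (\<lambda>_. n)) (b \<circ> (\<lambda>_. n))) (jn (a \<circ> (\<lambda>_. n)) (b \<circ> (\<lambda>_. n)))"
    and *: "R f P P"
    using assms(2) unfolding cmp_hyp_def by blast+
  from rel_ord(1)[OF assms(1), OF this(1), of 0] rel_ord(1)[OF assms(1), OF this(1), of 1] rel_ord(1)[OF assms(1), OF *]
  show "ord (a n)" "ord (b n)" "ord (P n)" by (simp_all add: jn_def)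
qed

lemma jn_push: "sfst (jn x y) = jn (sfst x) (sfst y)" "ssnd (jn x y) = jn (ssnd x) (ssnd y)"
  "sdeg (jn x y) = jn (sdeg x) (sdeg y)" "sap (jn x y) (jn z w) = jn (sap x z) (sap y w)"
  "smk k (jn x y) = jn (smk k x) (smk k y)" "e0 (jn x y) = jn (e0 x) (e0 y)" "e1 (jn x y) = jn (e1 x) (e1 y)"
  by (auto simp: seq_defs fun_eq_iff)

lemma o_push: "sfst (x \<circ> r) = sfst x \<circ> r" "ssnd (x \<circ> r) = ssnd x \<circ> r" "sdeg (x \<circ> r) = sdeg x \<circ> r"
  "sap (x \<circ> r) (y \<circ> r) = sap x y \<circ> r" "smk k (x \<circ> r) = smk k x \<circ> r" "e0 (x \<circ> r) = e0 x \<circ> r" "e1 (x \<circ> r) = e1 x \<circ> r"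
  by (auto simp: seq_defs)

lemma sdeg_push: "sdeg (sTR T f g x) = sTR T f g (sdeg x)" 
  "sdeg (sCM T f g a b P) = sCM T f g (sdeg a) (sdeg b) (sdeg P)"
  "sdeg (sap F w) = sap (sdeg F) (sdeg w)" "sdeg (sfst w) = sfst (sdeg w)" "sdeg (ssnd w) = ssnd (sdeg w)"
  "sdeg (sdeg w) = sdeg w" "e0 (sdeg w) = e0 w" "e1 (sdeg w) = e1 w"
  by (simp_all add: seq_defs)

lemma jn_diag: "jn (\<lambda>n. n) (\<lambda>n. n) = (\<lambda>n. n div 2)" by (simp add: jn_def fun_eq_iff)

lemma jn_o: "f \<circ> jn x y = jn (f \<circ> x) (f \<circ> y)" by (auto simp: jn_def)

lemma fib_sdeg [simp]: "fib B k (sdeg w) = fib B k w" by (simp add: fib_def sdeg_def)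
lemma fib_o: "fib B (k \<circ> j) (w \<circ> j) = fib B k w \<circ> j" by (simp add: fib_def fun_eq_iff)

lemma cmp_hyp_deg:
  assumes "rel R" "cmp_hyp R f g Q a b P"
  shows "cmp_hyp R f g Q (sdeg a) (sdeg b) (sdeg P)"
proof -
  have "R h (sdeg w) (sdeg w')" if "R h w w'" for h w w' using rel_deg[OF assms(1), OF that] .
  then show ?thesis using assms(2)
    unfolding cmp_hyp_def by (metis jn_push(3) o_push(3))
qed

section \<open>Dependent sums\<close>

lemma TRW_Sig: "fstW (TRW (SigC A B) (SigC A' B') z) = TRW A A' (fstW z)"
  "sndW (TRW (SigC A B) (SigC A' B') z) = TRW (app B (deg (fstW z))) (app B' (deg (TRW A A' (fstW z)))) (sndW z)"
  by (rule dom_eqI; simp add: TR_simps)+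

lemma CMW_Sig: "fstW (CMW (SigC A B) (SigC A' B') a b P) = CMW A A' (fstW a) (fstW b) (fstW P)"
  "sndW (CMW (SigC A B) (SigC A' B') a b P) = CMW (app B (deg (fstW P)))
     (app B' (deg (CMW A A' (fstW a) (fstW b) (fstW P)))) (sndW a) (sndW b) (sndW P)"
  by (rule dom_eqI; simp add: CM_simps)+

text \<open>Shared by dependent sums and products. \<open>S k w\<close> is the relation of the
  fibres over the index clique \<open>w\<close>; the assumptions say that it respects equality of
  indices, restricts along reindexings, and sees only actual parts of the index.\<close>

locale family =
  fixes A B :: sq and RA :: krel and S :: "(nat \<Rightarrow> nat) \<Rightarrow> sq \<Rightarrow> krel"
  assumes gA: "good A RA"
    and gB: "RA k w w' \<Longrightarrow> good (fib B k w) (S k w)"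
    and tB: "RA k w w' \<Longrightarrow> trok (fib B k w) (fib B k w') (S k w)"
    and eS: "RA k w w' \<Longrightarrow> S k w = S k w'"
    and cS: "RA k w w \<Longrightarrow> S (k \<circ> j) (w \<circ> j) = (\<lambda>l. S k w (j \<circ> l))"
    and dS: "RA k w w \<Longrightarrow> S k (sdeg w) = S k w"
begin

lemmas rA = goodD(1)[OF gA]
lemma rS: "RA k w w' \<Longrightarrow> rel (S k w)" using goodD(1)[OF gB] .

lemma S_sub: "RA k w w \<Longrightarrow> S k w j = S (k \<circ> j) (w \<circ> j) (\<lambda>n. n)"
  using cS[of k w j] by simp

lemma S_left: "RA (jn f g) (jn a b) (jn a b) \<Longrightarrow> S (jn f g) (jn a b) (\<lambda>n. 2 * n) = S f a (\<lambda>n. n)"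
  by (subst S_sub) simp_all

lemma rel_sig: "rel (sigR RA S)"
proof -
  have "sigR RA S h w' w" if "sigR RA S h w w'" for h w w'
  proof -
    have 1: "RA h (sfst w) (sfst w')" "S h (sfst w) (\<lambda>n. n) (ssnd w) (ssnd w')" using that by (auto simp: sigR_def)
    show ?thesis using rel_sym[OF rA, OF 1(1)] rel_sym[OF rS[OF 1(1)], OF 1(2)] eS[OF 1(1)] by (simp add: sigR_def)
  qed
  moreover have "sigR RA S h w w''" if "sigR RA S h w w'" "sigR RA S h w' w''" for h w w' w''
  proof -
    have 1: "RA h (sfst w) (sfst w')" "S h (sfst w) (\<lambda>n. n) (ssnd w) (ssnd w')" 
      and 2: "RA h (sfst w') (sfst w'')" "S h (sfst w') (\<lambda>n. n) (ssnd w') (ssnd w'')" 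
      using that by (auto simp: sigR_def)
    show ?thesis using rel_trans[OF rA, OF 1(1) 2(1)] rel_trans[OF rS[OF 1(1)], OF 1(2), of "ssnd w''"] 2(2) eS[OF 1(1)]
      by (simp add: sigR_def)
  qed
  moreover have "sigR RA S (h \<circ> k) (w \<circ> k) (w' \<circ> k)" if "sigR RA S h w w'" for h k w w'
  proof -
    have 1: "RA h (sfst w) (sfst w')" "S h (sfst w) (\<lambda>n. n) (ssnd w) (ssnd w')" using that by (auto simp: sigR_def)
    show ?thesis using rel_re[OF rA, OF 1(1), of k] rel_re[OF rS[OF 1(1)], OF 1(2), of k] 
        S_sub[OF rel_refl(1)[OF rA, OF 1(1)], of k]
      by (simp add: sigR_def o_push)
  qed
  moreover have "sigR RA S h (sdeg w) (sdeg w')" if "sigR RA S h w w'" for h w w'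
  proof -
    have 1: "RA h (sfst w) (sfst w')" "S h (sfst w) (\<lambda>n. n) (ssnd w) (ssnd w')" using that by (auto simp: sigR_def)
    show ?thesis using rel_deg[OF rA, OF 1(1)] rel_deg[OF rS[OF 1(1)], OF 1(2)] dS[OF rel_refl(1)[OF rA, OF 1(1)]]
      by (simp add: sigR_def sdeg_push(4,5)[symmetric])
  qed
  moreover have "ord (w n)" if "sigR RA S h w w'" for h w w' n
  proof -
    have 1: "RA h (sfst w) (sfst w')" "S h (sfst w) (\<lambda>n. n) (ssnd w) (ssnd w')" using that by (auto simp: sigR_def)
    have "ord (fstW (w n))" "ord (sndW (w n))"
      using rel_ord(1)[OF rA, OF 1(1), of n] rel_ord(1)[OF rS[OF 1(1)], OF 1(2), of n] by (simp_all add: sfst_def ssnd_def)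
    then show ?thesis using ord_W(8)[of "fstW (w n)" "sndW (w n)"] by simp
  qed
  ultimately show ?thesis unfolding rel_def by blast
qed

text \<open>The first components and their transports form one clique in \<open>A\<close>. Over it,
  the second components are moved by the transport of a single family of fibres, from its even to
  its odd positions.\<close>

lemma trok_sig:
  assumes A': "trok A A' RA" and B': "\<And>k w w'. RA k w w' \<Longrightarrow> trok (fib B k w) (fib B' k w') (S k w)"
  shows "trok (\<lambda>e. SigC (A e) (B e)) (\<lambda>e. SigC (A' e) (B' e)) (sigR RA S)"
  unfolding trok_def
proof (intro allI impI)
  fix f g w w' assume "sigR RA S f w w'"
  then have 1: "RA f (sfst w) (sfst w')" "S f (sfst w) (\<lambda>n. n) (ssnd w) (ssnd w')" by (auto simp: sigR_def)
  let ?a = "sTR A f g (sfst w)" and ?a' = "sTR A' f g (sfst w')"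
  let ?z = "jn (sfst w) ?a" and ?z' = "jn (sfst w') ?a'"
  have z: "RA (jn f g) ?z ?z'" by (rule trokD[OF A', OF 1(1)])
  have zz: "RA (jn f g) ?z ?z" by (rule rel_refl(1)[OF rA, OF z])
  have "S (jn f g) ?z (\<lambda>n. 2 * n) (ssnd w) (ssnd w')"
    using 1(2) S_left[OF zz] by simp
  from trokD[OF B'[OF z], OF this, of "\<lambda>n. Suc (2 * n)"]
  have "S (jn f g) ?z (\<lambda>n. n) (jn (ssnd w) (sTR (fib B (jn f g) ?z) (\<lambda>n. 2 * n) (\<lambda>n. Suc (2 * n)) (ssnd w)))
     (jn (ssnd w') (sTR (fib B' (jn f g) ?z') (\<lambda>n. 2 * n) (\<lambda>n. Suc (2 * n)) (ssnd w')))"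
    by (simp add: jn_id)
  with z show "sigR RA S (jn f g) (jn w (sTR (\<lambda>e. SigC (A e) (B e)) f g w)) (jn w' (sTR (\<lambda>e. SigC (A' e) (B' e)) f g w'))"
    unfolding sigR_def jn_push by (simp add: sfst_def ssnd_def sTR_def TRW_Sig fib_def)
qed

text \<open>The transported first component equals the old one, so the fibres over it may be
  exchanged for the fibres over the constant clique, where \<open>trid\<close> of the fibres
  applies.\<close>

lemma trid_sig: "trid (\<lambda>e. SigC (A e) (B e)) (sigR RA S)"
  unfolding trid_def
proof (intro allI impI)
  fix f w assume "sigR RA S f w w"
  then have 1: "RA f (sfst w) (sfst w)" "S f (sfst w) (\<lambda>n. n) (ssnd w) (ssnd w)" by (auto simp: sigR_def)
  let ?a = "sTR A f f (sfst w)"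
  let ?z = "jn (sfst w) ?a" and ?z' = "jn (sfst w) (sfst w)"
  have z: "RA (jn f f) ?z ?z'" by (rule tridD[OF goodD(3)[OF gA], OF 1(1)])
  have zz: "RA (jn f f) ?z ?z" by (rule rel_refl(1)[OF rA, OF z])
  have "S (jn f f) ?z (\<lambda>n. 2 * n) (ssnd w) (ssnd w)"
    using 1(2) S_left[OF zz] by simp
  from trokD[OF tB[OF z], OF this, of "\<lambda>n. Suc (2 * n)"]
  have 2: "S (jn f f) ?z (\<lambda>n. n) (jn (ssnd w) (sTR (fib B (jn f f) ?z) (\<lambda>n. 2 * n) (\<lambda>n. Suc (2 * n)) (ssnd w)))
     (jn (ssnd w) (sTR (fib B (jn f f) ?z') (\<lambda>n. 2 * n) (\<lambda>n. Suc (2 * n)) (ssnd w)))"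
    by (simp add: jn_id)
  have d: "jn f f = f \<circ> (\<lambda>n. n div 2)" "?z' = sfst w \<circ> (\<lambda>n. n div 2)" by (auto simp: jn_def)
  have "S (jn f f) ?z = (\<lambda>l. S f (sfst w) ((\<lambda>n. n div 2) \<circ> l))"
    using eS[OF z] cS[OF 1(1), of "\<lambda>n. n div 2"] d by simp
  then have S: "S (jn f f) ?z (\<lambda>n. n) = S f (sfst w) (jn (\<lambda>n. n) (\<lambda>n. n))"
    by (simp add: comp_def jn_diag)
  have "S f (sfst w) (jn (\<lambda>n. n) (\<lambda>n. n)) (jn (ssnd w) (sTR (fib B f (sfst w)) (\<lambda>n. n) (\<lambda>n. n) (ssnd w))) (jn (ssnd w) (ssnd w))"
    by (rule tridD[OF goodD(3)[OF gB[OF 1(1)]], OF 1(2)])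
  moreover have "sTR (fib B f (sfst w)) (\<lambda>n. n) (\<lambda>n. n) (ssnd w) = sTR (fib B (jn f f) ?z') (\<lambda>n. 2 * n) (\<lambda>n. Suc (2 * n)) (ssnd w)"
    by (simp add: sTR_def fib_def)
  ultimately have "S (jn f f) ?z (\<lambda>n. n) (jn (ssnd w) (sTR (fib B (jn f f) ?z) (\<lambda>n. 2 * n) (\<lambda>n. Suc (2 * n)) (ssnd w)))
     (jn (ssnd w) (ssnd w))"
    using rel_trans[OF rS[OF z], OF 2] S by simp
  with z show "sigR RA S (jn f f) (jn w (sTR (\<lambda>e. SigC (A e) (B e)) f f w)) (jn w w)"
    unfolding sigR_def jn_push by (simp add: sfst_def ssnd_def sTR_def TRW_Sig fib_def)
qed

text \<open>The composite \<open>q\<close> of the first components is found in \<open>A\<close>;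
  over the clique of \<open>sfst P\<close> and \<open>q\<close> the second components are composed
  from even to odd positions.\<close>

lemma cmpok_sig: "cmpok (\<lambda>e. SigC (A e) (B e)) (sigR RA S)"
  unfolding cmpok_def
proof (intro allI impI)
  fix f g Q a b P assume H: "cmp_hyp (sigR RA S) f g Q a b P"
  let ?Z = "sCM (\<lambda>e. SigC (A e) (B e)) f g a b P"
  have P: "RA f (sfst P) (sfst P)" "S f (sfst P) (\<lambda>n. n) (ssnd P) (ssnd P)"
    and Q: "\<forall>r\<in>Q. \<forall>k. r \<circ> k \<in> Q" "\<forall>n. (\<lambda>_. n) \<in> Q"
    using H by (auto simp: cmp_hyp_def sigR_def)
  have ab: "RA (jn (f \<circ> r) (g \<circ> r)) (jn (sfst a \<circ> r) (sfst b \<circ> r)) (jn (sfst a \<circ> r) (sfst b \<circ> r))"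
    "S (jn (f \<circ> r) (g \<circ> r)) (jn (sfst a \<circ> r) (sfst b \<circ> r)) (\<lambda>n. n) (jn (ssnd a \<circ> r) (ssnd b \<circ> r)) (jn (ssnd a \<circ> r) (ssnd b \<circ> r))"
    "RA (f \<circ> r) (sfst a \<circ> r) (sfst P \<circ> r)" 
    "S (f \<circ> r) (sfst a \<circ> r) (\<lambda>n. n) (ssnd a \<circ> r) (ssnd P \<circ> r)" if "r \<in> Q" for r
    using H that by (auto simp: cmp_hyp_def sigR_def jn_push o_push)
  have HA: "cmp_hyp RA f g Q (sfst a) (sfst b) (sfst P)"
    unfolding cmp_hyp_def using P Q ab by blast
  define q where "q = sCM A f g (sfst a) (sfst b) (sfst P)"
  let ?z = "jn (sfst P) q"
  note cA = goodD(4)[OF gA]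
  have z: "RA (jn f g) ?z ?z" unfolding q_def by (rule cmpokD(1)[OF cA, OF HA])
  have zr: "RA (jn (f \<circ> r) (g \<circ> r)) (jn (sfst P \<circ> r) (q \<circ> r)) (jn (sfst a \<circ> r) (sfst b \<circ> r))" if "r \<in> Q" for r
    unfolding q_def by (rule cmpokD(2)[OF cA, OF HA that])
  \<comment> \<open>\<open>r\<close> applied in both halves, each half staying where it is. Along
    this reindexing the clique of \<open>sfst P\<close> and \<open>q\<close> equals that of
    \<open>sfst a\<close> and \<open>sfst b\<close>, so the fibre relations coincide there.\<close>
  let ?J = "\<lambda>r. jn ((\<lambda>n. 2 * n) \<circ> r) ((\<lambda>n. Suc (2 * n)) \<circ> r) :: nat \<Rightarrow> nat"
  have SJ: "S (jn f g) ?z (?J r) = S (jn (f \<circ> r) (g \<circ> r)) (jn (sfst a \<circ> r) (sfst b \<circ> r)) (\<lambda>n. n)" if "r \<in> Q" for r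
  proof -
    have "jn f g \<circ> ?J r = jn (f \<circ> r) (g \<circ> r)" "?z \<circ> ?J r = jn (sfst P \<circ> r) (q \<circ> r)"
      by (simp_all add: jn_o)
    then show ?thesis using S_sub[OF z, of "?J r"] eS[OF zr[OF that]] by simp
  qed
  have SL: "S (jn f g) ?z ((\<lambda>n. 2 * n) \<circ> r) = S (f \<circ> r) (sfst a \<circ> r) (\<lambda>n. n)" if "r \<in> Q" for r
    using S_sub[OF z, of "(\<lambda>n. 2 * n) \<circ> r"] eS[OF ab(3)[OF that]] by (simp add: comp_def)
  let ?B = "fib B (jn f g) ?z"
  have HB: "cmp_hyp (S (jn f g) ?z) (\<lambda>n. 2 * n) (\<lambda>n. Suc (2 * n)) Q (ssnd a) (ssnd b) (ssnd P)"
    unfolding cmp_hyp_def using Q ab P(2) S_left[OF z] SJ SL by auto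
  have sZ: "sfst ?Z = q" "ssnd ?Z = sCM ?B (\<lambda>n. 2 * n) (\<lambda>n. Suc (2 * n)) (ssnd a) (ssnd b) (ssnd P)"
    by (simp_all add: q_def sfst_def ssnd_def sCM_def CMW_Sig fib_def)
  note cB = goodD(4)[OF gB[OF z]]
  have 1: "sigR RA S (jn f g) (jn P ?Z) (jn P ?Z)"
    using cmpokD(1)[OF cB, OF HB] z unfolding sigR_def jn_push sZ by (simp add: jn_id)
  have 2: "sigR RA S (jn (f \<circ> r) (g \<circ> r)) (jn (P \<circ> r) (?Z \<circ> r)) (jn (a \<circ> r) (b \<circ> r))" if r: "r \<in> Q" for r
    using cmpokD(2)[OF cB, OF HB r] zr[OF r] SJ[OF r] eS[OF zr[OF r]] unfolding sigR_def jn_push o_push sZ by simp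
  show "sigR RA S (jn f g) (jn P ?Z) (jn P ?Z) \<and>
       (\<forall>r\<in>Q. sigR RA S (jn (f \<circ> r) (g \<circ> r)) (jn (P \<circ> r) (?Z \<circ> r)) (jn (a \<circ> r) (b \<circ> r)))"
    using 1 2 by blast
qed

text \<open>First components are compared in \<open>A\<close>, which makes the fibre relations
  agree; then second components are compared in the fibres.\<close>

lemma uniq_sig: "uniq (sigR RA S)"
  unfolding uniq_def
proof (intro allI impI)
  fix f g x y x' y'
  assume H: "sigR RA S (jn f g) (jn x y) (jn x y)" "sigR RA S (jn f g) (jn x' y') (jn x' y')" "sigR RA S f x x'"
    "\<forall>n. sigR RA S (jn (\<lambda>_. f n) (\<lambda>_. g n)) (jn (\<lambda>_. x n) (\<lambda>_. y n)) (jn (\<lambda>_. x' n) (\<lambda>_. y' n))"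
  have c: "sfst (\<lambda>_. x n) = (\<lambda>_. sfst x n)" "ssnd (\<lambda>_. x n) = (\<lambda>_. ssnd x n)" for x n by (simp_all add: seq_defs)
  note D = H[unfolded sigR_def jn_push c]
  have z: "RA (jn f g) (jn (sfst x) (sfst y)) (jn (sfst x') (sfst y'))"
    by (rule uniqD[OF goodD(5)[OF gA]]) (simp_all add: D)
  let ?z = "jn (sfst x) (sfst y)"
  have zz: "RA (jn f g) ?z ?z" by (rule rel_refl(1)[OF rA, OF z])
  have "S (jn f g) ?z (jn (\<lambda>n. 2 * n) (\<lambda>n. Suc (2 * n))) (jn (ssnd x) (ssnd y)) (jn (ssnd x') (ssnd y'))"
  proof (rule uniqD[OF goodD(5)[OF gB[OF zz]]])
    fix n
    let ?j = "jn (\<lambda>_. 2 * n) (\<lambda>_. Suc (2 * n)) :: nat \<Rightarrow> nat"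
    have "S (jn f g) ?z ?j = S (jn (\<lambda>_. f n) (\<lambda>_. g n)) (jn (\<lambda>_. sfst x n) (\<lambda>_. sfst y n)) (\<lambda>n. n)"
      by (subst S_sub[OF zz]) (simp add: jn_o)
    then show "S (jn f g) ?z ?j (jn (\<lambda>_. ssnd x n) (\<lambda>_. ssnd y n)) (jn (\<lambda>_. ssnd x' n) (\<lambda>_. ssnd y' n))"
      using D by simp
  qed (use D S_left[OF zz] eS[OF z] in \<open>simp_all add: jn_id\<close>)
  with z show "sigR RA S (jn f g) (jn x y) (jn x' y')" by (simp add: sigR_def jn_push jn_id)
qed

lemma good_sig: "good (\<lambda>e. SigC (A e) (B e)) (sigR RA S)"
  unfolding good_def using rel_sig trok_sig[OF goodD(2)[OF gA] tB] trid_sig cmpok_sig uniq_sig by blast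

end

section \<open>Dependent products\<close>

lemma apW_TRW_Pi: "apW (TRW (PiC A B) (PiC A' B') F) x =
    TRW (app B (deg (TRW A' A x))) (app B' (deg x)) (apW F (TRW A' A x))"
proof -
  have "cont (\<lambda>x. TR (app B (deg (TRW A' A x))) (app B' (deg x)) (apW F (TRW A' A x)))" for F
    by (intro cont_TR cont_intros cont_W)
  from beta[OF this] show ?thesis by - (rule dom_eqI, simp_all add: TR_simps)
qed

lemma apW_CMW_Pi: "apW (CMW (PiC A B) (PiC A' B') a b P) x =
    CMW (app B (deg (TRW A' A x))) (app B' (deg x)) (apW a (TRW A' A x)) (apW b x) (apW P (TRW A' A x))"
proof -
  have "cont (\<lambda>x. CM (app B (deg (TRW A' A x))) (app B' (deg x)) (apW a (TRW A' A x)) (apW b x) (apW P (TRW A' A x)))" for a b P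
    by (intro cont_CM cont_TR cont_intros cont_W)
  from beta[OF this] show ?thesis by - (rule dom_eqI, simp_all add: CM_simps)
qed

text \<open>An argument \<open>w\<close> over \<open>jn f g \<circ> k\<close> has entries over \<open>f\<close> (where \<open>k\<close> is even) and over \<open>g\<close>;
  \<open>pull\<close> transports the latter back to \<open>f\<close>.\<close>

definition hf :: "(nat \<Rightarrow> nat) \<Rightarrow> nat \<Rightarrow> nat" where "hf k n = k n div 2"
text \<open>Each argument is listed twice, at an even position pulled back over \<open>f\<close> and
  at the odd position as it is. \<open>pick\<close> selects the copy at which the value of the
  interleaved function is found: the even one for arguments over \<open>f\<close>, which are their
  own pull, and the odd one for those over \<open>g\<close>.\<close>

definition pick :: "(nat \<Rightarrow> nat) \<Rightarrow> nat \<Rightarrow> nat" where "pick k n = (if even (k n) then 2 * n else Suc (2 * n))"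
definition pull :: "sq \<Rightarrow> (nat \<Rightarrow> nat) \<Rightarrow> (nat \<Rightarrow> nat) \<Rightarrow> (nat \<Rightarrow> nat) \<Rightarrow> sq \<Rightarrow> sq" where
  "pull A f g k w = (\<lambda>n. if even (k n) then w n else TRW (A (g (hf k n))) (A (f (hf k n))) (w n))"

lemma jn_k: "jn x y (k n) = (if even (k n) then x (hf k n) else y (hf k n))"
  by (simp add: jn_def hf_def)

lemma pick_simps [simp]: "jn (f \<circ> hf k) (jn f g \<circ> k) \<circ> pick k = jn f g \<circ> k"
  "jn (pull A f g k w) w \<circ> pick k = w"
  by (auto simp: fun_eq_iff pick_def jn_k[of _ _ k] pull_def)

lemma pull_rel:
  assumes "rel RA" "trok A A' RA" "RA (jn f g \<circ> k) w w'"
  shows "RA (jn (f \<circ> hf k) (jn f g \<circ> k)) (jn (pull A f g k w) w) (jn (pull A' f g k w') w')"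
proof -
  let ?x = "sTR A (jn f g \<circ> k) (f \<circ> hf k) w" and ?x' = "sTR A' (jn f g \<circ> k) (f \<circ> hf k) w'"
  have 1: "RA (jn (jn f g \<circ> k) (f \<circ> hf k)) (jn w ?x) (jn w' ?x')"
    by (rule trokD[OF assms(2), OF assms(3)])
  have p: "pull A f g k w = jn w (sTR A (jn f g \<circ> k) (f \<circ> hf k) w) \<circ> pick k" for A w
    by (simp add: pull_def pick_def fun_eq_iff sTR_def jn_k[of _ _ k])
  have q: "f \<circ> hf k = jn (jn f g \<circ> k) (f \<circ> hf k) \<circ> pick k"
    by (simp add: pick_def fun_eq_iff jn_k[of _ _ k])
  show ?thesis
    by (rule rel_reI[OF assms(1), OF 1, of _ "jn (pick k) (\<lambda>n. 2 * n)"]) (simp_all add: jn_o p q[symmetric])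
qed

text \<open>A transported function at any argument is a transport in the fibres over the doubled
  argument, from even to odd positions, of the values at the pulled back argument. All statements on
  transport of functions reduce to the fibres through this equation.\<close>

lemma pi_tr_eq:
  "sap (jn F (sTR (\<lambda>e. PiC (A e) (B e)) f g F) \<circ> k) w =
   jn (sap (F \<circ> hf k) (pull A f g k w))
     (sTR (fib B (jn (f \<circ> hf k) (jn f g \<circ> k)) (jn (pull A f g k w) w)) (\<lambda>n. 2 * n) (\<lambda>n. Suc (2 * n))
        (sap (F \<circ> hf k) (pull A f g k w))) \<circ> pick k" (is "?L = ?R")
proof
  fix n
  show "?L n = ?R n"
  proof (cases "even (k n)")
    case True
    then show ?thesis by (simp add: sap_def pick_def pull_def jn_k[of _ _ k])
  next
    case False
    then show ?thesis by (simp add: sap_def pick_def pull_def sTR_def fib_def apW_TRW_Pi jn_k[of _ _ k])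
  qed
qed

lemma pi_cm_eq:
  "sap (jn P (sCM (\<lambda>e. PiC (A e) (B e)) f g a b P) \<circ> k) w =
   jn (sap (P \<circ> hf k) (pull A f g k w))
     (sCM (fib B (jn (f \<circ> hf k) (jn f g \<circ> k)) (jn (pull A f g k w) w)) (\<lambda>n. 2 * n) (\<lambda>n. Suc (2 * n))
        (sap (a \<circ> hf k) (pull A f g k w)) (sap (jn a b \<circ> k) w)
        (sap (P \<circ> hf k) (pull A f g k w))) \<circ> pick k" (is "?L = ?R")
proof
  fix n
  show "?L n = ?R n"
  proof (cases "even (k n)")
    case True
    then show ?thesis by (simp add: sap_def pick_def pull_def jn_k[of _ _ k])
  next
    case False
    then show ?thesis by (simp add: sap_def pick_def pull_def sCM_def fib_def apW_CMW_Pi jn_k[of _ _ k])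
  qed
qed

lemma piH_D: "piH RA S h F F' \<Longrightarrow> RA (h \<circ> k) w w' \<Longrightarrow>
    S (h \<circ> k) w (\<lambda>n. n) (sap (F \<circ> k) w) (sap (F' \<circ> k) w')"
  unfolding piH_def by blast

lemma piH_re: "piH RA S h F F' \<Longrightarrow> piH RA S (h \<circ> k) (F \<circ> k) (F' \<circ> k)"
  unfolding piH_def by (simp add: comp_assoc)

context family
begin

lemma piH_sym: "piH RA S h F F' \<Longrightarrow> piH RA S h F' F"
  unfolding piH_def
proof (intro allI impI)
  fix k w w'
  assume H: "\<forall>k w w'. RA (h \<circ> k) w w' \<longrightarrow> S (h \<circ> k) w (\<lambda>n. n) (sap (F \<circ> k) w) (sap (F' \<circ> k) w')"
    and w: "RA (h \<circ> k) w w'"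
  have w': "RA (h \<circ> k) w' w" by (rule rel_sym[OF rA, OF w])
  have "S (h \<circ> k) w' (\<lambda>n. n) (sap (F \<circ> k) w') (sap (F' \<circ> k) w)" using H w' by blast
  from rel_sym[OF rS[OF w'], OF this]
  show "S (h \<circ> k) w (\<lambda>n. n) (sap (F' \<circ> k) w) (sap (F \<circ> k) w')" using eS[OF w] by simp
qed

lemma piH_trans:
  assumes "piH RA S h F F'" "piH RA S h F' F''" shows "piH RA S h F F''"
  unfolding piH_def
proof (intro allI impI)
  fix k w w' assume w: "RA (h \<circ> k) w w'"
  have w1: "RA (h \<circ> k) w w" by (rule rel_refl(1)[OF rA, OF w])
  show "S (h \<circ> k) w (\<lambda>n. n) (sap (F \<circ> k) w) (sap (F'' \<circ> k) w')"
    by (rule rel_trans[OF rS[OF w], OF piH_D[OF assms(1), OF w1] piH_D[OF assms(2), OF w]])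
qed

lemma rel_pi: "rel (piR RA S)"
  unfolding rel_def
proof (intro conjI allI impI)
  fix h F F' assume H: "piR RA S h F F'"
  show "piR RA S h F' F" using H piH_sym unfolding piR_def by blast
  show "piR RA S h (sdeg F) (sdeg F')" using H unfolding piR_def sdeg_push by (simp add: sdeg_def)
  show "ord (F n)" for n using H unfolding piR_def by blast
  show "piR RA S (h \<circ> k) (F \<circ> k) (F' \<circ> k)" for k
    using H piH_re[of RA S h _ _ k] unfolding piR_def by (simp add: o_push)
  fix F'' assume "piR RA S h F' F''"
  with H show "piR RA S h F F''" using piH_trans unfolding piR_def by blast
qed

lemma S_pick:
  assumes "RA (jn (f \<circ> hf k) (jn f g \<circ> k)) (jn (pull A f g k w) w) (jn (pull A f g k w) w)"
    and "S (jn (f \<circ> hf k) (jn f g \<circ> k)) (jn (pull A f g k w) w) (\<lambda>n. n) V V'"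
  shows "S (jn f g \<circ> k) w (\<lambda>n. n) (V \<circ> pick k) (V' \<circ> pick k)"
  using rel_re[OF rS[OF assms(1)], OF assms(2), of "pick k"] S_sub[OF assms(1), of "pick k"] by simp

lemma piH_trok:
  assumes A': "trok A A' RA" and B': "\<And>k w w'. RA k w w' \<Longrightarrow> trok (fib B k w) (fib B' k w') (S k w)"
    and F: "piH RA S f F F'"
  shows "piH RA S (jn f g) (jn F (sTR (\<lambda>e. PiC (A e) (B e)) f g F)) (jn F' (sTR (\<lambda>e. PiC (A' e) (B' e)) f g F'))"
  unfolding piH_def
proof (intro allI impI)
  fix k w w' assume w: "RA (jn f g \<circ> k) w w'"
  let ?y = "pull A f g k w" and ?y' = "pull A' f g k w'" and ?h = "jn (f \<circ> hf k) (jn f g \<circ> k)"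
  have Z: "RA ?h (jn ?y w) (jn ?y' w')" by (rule pull_rel[OF rA A' w])
  have Zr: "RA ?h (jn ?y w) (jn ?y w)" by (rule rel_refl(1)[OF rA, OF Z])
  have Y: "RA (f \<circ> hf k) ?y ?y'" by (rule rel_jn(1)[OF rA, OF Z])
  have "S ?h (jn ?y w) (\<lambda>n. 2 * n) (sap (F \<circ> hf k) ?y) (sap (F' \<circ> hf k) ?y')"
    using piH_D[OF F, OF Y] S_left[OF Zr] by simp
  from trokD[OF B'[OF Z], OF this, of "\<lambda>n. Suc (2 * n)"]
  show "S (jn f g \<circ> k) w (\<lambda>n. n) (sap (jn F (sTR (\<lambda>e. PiC (A e) (B e)) f g F) \<circ> k) w)
     (sap (jn F' (sTR (\<lambda>e. PiC (A' e) (B' e)) f g F') \<circ> k) w')"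
    unfolding pi_tr_eq jn_id by (rule S_pick[OF Zr])
qed

lemma trok_pi:
  assumes A': "trok A A' RA" and B': "\<And>k w w'. RA k w w' \<Longrightarrow> trok (fib B k w) (fib B' k w') (S k w)"
  shows "trok (\<lambda>e. PiC (A e) (B e)) (\<lambda>e. PiC (A' e) (B' e)) (piR RA S)"
  unfolding trok_def
proof (intro allI impI)
  fix f g F F' assume F: "piR RA S f F F'"
  note H = piH_trok[where A' = A' and B' = B', OF A' B']
  have "\<forall>n. ord (jn F (sTR T f g F) n)" if "\<forall>n. ord (F n)" for F T
    using that by (auto simp: jn_def sTR_def ord_W)
  with F H[of f F F' g] H[of f "sdeg F" "sdeg F'" g]
  show "piR RA S (jn f g) (jn F (sTR (\<lambda>e. PiC (A e) (B e)) f g F)) (jn F' (sTR (\<lambda>e. PiC (A' e) (B' e)) f g F'))"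
    unfolding piR_def jn_push sdeg_push by blast
qed

lemma S_const:
  assumes "RA f w w"
  shows "S (jn f f) (jn w w) l = S f w ((\<lambda>n. n div 2) \<circ> l)"
proof -
  have d: "jn f f = f \<circ> (\<lambda>n. n div 2)" "jn w w = w \<circ> (\<lambda>n. n div 2)" by (auto simp: jn_def)
  show ?thesis unfolding d using cS[OF assms, of "\<lambda>n. n div 2"] by simp
qed

lemma jn_const: "jn x x \<circ> k = x \<circ> hf k" by (simp add: fun_eq_iff jn_def hf_def)
lemma hf_pick: "hf (pick k) = (\<lambda>n. n)" "hf (\<lambda>n. 2 * n) = (\<lambda>n. n)"
  by (simp_all add: fun_eq_iff hf_def pick_def)

text \<open>The pulled back argument equals the argument by \<open>trid\<close> of \<open>A\<close>;
  so the fibres over the doubled argument are those over a constant clique, and \<open>trid\<close>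
  of the fibres finishes.\<close>

lemma piH_trid:
  assumes F: "piH RA S f F F"
  shows "piH RA S (jn f f) (jn F (sTR (\<lambda>e. PiC (A e) (B e)) f f F)) (jn F F)"
  unfolding piH_def
proof (intro allI impI)
  fix k w w' assume w: "RA (jn f f \<circ> k) w w'"
  let ?y = "pull A f f k w" and ?h = "jn (f \<circ> hf k) (jn f f \<circ> k)"
  have ff: "jn f f \<circ> k = f \<circ> hf k" by (simp add: fun_eq_iff jn_def hf_def)
  have w1: "RA (f \<circ> hf k) w w" and w0: "RA (f \<circ> hf k) w w'" using rel_refl(1)[OF rA, OF w] w by (simp_all add: ff)
  have "RA (jn (f \<circ> hf k) (f \<circ> hf k)) (jn w (sTR A (f \<circ> hf k) (f \<circ> hf k) w)) (jn w w)"
    by (rule tridD[OF goodD(3)[OF gA], OF w1])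
  then have Z: "RA ?h (jn ?y w) (jn w w)"
  proof (rule rel_reI[OF rA, of _ _ _ _ "jn (pick k) (\<lambda>n. 2 * n)"])
    show "jn ?y w = jn w (sTR A (f \<circ> hf k) (f \<circ> hf k) w) \<circ> jn (pick k) (\<lambda>n. 2 * n)"
      by (simp add: jn_o) (rule arg_cong2[of _ _ _ _ jn], simp add: pull_def pick_def fun_eq_iff sTR_def, simp)
  qed (simp_all add: jn_o ff jn_const hf_pick)
  have Zr: "RA ?h (jn ?y w) (jn ?y w)" by (rule rel_refl(1)[OF rA, OF Z])
  have Y: "RA (f \<circ> hf k) ?y w" by (rule rel_jn(1)[OF rA, OF Z])
  let ?P = "sap (F \<circ> hf k) ?y" and ?Pw = "sap (F \<circ> hf k) w"
  have "S ?h (jn ?y w) (\<lambda>n. 2 * n) ?P ?Pw"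
    using piH_D[OF F, OF Y] S_left[OF Zr] by simp
  from trokD[OF tB[OF Z], OF this, of "\<lambda>n. Suc (2 * n)"]
  have 1: "S ?h (jn ?y w) (\<lambda>n. n) (jn ?P (sTR (fib B ?h (jn ?y w)) (\<lambda>n. 2 * n) (\<lambda>n. Suc (2 * n)) ?P))
     (jn ?Pw (sTR (fib B ?h (jn w w)) (\<lambda>n. 2 * n) (\<lambda>n. Suc (2 * n)) ?Pw))"
    by (simp add: jn_id)
  have "S (f \<circ> hf k) w (jn (\<lambda>n. n) (\<lambda>n. n)) (jn ?Pw (sTR (fib B (f \<circ> hf k) w) (\<lambda>n. n) (\<lambda>n. n) ?Pw)) (jn ?Pw ?Pw)"
    by (rule tridD[OF goodD(3)[OF gB[OF w1]], OF piH_D[OF F, OF w1]])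
  moreover have "sTR (fib B (f \<circ> hf k) w) (\<lambda>n. n) (\<lambda>n. n) ?Pw = sTR (fib B ?h (jn w w)) (\<lambda>n. 2 * n) (\<lambda>n. Suc (2 * n)) ?Pw"
    by (simp add: sTR_def fib_def ff)
  moreover have "S ?h (jn ?y w) (\<lambda>n. n) = S (f \<circ> hf k) w (jn (\<lambda>n. n) (\<lambda>n. n))"
    using eS[OF Z] S_const[OF w1, of "\<lambda>n. n"] by (simp add: jn_diag ff)
  ultimately have 2: "S ?h (jn ?y w) (\<lambda>n. n) (jn ?P (sTR (fib B ?h (jn ?y w)) (\<lambda>n. 2 * n) (\<lambda>n. Suc (2 * n)) ?P)) (jn ?Pw ?Pw)"
    using rel_trans[OF rS[OF Zr], OF 1] by simp
  have "jn ?Pw ?Pw \<circ> pick k = sap (jn F F \<circ> k) w" 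
    by (simp add: fun_eq_iff sap_def) (simp add: jn_def hf_def pick_def)
  with S_pick[OF Zr, OF 2]
  have 3: "S (jn f f \<circ> k) w (\<lambda>n. n) (sap (jn F (sTR (\<lambda>e. PiC (A e) (B e)) f f F) \<circ> k) w) (sap (jn F F \<circ> k) w)"
    unfolding pi_tr_eq by simp
  have "jn F F = F \<circ> hf (\<lambda>n. n)" "jn f f = f \<circ> hf (\<lambda>n. n)" by (simp_all add: fun_eq_iff jn_def hf_def)
  then have "piH RA S (jn f f) (jn F F) (jn F F)" using piH_re[OF F] by simp
  from rel_trans[OF rS[OF w], OF 3 piH_D[OF this, OF w]]
  show "S (jn f f \<circ> k) w (\<lambda>n. n) (sap (jn F (sTR (\<lambda>e. PiC (A e) (B e)) f f F) \<circ> k) w) (sap (jn F F \<circ> k) w')" .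
qed

lemma trid_pi: "trid (\<lambda>e. PiC (A e) (B e)) (piR RA S)"
  unfolding trid_def
proof (intro allI impI)
  fix f F assume F: "piR RA S f F F"
  have "\<forall>n. ord (jn F (sTR T f f F) n)" "\<forall>n. ord (jn F F n)" if "\<forall>n. ord (F n)" for F T
    using that by (auto simp: jn_def sTR_def ord_W)
  with F piH_trid[of f F] piH_trid[of f "sdeg F"]
  show "piR RA S (jn f f) (jn F (sTR (\<lambda>e. PiC (A e) (B e)) f f F)) (jn F F)"
    unfolding piR_def jn_push sdeg_push by blast
qed

text \<open>An edge of the values at an argument comes from an edge between the functions and an
  edge of the doubled argument. Locality in the fibres therefore reduces the claim to single
  edges.\<close>

lemma piH_uniq:
  assumes 1: "piH RA S (jn f g) (jn x y) (jn x y)" and 2: "piH RA S (jn f g) (jn x' y') (jn x' y')"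
    and 3: "piH RA S f x x'"
    and 4: "\<And>n. piH RA S (jn (\<lambda>_. f n) (\<lambda>_. g n)) (jn (\<lambda>_. x n) (\<lambda>_. y n)) (jn (\<lambda>_. x' n) (\<lambda>_. y' n))"
  shows "piH RA S (jn f g) (jn x y) (jn x' y')"
  unfolding piH_def
proof (intro allI impI)
  fix k w w' assume w: "RA (jn f g \<circ> k) w w'"
  let ?v = "pull A f g k w" and ?v' = "pull A f g k w'" and ?h = "jn (f \<circ> hf k) (jn f g \<circ> k)"
  have Z: "RA ?h (jn ?v w) (jn ?v' w')" by (rule pull_rel[OF rA goodD(2)[OF gA] w])
  have Zr: "RA ?h (jn ?v w) (jn ?v w)" "RA ?h (jn ?v' w') (jn ?v' w')" by (rule rel_refl[OF rA, OF Z])+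
  have V: "RA (f \<circ> hf k) ?v ?v'" by (rule rel_jn(1)[OF rA, OF Z])
  let ?j = "jn (\<lambda>n. 2 * hf k n) k"
  have h: "?h = jn f g \<circ> ?j" by (simp add: jn_o) (simp add: fun_eq_iff jn_def)
  have sj: "sap (jn x y \<circ> ?j) (jn v w) = jn (sap (x \<circ> hf k) v) (sap (jn x y \<circ> k) w)" for x y v w
    by (simp add: jn_o jn_push) (simp add: fun_eq_iff jn_def sap_def)
  have "S ?h (jn ?v w) (jn (\<lambda>n. 2 * n) (\<lambda>n. Suc (2 * n))) (jn (sap (x \<circ> hf k) ?v) (sap (jn x y \<circ> k) w))
     (jn (sap (x' \<circ> hf k) ?v') (sap (jn x' y' \<circ> k) w'))"
  proof (rule uniqD[OF goodD(5)[OF gB[OF Zr(1)]]])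
    show "S ?h (jn ?v w) (jn (\<lambda>n. 2 * n) (\<lambda>n. Suc (2 * n))) (jn (sap (x \<circ> hf k) ?v) (sap (jn x y \<circ> k) w))
      (jn (sap (x \<circ> hf k) ?v) (sap (jn x y \<circ> k) w))"
      using piH_D[OF 1, OF Zr(1)[unfolded h]] unfolding sj h[symmetric] jn_id .
    show "S ?h (jn ?v w) (jn (\<lambda>n. 2 * n) (\<lambda>n. Suc (2 * n))) (jn (sap (x' \<circ> hf k) ?v') (sap (jn x' y' \<circ> k) w'))
      (jn (sap (x' \<circ> hf k) ?v') (sap (jn x' y' \<circ> k) w'))"
      using piH_D[OF 2, OF Zr(2)[unfolded h]] unfolding sj h[symmetric] jn_id eS[OF Z] .
    show "S ?h (jn ?v w) (\<lambda>n. 2 * n) (sap (x \<circ> hf k) ?v) (sap (x' \<circ> hf k) ?v')"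
      using piH_D[OF 3, OF V] S_left[OF Zr(1)] by simp
    fix n
    let ?jn = "jn (\<lambda>_. 2 * n) (\<lambda>_. Suc (2 * n)) :: nat \<Rightarrow> nat"
    \<comment> \<open>If the argument at \<open>n\<close> lies over \<open>f\<close>, the edge
      degenerates to the entry over \<open>f\<close> taken twice; if it lies over \<open>g\<close>,
      it is the true edge from \<open>f\<close> to \<open>g\<close>.\<close>
    let ?l = "jn (\<lambda>_. 0) (\<lambda>_. k n mod 2) :: nat \<Rightarrow> nat"
    have kn: "k n = 2 * hf k n \<or> k n = Suc (2 * hf k n)" by (auto simp: hf_def elim: evenE oddE)
    have l: "jn (\<lambda>_. x (hf k n)) (\<lambda>_. y (hf k n)) \<circ> ?l = jn (\<lambda>_. x (hf k n)) (\<lambda>_. jn x y (k n))" for x y :: "nat \<Rightarrow> 'b"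
      using kn by (auto simp: jn_o jn_def)
    have hh: "?h \<circ> ?jn = jn (\<lambda>_. f (hf k n)) (\<lambda>_. jn f g (k n))" by (simp add: jn_o)
    have ww: "jn v w \<circ> ?jn = jn (\<lambda>_. v n) (\<lambda>_. w n)" for v w :: sq by (simp add: jn_o)
    have "RA (jn (\<lambda>_. f (hf k n)) (\<lambda>_. g (hf k n)) \<circ> ?l) (jn (\<lambda>_. ?v n) (\<lambda>_. w n)) (jn (\<lambda>_. ?v' n) (\<lambda>_. w' n))"
      using rel_re[OF rA, OF Z, of ?jn] unfolding hh ww l .
    from piH_D[OF 4, OF this]
    have "S (?h \<circ> ?jn) (jn ?v w \<circ> ?jn) (\<lambda>n. n) (jn (\<lambda>_. apW (x (hf k n)) (?v n)) (\<lambda>_. apW (jn x y (k n)) (w n)))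
       (jn (\<lambda>_. apW (x' (hf k n)) (?v' n)) (\<lambda>_. apW (jn x' y' (k n)) (w' n)))"
      unfolding l hh ww jn_push by (simp add: sap_def)
    then show "S ?h (jn ?v w) ?jn (jn (\<lambda>_. sap (x \<circ> hf k) ?v n) (\<lambda>_. sap (jn x y \<circ> k) w n))
      (jn (\<lambda>_. sap (x' \<circ> hf k) ?v' n) (\<lambda>_. sap (jn x' y' \<circ> k) w' n))"
      unfolding S_sub[OF Zr(1), of ?jn] by (simp add: sap_def)
  qed
  then have "S ?h (jn ?v w) (\<lambda>n. n) (jn (sap (x \<circ> hf k) ?v) (sap (jn x y \<circ> k) w))
     (jn (sap (x' \<circ> hf k) ?v') (sap (jn x' y' \<circ> k) w'))" by (simp add: jn_id)
  from S_pick[OF Zr(1), OF this]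
  have "S (jn f g \<circ> k) w (\<lambda>n. n) (jn (sap (x \<circ> hf k) ?v) (sap (jn x y \<circ> k) w) \<circ> pick k)
    (jn (sap (x' \<circ> hf k) ?v') (sap (jn x' y' \<circ> k) w') \<circ> pick k)" .
  moreover have "jn (sap (x \<circ> hf k) (pull A f g k w)) (sap (jn x y \<circ> k) w) \<circ> pick k = sap (jn x y \<circ> k) w" for x y w
    by (simp add: fun_eq_iff pick_def sap_def pull_def jn_k[of _ _ k])
  ultimately show "S (jn f g \<circ> k) w (\<lambda>n. n) (sap (jn x y \<circ> k) w) (sap (jn x' y' \<circ> k) w')" by simp
qed

lemma uniq_pi: "uniq (piR RA S)"
  unfolding uniq_def
proof (intro allI impI)
  fix f g x y x' y'
  assume H: "piR RA S (jn f g) (jn x y) (jn x y)" "piR RA S (jn f g) (jn x' y') (jn x' y')" "piR RA S f x x'"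
    "\<forall>n. piR RA S (jn (\<lambda>_. f n) (\<lambda>_. g n)) (jn (\<lambda>_. x n) (\<lambda>_. y n)) (jn (\<lambda>_. x' n) (\<lambda>_. y' n))"
  have c: "sdeg (\<lambda>_. x n) = (\<lambda>_. sdeg x n)" for x n by (simp add: seq_defs)
  note D = H[unfolded piR_def jn_push c]
  have "piH RA S (jn f g) (jn x y) (jn x' y')"
    by (rule piH_uniq) (use D in blast)+
  moreover have "piH RA S (jn f g) (jn (sdeg x) (sdeg y)) (jn (sdeg x') (sdeg y'))"
    by (rule piH_uniq) (use D in blast)+
  ultimately show "piR RA S (jn f g) (jn x y) (jn x' y')"
    unfolding piR_def jn_push using D by blast
qed

text \<open>At an argument, the composite function is a composite in the fibres over the doubled
  argument. The functions \<open>a\<close> and \<open>b\<close> are linked along \<open>Q\<close>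
  only, so the composites for equal arguments are compared through \<open>uniq\<close> on single
  edges. Where the reindexing does belong to \<open>Q\<close>, the comparison can be made for the
  whole clique.\<close>

lemma piH_cmp:
  assumes P: "piH RA S f P P" and Q: "\<forall>r\<in>Q. \<forall>k. r \<circ> k \<in> Q" "\<forall>n. (\<lambda>_. n) \<in> Q"
    and ab: "\<And>r. r \<in> Q \<Longrightarrow> piH RA S (jn (f \<circ> r) (g \<circ> r)) (jn (a \<circ> r) (b \<circ> r)) (jn (a \<circ> r) (b \<circ> r))"
    and aP: "\<And>r. r \<in> Q \<Longrightarrow> piH RA S (f \<circ> r) (a \<circ> r) (P \<circ> r)"
    and w: "RA (jn f g \<circ> k) w w'"
  defines "Z \<equiv> sCM (\<lambda>e. PiC (A e) (B e)) f g a b P"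
  shows "S (jn f g \<circ> k) w (\<lambda>n. n) (sap (jn P Z \<circ> k) w) (sap (jn P Z \<circ> k) w')"
    and "hf k \<in> Q \<Longrightarrow> S (jn f g \<circ> k) w (\<lambda>n. n) (sap (jn P Z \<circ> k) w) (sap (jn a b \<circ> k) w')"
proof -
  let ?h = "jn (f \<circ> hf k) (jn f g \<circ> k)"
  define z where "z w = jn (pull A f g k w) w" for w
  define aB where "aB w = sap (a \<circ> hf k) (pull A f g k w)" for w
  define bB where "bB w = sap (jn a b \<circ> k) w" for w
  define PB where "PB w = sap (P \<circ> hf k) (pull A f g k w)" for w
  define ZB where "ZB w = sCM (fib B ?h (z w)) (\<lambda>n. 2 * n) (\<lambda>n. Suc (2 * n)) (aB w) (bB w) (PB w)" for w
  have V: "sap (jn P Z \<circ> k) w = jn (PB w) (ZB w) \<circ> pick k" for w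
    unfolding Z_def pi_cm_eq ZB_def aB_def bB_def PB_def z_def ..
  have Zz: "RA ?h (z w) (z w')" unfolding z_def by (rule pull_rel[OF rA goodD(2)[OF gA] w])
  have Zr: "RA ?h (z w) (z w)" "RA ?h (z w') (z w')" by (rule rel_refl[OF rA, OF Zz])+
  \<comment> \<open>The reindexings of the argument whose underlying reindexing of the functions
    lies in \<open>Q\<close>.\<close>
  let ?Q = "{r. hf k \<circ> r \<in> Q}"
  let ?J = "\<lambda>r. jn ((\<lambda>n. 2 * n) \<circ> r) ((\<lambda>n. Suc (2 * n)) \<circ> r) :: nat \<Rightarrow> nat"
  have SJ: "S ?h (z w) (?J r) = S (jn (f \<circ> hf k \<circ> r) (jn f g \<circ> k \<circ> r)) (z w \<circ> ?J r) (\<lambda>n. n)" for r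
    unfolding S_sub[OF Zr(1), of "?J r"] by (simp add: jn_o)
  have zJ: "z w \<circ> ?J r = jn (pull A f g k w \<circ> r) (w \<circ> r)" for w r
    by (simp add: z_def jn_o)
  have edge: "S ?h (z w) (?J r) (jn (aB v \<circ> r) (bB v \<circ> r)) (jn (aB v' \<circ> r) (bB v' \<circ> r))"
    if r: "r \<in> ?Q" and v: "RA ?h (z v) (z v')" "S ?h (z v) = S ?h (z w)" for r v v'
  proof -
    let ?r = "hf k \<circ> r"
    \<comment> \<open>The pulled back argument always meets \<open>a\<close>, while the original
      argument meets \<open>a\<close> or \<open>b\<close> according to the parity of
      \<open>k\<close>.\<close>
    let ?l = "jn (\<lambda>n. 2 * n) (\<lambda>n. if even (k (r n)) then 2 * n else Suc (2 * n)) :: nat \<Rightarrow> nat"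
    have l: "jn (x \<circ> ?r) (y \<circ> ?r) \<circ> ?l = jn (x \<circ> ?r) (jn x y \<circ> k \<circ> r)" for x y :: "nat \<Rightarrow> 'b"
      by (simp add: jn_o) (rule arg_cong2[of _ _ _ _ jn], simp_all add: fun_eq_iff, simp add: jn_def hf_def)
    have "RA (jn (f \<circ> ?r) (g \<circ> ?r) \<circ> ?l) (z v \<circ> ?J r) (z v' \<circ> ?J r)"
      using rel_re[OF rA, OF v(1), of "?J r"] unfolding l by (simp add: jn_o comp_assoc)
    from piH_D[OF ab[of ?r], OF _ this] r
    have *: "S (jn (f \<circ> ?r) (jn f g \<circ> k \<circ> r)) (z v \<circ> ?J r) (\<lambda>n. n) (sap (jn (a \<circ> ?r) (jn a b \<circ> k \<circ> r)) (z v \<circ> ?J r))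
      (sap (jn (a \<circ> ?r) (jn a b \<circ> k \<circ> r)) (z v' \<circ> ?J r))" unfolding l by simp
    have e: "sap (jn (a \<circ> ?r) (jn a b \<circ> k \<circ> r)) (z v \<circ> ?J r) = jn (aB v \<circ> r) (bB v \<circ> r)" for v
      by (simp add: zJ jn_push) (simp add: aB_def bB_def o_push[symmetric] comp_assoc)
    have "S ?h (z v) (?J r) = S (jn (f \<circ> ?r) (jn f g \<circ> k \<circ> r)) (z v \<circ> ?J r) (\<lambda>n. n)"
      using rel_refl(1)[OF rA, OF v(1)] by (subst S_sub) (simp_all add: jn_o comp_assoc)
    with * show ?thesis unfolding e v(2) by simp
  qed
  have HB: "cmp_hyp (S ?h (z w)) (\<lambda>n. 2 * n) (\<lambda>n. Suc (2 * n)) ?Q (aB v) (bB v) (PB v)"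
    if v: "RA ?h (z v) (z v)" "S ?h (z v) = S ?h (z w)" for v
    unfolding cmp_hyp_def
  proof (intro conjI ballI)
    have y: "RA (f \<circ> hf k) (pull A f g k v) (pull A f g k v)"
      using rel_jn(1)[OF rA, OF v(1)[unfolded z_def]] .
    have SL: "S ?h (z w) (\<lambda>n. 2 * n) = S (f \<circ> hf k) (pull A f g k v) (\<lambda>n. n)"
      using S_left[OF v(1)[unfolded z_def]] v(2) by (simp add: z_def)
    show "S ?h (z w) (\<lambda>n. 2 * n) (PB v) (PB v)"
      unfolding SL PB_def by (rule piH_D[OF P, OF y])
    fix r assume r: "r \<in> ?Q"
    show "\<forall>k. r \<circ> k \<in> ?Q" using r Q by (simp add: o_assoc)
    show "S ?h (z w) (?J r) (jn (aB v \<circ> r) (bB v \<circ> r)) (jn (aB v \<circ> r) (bB v \<circ> r))"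
      using edge[OF r v] .
    have yr: "RA (f \<circ> (hf k \<circ> r) \<circ> (\<lambda>n. n)) (pull A f g k v \<circ> r) (pull A f g k v \<circ> r)"
      using rel_re[OF rA, OF y, of r] by (simp add: comp_assoc)
    have "S ?h (z w) ((\<lambda>n. 2 * n) \<circ> r) = S (f \<circ> (hf k \<circ> r) \<circ> (\<lambda>n. n)) (pull A f g k v \<circ> r) (\<lambda>n. n)"
      using S_sub[OF v(1), of "(\<lambda>n. 2 * n) \<circ> r"] v(2) by (simp add: z_def comp_assoc)
    then show "S ?h (z w) ((\<lambda>n. 2 * n) \<circ> r) (aB v \<circ> r) (PB v \<circ> r)"
      using piH_D[OF aP[of "hf k \<circ> r"], OF _ yr] r by (simp add: aB_def PB_def o_push[symmetric] comp_assoc)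
  qed (use Q in simp)
  have Q': "(\<lambda>_. n) \<in> ?Q" for n using Q by simp
  have eS': "S ?h (z w') = S ?h (z w)" using eS[OF Zz] by simp
  have cB: "cmpok (fib B ?h (z v)) (S ?h (z w))" if "RA ?h (z v) (z v)" "S ?h (z v) = S ?h (z w)" for v
    using goodD(4)[OF gB[OF that(1)]] that(2) by simp
  have self: "S ?h (z w) (jn (\<lambda>n. 2 * n) (\<lambda>n. Suc (2 * n))) (jn (PB v) (ZB v)) (jn (PB v) (ZB v))"
    if v: "RA ?h (z v) (z v)" "S ?h (z v) = S ?h (z w)" for v
    unfolding ZB_def by (rule cmpokD(1)[OF cB[OF v], OF HB[OF v]])
  have edgeB: "S ?h (z w) (?J r) (jn (PB v \<circ> r) (ZB v \<circ> r)) (jn (aB v \<circ> r) (bB v \<circ> r))"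
    if v: "RA ?h (z v) (z v)" "S ?h (z v) = S ?h (z w)" and r: "r \<in> ?Q" for v r
    unfolding ZB_def by (rule cmpokD(2)[OF cB[OF v], OF HB[OF v] r])
  have y: "RA (f \<circ> hf k) (pull A f g k w) (pull A f g k w')"
    using rel_jn(1)[OF rA, OF Zz[unfolded z_def]] .
  have J: "?J (\<lambda>_. n) = jn (\<lambda>_. 2 * n) (\<lambda>_. Suc (2 * n))" for n by simp
  \<comment> \<open>No clique formed from \<open>a\<close> and \<open>b\<close> over all of
    \<open>k\<close> is at hand for a direct comparison. On one edge the reindexing is constant,
    hence in \<open>Q\<close>, and the composite passes through the edge from \<open>a\<close> to
    \<open>b\<close> at \<open>w\<close>, the same edge at \<open>w'\<close>, and back.\<close>
  have "S ?h (z w) (jn (\<lambda>n. 2 * n) (\<lambda>n. Suc (2 * n))) (jn (PB w) (ZB w)) (jn (PB w') (ZB w'))"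
  proof (rule uniqD[OF goodD(5)[OF gB[OF Zr(1)]]])
    show "S ?h (z w) (\<lambda>n. 2 * n) (PB w) (PB w')"
      using piH_D[OF P, OF y] S_left[OF Zr(1)[unfolded z_def]] by (simp add: PB_def z_def)
    show "S ?h (z w) (jn (\<lambda>n. 2 * n) (\<lambda>n. Suc (2 * n))) (jn (PB w) (ZB w)) (jn (PB w) (ZB w))"
      using self[OF Zr(1) refl] .
    show "S ?h (z w) (jn (\<lambda>n. 2 * n) (\<lambda>n. Suc (2 * n))) (jn (PB w') (ZB w')) (jn (PB w') (ZB w'))"
      using self[OF Zr(2) eS'] .
    fix n
    let ?j = "jn (\<lambda>_. 2 * n) (\<lambda>_. Suc (2 * n)) :: nat \<Rightarrow> nat"
    have 1: "S ?h (z w) ?j (jn (\<lambda>_. PB w n) (\<lambda>_. ZB w n)) (jn (\<lambda>_. aB w n) (\<lambda>_. bB w n))"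
      using edgeB[OF Zr(1) refl Q'[of n]] by simp
    have 2: "S ?h (z w) ?j (jn (\<lambda>_. PB w' n) (\<lambda>_. ZB w' n)) (jn (\<lambda>_. aB w' n) (\<lambda>_. bB w' n))"
      using edgeB[OF Zr(2) eS' Q'[of n]] by simp
    have 3: "S ?h (z w) ?j (jn (\<lambda>_. aB w n) (\<lambda>_. bB w n)) (jn (\<lambda>_. aB w' n) (\<lambda>_. bB w' n))"
      using edge[OF Q'[of n] Zz refl] by simp
    note rl = rS[OF Zr(1)]
    show "S ?h (z w) ?j (jn (\<lambda>_. PB w n) (\<lambda>_. ZB w n)) (jn (\<lambda>_. PB w' n) (\<lambda>_. ZB w' n))"
      by (rule rel_trans[OF rl, OF 1 rel_trans[OF rl, OF 3 rel_sym[OF rl, OF 2]]])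
  qed
  from S_pick[OF Zr(1)[unfolded z_def], OF this[unfolded jn_id z_def]]
  show "S (jn f g \<circ> k) w (\<lambda>n. n) (sap (jn P Z \<circ> k) w) (sap (jn P Z \<circ> k) w')"
    unfolding V .
  assume "hf k \<in> Q"
  then have Qi: "(\<lambda>n. n) \<in> ?Q" by simp
  have "S ?h (z w) (\<lambda>n. n) (jn (PB w) (ZB w)) (jn (aB w) (bB w))"
    using edgeB[OF Zr(1) refl Qi] by (simp add: jn_id)
  moreover have "S ?h (z w) (\<lambda>n. n) (jn (aB w) (bB w)) (jn (aB w') (bB w'))"
    using edge[OF Qi Zz refl] by (simp add: jn_id)
  ultimately have "S ?h (z w) (\<lambda>n. n) (jn (PB w) (ZB w)) (jn (aB w') (bB w'))"
    by (rule rel_trans[OF rS[OF Zr(1)]])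
  from S_pick[OF Zr(1)[unfolded z_def], OF this[unfolded z_def]]
  have "S (jn f g \<circ> k) w (\<lambda>n. n) (sap (jn P Z \<circ> k) w) (jn (aB w') (bB w') \<circ> pick k)" unfolding V .
  moreover have "jn (aB w') (bB w') \<circ> pick k = sap (jn a b \<circ> k) w'"
    by (simp add: fun_eq_iff pick_def aB_def bB_def sap_def pull_def jn_k[of _ _ k])
  ultimately show "S (jn f g \<circ> k) w (\<lambda>n. n) (sap (jn P Z \<circ> k) w) (sap (jn a b \<circ> k) w')" by simp
qed

lemma cmpok_pi: "cmpok (\<lambda>e. PiC (A e) (B e)) (piR RA S)"
  unfolding cmpok_def
proof (intro allI impI)
  fix f g Q a b P assume H: "cmp_hyp (piR RA S) f g Q a b P"
  let ?T = "\<lambda>e. PiC (A e) (B e)"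
  have Q: "\<forall>r\<in>Q. \<forall>k. r \<circ> k \<in> Q" "\<forall>n. (\<lambda>_. n) \<in> Q" using H by (auto simp: cmp_hyp_def)
  have half: "piH RA S (jn f g) (jn P (sCM ?T f g a b P)) (jn P (sCM ?T f g a b P)) \<and>
     (\<forall>r\<in>Q. piH RA S (jn (f \<circ> r) (g \<circ> r)) (jn (P \<circ> r) (sCM ?T f g a b P \<circ> r)) (jn (a \<circ> r) (b \<circ> r)))"
    if H: "cmp_hyp (piR RA S) f g Q a b P" for a b P
  proof -
    let ?Z = "sCM ?T f g a b P"
    have P: "piH RA S f P P" using H by (simp add: cmp_hyp_def piR_def)
    have ab: "piH RA S (jn (f \<circ> r) (g \<circ> r)) (jn (a \<circ> r) (b \<circ> r)) (jn (a \<circ> r) (b \<circ> r))" 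
      "piH RA S (f \<circ> r) (a \<circ> r) (P \<circ> r)" if "r \<in> Q" for r
      using H that by (auto simp: cmp_hyp_def piR_def)
    note core = piH_cmp[OF P Q ab]
    have 1: "piH RA S (jn f g) (jn P ?Z) (jn P ?Z)"
      unfolding piH_def using core(1) by blast
    have 2: "piH RA S (jn (f \<circ> r) (g \<circ> r)) (jn (P \<circ> r) (?Z \<circ> r)) (jn (a \<circ> r) (b \<circ> r))" if r: "r \<in> Q" for r
      unfolding piH_def
    proof (intro allI impI)
      fix k w w' assume w: "RA (jn (f \<circ> r) (g \<circ> r) \<circ> k) w w'"
      \<comment> \<open>Absorbs \<open>r\<close> into the reindexing of the argument, keeping the
        half; its underlying reindexing is \<open>r \<circ> hf k\<close>, which stays in
        \<open>Q\<close>.\<close>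
      let ?k = "\<lambda>n. if even (k n) then 2 * r (hf k n) else Suc (2 * r (hf k n))"
      have k: "jn (x \<circ> r) (y \<circ> r) \<circ> k = jn x y \<circ> ?k" for x y :: "nat \<Rightarrow> 'b"
        by (simp add: fun_eq_iff jn_k[of _ _ k])
      have "hf ?k = r \<circ> hf k" by (auto simp: fun_eq_iff hf_def)
      then have "hf ?k \<in> Q" using r Q(1) by simp
      from core(2)[OF _ _ w[unfolded k] this]
      show "S (jn (f \<circ> r) (g \<circ> r) \<circ> k) w (\<lambda>n. n) (sap (jn (P \<circ> r) (?Z \<circ> r) \<circ> k) w) (sap (jn (a \<circ> r) (b \<circ> r) \<circ> k) w')"
        unfolding k by simp
    qed
    show ?thesis using 1 2 by blast
  qed
  let ?Z = "sCM ?T f g a b P"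
  have o: "ord (a n)" "ord (b n)" "ord (P n)" for n using cmp_hyp_ord[OF rel_pi, OF H] by auto
  have oZ: "ord (jn P ?Z n)" for n using o by (auto simp: jn_def sCM_def ord_W)
  have oZr: "ord (jn (P \<circ> r) (?Z \<circ> r) n)" "ord (jn (a \<circ> r) (b \<circ> r) n)" for n r
    using o by (auto simp: jn_def sCM_def ord_W)
  from half[OF H] half[OF cmp_hyp_deg[OF rel_pi, OF H]]
  show "piR RA S (jn f g) (jn P ?Z) (jn P ?Z) \<and>
       (\<forall>r\<in>Q. piR RA S (jn (f \<circ> r) (g \<circ> r)) (jn (P \<circ> r) (?Z \<circ> r)) (jn (a \<circ> r) (b \<circ> r)))"
    unfolding piR_def by (simp add: oZ oZr jn_push o_push sdeg_push)
qed

lemma good_pi: "good (\<lambda>e. PiC (A e) (B e)) (piR RA S)"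
  unfolding good_def using rel_pi trok_pi[OF goodD(2)[OF gA] tB] trid_pi cmpok_pi uniq_pi by blast

end

section \<open>Ground types, sums and identity types\<close>

lemma good_one: "(\<And>e. T e = OneC) \<Longrightarrow> good T oneR"
proof -
  assume T: "\<And>e. T e = OneC"
  have "ord (sTR T f g x n)" if "ord (x n)" for f g x n using that by (simp add: sTR_def ord_W)
  moreover have "ord (sCM T f g a b P n)" if "ord (a n)" "ord (b n)" "ord (P n)" for f g a b P n
    using that by (simp add: sCM_def ord_W)
  moreover have r: "rel oneR" by (auto simp: rel_def oneR_def sdeg_def)
  ultimately show ?thesis
    unfolding good_def trok_def trid_def cmpok_def uniq_def using cmp_hyp_ord[OF r]
    by (auto simp: oneR_def jn_def)
qed

lemma good_zero: "good T zeroR"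
  unfolding good_def rel_def trok_def trid_def cmpok_def uniq_def cmp_hyp_def by (auto simp: zeroR_def)

text \<open>Transport and composition do nothing here. The dual bit is one value for the whole
  clique, so agreement at a single entry forces agreement everywhere.\<close>

lemma good_hid: 
  assumes T: "\<And>e. T e = HidC" shows "good T hidR"
proof -
  have r: "rel hidR"
    unfolding rel_def
  proof (intro conjI allI impI)
    fix h w w' assume H: "hidR h w w'"
    then obtain b where b: "\<And>n. ord (w n) \<and> ord (w' n) \<and> 0 \<notin> p1 (w n) \<and> 0 \<notin> p1 (w' n)"
      "\<And>n. (0 \<in> p2 (w n)) = b \<and> (0 \<in> p2 (w' n)) = b" unfolding hidR_def by auto
    show "ord (w n)" for n using b by blast
    show "hidR h w' w" "hidR (h \<circ> k) (w \<circ> k) (w' \<circ> k)" "hidR h (sdeg w) (sdeg w')" for k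
      using b by (auto simp: hidR_def sdeg_def)
    fix w'' assume "hidR h w' w''"
    then obtain c where c: "\<And>n. ord (w' n) \<and> ord (w'' n) \<and> 0 \<notin> p1 (w' n) \<and> 0 \<notin> p1 (w'' n)"
      "\<And>n. (0 \<in> p2 (w' n)) = c \<and> (0 \<in> p2 (w'' n)) = c" unfolding hidR_def by auto
    show "hidR h w w''" using b c by (auto simp: hidR_def)
  qed
  have t: "sTR T f g x = x" for f g x
    by (rule ext) (simp add: sTR_def T TRW_eq TR_simps)
  have c: "sCM T f g a b P = P" for f g a b P
    by (rule ext) (simp add: sCM_def T CMW_eq CM_simps)
  have d: "hidR (jn f g) (jn x x) (jn x' x')" if "hidR f x x'" for f g x x'
    using that unfolding hidR_def jn_def by (auto; metis)
  have "trok T T hidR" unfolding trok_def t using d by blast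
  moreover have "trid T hidR" unfolding trid_def t using d by blast
  moreover have "cmpok T hidR"
    unfolding cmpok_def
  proof (intro allI impI conjI ballI)
    fix f g Q a b P assume H: "cmp_hyp hidR f g Q a b P"
    then have P: "hidR f P P" by (simp add: cmp_hyp_def)
    show "hidR (jn f g) (jn P (sCM T f g a b P)) (jn P (sCM T f g a b P))" unfolding c by (rule d[OF P])
    fix r assume "r \<in> Q"
    then have 1: "hidR (jn (f \<circ> r) (g \<circ> r)) (jn (a \<circ> r) (b \<circ> r)) (jn (a \<circ> r) (b \<circ> r))" 
      and 2: "hidR (f \<circ> r) (a \<circ> r) (P \<circ> r)" using H by (auto simp: cmp_hyp_def)
    have "jn (P \<circ> r) (P \<circ> r) n = (P \<circ> r) (n div 2)" for n by (simp add: jn_def)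
    moreover have "jn (a \<circ> r) (b \<circ> r) 0 = (a \<circ> r) 0" by (simp add: jn_def)
    ultimately show "hidR (jn (f \<circ> r) (g \<circ> r)) (jn (P \<circ> r) (sCM T f g a b P \<circ> r)) (jn (a \<circ> r) (b \<circ> r))"
      using 1 2 unfolding c hidR_def by metis
  qed
  moreover have "uniq hidR"
    unfolding uniq_def
  proof (intro allI impI)
    fix f g x y x' y' 
    assume "hidR (jn f g) (jn x y) (jn x y)" "hidR (jn f g) (jn x' y') (jn x' y')" "hidR f x x'"
    moreover have "jn x y 0 = x 0" "jn x' y' 0 = x' 0" by (simp_all add: jn_def)
    ultimately show "hidR (jn f g) (jn x y) (jn x' y')" unfolding hidR_def by metis
  qed
  ultimately show ?thesis using r by (simp add: good_def)
qed

section \<open>Binary sums\<close>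

definition sel :: "'a \<Rightarrow> 'a \<Rightarrow> nat \<Rightarrow> 'a" where "sel x y s = (if s = 0 then x else y)"

lemma plusR_iff: "plusR RA RB h w w' \<longleftrightarrow> (\<exists>s a a'. s \<le> 1 \<and> w = smk s a \<and> w' = smk s a' \<and> sel RA RB s h a a')"
proof -
  have "(\<exists>s\<le>1. P s) \<longleftrightarrow> P 0 \<or> P 1" for P :: "nat \<Rightarrow> bool" by (auto simp: le_Suc_eq)
  from this[of "\<lambda>s. \<exists>a a'. w = smk s a \<and> w' = smk s a' \<and> sel RA RB s h a a'"]
  show ?thesis by (simp add: plusR_def sel_def)
qed

lemma smk_inject [simp]: "smk s a = smk t b \<longleftrightarrow> s = t \<and> a = b"
  by (auto simp: smk_def fun_eq_iff)

lemma plusR_smk [simp]: "plusR RA RB h (smk s a) (smk t b) \<longleftrightarrow> s = t \<and> s \<le> 1 \<and> sel RA RB s h a b"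
  by (auto simp: plusR_iff)

lemma sTR_smk:
  assumes "s \<le> 1"
  shows "sTR (\<lambda>e. PlusC (A e) (B e)) f g (smk s x) = smk s (sTR (sel A B s) f g x)"
proof -
  have "TRW (PlusC A B) (PlusC A' B') (mkW s z) = mkW s (TRW (sel A B s) (sel A' B' s) z)" for A B A' B' z
    using assms by (intro dom_eqI[of "TRW _ _ _"]) (auto simp: TR_simps TR_simps(7)[unfolded One_nat_def] sel_def le_Suc_eq)
  then show ?thesis by (simp add: sTR_def smk_def sel_def)
qed

lemma sCM_smk:
  assumes "s \<le> 1"
  shows "sCM (\<lambda>e. PlusC (A e) (B e)) f g (smk s a) (smk s b) (smk s x) = smk s (sCM (sel A B s) f g a b x)"
proof -
  have "CMW (PlusC A B) (PlusC A' B') (mkW s a) (mkW s b) (mkW s z) = mkW s (CMW (sel A B s) (sel A' B' s) a b z)" for A B A' B' a b z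
    using assms by (intro dom_eqI[of "CMW _ _ _ _ _"]) (auto simp: CM_simps CM_simps(7)[unfolded One_nat_def] sel_def le_Suc_eq)
  then show ?thesis by (simp add: sCM_def smk_def sel_def)
qed

lemma jn_smkE:
  assumes "jn x y = smk s c"
  obtains x' y' where "x = smk s x'" "y = smk s y'" "c = jn x' y'"
proof
  show "x = smk s (c \<circ> (*) 2)" using assms jn_comp(1)[of x y] by (simp add: o_push)
  moreover show "y = smk s (c \<circ> (\<lambda>n. Suc (2 * n)))" using assms jn_comp(2)[of x y] by (simp add: o_push)
  ultimately have "smk s c = smk s (jn (c \<circ> (*) 2) (c \<circ> (\<lambda>n. Suc (2 * n))))"
    using assms by (simp add: jn_push)
  then show "c = jn (c \<circ> (*) 2) (c \<circ> (\<lambda>n. Suc (2 * n)))" by simp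
qed

lemma rel_plus: "rel RA \<Longrightarrow> rel RB \<Longrightarrow> rel (plusR RA RB)"
proof -
  assume "rel RA" "rel RB"
  then have r: "rel (sel RA RB s)" for s by (simp add: sel_def)
  show ?thesis
    unfolding rel_def plusR_iff
  proof (intro conjI allI impI; elim exE conjE)
    fix h w w' s a a' assume H: "s \<le> (1::nat)" "w = smk s a" "w' = smk s a'" "sel RA RB s h a a'"
    show "\<exists>s a a'. s \<le> 1 \<and> w' = smk s a \<and> w = smk s a' \<and> sel RA RB s h a a'"
      using H rel_sym[OF r, OF H(4)] by blast
    show "\<exists>s a a'. s \<le> 1 \<and> w \<circ> k = smk s a \<and> w' \<circ> k = smk s a' \<and> sel RA RB s (h \<circ> k) a a'" for k
      using H rel_re[OF r, OF H(4)] o_push(5) by metis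
    show "\<exists>s a a'. s \<le> 1 \<and> sdeg w = smk s a \<and> sdeg w' = smk s a' \<and> sel RA RB s h a a'"
      using H rel_deg[OF r, OF H(4)] by (intro exI[of _ s] exI[of _ "sdeg a"] exI[of _ "sdeg a'"]) (simp add: seq_defs)
    show "ord (w n)" for n using H rel_ord(1)[OF r, OF H(4)] by (simp add: smk_def ord_W)
  next
    fix h w w' w'' s a a' s' b b'
    assume H: "s \<le> (1::nat)" "w = smk s a" "w' = smk s a'" "sel RA RB s h a a'"
      "s' \<le> (1::nat)" "w' = smk s' b" "w'' = smk s' b'" "sel RA RB s' h b b'"
    then have "s' = s" "b = a'" by auto
    then show "\<exists>s a a'. s \<le> 1 \<and> w = smk s a \<and> w'' = smk s a' \<and> sel RA RB s h a a'"
      using H rel_trans[OF r, OF H(4)] by blast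
  qed
qed

lemma trok_plus:
  assumes "trok A A' RA" "trok B B' RB"
  shows "trok (\<lambda>e. PlusC (A e) (B e)) (\<lambda>e. PlusC (A' e) (B' e)) (plusR RA RB)"
  unfolding trok_def
proof (intro allI impI)
  fix f g w w' assume "plusR RA RB f w w'"
  then obtain s a a' where *: "s \<le> 1" "w = smk s a" "w' = smk s a'" "sel RA RB s f a a'"
    unfolding plusR_iff by blast
  have "trok (sel A B s) (sel A' B' s) (sel RA RB s)" using assms by (simp add: sel_def)
  from trokD[OF this, OF *(4)] * show "plusR RA RB (jn f g) (jn w (sTR (\<lambda>e. PlusC (A e) (B e)) f g w))
     (jn w' (sTR (\<lambda>e. PlusC (A' e) (B' e)) f g w'))"
    by (simp add: sTR_smk jn_push(5)[symmetric])
qed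

lemma good_plus:
  assumes gA: "good A RA" and gB: "good B RB"
  shows "good (\<lambda>e. PlusC (A e) (B e)) (plusR RA RB)"
proof -
  let ?T = "\<lambda>e. PlusC (A e) (B e)"
  have g: "good (sel A B s) (sel RA RB s)" for s using assms by (simp add: sel_def)
  have r: "rel (plusR RA RB)" using rel_plus goodD(1)[OF gA] goodD(1)[OF gB] by blast
  have "trid ?T (plusR RA RB)"
    unfolding trid_def
  proof (intro allI impI)
    fix f w assume "plusR RA RB f w w"
    then obtain s a where *: "s \<le> 1" "w = smk s a" "sel RA RB s f a a"
      unfolding plusR_iff by auto
    from tridD[OF goodD(3)[OF g], OF *(3)] *
    show "plusR RA RB (jn f f) (jn w (sTR ?T f f w)) (jn w w)"
      by (simp add: sTR_smk jn_push(5)[symmetric])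
  qed
  moreover have "cmpok ?T (plusR RA RB)"
    unfolding cmpok_def
  proof (intro allI impI)
    fix f g Q a b P assume H: "cmp_hyp (plusR RA RB) f g Q a b P"
    then obtain s p where p: "s \<le> 1" "P = smk s p" "sel RA RB s f p p"
      by (auto simp: cmp_hyp_def plusR_iff)
    have Q: "(\<lambda>_. n) \<in> Q" for n using H by (auto simp: cmp_hyp_def)
    have inj: "\<exists>a' b'. a \<circ> r = smk s a' \<and> b \<circ> r = smk s b'" if "r \<in> Q" for r
    proof -
      have 1: "plusR RA RB (jn (f \<circ> r) (g \<circ> r)) (jn (a \<circ> r) (b \<circ> r)) (jn (a \<circ> r) (b \<circ> r))" 
        and 2: "plusR RA RB (f \<circ> r) (a \<circ> r) (P \<circ> r)" using H that by (auto simp: cmp_hyp_def)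
      have P: "P \<circ> r = smk s (p \<circ> r)" using p by (simp add: o_push)
      obtain t c where "jn (a \<circ> r) (b \<circ> r) = smk t c" using 1 unfolding plusR_iff by blast
      then obtain a' b' where "a \<circ> r = smk t a'" "b \<circ> r = smk t b'" by (rule jn_smkE)
      moreover from this 2 have "t = s" unfolding P by simp
      ultimately show ?thesis by blast
    qed
    define a' b' where "a' = ssnd a" and "b' = ssnd b"
    \<comment> \<open>The tag \<open>s\<close> is that of \<open>P\<close>. The constant reindexings
      lie in \<open>Q\<close>, so \<open>a\<close> agrees with \<open>P\<close> at each single entry
      and \<open>b\<close> is linked to it there; both thus carry the same tag.\<close>
    have "a n = mkW s (sndW (a n)) \<and> b n = mkW s (sndW (b n))" for n
    proof -
      have "\<exists>u v. a n = mkW s u \<and> b n = mkW s v" using inj[OF Q[of n]] unfolding smk_def fun_eq_iff jn_comp by blast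
      then show ?thesis by auto
    qed
    then have ab: "a = smk s a'" "b = smk s b'" unfolding a'_def b'_def smk_def ssnd_def by blast+
    have "cmp_hyp (sel RA RB s) f g Q a' b' p"
      using H p(1) unfolding cmp_hyp_def ab p(2) o_push(5)[symmetric] by (simp add: jn_push(5)[symmetric])
    note c = cmpokD[OF goodD(4)[OF g], OF this]
    show "plusR RA RB (jn f g) (jn P (sCM ?T f g a b P)) (jn P (sCM ?T f g a b P)) \<and>
     (\<forall>r\<in>Q. plusR RA RB (jn (f \<circ> r) (g \<circ> r)) (jn (P \<circ> r) (sCM ?T f g a b P \<circ> r)) (jn (a \<circ> r) (b \<circ> r)))"
      using c p(1) unfolding ab p(2) sCM_smk[OF p(1)] o_push(5)[symmetric] by (simp add: jn_push(5)[symmetric])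
  qed
  moreover have "uniq (plusR RA RB)"
    unfolding uniq_def
  proof (intro allI impI)
    fix f g x y x' y'
    assume H: "plusR RA RB (jn f g) (jn x y) (jn x y)" "plusR RA RB (jn f g) (jn x' y') (jn x' y')"
      "plusR RA RB f x x'" "\<forall>n. plusR RA RB (jn (\<lambda>_. f n) (\<lambda>_. g n)) (jn (\<lambda>_. x n) (\<lambda>_. y n)) (jn (\<lambda>_. x' n) (\<lambda>_. y' n))"
    obtain s c where s: "jn x y = smk s c" "s \<le> 1" using H(1) unfolding plusR_iff by blast
    from s(1) obtain x1 y1 where x: "x = smk s x1" "y = smk s y1" by (rule jn_smkE)
    obtain s' c' where s': "jn x' y' = smk s' c'" using H(2) unfolding plusR_iff by blast
    then obtain x1' y1' where x': "x' = smk s' x1'" "y' = smk s' y1'" by (rule jn_smkE)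
    have [simp]: "s' = s" using H(3) unfolding x x' by simp
    have c: "smk s (jn (\<lambda>_. x n) (\<lambda>_. y n)) = jn (\<lambda>_. smk s x n) (\<lambda>_. smk s y n)" for x y n
      by (simp add: jn_push(5)) (simp add: smk_def)
    note H' = H[unfolded x x' jn_push(5)[symmetric] c[symmetric] \<open>s' = s\<close> plusR_smk]
    have "sel RA RB s (jn f g) (jn x1 y1) (jn x1' y1')"
      using H'(1,2,3) H'(4)[rule_format] uniqD[OF goodD(5)[OF g, of s], of f g x1 y1 x1' y1'] by presburger
    then show "plusR RA RB (jn f g) (jn x y) (jn x' y')"
      using s(2) unfolding x x' \<open>s' = s\<close> jn_push(5)[symmetric] plusR_smk by simp
  qed
  ultimately show ?thesis
    unfolding good_def using r trok_plus[OF goodD(2)[OF gA] goodD(2)[OF gB]] by blast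
qed

section \<open>Identity types\<close>

definition shuf :: "nat \<Rightarrow> nat" where
  "shuf = jn (jn (\<lambda>n. 2 * (2 * n)) (\<lambda>n. Suc (2 * (2 * n)))) (jn (\<lambda>n. 2 * Suc (2 * n)) (\<lambda>n. Suc (2 * Suc (2 * n))))"

text \<open>The exchange law of interleaving. It turns a path between cliques into a clique of paths
  and back.\<close>

lemma jn_shuf: "jn (jn a b) (jn c d) \<circ> shuf = jn (jn a c) (jn b d)"
proof -
  have "jn x y \<circ> (\<lambda>n. 2 * h n) = x \<circ> h" "jn x y \<circ> (\<lambda>n. Suc (2 * h n)) = y \<circ> h" for x y :: "nat \<Rightarrow> 'a" and h
    by (simp_all add: fun_eq_iff)
  note * = this
  show ?thesis unfolding shuf_def jn_o * by simp
qed

locale idtype =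
  fixes A a b :: sq and RA :: krel
  assumes gA: "good A RA" 
    and ra: "RA (\<lambda>n. n) (\<lambda>n. dbl (a n)) (\<lambda>n. dbl (a n))"
    and rb: "RA (\<lambda>n. n) (\<lambda>n. dbl (b n)) (\<lambda>n. dbl (b n))"
begin

lemmas rA = goodD(1)[OF gA]

abbreviation da :: "(nat \<Rightarrow> nat) \<Rightarrow> sq" where "da h \<equiv> \<lambda>n. dbl (a (h n))"
abbreviation db :: "(nat \<Rightarrow> nat) \<Rightarrow> sq" where "db h \<equiv> \<lambda>n. dbl (b (h n))"

lemma rel_eq: "rel (eqR RA a b)"
  unfolding rel_def
proof (intro conjI allI impI)
  fix h w w' assume H: "eqR RA a b h w w'"
  show "eqR RA a b h w' w" using H rel_sym[OF rA] unfolding eqR_def by blast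
  show "ord (w n)" for n using H unfolding eqR_def eqH_def by blast
  show "eqR RA a b h (sdeg w) (sdeg w')" using H unfolding eqR_def eqH_def sdeg_push by (simp add: sdeg_def)
  show "eqR RA a b (h \<circ> k) (w \<circ> k) (w' \<circ> k)" for k
  proof -
    have 1: "eqH RA a b (h \<circ> k) (w \<circ> k)" if w: "eqH RA a b h w" for w
    proof -
      have "RA h (e0 w) (da h)" "RA h (e1 w) (db h)" using w by (auto simp: eqH_def)
      from rel_re[OF rA, OF this(1), of k] rel_re[OF rA, OF this(2), of k] w show ?thesis
        by (simp add: eqH_def o_push) (simp add: o_def)
    qed
    have "RA (jn h h) (jn (e0 w) (e1 w)) (jn (e0 w') (e1 w'))" using H by (auto simp: eqR_def)
    then have "RA (jn (h \<circ> k) (h \<circ> k)) (jn (e0 w \<circ> k) (e1 w \<circ> k)) (jn (e0 w' \<circ> k) (e1 w' \<circ> k))"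
      by (rule rel_reI[OF rA, of _ _ _ _ "jn (\<lambda>n. 2 * k n) (\<lambda>n. Suc (2 * k n))"])
         (simp_all only: jn_o, simp_all add: o_def)
    then show ?thesis using H 1 by (simp add: eqR_def o_push)
  qed
  fix w'' assume "eqR RA a b h w' w''"
  with H show "eqR RA a b h w w''" using rel_trans[OF rA] unfolding eqR_def by blast
qed

lemma eqR_shuf: 
  assumes "eqR RA a b (jn f g) (jn x y) (jn x' y')"
  shows "RA (jn (jn f f) (jn g g)) (jn (jn (e0 x) (e1 x)) (jn (e0 y) (e1 y))) (jn (jn (e0 x') (e1 x')) (jn (e0 y') (e1 y')))"
proof -
  have "RA (jn (jn f g) (jn f g)) (jn (jn (e0 x) (e0 y)) (jn (e1 x) (e1 y))) (jn (jn (e0 x') (e0 y')) (jn (e1 x') (e1 y')))"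
    using assms by (simp add: eqR_def jn_push)
  then show ?thesis by (rule rel_reI[OF rA, of _ _ _ _ shuf]) (simp_all only: jn_shuf)
qed

lemma jn_db: "(\<lambda>n. dbl (c (jn f g n))) = jn (\<lambda>n. dbl (c (f n))) (\<lambda>n. dbl (c (g n)))"
  by (auto simp: jn_def fun_eq_iff)

text \<open>A clique of paths is determined by its part over \<open>f\<close>: each edge from
  \<open>f\<close> to \<open>g\<close> between the entries of a path agrees with the edge between
  the prescribed end points, which is the same for both sequences, and \<open>uniq\<close> in
  \<open>A\<close> assembles the edges.\<close>

lemma eqR_cover:
  assumes 1: "eqR RA a b (jn f g) (jn x y) (jn x y)" and 2: "eqR RA a b (jn f g) (jn x' y') (jn x' y')"
    and 3: "eqR RA a b f x x'"
  shows "eqR RA a b (jn f g) (jn x y) (jn x' y')"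
proof -
  have edge: "RA (jn (\<lambda>_. jn f f n) (\<lambda>_. jn g g n)) (jn (\<lambda>_. jn (e0 x) (e1 x) n) (\<lambda>_. jn (e0 y) (e1 y) n))
     (jn (\<lambda>_. jn (da f) (db f) n) (\<lambda>_. jn (da g) (db g) n))" if H: "eqR RA a b (jn f g) (jn x y) (jn x y)" for x y n
  proof -
    have e: "RA (jn f g) (jn (e0 x) (e0 y)) (jn (da f) (da g))" "RA (jn f g) (jn (e1 x) (e1 y)) (jn (db f) (db g))"
      using H by (auto simp: eqR_def eqH_def jn_push jn_db)
    let ?j = "jn (\<lambda>_. 2 * (n div 2)) (\<lambda>_. Suc (2 * (n div 2))) :: nat \<Rightarrow> nat"
    have j: "jn x y \<circ> ?j = jn (\<lambda>_. x (n div 2)) (\<lambda>_. y (n div 2))" for x y :: "nat \<Rightarrow> 'b"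
      by (simp add: jn_o)
    have n: "jn x y n = (if even n then x (n div 2) else y (n div 2))" for x y :: "nat \<Rightarrow> 'b" by (simp add: jn_def)
    show ?thesis
      using rel_re[OF rA, OF e(1), of ?j] rel_re[OF rA, OF e(2), of ?j] unfolding j by (simp add: n jn_def[of _ _ n])
  qed
  have "RA (jn (jn f f) (jn g g)) (jn (jn (e0 x) (e1 x)) (jn (e0 y) (e1 y))) (jn (jn (e0 x') (e1 x')) (jn (e0 y') (e1 y')))"
    using eqR_shuf[OF 1] eqR_shuf[OF 2]
  proof (rule uniqD[OF goodD(5)[OF gA]])
    show "RA (jn f f) (jn (e0 x) (e1 x)) (jn (e0 x') (e1 x'))" using 3 by (simp add: eqR_def)
    show "RA (jn (\<lambda>_. jn f f n) (\<lambda>_. jn g g n)) (jn (\<lambda>_. jn (e0 x) (e1 x) n) (\<lambda>_. jn (e0 y) (e1 y) n))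
       (jn (\<lambda>_. jn (e0 x') (e1 x') n) (\<lambda>_. jn (e0 y') (e1 y') n))" for n
      by (rule rel_trans[OF rA, OF edge[OF 1] rel_sym[OF rA, OF edge[OF 2]]])
  qed
  then have "RA (jn (jn f g) (jn f g)) (jn (e0 (jn x y)) (e1 (jn x y))) (jn (e0 (jn x' y')) (e1 (jn x' y')))"
    unfolding jn_push by (rule rel_reI[OF rA, of _ _ _ _ shuf]) (simp_all only: jn_shuf)
  then show ?thesis using 1 2 by (simp add: eqR_def)
qed

text \<open>The reindexings that stay in one half of the doubled index, that is, with one of the two
  ends. Along these the end points form cliques; \<open>a\<close> interleaved with \<open>b\<close>
  need not be one.\<close>

definition pth :: "(nat \<Rightarrow> nat) set" where "pth = {r. (\<forall>n. even (r n)) \<or> (\<forall>n. odd (r n))}"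

lemma eq_cmp_hyp:
  assumes "eqR RA a b f w w"
  shows "cmp_hyp RA (jn f f) (jn g g) pth (jn (da f) (db f)) (jn (da g) (db g)) (jn (e0 w) (e1 w))"
  unfolding cmp_hyp_def
proof (intro conjI; (intro ballI)?)
  show "RA (jn f f) (jn (e0 w) (e1 w)) (jn (e0 w) (e1 w))" using assms by (simp add: eqR_def)
  show "\<forall>n. (\<lambda>_. n) \<in> pth" by (simp add: pth_def)
  fix r assume r: "r \<in> pth"
  then show "\<forall>k. r \<circ> k \<in> pth" by (auto simp: pth_def)
  have w: "RA f (e0 w) (da f)" "RA f (e1 w) (db f)" using assms by (auto simp: eqR_def eqH_def)
  have da: "RA h (da h) (da h)" "RA h (db h) (db h)" for h
    using rel_re[OF rA, OF ra, of h] rel_re[OF rA, OF rb, of h] by (simp_all add: o_def)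
  let ?r = "\<lambda>n. r n div 2"
  from r consider "r = (\<lambda>n. 2 * ?r n)" | "r = (\<lambda>n. Suc (2 * ?r n))" by (auto simp: pth_def fun_eq_iff)
  then show "RA (jn (jn f f \<circ> r) (jn g g \<circ> r)) (jn (jn (da f) (db f) \<circ> r) (jn (da g) (db g) \<circ> r))
      (jn (jn (da f) (db f) \<circ> r) (jn (da g) (db g) \<circ> r)) \<and> RA (jn f f \<circ> r) (jn (da f) (db f) \<circ> r) (jn (e0 w) (e1 w) \<circ> r)"
  proof cases
    case 1
    have *: "jn x y \<circ> r = x \<circ> ?r" for x y :: "nat \<Rightarrow> 'b" by (subst 1) (simp add: fun_eq_iff)
    show ?thesis unfolding * using da(1)[of "jn (f \<circ> ?r) (g \<circ> ?r)"] rel_re[OF rA, OF rel_sym[OF rA, OF w(1)], of ?r]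
      unfolding jn_db by (simp add: o_def)
  next
    case 2
    have *: "jn x y \<circ> r = y \<circ> ?r" for x y :: "nat \<Rightarrow> 'b" by (subst 2) (simp add: fun_eq_iff)
    show ?thesis unfolding * using da(2)[of "jn (f \<circ> ?r) (g \<circ> ?r)"] rel_re[OF rA, OF rel_sym[OF rA, OF w(2)], of ?r]
      unfolding jn_db by (simp add: o_def)
  qed
qed

text \<open>Transport of paths is a composition in \<open>A\<close> over the doubled index: the
  two-entry clique of the path is moved from the old end points to the new ones.\<close>

lemma e_sTR:
  "jn (e0 (sTR (\<lambda>e. EqC (A e) (a e) (b e)) f g w)) (e1 (sTR (\<lambda>e. EqC (A e) (a e) (b e)) f g w)) =
   sCM A (jn f f) (jn g g) (jn (da f) (db f)) (jn (da g) (db g)) (jn (e0 w) (e1 w))"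
proof -
  have "dbl (CM S T (dbl x) (dbl y) (deg z)) = CMW S T (dbl x) (dbl y) (deg z)" 
    "dbl (CM S T (dbl x) (dbl y) (dbl z)) = CMW S T (dbl x) (dbl y) (dbl z)" for S T x y z
    by (rule dom_eqI, simp_all)+
  then show ?thesis by (auto simp: fun_eq_iff jn_def sTR_def sCM_def e0_def e1_def TR_simps)
qed

lemma eq_tr_self:
  fixes f g w defines "q \<equiv> sTR (\<lambda>e. EqC (A e) (a e) (b e)) f g w"
  assumes w: "eqR RA a b f w w"
  shows "eqR RA a b (jn f g) (jn w q) (jn w q)"
proof -
  note c = cmpokD[OF goodD(4)[OF gA], OF eq_cmp_hyp[OF w], folded e_sTR, folded q_def]
  have "RA (jn (jn f g) (jn f g)) (jn (e0 (jn w q)) (e1 (jn w q))) (jn (e0 (jn w q)) (e1 (jn w q)))"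
    using c(1) unfolding jn_push by (rule rel_reI[OF rA, of _ _ _ _ shuf]) (simp_all only: jn_shuf q_def)
  moreover have "ord (jn w q n)" for n
    using w by (auto simp: jn_def q_def sTR_def eqR_def eqH_def intro!: ord_W)
  moreover have p: "(\<lambda>n. 2 * n) \<in> pth" "(\<lambda>n. Suc (2 * n)) \<in> pth" by (auto simp: pth_def)
  moreover note c(2)[OF p(1)] c(2)[OF p(2)]
  ultimately show ?thesis
    unfolding q_def by (simp add: eqR_def eqH_def jn_push jn_db)
qed

text \<open>Two extensions of the same clique of paths coincide by \<open>eqR_cover\<close>. Hence
  any path over the new index is the right one, and transport also serves as composition.\<close>

lemma good_eq_aux:
  assumes "trok (\<lambda>e. EqC (A e) (a e) (b e)) (\<lambda>e. EqC (A e) (a e) (b e)) (eqR RA a b)"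
  shows "good (\<lambda>e. EqC (A e) (a e) (b e)) (eqR RA a b)"
proof -
  let ?T = "\<lambda>e. EqC (A e) (a e) (b e)"
  have "trid ?T (eqR RA a b)"
    unfolding trid_def
  proof (intro allI impI)
    fix f w assume w: "eqR RA a b f w w"
    have "eqR RA a b (jn f f) (jn w w) (jn w w)"
      by (rule rel_reI[OF rel_eq, OF w, of _ "\<lambda>n. n div 2"]) (simp_all add: fun_eq_iff jn_def)
    from eqR_cover[OF eq_tr_self[OF w] this w]
    show "eqR RA a b (jn f f) (jn w (sTR ?T f f w)) (jn w w)" .
  qed
  moreover have "cmpok ?T (eqR RA a b)"
    unfolding cmpok_def
  proof (intro allI impI)
    fix f g Q c d P assume H: "cmp_hyp (eqR RA a b) f g Q c d P"
    have s: "sCM ?T f g c d P = sTR ?T f g P" by (rule ext) (simp add: sCM_def sTR_def CMW_eq TRW_eq CM_simps)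
    have P: "eqR RA a b f P P" using H by (simp add: cmp_hyp_def)
    have 1: "eqR RA a b (jn f g) (jn P (sCM ?T f g c d P)) (jn P (sCM ?T f g c d P))"
      unfolding s by (rule eq_tr_self[OF P])
    have "eqR RA a b (jn (f \<circ> r) (g \<circ> r)) (jn (P \<circ> r) (sCM ?T f g c d P \<circ> r)) (jn (c \<circ> r) (d \<circ> r))" if "r \<in> Q" for r
    proof (rule eqR_cover)
      show "eqR RA a b (jn (f \<circ> r) (g \<circ> r)) (jn (P \<circ> r) (sCM ?T f g c d P \<circ> r)) (jn (P \<circ> r) (sCM ?T f g c d P \<circ> r))"
        by (rule rel_reI[OF rel_eq, OF 1, of _ "jn (\<lambda>n. 2 * r n) (\<lambda>n. Suc (2 * r n))"])
           (simp_all only: jn_o, simp_all add: o_def)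
      show "eqR RA a b (f \<circ> r) (P \<circ> r) (c \<circ> r)"
        by (rule rel_sym[OF rel_eq]) (use H that in \<open>auto simp: cmp_hyp_def\<close>)
    qed (use H that in \<open>auto simp: cmp_hyp_def\<close>)
    with 1 show "eqR RA a b (jn f g) (jn P (sCM ?T f g c d P)) (jn P (sCM ?T f g c d P)) \<and>
      (\<forall>r\<in>Q. eqR RA a b (jn (f \<circ> r) (g \<circ> r)) (jn (P \<circ> r) (sCM ?T f g c d P \<circ> r)) (jn (c \<circ> r) (d \<circ> r)))" by blast
  qed
  moreover have "uniq (eqR RA a b)"
    unfolding uniq_def using eqR_cover by blast
  ultimately show ?thesis using rel_eq assms unfolding good_def by blast
qed

end

lemma trok_eq:
  assumes 1: "idtype A a b RA" and 2: "idtype A' a' b' RA"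
    and raa: "RA (\<lambda>n. n) (\<lambda>n. dbl (a n)) (\<lambda>n. dbl (a' n))" and rbb: "RA (\<lambda>n. n) (\<lambda>n. dbl (b n)) (\<lambda>n. dbl (b' n))"
  shows "eqR RA a' b' = eqR RA a b"
    and "trok (\<lambda>e. EqC (A e) (a e) (b e)) (\<lambda>e. EqC (A' e) (a' e) (b' e)) (eqR RA a b)"
proof -
  interpret idtype A a b RA by fact
  interpret P: idtype A' a' b' RA by fact
  have aa: "RA h (da h) (P.da h)" "RA h (db h) (P.db h)" for h
    using rel_re[OF rA, OF raa, of h] rel_re[OF rA, OF rbb, of h] by (simp_all add: o_def)
  have "eqH RA a' b' h w \<longleftrightarrow> eqH RA a b h w" for h w
    unfolding eqH_def using aa[of h] rel_sym[OF rA] rel_trans[OF rA] by blast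
  then show e: "eqR RA a' b' = eqR RA a b" by (intro ext) (simp add: eqR_def)
  show "trok (\<lambda>e. EqC (A e) (a e) (b e)) (\<lambda>e. EqC (A' e) (a' e) (b' e)) (eqR RA a b)"
    unfolding trok_def
  proof (intro allI impI)
    fix f g w w' assume w: "eqR RA a b f w w'"
    let ?q = "sTR (\<lambda>e. EqC (A e) (a e) (b e)) f g w" and ?q' = "sTR (\<lambda>e. EqC (A' e) (a' e) (b' e)) f g w'"
    note s = eq_tr_self[OF rel_refl(1)[OF rel_eq, OF w]]
    note s' = P.eq_tr_self[unfolded e, OF rel_refl(2)[OF rel_eq, OF w]]
    show "eqR RA a b (jn f g) (jn w ?q) (jn w' ?q')" by (rule eqR_cover[OF s s' w])
  qed
qed

lemma good_eq: "idtype A a b RA \<Longrightarrow> good (\<lambda>e. EqC (A e) (a e) (b e)) (eqR RA a b)"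
  by (rule idtype.good_eq_aux) (auto intro: trok_eq simp: idtype_def)

section \<open>Small types\<close>

definition le :: "dom \<Rightarrow> dom \<Rightarrow> bool" where "le x y \<longleftrightarrow> p1 x = p1 y \<and> p2 x \<subseteq> p2 y"

lemma le_W: "le x y \<Longrightarrow> le (fstW x) (fstW y)" "le x y \<Longrightarrow> le (sndW x) (sndW y)"
  "le x y \<Longrightarrow> deg x = deg y" "le F G \<Longrightarrow> le (apW F z) (apW G z)" "le x y \<Longrightarrow> le (apW F x) (apW F y)" "le x y \<Longrightarrow> le (fap u x) (fap u y)"
proof -
  assume H: "le x y"
  then show d: "deg x = deg y" by (simp add: le_def deg_def)
  have s: "x \<subseteq> y" by (rule dom_leI) (use H in \<open>auto simp: le_def\<close>)
  show "le (fstW x) (fstW y)" "le (sndW x) (sndW y)" using H by (simp_all add: le_def p_mono)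
  show "le (apW F x) (apW F y)" "le (fap u x) (fap u y)" using d s by (simp_all add: le_def app_mono)
next
  assume "le F G" then show "le (apW F z) (apW G z)" by (simp add: le_def app_mono)
qed

text \<open>Three ways in which small types resemble sets. \<open>vert\<close>: links survive
  replacing entries by equal ones. \<open>disc\<close>: cliques that agree at one entry agree
  everywhere. \<open>conv\<close>: what lies between two equal elements with the same actual part is
  equal to them. They are demanded of small types only; \<open>conv\<close> is there for the action
  of an isomorphism at indices with a dual part.\<close>

definition vert :: "krel \<Rightarrow> bool" where
  "vert R \<longleftrightarrow> (\<forall>h w w'. R h w w \<longrightarrow> (\<forall>n. R (\<lambda>_. h n) (\<lambda>_. w n) (\<lambda>_. w' n)) \<longrightarrow> R h w w')"
definition disc :: "krel \<Rightarrow> bool" where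
  "disc R \<longleftrightarrow> (\<forall>h w w' m. R h w w \<longrightarrow> R h w' w' \<longrightarrow> R (\<lambda>_. h m) (\<lambda>_. w m) (\<lambda>_. w' m) \<longrightarrow> R h w w')"
definition conv :: "krel \<Rightarrow> bool" where
  "conv R \<longleftrightarrow> (\<forall>h w w1 w2. R h w w2 \<longrightarrow> R h w1 w1 \<longrightarrow> (\<forall>n. le (w n) (w1 n) \<and> le (w1 n) (w2 n)) \<longrightarrow> R h w w1)"
definition small :: "krel \<Rightarrow> bool" where "small R \<longleftrightarrow> vert R \<and> disc R \<and> conv R"

lemma vertD: "small R \<Longrightarrow> R h w w \<Longrightarrow> (\<And>n. R (\<lambda>_. h n) (\<lambda>_. w n) (\<lambda>_. w' n)) \<Longrightarrow> R h w w'"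
  unfolding small_def vert_def by blast
lemma discD: "small R \<Longrightarrow> R h w w \<Longrightarrow> R h w' w' \<Longrightarrow> R (\<lambda>_. h m) (\<lambda>_. w m) (\<lambda>_. w' m) \<Longrightarrow> R h w w'"
  unfolding small_def disc_def by blast
lemma convD: "small R \<Longrightarrow> R h w w2 \<Longrightarrow> R h w1 w1 \<Longrightarrow> (\<And>n. le (w n) (w1 n)) \<Longrightarrow> (\<And>n. le (w1 n) (w2 n)) \<Longrightarrow> R h w w1"
  unfolding small_def conv_def by blast

lemma small_one: "small oneR"
  unfolding small_def vert_def disc_def conv_def oneR_def by blast

lemma small_zero: "small zeroR"
  unfolding small_def vert_def disc_def conv_def zeroR_def by blast

lemma small_hid: "small hidR"
  unfolding small_def
proof (intro conjI)
  show "vert hidR" unfolding vert_def hidR_def by (intro allI impI) metis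
  show "disc hidR" unfolding disc_def hidR_def by (intro allI impI) metis
  show "conv hidR" unfolding conv_def
  proof (intro allI impI)
    fix h w w1 w2 assume H: "hidR h w w2" "hidR h w1 w1" and le: "\<forall>n. le (w n) (w1 n) \<and> le (w1 n) (w2 n)"
    obtain b where b: "\<And>n. (0 \<in> p2 (w n)) = b" "\<And>n. (0 \<in> p2 (w2 n)) = b" using H(1) unfolding hidR_def by auto
    have "(0 \<in> p2 (w1 n)) = b" for n using le b[of n] unfolding le_def by blast
    with b(1) H show "hidR h w w1" unfolding hidR_def by auto
  qed
qed

lemma small_plus:
  assumes "small RA" "small RB" shows "small (plusR RA RB)"
proof -
  have s: "small (sel RA RB s)" for s using assms by (simp add: sel_def)
  have c: "(\<lambda>_. smk s x n) = smk s (\<lambda>_. x n)" for s x n by (simp add: smk_def)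
  have "plusR RA RB h w w'" if H: "plusR RA RB h w w" "\<forall>n. plusR RA RB (\<lambda>_. h n) (\<lambda>_. w n) (\<lambda>_. w' n)" for h w w'
  proof -
    obtain s a where a: "w = smk s a" "s \<le> 1" "sel RA RB s h a a" using H(1) unfolding plusR_iff by auto
    have "\<exists>z. w' n = mkW s z" for n
      using H(2)[rule_format, of n] unfolding a(1) c plusR_iff smk_inject by (auto simp: smk_def fun_eq_iff) blast
    then have "w' n = mkW s (sndW (w' n))" for n by (metis W_simps(4))
    then have w': "w' = smk s (ssnd w')" unfolding smk_def ssnd_def by (rule ext)
    have "sel RA RB s (\<lambda>_. h n) (\<lambda>_. a n) (\<lambda>_. ssnd w' n)" for n
    proof -
      have "plusR RA RB (\<lambda>_. h n) (smk s (\<lambda>_. a n)) (smk s (\<lambda>_. ssnd w' n))"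
        using H(2)[rule_format, of n] w' unfolding a(1) c by (metis c)
      then show ?thesis by simp
    qed
    from vertD[OF s, OF a(3), OF this] a(2) show ?thesis unfolding a(1) by (subst w') simp
  qed
  moreover have "plusR RA RB h w w'" if H: "plusR RA RB h w w" "plusR RA RB h w' w'" "plusR RA RB (\<lambda>_. h m) (\<lambda>_. w m) (\<lambda>_. w' m)" for h w w' m
  proof -
    obtain s a where a: "w = smk s a" "s \<le> 1" "sel RA RB s h a a" using H(1) unfolding plusR_iff by auto
    obtain t b where b: "w' = smk t b" "t \<le> 1" "sel RA RB t h b b" using H(2) unfolding plusR_iff by auto
    have *: "s = t" "sel RA RB s (\<lambda>_. h m) (\<lambda>_. a m) (\<lambda>_. b m)" using H(3) unfolding a(1) b(1) c by auto
    have "sel RA RB s h b b" using b *(1) by simp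
    from discD[OF s, of s h a b m, OF a(3) this *(2)] show ?thesis using b a(1,2) * by simp
  qed
  moreover have "plusR RA RB h w w1" if H: "plusR RA RB h w w2" "plusR RA RB h w1 w1" "\<forall>n. le (w n) (w1 n) \<and> le (w1 n) (w2 n)" for h w w1 w2
  proof -
    obtain s a a2 where a: "w = smk s a" "w2 = smk s a2" "s \<le> 1" "sel RA RB s h a a2" using H(1) unfolding plusR_iff by auto
    obtain t b where b: "w1 = smk t b" "t \<le> 1" "sel RA RB t h b b" using H(2) unfolding plusR_iff by auto
    have "mk s (p1 (a 0)) = mk t (p1 (b 0))" using H(3)[rule_format, of 0] by (simp add: a(1) b(1) smk_def le_def)
    then have [simp]: "t = s" by simp
    have "le (a n) (b n)" "le (b n) (a2 n)" for n
      using H(3)[rule_format, of n] le_W(2) unfolding a(1,2) b(1) smk_def by (metis W_simps(4))+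
    from convD[OF s, OF a(4) _ this] b a show ?thesis by simp
  qed
  ultimately show ?thesis unfolding small_def vert_def disc_def conv_def by blast
qed

lemma small_eq:
  assumes "idtype A a b RA" and s: "small RA" shows "small (eqR RA a b)"
proof -
  interpret idtype A a b RA by fact
  have c: "e0 (\<lambda>_. w n) = (\<lambda>_. e0 w n)" "e1 (\<lambda>_. w n) = (\<lambda>_. e1 w n)" for w n by (simp_all add: seq_defs)
  have v: "eqR RA a b h w w'" if H: "eqR RA a b h w w" "\<forall>n. eqR RA a b (\<lambda>_. h n) (\<lambda>_. w n) (\<lambda>_. w' n)" for h w w'
  proof -
    have *: "RA (\<lambda>_. jn h h n) (\<lambda>_. jn (e0 w) (e1 w) n) (\<lambda>_. jn (e0 w') (e1 w') n)" for n
    proof -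
      have "RA (jn (\<lambda>_. h (n div 2)) (\<lambda>_. h (n div 2))) (jn (\<lambda>_. e0 w (n div 2)) (\<lambda>_. e1 w (n div 2)))
         (jn (\<lambda>_. e0 w' (n div 2)) (\<lambda>_. e1 w' (n div 2)))"
        using H(2)[rule_format, of "n div 2"] by (simp add: eqR_def c)
      from rel_re[OF rA, OF this, of "\<lambda>_. n mod 2"] show ?thesis by (simp add: jn_def)
    qed
    have 1: "RA (jn h h) (jn (e0 w) (e1 w)) (jn (e0 w') (e1 w'))"
      by (rule vertD[OF s]) (use H(1) * in \<open>simp_all add: eqR_def\<close>)
    have "ord (w' n)" for n using H(2) unfolding eqR_def eqH_def by blast
    then have "eqH RA a b h w'" 
      using rel_jn[OF rA, OF 1] H(1) rel_sym[OF rA] rel_trans[OF rA] unfolding eqR_def eqH_def by blast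
    with 1 H(1) show ?thesis by (simp add: eqR_def)
  qed
  have d: "eqR RA a b h w w'" if H: "eqR RA a b h w w" "eqR RA a b h w' w'" "eqR RA a b (\<lambda>_. h m) (\<lambda>_. w m) (\<lambda>_. w' m)" for h w w' m
  proof -
    have "RA (jn (\<lambda>_. h m) (\<lambda>_. h m)) (jn (\<lambda>_. e0 w m) (\<lambda>_. e1 w m)) (jn (\<lambda>_. e0 w' m) (\<lambda>_. e1 w' m))"
      using H(3) by (simp add: eqR_def c)
    from rel_jn(1)[OF rA, OF this]
    have "RA (\<lambda>_. jn h h (2 * m)) (\<lambda>_. jn (e0 w) (e1 w) (2 * m)) (\<lambda>_. jn (e0 w') (e1 w') (2 * m))" by simp
    then have "RA (jn h h) (jn (e0 w) (e1 w)) (jn (e0 w') (e1 w'))"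
      by (rule discD[OF s, rotated 2]) (use H in \<open>simp_all add: eqR_def\<close>)
    with H show ?thesis by (simp add: eqR_def)
  qed
  have "eqR RA a b h w w1" if H: "eqR RA a b h w w2" "eqR RA a b h w1 w1" "\<forall>n. le (w n) (w1 n) \<and> le (w1 n) (w2 n)" for h w w1 w2
  proof -
    \<comment> \<open>\<open>le\<close> fixes actual parts, and the two entries of a path are read
      off its actual part.\<close>
    have "e0 w1 = e0 w" "e1 w1 = e1 w" using H(3) by (simp_all add: e0_def e1_def le_def)
    with H show ?thesis using rel_refl(1)[OF rel_eq, OF H(1)] by (simp add: eqR_def)
  qed
  with v d show ?thesis unfolding small_def vert_def disc_def conv_def by blast
qed

context family
begin

lemma S_vertex:
  assumes "RA h w w'" shows "S (\<lambda>_. h n) (\<lambda>_. w n) (\<lambda>n. n) = S h w (\<lambda>_. n)"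
  using S_sub[OF rel_refl(1)[OF rA, OF assms], of "\<lambda>_. n"] by simp

lemma small_sig:
  assumes s: "small RA" and sS: "\<And>k w. RA k w w \<Longrightarrow> small (S k w)"
  shows "small (sigR RA S)"
proof -
  have c: "sfst (\<lambda>_. w n) = (\<lambda>_. sfst w n)" "ssnd (\<lambda>_. w n) = (\<lambda>_. ssnd w n)" for w n by (simp_all add: seq_defs)
  have "sigR RA S h w w'" if H: "sigR RA S h w w" "\<forall>n. sigR RA S (\<lambda>_. h n) (\<lambda>_. w n) (\<lambda>_. w' n)" for h w w'
  proof -
    have 1: "RA h (sfst w) (sfst w)" "S h (sfst w) (\<lambda>n. n) (ssnd w) (ssnd w)" using H by (auto simp: sigR_def)
    have 2: "RA (\<lambda>_. h n) (\<lambda>_. sfst w n) (\<lambda>_. sfst w' n)" 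
      "S (\<lambda>_. h n) (\<lambda>_. sfst w n) (\<lambda>n. n) (\<lambda>_. ssnd w n) (\<lambda>_. ssnd w' n)" for n
      using H(2) by (auto simp: sigR_def c)
    show ?thesis
      using vertD[OF s, OF 1(1) 2(1)] vertD[OF sS[OF 1(1)], OF 1(2)] 2(2) S_vertex[OF 1(1)] by (simp add: sigR_def)
  qed
  moreover have "sigR RA S h w w'" if H: "sigR RA S h w w" "sigR RA S h w' w'" "sigR RA S (\<lambda>_. h m) (\<lambda>_. w m) (\<lambda>_. w' m)" for h w w' m
  proof -
    have 1: "RA h (sfst w) (sfst w)" "S h (sfst w) (\<lambda>n. n) (ssnd w) (ssnd w)" 
      "RA h (sfst w') (sfst w')" "S h (sfst w') (\<lambda>n. n) (ssnd w') (ssnd w')" using H by (auto simp: sigR_def)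
    have 2: "RA (\<lambda>_. h m) (\<lambda>_. sfst w m) (\<lambda>_. sfst w' m)" 
      "S (\<lambda>_. h m) (\<lambda>_. sfst w m) (\<lambda>n. n) (\<lambda>_. ssnd w m) (\<lambda>_. ssnd w' m)"
      using H(3) by (auto simp: sigR_def c)
    have 3: "RA h (sfst w) (sfst w')" by (rule discD[OF s, OF 1(1) 1(3) 2(1)])
    show ?thesis
      using discD[OF sS[OF 1(1)], OF 1(2), of "ssnd w'" m] 1(4) 2(2) S_vertex[OF 1(1)] eS[OF 3] 3 by (simp add: sigR_def)
  qed
  moreover have "sigR RA S h w w1" if H: "sigR RA S h w w2" "sigR RA S h w1 w1" "\<forall>n. le (w n) (w1 n) \<and> le (w1 n) (w2 n)" for h w w1 w2
  proof -
    have 1: "RA h (sfst w) (sfst w2)" "S h (sfst w) (\<lambda>n. n) (ssnd w) (ssnd w2)" 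
      "RA h (sfst w1) (sfst w1)" "S h (sfst w1) (\<lambda>n. n) (ssnd w1) (ssnd w1)" using H by (auto simp: sigR_def)
    have 3: "RA h (sfst w) (sfst w1)" 
      by (rule convD[OF s, OF 1(1) 1(3)]) (use H(3) in \<open>simp_all add: sfst_def le_W\<close>)
    have "S h (sfst w) (\<lambda>n. n) (ssnd w) (ssnd w1)"
      by (rule convD[OF sS[OF rel_refl(1)[OF rA, OF 3]], OF 1(2)]) (use H(3) 1(4) eS[OF 3] in \<open>simp_all add: ssnd_def le_W\<close>)
    with 3 show ?thesis by (simp add: sigR_def)
  qed
  ultimately show ?thesis unfolding small_def vert_def disc_def conv_def by blast
qed

lemma small_pi:
  assumes sS: "\<And>k w. RA k w w \<Longrightarrow> small (S k w)"
  shows "small (piR RA S)"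
proof -
  have c: "sdeg (\<lambda>_. w n) = (\<lambda>_. sdeg w n)" for w n by (simp add: seq_defs)
  have cw: "RA (\<lambda>_. h (k n)) (\<lambda>_. w n) (\<lambda>_. w' n)" if "RA (h \<circ> k) w w'" for h k w w' n
    using rel_re[OF rA, OF that, of "\<lambda>_. n"] by simp
  have V: "piH RA S h F F'" if H: "piH RA S h F F" "\<forall>n. piH RA S (\<lambda>_. h n) (\<lambda>_. F n) (\<lambda>_. F' n)" for h F F'
    unfolding piH_def
  proof (intro allI impI)
    fix k w w' assume w: "RA (h \<circ> k) w w'"
    note w1 = rel_refl(1)[OF rA, OF w]
    have 1: "S (h \<circ> k) w (\<lambda>n. n) (sap (F \<circ> k) w) (sap (F \<circ> k) w)" by (rule piH_D[OF H(1), OF w1])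
    show "S (h \<circ> k) w (\<lambda>n. n) (sap (F \<circ> k) w) (sap (F' \<circ> k) w')"
    proof (rule vertD[OF sS[OF w1], OF 1])
      fix n
      have "RA ((\<lambda>_. h (k n)) \<circ> (\<lambda>n. n)) (\<lambda>_. w n) (\<lambda>_. w' n)" using cw[OF w] by simp
      from piH_D[OF H(2)[rule_format, of "k n"], OF this]
      show "S (h \<circ> k) w (\<lambda>_. n) (\<lambda>_. sap (F \<circ> k) w n) (\<lambda>_. sap (F' \<circ> k) w' n)"
        using S_vertex[OF w, of n] by (simp add: sap_def)
    qed
  qed
  have D: "piH RA S h F F'" if H: "piH RA S h F F" "piH RA S h F' F'" "piH RA S (\<lambda>_. h m) (\<lambda>_. F m) (\<lambda>_. F' m)" for h F F' m
    unfolding piH_def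
  proof (intro allI impI)
    fix k w w' assume w: "RA (h \<circ> k) w w'"
    \<comment> \<open>The argument may have no entry over \<open>m\<close>, where the functions are
      known to agree. It is extended by its transport to \<open>h m\<close>, and discreteness of the
      fibres is used at position 1, the first transported entry.\<close>
    let ?t = "\<lambda>w. jn w (sTR A (h \<circ> k) (\<lambda>_. h m) w)" and ?k = "jn k (\<lambda>_. m)"
    have h: "h \<circ> ?k = jn (h \<circ> k) (\<lambda>_. h m)" by (simp add: jn_o)
    have t: "RA (h \<circ> ?k) (?t w) (?t w')" unfolding h by (rule trokD[OF goodD(2)[OF gA], OF w])
    have tr: "RA (h \<circ> ?k) (?t w) (?t w)" "RA (h \<circ> ?k) (?t w') (?t w')" by (rule rel_refl[OF rA, OF t])+
    have "S (h \<circ> ?k) (?t w) (\<lambda>n. n) (sap (F \<circ> ?k) (?t w)) (sap (F' \<circ> ?k) (?t w'))"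
    proof (rule discD[OF sS[OF tr(1)], of _ _ _ "Suc 0"])
      show "S (h \<circ> ?k) (?t w) (\<lambda>n. n) (sap (F \<circ> ?k) (?t w)) (sap (F \<circ> ?k) (?t w))" by (rule piH_D[OF H(1), OF tr(1)])
      show "S (h \<circ> ?k) (?t w) (\<lambda>n. n) (sap (F' \<circ> ?k) (?t w')) (sap (F' \<circ> ?k) (?t w'))" 
        using piH_D[OF H(2), OF tr(2)] eS[OF t] by simp
      have "RA ((\<lambda>_. h m) \<circ> (\<lambda>n. n)) (\<lambda>_. ?t w (Suc 0)) (\<lambda>_. ?t w' (Suc 0))"
        using rel_re[OF rA, OF t, of "\<lambda>_. Suc 0"] by (simp add: jn_def)
      from piH_D[OF H(3), OF this]
      show "S (h \<circ> ?k) (?t w) (\<lambda>_. Suc 0) (\<lambda>_. sap (F \<circ> ?k) (?t w) (Suc 0)) (\<lambda>_. sap (F' \<circ> ?k) (?t w') (Suc 0))"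
        using S_vertex[OF t, of "Suc 0"] by (simp add: sap_def jn_def)
    qed
    from rel_re[OF rS[OF tr(1)], OF this, of "(*) 2"]
    have "S (h \<circ> ?k) (?t w) ((*) 2) (sap (F \<circ> k) w) (sap (F' \<circ> k) w')"
      by (simp add: jn_o jn_push)
    then show "S (h \<circ> k) w (\<lambda>n. n) (sap (F \<circ> k) w) (sap (F' \<circ> k) w')"
      unfolding S_sub[OF tr(1), of "(*) 2"] by (simp add: jn_o)
  qed
  have "piR RA S h F F1" if H: "piR RA S h F F2" "piR RA S h F1 F1" "\<forall>n. le (F n) (F1 n) \<and> le (F1 n) (F2 n)" for h F F1 F2
  proof -
    have sd: "sdeg F1 = sdeg F" using H(3) le_W(3) unfolding sdeg_def by (intro ext) metis
    have "piH RA S h F F1" unfolding piH_def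
    proof (intro allI impI)
      fix k w w' assume w: "RA (h \<circ> k) w w'"
      note w1 = rel_refl(1)[OF rA, OF w]
      have f: "piH RA S h F F2" "piH RA S h F1 F1" using H by (auto simp: piR_def)
      have "S (h \<circ> k) w (\<lambda>n. n) (sap (F \<circ> k) w) (sap (F1 \<circ> k) w)"
        by (rule convD[OF sS[OF w1], OF piH_D[OF f(1), OF w1] piH_D[OF f(2), OF w1]])
          (use H(3) in \<open>simp_all add: sap_def le_W\<close>)
      from rel_trans[OF rS[OF w], OF this piH_D[OF f(2), OF w]]
      show "S (h \<circ> k) w (\<lambda>n. n) (sap (F \<circ> k) w) (sap (F1 \<circ> k) w')" .
    qed
    with H sd show ?thesis using piH_trans piH_sym unfolding piR_def by metis
  qed
  moreover have "piR RA S h F F'" if H: "piR RA S h F F" "\<forall>n. piR RA S (\<lambda>_. h n) (\<lambda>_. F n) (\<lambda>_. F' n)" for h F F'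
  proof -
    note D = H[unfolded piR_def c]
    have "piH RA S h F F'" by (rule V) (use D in blast)+
    moreover have "piH RA S h (sdeg F) (sdeg F')" by (rule V) (use D in blast)+
    ultimately show ?thesis unfolding piR_def using D by blast
  qed
  moreover have "piR RA S h F F'" if H: "piR RA S h F F" "piR RA S h F' F'" "piR RA S (\<lambda>_. h m) (\<lambda>_. F m) (\<lambda>_. F' m)" for h F F' m
  proof -
    note E = H[unfolded piR_def c]
    have "piH RA S h F F'" by (rule D[of _ _ _ m]) (use E in blast)+
    moreover have "piH RA S h (sdeg F) (sdeg F')" by (rule D[of _ _ _ m]) (use E in blast)+
    ultimately show ?thesis unfolding piR_def using E by blast
  qed
  ultimately show ?thesis
    unfolding small_def vert_def disc_def conv_def by blast
qed

end

section \<open>Framed types\<close>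

text \<open>Mutually inverse maps between two partial equivalence relations, presented by functions
  on realizers.\<close>

definition isoF :: "(dom \<Rightarrow> dom) \<Rightarrow> (dom \<Rightarrow> dom) \<Rightarrow> (dom \<Rightarrow> dom \<Rightarrow> bool) \<Rightarrow> (dom \<Rightarrow> dom \<Rightarrow> bool) \<Rightarrow> bool" where
  "isoF F G P Q \<longleftrightarrow> (\<forall>x x'. P x x' \<longrightarrow> Q (F x) (F x')) \<and> (\<forall>y y'. Q y y' \<longrightarrow> P (G y) (G y')) \<and>
     (\<forall>x. P x x \<longrightarrow> P (G (F x)) x) \<and> (\<forall>y. Q y y \<longrightarrow> Q (F (G y)) y)"

definition vx :: "krel \<Rightarrow> nat \<Rightarrow> dom \<Rightarrow> dom \<Rightarrow> bool" where
  "vx R e x x' \<longleftrightarrow> R (\<lambda>_. e) (\<lambda>_. x) (\<lambda>_. x')"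

text \<open>The isomorphisms between \<open>X\<close> and \<open>Y\<close> are given for each entry
  separately and no naturality is required, because the links between entries are those of
  \<open>X\<close> alone.\<close>

locale frame =
  fixes Y X u v :: sq and RX :: krel and RY :: "nat \<Rightarrow> krel"
  assumes gX: "good X RX" and sX: "small RX"
    and rY: "\<And>e. rel (RY e)" and sY: "\<And>e. small (RY e)" and cY: "\<And>e h k. RY e h = RY e k"
    and iso: "\<And>e. isoF (fap (u e)) (fap (v e)) (vx RX e) (vx (RY e) 0)"
begin

lemmas rX = goodD(1)[OF gX]
abbreviation R where "R \<equiv> frR RX RY v"
abbreviation T where "T \<equiv> \<lambda>e. Fr (Y e) (X e) (u e) (v e)"
abbreviation uh where "uh h x \<equiv> \<lambda>n. fap (u (h n)) (x n)"
abbreviation vh where "vh h x \<equiv> \<lambda>n. fap (v (h n)) (x n)"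

lemma isoD: 
  "vx RX e x x' \<Longrightarrow> vx (RY e) 0 (fap (u e) x) (fap (u e) x')" "vx (RY e) 0 y y' \<Longrightarrow> vx RX e (fap (v e) y) (fap (v e) y')"
  "vx RX e x x \<Longrightarrow> vx RX e (fap (v e) (fap (u e) x)) x" "vx (RY e) 0 y y \<Longrightarrow> vx (RY e) 0 (fap (u e) (fap (v e) y)) y"
  using iso unfolding isoF_def by blast+

lemma RY: "RY e h (\<lambda>_. x) (\<lambda>_. y) \<longleftrightarrow> vx (RY e) 0 x y"
  unfolding vx_def by (subst cY[of e h]) simp

lemma R_iff: "R h w w' \<longleftrightarrow> RX h (vh h w) (vh h w') \<and> (\<forall>n. vx (RY (h n)) 0 (w n) (w' n))"
  by (simp add: frR_def RY)

lemma vxX: "RX h x x' \<Longrightarrow> vx RX (h n) (x n) (x' n)"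
  unfolding vx_def using rel_re[OF rX, of h x x' "\<lambda>_. n"] by simp

lemma vxY_sym: "vx (RY e) 0 x y \<Longrightarrow> vx (RY e) 0 y x" unfolding vx_def using rel_sym[OF rY] by blast
lemma vxY_trans: "vx (RY e) 0 x y \<Longrightarrow> vx (RY e) 0 y z \<Longrightarrow> vx (RY e) 0 x z" unfolding vx_def using rel_trans[OF rY] by blast
lemma vxX_sym: "vx RX e x y \<Longrightarrow> vx RX e y x" unfolding vx_def using rel_sym[OF rX] by blast

lemma vu: assumes "RX h x x" shows "RX h x (vh h (uh h x))"
  by (rule vertD[OF sX, OF assms]) (use isoD(3)[OF vxX[OF assms]] vxX_sym in \<open>simp add: vx_def\<close>)

text \<open>Entrywise agreement in \<open>Y\<close> is recovered by going to \<open>X\<close> along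
  \<open>v\<close> and back along \<open>u\<close>.\<close>

lemma R_I: 
  assumes "R h w w" "R h w' w'" "RX h (vh h w) (vh h w')" shows "R h w w'"
proof -
  have "vx (RY (h n)) 0 (w n) (w' n)" for n
    using isoD(1)[OF vxX[OF assms(3)], of n] isoD(4)[of "h n" "w n"] isoD(4)[of "h n" "w' n"] assms(1,2)
    unfolding R_iff by (meson vxY_sym vxY_trans)
  with assms show ?thesis unfolding R_iff by blast
qed

lemma vh_o: "vh (h \<circ> k) (w \<circ> k) = vh h w \<circ> k" by auto
lemma vh_jn: "vh (jn f g) (jn x y) = jn (vh f x) (vh g y)" by (auto simp: jn_def fun_eq_iff)
lemma vx_R: "vx R e = vx (RY e) 0"
proof (intro ext)
  fix x y
  show "vx R e x y = vx (RY e) 0 x y"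
    unfolding vx_def[of R] R_iff using isoD(2)[of e x y] by (auto simp: vx_def)
qed

lemma rel_R: "rel R"
  unfolding rel_def
proof (intro conjI allI impI)
  fix h w w' assume H: "R h w w'"
  show "R h w' w" using H rel_sym[OF rX] vxY_sym unfolding R_iff by blast
  show "R (h \<circ> k) (w \<circ> k) (w' \<circ> k)" for k using H rel_re[OF rX, of h "vh h w" "vh h w'" k] unfolding R_iff vh_o by simp
  have "vh h (sdeg w) = sdeg (vh h w)" for w by (simp add: sdeg_def)
  moreover have "sdeg (\<lambda>_. x) = (\<lambda>_. deg x)" for x by (simp add: sdeg_def)
  ultimately show "R h (sdeg w) (sdeg w')" 
    using H rel_deg[OF rX, of h "vh h w" "vh h w'"] rel_deg[OF rY, of _ "\<lambda>_. 0" "\<lambda>_. w _" "\<lambda>_. w' _"] unfolding R_iff vx_def 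
    by (simp add: sdeg_def)
  show "ord (w n)" for n using H rel_ord(1)[OF rY] unfolding R_iff vx_def by blast
  fix w'' assume "R h w' w''"
  with H show "R h w w''" using rel_trans[OF rX] vxY_trans unfolding R_iff by blast
qed

lemma sTR_T: "sTR T f g w = uh g (sTR X f g (vh f w))"
proof -
  have "TRW (Fr Y X u v) (Fr Y' X' u' v') z = fap u' (TRW X X' (fap v z))" for Y X u v Y' X' u' v' z
    by (rule dom_eqI) (simp_all add: TR_simps)
  then show ?thesis by (simp add: sTR_def)
qed

lemma sCM_T: "sCM T f g a b P = uh g (sCM X f g (vh f a) (vh g b) (vh f P))"
proof -
  have "CMW (Fr Y X u v) (Fr Y' X' u' v') a b P = fap u' (CMW X X' (fap v a) (fap v' b) (fap v P))" for Y X u v Y' X' u' v' a b P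
    by (rule dom_eqI) (simp_all add: CM_simps)
  then show ?thesis by (simp add: sCM_def)
qed

text \<open>Pushing \<open>t\<close> along \<open>u\<close> and pulling back along \<open>v\<close>
  returns it up to entrywise equality, and by \<open>vert\<close> this leaves the links of
  \<open>X\<close> intact. So whatever is constructed in \<open>X\<close> can be moved to the framed
  type.\<close>

lemma extend:
  assumes w: "R f w w" and t: "RX (jn f g) (jn (vh f w) t) (jn (vh f w) t)"
  shows "R (jn f g) (jn w (uh g t)) (jn w (uh g t))" "RX (jn f g) (jn (vh f w) t) (vh (jn f g) (jn w (uh g t)))"
proof -
  have n: "jn x y n = (if even n then x (n div 2) else y (n div 2))" for x y :: "nat \<Rightarrow> 'b" and n by (simp add: jn_def)
  have tt: "RX g t t" by (rule rel_jn(2)[OF rX, OF t])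
  have ww: "RX f (vh f w) (vh f w)" by (rule rel_jn(1)[OF rX, OF t])
  show 1: "RX (jn f g) (jn (vh f w) t) (vh (jn f g) (jn w (uh g t)))"
    unfolding vh_jn
  proof (rule vertD[OF sX, OF t])
    fix n
    show "RX (\<lambda>_. jn f g n) (\<lambda>_. jn (vh f w) t n) (\<lambda>_. jn (vh f w) (vh g (uh g t)) n)"
      using vxX[OF vu[OF tt], of "n div 2"] vxX[OF ww, of "n div 2"] unfolding n vx_def by simp
  qed
  have "vx (RY (jn f g n)) 0 (jn w (uh g t) n) (jn w (uh g t) n)" for n
    using w isoD(1)[OF vxX[OF tt]] unfolding n R_iff by simp
  then show "R (jn f g) (jn w (uh g t)) (jn w (uh g t))"
    unfolding R_iff using rel_refl(2)[OF rX, OF 1] by blast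
qed

lemma good_frame: "good T R"
proof -
  have trok: "trok T T R" unfolding trok_def
  proof (intro allI impI)
    fix f g w w' assume H: "R f w w'"
    note ww = rel_refl[OF rel_R, OF H]
    have x: "RX f (vh f w) (vh f w')" using H by (simp add: R_iff)
    have t: "RX (jn f g) (jn (vh f w) (sTR X f g (vh f w))) (jn (vh f w') (sTR X f g (vh f w')))"
      by (rule trokD[OF goodD(2)[OF gX], OF x])
    note e = extend[OF ww(1) rel_refl(1)[OF rX, OF t]] and e' = extend[OF ww(2) rel_refl(2)[OF rX, OF t]]
    show "R (jn f g) (jn w (sTR T f g w)) (jn w' (sTR T f g w'))" unfolding sTR_T
      by (rule R_I[OF e(1) e'(1)]) (rule rel_trans[OF rX, OF rel_sym[OF rX, OF e(2)] rel_trans[OF rX, OF t e'(2)]])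
  qed
  moreover have "trid T R" unfolding trid_def
  proof (intro allI impI)
    fix f w assume H: "R f w w"
    have x: "RX f (vh f w) (vh f w)" using H by (simp add: R_iff)
    have t: "RX (jn f f) (jn (vh f w) (sTR X f f (vh f w))) (jn (vh f w) (vh f w))"
      by (rule tridD[OF goodD(3)[OF gX], OF x])
    note e = extend[OF H rel_refl(1)[OF rX, OF t]]
    have "R (jn f f) (jn w w) (jn w w)"
      by (rule rel_reI[OF rel_R, OF H, of _ "\<lambda>n. n div 2"]) (auto simp: jn_def)
    then show "R (jn f f) (jn w (sTR T f f w)) (jn w w)" unfolding sTR_T
      by (rule R_I[OF e(1)]) (rule rel_trans[OF rX, OF rel_sym[OF rX, OF e(2)]], unfold vh_jn, rule t)
  qed
  moreover have "cmpok T R" unfolding cmpok_def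
  proof (intro allI impI)
    fix f g Q a b P assume H: "cmp_hyp R f g Q a b P"
    have P: "R f P P" using H by (simp add: cmp_hyp_def)
    have vr: "vh f a \<circ> r = vh (f \<circ> r) (a \<circ> r)" for f r a by auto
    have HX: "cmp_hyp RX f g Q (vh f a) (vh g b) (vh f P)"
      using H unfolding cmp_hyp_def R_iff vh_jn vr by blast
    note c = cmpokD[OF goodD(4)[OF gX], OF HX]
    let ?t = "sCM X f g (vh f a) (vh g b) (vh f P)"
    note e = extend[OF P c(1)]
    have "R (jn (f \<circ> r) (g \<circ> r)) (jn (P \<circ> r) (uh g ?t \<circ> r)) (jn (a \<circ> r) (b \<circ> r))" if r: "r \<in> Q" for r
    proof (rule R_I)
      let ?j = "jn (\<lambda>n. 2 * r n) (\<lambda>n. Suc (2 * r n)) :: nat \<Rightarrow> nat"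
      have j: "jn x y \<circ> ?j = jn (x \<circ> r) (y \<circ> r)" for x y :: "nat \<Rightarrow> 'b"
        unfolding jn_o by (rule arg_cong2[of _ _ _ _ jn]) (simp_all add: fun_eq_iff)
      show "R (jn (f \<circ> r) (g \<circ> r)) (jn (P \<circ> r) (uh g ?t \<circ> r)) (jn (P \<circ> r) (uh g ?t \<circ> r))"
        using rel_re[OF rel_R, OF e(1), of ?j] unfolding j .
      show "R (jn (f \<circ> r) (g \<circ> r)) (jn (a \<circ> r) (b \<circ> r)) (jn (a \<circ> r) (b \<circ> r))"
        using H r by (simp add: cmp_hyp_def)
      have "RX (jn (f \<circ> r) (g \<circ> r)) (jn (vh f P \<circ> r) (?t \<circ> r)) (vh (jn (f \<circ> r) (g \<circ> r)) (jn (P \<circ> r) (uh g ?t \<circ> r)))"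
        using rel_re[OF rX, OF e(2), of ?j] unfolding vh_o[symmetric] j .
      from rel_trans[OF rX, OF rel_sym[OF rX, OF this] c(2)[OF r]]
      show "RX (jn (f \<circ> r) (g \<circ> r)) (vh (jn (f \<circ> r) (g \<circ> r)) (jn (P \<circ> r) (uh g ?t \<circ> r))) (vh (jn (f \<circ> r) (g \<circ> r)) (jn (a \<circ> r) (b \<circ> r)))"
        unfolding vh_jn vr .
    qed
    with e(1) show "R (jn f g) (jn P (sCM T f g a b P)) (jn P (sCM T f g a b P)) \<and>
      (\<forall>r\<in>Q. R (jn (f \<circ> r) (g \<circ> r)) (jn (P \<circ> r) (sCM T f g a b P \<circ> r)) (jn (a \<circ> r) (b \<circ> r)))"
      unfolding sCM_T by blast
  qed
  moreover have "uniq R" unfolding uniq_def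
  proof (intro allI impI)
    fix f g x y x' y'
    assume H: "R (jn f g) (jn x y) (jn x y)" "R (jn f g) (jn x' y') (jn x' y')" "R f x x'"
      "\<forall>n. R (jn (\<lambda>_. f n) (\<lambda>_. g n)) (jn (\<lambda>_. x n) (\<lambda>_. y n)) (jn (\<lambda>_. x' n) (\<lambda>_. y' n))"
    show "R (jn f g) (jn x y) (jn x' y')"
    proof (rule R_I[OF H(1,2)], unfold vh_jn, rule uniqD[OF goodD(5)[OF gX]])
      show "RX (jn f g) (jn (vh f x) (vh g y)) (jn (vh f x) (vh g y))" 
        "RX (jn f g) (jn (vh f x') (vh g y')) (jn (vh f x') (vh g y'))"
        "RX f (vh f x) (vh f x')" using H unfolding R_iff vh_jn by blast+
      show "RX (jn (\<lambda>_. f n) (\<lambda>_. g n)) (jn (\<lambda>_. vh f x n) (\<lambda>_. vh g y n)) (jn (\<lambda>_. vh f x' n) (\<lambda>_. vh g y' n))" for n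
        using H(4)[rule_format, of n] unfolding R_iff vh_jn by blast
    qed
  qed
  ultimately show ?thesis using rel_R unfolding good_def by blast
qed

lemma small_frame: "small R"
  unfolding small_def vert_def disc_def conv_def
proof (intro conjI allI impI)
  fix h w w' assume H: "R h w w" "\<forall>n. R (\<lambda>_. h n) (\<lambda>_. w n) (\<lambda>_. w' n)"
  have 1: "RX h (vh h w) (vh h w)" using H by (simp add: R_iff)
  have "RX h (vh h w) (vh h w')" by (rule vertD[OF sX, OF 1]) (use H(2) in \<open>simp add: R_iff\<close>)
  with H(2) show "R h w w'" by (simp add: R_iff)
next
  fix h w w' m assume H: "R h w w" "R h w' w'" "R (\<lambda>_. h m) (\<lambda>_. w m) (\<lambda>_. w' m)"
  have 1: "RX h (vh h w) (vh h w)" "RX h (vh h w') (vh h w')" "RX (\<lambda>_. h m) (\<lambda>_. vh h w m) (\<lambda>_. vh h w' m)" 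
    using H by (simp_all add: R_iff)
  show "R h w w'" by (rule R_I[OF H(1,2) discD[OF sX, OF 1]])
next
  fix h w w1 w2 assume H: "R h w w2" "R h w1 w1" and le: "\<forall>n. le (w n) (w1 n) \<and> le (w1 n) (w2 n)"
  have "R h w w" using rel_refl(1)[OF rel_R, OF H(1)] .
  have 1: "RX h (vh h w) (vh h w2)" "RX h (vh h w1) (vh h w1)" using H by (simp_all add: R_iff)
  have "RX h (vh h w) (vh h w1)"
    by (rule convD[OF sX, OF 1]) (use le in \<open>simp_all add: le_W\<close>)
  then show "R h w w1" by (rule R_I[OF \<open>R h w w\<close> H(2)])
qed

end

section \<open>The universe\<close>

text \<open>Interprets nothing: the code of the universe denotes no small type.\<close>

definition uu0 :: "sq \<Rightarrow> krel \<Rightarrow> bool" where "uu0 T R \<longleftrightarrow> False"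

lemma den0_det: "den uu0 T R \<Longrightarrow> den uu0 T R' \<Longrightarrow> R = R'"
  by (erule (1) den_det) (simp add: uu0_def)
lemma den0_reindex: "den uu0 T R \<Longrightarrow> den uu0 (T \<circ> h) (\<lambda>k. R (h \<circ> k))"
  by (erule den_reindex) (simp add: uu0_def)

text \<open>Reindexing does not change a constant sequence of codes, and denotations are unique, so
  the relation cannot depend on the reindexing.\<close>

lemma den0_const: "den uu0 (\<lambda>_. Y) R \<Longrightarrow> R h = R k"
proof -
  assume H: "den uu0 (\<lambda>_. Y) R"
  have c: "(\<lambda>_. Y) \<circ> h = (\<lambda>_. Y)" for h :: "nat \<Rightarrow> nat" by (simp add: fun_eq_iff)
  have "(\<lambda>l. R (h \<circ> l)) = R" for h
    using den0_det[OF den0_reindex[OF H, of h, unfolded c] H] .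
  from fun_cong[OF this[of h], of "\<lambda>n. n"] fun_cong[OF this[of "\<lambda>_. 0"], of k] fun_cong[OF this[of "\<lambda>_. 0"], of h]
  show "R h = R k" by (simp add: o_def)
qed

lemma rel_reindex: "rel R \<Longrightarrow> rel (\<lambda>h. R (k \<circ> h))"
  unfolding rel_def o_assoc by blast

lemma good_reindex: assumes "good T R" shows "good (T \<circ> k) (\<lambda>h. R (k \<circ> h))"
proof -
  have s: "sTR (T \<circ> k) f g x = sTR T (k \<circ> f) (k \<circ> g) x" "sCM (T \<circ> k) f g a b P = sCM T (k \<circ> f) (k \<circ> g) a b P" for f g x a b P
    by (simp_all add: sTR_def sCM_def)
  have c: "cmp_hyp (\<lambda>h. R (k \<circ> h)) f g Q a b P \<longleftrightarrow> cmp_hyp R (k \<circ> f) (k \<circ> g) Q a b P" for f g Q a b P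
    by (simp add: cmp_hyp_def jn_o o_assoc)
  have "trok (T \<circ> k) (T \<circ> k) (\<lambda>h. R (k \<circ> h))" using goodD(2)[OF assms] unfolding trok_def s jn_o by blast
  moreover have "trid (T \<circ> k) (\<lambda>h. R (k \<circ> h))" using goodD(3)[OF assms] unfolding trid_def s jn_o by blast
  moreover have "cmpok (T \<circ> k) (\<lambda>h. R (k \<circ> h))" using goodD(4)[OF assms] unfolding cmpok_def s jn_o c by (simp add: o_assoc)
  moreover have "uniq (\<lambda>h. R (k \<circ> h))" 
    unfolding uniq_def jn_o
  proof (intro allI impI)
    fix f g x y x' y'
    assume H: "R (jn (k \<circ> f) (k \<circ> g)) (jn x y) (jn x y)" "R (jn (k \<circ> f) (k \<circ> g)) (jn x' y') (jn x' y')" "R (k \<circ> f) x x'"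
     "\<forall>n. R (jn (k \<circ> (\<lambda>_. f n)) (k \<circ> (\<lambda>_. g n))) (jn (\<lambda>_. x n) (\<lambda>_. y n)) (jn (\<lambda>_. x' n) (\<lambda>_. y' n))"
    show "R (jn (k \<circ> f) (k \<circ> g)) (jn x y) (jn x' y')"
      by (rule uniqD[OF goodD(5)[OF assms], OF H(1,2,3)]) (use H(4) in simp)
  qed
  ultimately show ?thesis using rel_reindex[OF goodD(1)[OF assms]] by (simp add: good_def)
qed

lemma small_reindex: assumes "small R" shows "small (\<lambda>h. R (k \<circ> h))"
  unfolding small_def vert_def disc_def conv_def
proof (intro conjI allI impI)
  fix h w w' assume H: "R (k \<circ> h) w w" "\<forall>n. R (k \<circ> (\<lambda>_. h n)) (\<lambda>_. w n) (\<lambda>_. w' n)"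
  show "R (k \<circ> h) w w'" by (rule vertD[OF assms, OF H(1)]) (use H(2) in simp)
next
  fix h w w' m assume H: "R (k \<circ> h) w w" "R (k \<circ> h) w' w'" "R (k \<circ> (\<lambda>_. h m)) (\<lambda>_. w m) (\<lambda>_. w' m)"
  show "R (k \<circ> h) w w'" by (rule discD[OF assms, OF H(1,2), of m]) (use H(3) in simp)
next
  fix h w w1 w2 assume "R (k \<circ> h) w w2" "R (k \<circ> h) w1 w1" "\<forall>n. le (w n) (w1 n) \<and> le (w1 n) (w2 n)"
  then show "R (k \<circ> h) w w1" using convD[OF assms] by blast
qed

text \<open>Membership in the universe. Both \<open>X\<close> and \<open>Y\<close> denote over
  \<open>uu0\<close>, and the isomorphisms that \<open>den\<close> leaves open are supplied by
  \<open>frame\<close>.\<close>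

definition framed :: "sq \<Rightarrow> krel \<Rightarrow> bool" where
  "framed T R \<longleftrightarrow> (\<exists>Y X u v RX RY. (\<forall>e. T e = Fr (Y e) (X e) (u e) (v e)) \<and> frame X u v RX RY \<and>
     den uu0 X RX \<and> (\<forall>e. den uu0 (\<lambda>_. Y e) (RY e)) \<and> R = frR RX RY v)"

lemma framedD:
  assumes "framed T R"
  shows "den uu0 T R" "good T R" "small R"
    "\<exists>RY. den uu0 (\<lambda>_. frY (T e)) RY \<and> rel RY \<and> small RY \<and> vx R e = vx RY 0"
proof -
  obtain Y X u v RX RY where T: "\<And>e. T e = Fr (Y e) (X e) (u e) (v e)" and f: "frame X u v RX RY"
    and X: "den uu0 X RX" and Y: "\<And>e. den uu0 (\<lambda>_. Y e) (RY e)" and R: "R = frR RX RY v"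
    using assms unfolding framed_def by blast
  show "den uu0 T R" unfolding R by (rule den_Fr[OF T X Y])
  have T': "T = (\<lambda>e. Fr (Y e) (X e) (u e) (v e))" using T by blast
  show "good T R" "small R" unfolding T' R by (rule frame.good_frame[OF f], rule frame.small_frame[OF f])
  show "\<exists>RY. den uu0 (\<lambda>_. frY (T e)) RY \<and> rel RY \<and> small RY \<and> vx R e = vx RY 0"
    using Y[of e] frame.vx_R[OF f, of e] frame.rY[OF f, of e] frame.sY[OF f, of e] by (auto simp: T R)
qed

lemma framed_det: "framed T R \<Longrightarrow> framed T R' \<Longrightarrow> R = R'"
  using framedD(1) den0_det by blast

lemma vx_reindex: "vx (\<lambda>h. R (k \<circ> h)) e = vx R (k e)"
  by (simp add: vx_def fun_eq_iff)

lemma framed_reindex: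
  assumes "framed T R" shows "framed (T \<circ> k) (\<lambda>h. R (k \<circ> h))"
proof -
  obtain Y X u v RX RY where T: "\<And>e. T e = Fr (Y e) (X e) (u e) (v e)" and f: "frame X u v RX RY"
    and X: "den uu0 X RX" and Y: "\<And>e. den uu0 (\<lambda>_. Y e) (RY e)" and R: "R = frR RX RY v"
    using assms unfolding framed_def by blast
  have "frame (X \<circ> k) (u \<circ> k) (v \<circ> k) (\<lambda>h. RX (k \<circ> h)) (RY \<circ> k)"
    using f unfolding frame_def vx_reindex by (simp add: good_reindex small_reindex)
  moreover have "den uu0 (X \<circ> k) (\<lambda>h. RX (k \<circ> h))" by (rule den0_reindex[OF X])
  moreover have "(\<lambda>h. R (k \<circ> h)) = frR (\<lambda>h. RX (k \<circ> h)) (RY \<circ> k) (v \<circ> k)"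
    by (simp add: R frR_def fun_eq_iff)
  ultimately show ?thesis
    unfolding framed_def using T Y
    by (intro exI[of _ "Y \<circ> k"] exI[of _ "X \<circ> k"] exI[of _ "u \<circ> k"] exI[of _ "v \<circ> k"]
        exI[of _ "\<lambda>h. RX (k \<circ> h)"] exI[of _ "RY \<circ> k"]) simp
qed

section \<open>Cliques of a small type in terms of single entries and transports\<close>

definition fr :: "sq \<Rightarrow> bool" where "fr T \<longleftrightarrow> (\<exists>R. framed T R)"
definition RF :: "sq \<Rightarrow> krel" where "RF T = (THE R. framed T R)"
definition VX :: "sq \<Rightarrow> nat \<Rightarrow> dom \<Rightarrow> dom \<Rightarrow> bool" where "VX T e = vx (RF T) e"

lemma RF: "framed T R \<Longrightarrow> RF T = R"
  unfolding RF_def using framed_det by blast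
lemma fr_RF: "fr T \<Longrightarrow> framed T (RF T)"
  unfolding fr_def using RF by blast
lemmas frD = framedD[OF fr_RF]

lemma fr_reindex: "fr T \<Longrightarrow> fr (T \<circ> k)" "fr T \<Longrightarrow> RF (T \<circ> k) = (\<lambda>h. RF T (k \<circ> h))" 
    "fr T \<Longrightarrow> VX (T \<circ> k) e = VX T (k e)"
  using framed_reindex[OF fr_RF, of T k] RF[of "T \<circ> k"] unfolding fr_def VX_def by (auto simp: vx_reindex)

lemma VX_PER: assumes "fr T" 
  shows "VX T e x y \<Longrightarrow> VX T e y x" "VX T e x y \<Longrightarrow> VX T e y z \<Longrightarrow> VX T e x z" 
    "VX T e x y \<Longrightarrow> VX T e x x" "VX T e x y \<Longrightarrow> VX T e y y"
  unfolding VX_def vx_def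
  using rel_sym[OF goodD(1)[OF frD(2)[OF assms]]] rel_trans[OF goodD(1)[OF frD(2)[OF assms]]]
    rel_refl[OF goodD(1)[OF frD(2)[OF assms]]] by blast+

lemma RF_VX: "fr T \<Longrightarrow> RF T h w w' \<Longrightarrow> VX T (h n) (w n) (w' n)"
  unfolding VX_def vx_def using rel_re[OF goodD(1)[OF frD(2)], of T h w w' "\<lambda>_. n"] by simp

lemma tr_VX:
  assumes T: "fr T" and x: "VX T i x x'"
  shows "VX T j (TRW (T i) (T j) x) (TRW (T i) (T j) x')"
proof -
  note R = goodD[OF frD(2)[OF T]]
  have "RF T (jn (\<lambda>_. i) (\<lambda>_. j)) (jn (\<lambda>_. x) (sTR T (\<lambda>_. i) (\<lambda>_. j) (\<lambda>_. x))) (jn (\<lambda>_. x') (sTR T (\<lambda>_. i) (\<lambda>_. j) (\<lambda>_. x')))"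
    using x unfolding VX_def vx_def by (rule trokD[OF R(2)])
  from rel_jn(2)[OF R(1), OF this] show ?thesis by (simp add: VX_def vx_def sTR_def)
qed

text \<open>The entry \<open>w m\<close> extended by \<open>w n\<close>, and the same entry extended
  by its transport, are two cliques that agree at their first entry; discreteness identifies
  them.\<close>

lemma RF_edge:
  assumes T: "fr T" and w: "RF T h w w"
  shows "VX T (h n) (TRW (T (h m)) (T (h n)) (w m)) (w n)"
proof -
  note R = goodD[OF frD(2)[OF T]]
  let ?x = "\<lambda>_::nat. w m"
  have 1: "RF T (jn (\<lambda>_. h m) (\<lambda>_. h n)) (jn ?x (\<lambda>_. w n)) (jn ?x (\<lambda>_. w n))"
    by (rule rel_reI[OF R(1), OF w, of _ "jn (\<lambda>_. m) (\<lambda>_. n)"]) (simp_all add: jn_o)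
  have x: "RF T (\<lambda>_. h m) ?x ?x" using rel_jn(1)[OF R(1), OF 1] .
  have "RF T (jn (\<lambda>_. h m) (\<lambda>_. h n)) (jn ?x (sTR T (\<lambda>_. h m) (\<lambda>_. h n) ?x)) (jn ?x (sTR T (\<lambda>_. h m) (\<lambda>_. h n) ?x))"
    by (rule trokD[OF R(2), OF x])
  from discD[OF frD(3)[OF T], OF this 1, of 0] x
  have "RF T (jn (\<lambda>_. h m) (\<lambda>_. h n)) (jn ?x (sTR T (\<lambda>_. h m) (\<lambda>_. h n) ?x)) (jn ?x (\<lambda>_. w n))"
    by (simp add: jn_def)
  from rel_jn(2)[OF R(1), OF this] show ?thesis by (simp add: VX_def vx_def sTR_def)
qed

text \<open>The transports of \<open>w 0\<close> form a clique, and by \<open>vert\<close> its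
  entries may be replaced by those of \<open>w\<close>. Together with \<open>RF_edge\<close>,
  relations of small types are reduced to elements of single entries and transports between
  them.\<close>

lemma RF_I:
  assumes T: "fr T" and v: "\<And>n. VX T (h n) (w n) (w' n)" 
    and e: "\<And>m n. VX T (h n) (TRW (T (h m)) (T (h n)) (w m)) (w n)"
  shows "RF T h w w'"
proof -
  note R = goodD[OF frD(2)[OF T]]
  have "RF T (\<lambda>_. h 0) (\<lambda>_. w 0) (\<lambda>_. w 0)" using VX_PER(3)[OF T v[of 0]] by (simp add: VX_def vx_def)
  from trokD[OF R(2), OF this, of h] have 1: "RF T h (sTR T (\<lambda>_. h 0) h (\<lambda>_. w 0)) (sTR T (\<lambda>_. h 0) h (\<lambda>_. w 0))"
    by (rule rel_jn(2)[OF R(1)])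
  have "RF T h (sTR T (\<lambda>_. h 0) h (\<lambda>_. w 0)) w"
    by (rule vertD[OF frD(3)[OF T], OF 1]) (use e in \<open>simp add: VX_def vx_def sTR_def\<close>)
  then have "RF T h w w" by (rule rel_refl(2)[OF R(1)])
  then show ?thesis by (rule vertD[OF frD(3)[OF T]]) (use v in \<open>simp add: VX_def vx_def\<close>)
qed

lemma tr_id: assumes T: "fr T" and x: "VX T i x x" shows "VX T i (TRW (T i) (T i) x) x"
proof -
  have "RF T (\<lambda>_. i) (\<lambda>_. x) (\<lambda>_. x)" using x by (simp add: VX_def vx_def)
  from RF_edge[OF T this] show ?thesis .
qed

text \<open>The transports of \<open>x\<close> to \<open>j\<close> and to \<open>k\<close> are two
  entries of one clique, to which \<open>RF_edge\<close> applies.\<close>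

lemma tr_comp: assumes T: "fr T" and x: "VX T i x x" 
  shows "VX T k (TRW (T j) (T k) (TRW (T i) (T j) x)) (TRW (T i) (T k) x)"
proof -
  note R = goodD[OF frD(2)[OF T]]
  have "RF T (\<lambda>_. i) (\<lambda>_. x) (\<lambda>_. x)" using x by (simp add: VX_def vx_def)
  from trokD[OF R(2), OF this, of "jn (\<lambda>_. j) (\<lambda>_. k)"]
  have "RF T (jn (\<lambda>_. j) (\<lambda>_. k)) (sTR T (\<lambda>_. i) (jn (\<lambda>_. j) (\<lambda>_. k)) (\<lambda>_. x)) (sTR T (\<lambda>_. i) (jn (\<lambda>_. j) (\<lambda>_. k)) (\<lambda>_. x))"
    by (rule rel_jn(2)[OF R(1)])
  from RF_edge[OF T this, of "Suc 0" 0] show ?thesis by (simp add: sTR_def jn_def)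
qed

lemma iso_tr: assumes T: "fr T" shows "isoF (TRW (T i) (T j)) (TRW (T j) (T i)) (VX T i) (VX T j)"
  unfolding isoF_def using tr_VX[OF T] tr_comp[OF T] tr_id[OF T] VX_PER(2)[OF T] by blast

lemma isoFD: assumes "isoF F G P Q"
  shows "P x x' \<Longrightarrow> Q (F x) (F x')" "Q y y' \<Longrightarrow> P (G y) (G y')" "P x x \<Longrightarrow> P (G (F x)) x" "Q y y \<Longrightarrow> Q (F (G y)) y"
  using assms unfolding isoF_def by blast+

lemma isoF_comp:
  assumes 1: "isoF F G P Q" and 2: "isoF F' G' Q W" 
    and P: "\<And>x y z. P x y \<Longrightarrow> P y z \<Longrightarrow> P x z" and W: "\<And>x y z. W x y \<Longrightarrow> W y z \<Longrightarrow> W x z"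
  shows "isoF (\<lambda>x. F' (F x)) (\<lambda>y. G (G' y)) P W"
  unfolding isoF_def
proof (intro conjI allI impI)
  fix x x' assume x: "P x x'" show "W (F' (F x)) (F' (F x'))" by (rule isoFD(1)[OF 2 isoFD(1)[OF 1 x]])
next
  fix x x' assume x: "W x x'" show "P (G (G' x)) (G (G' x'))" by (rule isoFD(2)[OF 1 isoFD(2)[OF 2 x]])
next
  fix x assume x: "P x x"
  show "P (G (G' (F' (F x)))) x"
    by (rule P[OF isoFD(2)[OF 1 isoFD(3)[OF 2 isoFD(1)[OF 1 x]]] isoFD(3)[OF 1 x]])
next
  fix x assume x: "W x x"
  show "W (F' (F (G (G' x)))) x"
    by (rule W[OF isoFD(1)[OF 2 isoFD(4)[OF 1 isoFD(2)[OF 2 x]]] isoFD(4)[OF 2 x]])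
qed

section \<open>Equality in the universe\<close>

definition bs :: "sq \<Rightarrow> sq" where "bs w = (\<lambda>n. p1 (w n))"
definition urel :: "sq \<Rightarrow> sq \<Rightarrow> bool" where
  "urel w w' \<longleftrightarrow> (\<forall>n. ord (w n) \<and> ord (w' n)) \<and> fr (bs w) \<and> fr (bs w') \<and> RF (bs w) = RF (bs w') \<and>
     trok (bs w) (bs w') (RF (bs w))"

definition agr :: "sq \<Rightarrow> sq \<Rightarrow> nat \<Rightarrow> nat \<Rightarrow> bool" where
  "agr T T' i j \<longleftrightarrow> (\<forall>x. VX T i x x \<longrightarrow> VX T j (TRW (T i) (T j) x) (TRW (T' i) (T' j) x))"

definition usame :: "sq \<Rightarrow> sq \<Rightarrow> bool" where
  "usame T T' \<longleftrightarrow> fr T \<and> fr T' \<and> (\<forall>e. VX T e = VX T' e) \<and> (\<forall>i j. agr T T' i j)"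

text \<open>By \<open>RF_edge\<close> and \<open>RF_I\<close> the relation is recovered from its
  entries and transports, so agreement of these data is the same as equality of the relations with
  agreeing transport.\<close>

lemma usame_iff: "usame T T' \<longleftrightarrow> fr T \<and> fr T' \<and> RF T = RF T' \<and> trok T T' (RF T)"
proof
  assume "usame T T'"
  then have T: "fr T" and T': "fr T'" and V: "\<And>e. VX T e = VX T' e" and A: "\<And>i j. agr T T' i j"
    by (auto simp: usame_def)
  have A: "VX T j (TRW (T i) (T j) x) (TRW (T' i) (T' j) x)" if "VX T i x x" for i j x
    using A that unfolding agr_def by blast
  have "RF T h w w' = RF T' h w w'" for h w w'
  proof
    assume H: "RF T h w w'"
    note H1 = rel_refl(1)[OF goodD(1)[OF frD(2)[OF T]], OF H]
    show "RF T' h w w'"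
      using RF_VX[OF T H] RF_edge[OF T H1] A VX_PER[OF T]
      by (intro RF_I[OF T']) (metis V, metis V RF_VX[OF T H1])
  next
    assume H: "RF T' h w w'"
    note H1 = rel_refl(1)[OF goodD(1)[OF frD(2)[OF T']], OF H]
    show "RF T h w w'"
      using RF_VX[OF T' H] RF_edge[OF T' H1] A VX_PER[OF T]
      by (intro RF_I[OF T]) (metis V, metis V RF_VX[OF T' H1])
  qed
  then have R: "RF T = RF T'" by blast
  moreover have "trok T T' (RF T)"
    unfolding trok_def
  proof (intro allI impI)
    fix f g x x' assume x: "RF T f x x'"
    note xx = rel_refl[OF goodD(1)[OF frD(2)[OF T]], OF x]
    have "RF T (jn f g) (jn x (sTR T f g x)) (jn x (sTR T f g x))"
      by (rule trokD[OF goodD(2)[OF frD(2)[OF T]], OF xx(1)])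
    moreover have "RF T (jn f g) (jn x' (sTR T' f g x')) (jn x' (sTR T' f g x'))"
      using trokD[OF goodD(2)[OF frD(2)[OF T']], of f x' x'] xx(2) unfolding R .
    ultimately show "RF T (jn f g) (jn x (sTR T f g x)) (jn x' (sTR T' f g x'))"
      by (rule discD[OF frD(3)[OF T], of _ _ _ 0]) (use RF_VX[OF T x, of 0] in \<open>simp add: jn_def VX_def vx_def\<close>)
  qed
  ultimately show "fr T \<and> fr T' \<and> RF T = RF T' \<and> trok T T' (RF T)" using T T' by blast
next
  assume H: "fr T \<and> fr T' \<and> RF T = RF T' \<and> trok T T' (RF T)"
  then have T: "fr T" and t: "trok T T' (RF T)" by auto
  have "agr T T' i j" for i j
    unfolding agr_def
  proof (intro allI impI)
    fix x assume "VX T i x x"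
    then have "RF T (\<lambda>_. i) (\<lambda>_. x) (\<lambda>_. x)" by (simp add: VX_def vx_def)
    from rel_jn(2)[OF goodD(1)[OF frD(2)[OF T]], OF trokD[OF t, OF this, of "\<lambda>_. j"]]
    show "VX T j (TRW (T i) (T j) x) (TRW (T' i) (T' j) x)" by (simp add: sTR_def VX_def vx_def)
  qed
  with H show "usame T T'" by (simp add: usame_def VX_def)
qed

lemma urel_iff: "urel w w' \<longleftrightarrow> (\<forall>n. ord (w n) \<and> ord (w' n)) \<and> usame (bs w) (bs w')"
  unfolding urel_def usame_iff by blast

lemma usame_refl: "fr T \<Longrightarrow> usame T T"
  unfolding usame_iff using goodD(2)[OF frD(2)] by blast

lemma usame_sym: "usame T T' \<Longrightarrow> usame T' T"
  unfolding usame_def agr_def using VX_PER by metis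
lemma usame_trans: "usame T T' \<Longrightarrow> usame T' T'' \<Longrightarrow> usame T T''"
  unfolding usame_def agr_def using VX_PER by metis
lemma usame_reindex: "usame T T' \<Longrightarrow> usame (T \<circ> k) (T' \<circ> k)"
proof -
  assume H: "usame T T'"
  then have "VX T = VX T'" by (auto simp: usame_def)
  with H show "usame (T \<circ> k) (T' \<circ> k)" by (simp add: usame_def agr_def fr_reindex)
qed

lemma agr_comp:
  assumes T: "fr T" and T': "fr T'" and V: "\<And>e. VX T e = VX T' e" and a: "agr T T' i j" "agr T T' j k"
  shows "agr T T' i k"
  unfolding agr_def
proof (intro allI impI)
  fix x assume x: "VX T i x x"
  let ?y = "TRW (T i) (T j) x" and ?y' = "TRW (T' i) (T' j) x"
  have y: "VX T j ?y ?y'" using a(1) x by (auto simp: agr_def)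
  have "VX T k (TRW (T i) (T k) x) (TRW (T j) (T k) ?y)" using VX_PER(1)[OF T tr_comp[OF T x]] .
  moreover have "VX T k (TRW (T j) (T k) ?y) (TRW (T' j) (T' k) ?y)"
    using a(2) VX_PER(3)[OF T y] by (auto simp: agr_def)
  moreover have "VX T k (TRW (T' j) (T' k) ?y) (TRW (T' j) (T' k) ?y')" using tr_VX[OF T'] y V by simp
  moreover have "VX T k (TRW (T' j) (T' k) ?y') (TRW (T' i) (T' k) x)" using tr_comp[OF T'] x V by simp
  ultimately show "VX T k (TRW (T i) (T k) x) (TRW (T' i) (T' k) x)" using VX_PER(2)[OF T] by blast
qed

text \<open>Every transport factors through the even half, so it is enough to compare transports
  within that half and across each rung from \<open>2 * n\<close> to its successor.\<close>

lemma usame_jn: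
  assumes T: "fr T" and T': "fr T'" and V: "\<And>e. VX T e = VX T' e"
    and a: "\<And>n m. agr T T' (2 * n) (2 * m)" "\<And>n. agr T T' (2 * n) (Suc (2 * n))" "\<And>n. agr T T' (Suc (2 * n)) (2 * n)"
  shows "usame T T'"
proof -
  have 1: "agr T T' i (2 * (i div 2))" for i
    using a(1)[of "i div 2" "i div 2"] a(3)[of "i div 2"] by (cases "even i") auto
  have 2: "agr T T' (2 * (i div 2)) i" for i
    using a(1)[of "i div 2" "i div 2"] a(2)[of "i div 2"] by (cases "even i") auto
  have "agr T T' i j" for i j
    using agr_comp[OF T T' V 1 agr_comp[OF T T' V a(1) 2]] .
  with T T' V show ?thesis by (simp add: usame_def)
qed

lemma bs_push: "bs (w \<circ> k) = bs w \<circ> k" "bs (sdeg w) = bs w" "bs (jn x y) = jn (bs x) (bs y)" "bs (\<lambda>_. x n) = (\<lambda>_. bs x n)"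
  by (auto simp: bs_def sdeg_def jn_def fun_eq_iff)

lemma rel_univ: "rel (\<lambda>h. urel)"
  unfolding rel_def
proof (intro conjI allI impI)
  fix w w' assume H: "urel w w'"
  show "urel w' w" using H usame_sym unfolding urel_iff by blast
  show "urel (w \<circ> k) (w' \<circ> k)" for k using H usame_reindex unfolding urel_iff bs_push by simp
  show "urel (sdeg w) (sdeg w')" using H unfolding urel_iff bs_push by (simp add: sdeg_def)
  show "ord (w n)" for n using H unfolding urel_iff by blast
  fix w'' assume "urel w' w''"
  with H show "urel w w''" using usame_trans unfolding urel_iff by blast
qed

text \<open>The frames of a small type can be composed with isomorphisms between its entries and other
  small types, without any condition of coherence.\<close>

lemma frame_change:
  assumes T: "fr T" and T': "\<And>e. T' e = Fr (Y' e) (frX (T (k e))) (u' e) (v' e)"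
    and Y': "\<And>e. den uu0 (\<lambda>_. Y' e) (RY' e)" "\<And>e. rel (RY' e)" "\<And>e. small (RY' e)"
    and iso: "\<And>e. isoF (F e) (G e) (VX T (k e)) (vx (RY' e) 0)"
    and u': "\<And>e z. fap (u' e) z = F e (fap (frU (T (k e))) z)" and v': "\<And>e z. fap (v' e) z = fap (frV (T (k e))) (G e z)"
  shows "fr T'" "VX T' e = vx (RY' e) 0" "TRW (T' i) (T' j) w = F j (TRW (T (k i)) (T (k j)) (G i w))"
proof -
  obtain Y X u v RX RY where Tx: "\<And>e. T e = Fr (Y e) (X e) (u e) (v e)" and f: "frame X u v RX RY"
    and X: "den uu0 X RX" and Y: "\<And>e. den uu0 (\<lambda>_. Y e) (RY e)" and R: "RF T = frR RX RY v"
    using fr_RF[OF T] unfolding framed_def by blast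
  have gX: "good X RX" using f unfolding frame_def by blast
  have V: "VX T e = vx (RY e) 0" for e using frame.vx_R[OF f, of e] by (simp add: VX_def R)
  let ?RX = "\<lambda>h. RX (k \<circ> h)"
  have trRX: "vx RX e x y \<Longrightarrow> vx RX e y z \<Longrightarrow> vx RX e x z" for e x y z
    unfolding vx_def using rel_trans[OF goodD(1)[OF gX]] by blast
  have trRY: "vx (RY' e) 0 x y \<Longrightarrow> vx (RY' e) 0 y z \<Longrightarrow> vx (RY' e) 0 x z" for e x y z
    unfolding vx_def using rel_trans[OF Y'(2)] by blast
  have "isoF (fap (u' e)) (fap (v' e)) (vx ?RX e) (vx (RY' e) 0)" for e
  proof -
    have "isoF (fap (u (k e))) (fap (v (k e))) (vx RX (k e)) (VX T (k e))"
      using f unfolding frame_def V by blast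
    from isoF_comp[OF this iso trRX trRY] show ?thesis
      using u'[of e] v'[of e] by (simp add: vx_reindex Tx fun_eq_iff isoF_def)
  qed
  then have f': "frame (X \<circ> k) u' v' ?RX RY'"
    using f Y' den0_const[OF Y'(1)] unfolding frame_def by (simp add: good_reindex small_reindex)
  have R': "framed T' (frR ?RX RY' v')"
    unfolding framed_def using T' Y'(1) den0_reindex[OF X, of k] f'
    by (intro exI[of _ Y'] exI[of _ "X \<circ> k"] exI[of _ u'] exI[of _ v'] exI[of _ ?RX] exI[of _ RY']) (simp add: Tx)
  then show "fr T'" unfolding fr_def by blast
  show "VX T' e = vx (RY' e) 0" using frame.vx_R[OF f', of e] RF[OF R'] by (simp add: VX_def)
  have "TRW (Fr Y X u v) (Fr Y' X' u' v') z = fap u' (TRW X X' (fap v z))" for Y X u v Y' X' u' v' z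
    by (rule dom_eqI) (simp_all add: TR_simps)
  then show "TRW (T' i) (T' j) w = F j (TRW (T (k i)) (T (k j)) (G i w))"
    unfolding T' by (simp add: u' v') (simp add: Tx)
qed

lemma TRW_univ: "TRW UnivC UnivC z = z"
  by (rule dom_eqI) (simp_all add: TR_simps)

lemma CMW_univ:
  fixes a b P defines "p \<equiv> p1 P" and "s \<equiv> p1 a" and "t \<equiv> p1 b"
  shows "p1 (CMW UnivC UnivC a b P) = Fr (frY t) (frX p)
        (lam (\<lambda>z. TR s t (fap (frU p) z))) (lam (\<lambda>z. app (frV p) (TRW t s z)))"
    "fap (lam (\<lambda>z. TR s t (fap (frU p) z))) x = TRW s t (fap (frU p) x)"
    "fap (lam (\<lambda>z. app (frV p) (TRW t s z))) x = fap (frV p) (TRW t s x)"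
proof -
  have c: "cont (\<lambda>z. TR s t (fap u z))" "cont (\<lambda>z. app u (TRW t s z))" for u
    by (intro cont_TR cont_intros cont_W)+
  show "p1 (CMW UnivC UnivC a b P) = Fr (frY t) (frX p)
        (lam (\<lambda>z. TR s t (fap (frU p) z))) (lam (\<lambda>z. app (frV p) (TRW t s z)))"
    by (simp add: CM_simps p_def s_def t_def)
  show "fap (lam (\<lambda>z. TR s t (fap (frU p) z))) x = TRW s t (fap (frU p) x)"
    "fap (lam (\<lambda>z. app (frV p) (TRW t s z))) x = fap (frV p) (TRW t s x)"
    by (rule dom_eqI; simp add: beta c)+
qed

text \<open>The hypotheses give agreement within the first half and on each single edge, which is
  what \<open>usame_jn\<close> asks for.\<close>

lemma uniq_univ: "uniq (\<lambda>h. urel)"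
  unfolding uniq_def
proof (intro allI impI)
  fix x y x' y'
  assume H: "urel (jn x y) (jn x y)" "urel (jn x' y') (jn x' y')" "urel x x'"
    "\<forall>n::nat. urel (jn (\<lambda>_. x n) (\<lambda>_. y n)) (jn (\<lambda>_. x' n) (\<lambda>_. y' n))"
  let ?T = "bs (jn x y)" and ?T' = "bs (jn x' y')"
  have T: "fr ?T" "fr ?T'" using H(1,2) by (auto simp: urel_def)
  have 0: "usame (?T \<circ> (*) 2) (?T' \<circ> (*) 2)" using H(3) by (simp add: urel_iff bs_push)
  have e: "usame (?T \<circ> jn (\<lambda>_. 2 * n) (\<lambda>_. Suc (2 * n))) (?T' \<circ> jn (\<lambda>_. 2 * n) (\<lambda>_. Suc (2 * n)))" for n
    using H(4)[rule_format, of n] by (simp add: urel_iff bs_push jn_o)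
  have a0: "agr ?T ?T' (2 * n) (2 * m)" "VX ?T (2 * n) = VX ?T' (2 * n)" for n m
  proof -
    have V: "VX (?T \<circ> (*) 2) = (\<lambda>e. VX ?T (2 * e))" "VX (?T' \<circ> (*) 2) = (\<lambda>e. VX ?T' (2 * e))"
      using fr_reindex(3)[OF T(1), of "(*) 2"] fr_reindex(3)[OF T(2), of "(*) 2"] by auto
    have "agr (?T \<circ> (*) 2) (?T' \<circ> (*) 2) n m" "VX (?T \<circ> (*) 2) n = VX (?T' \<circ> (*) 2) n"
      using 0 unfolding usame_def by blast+
    then show "agr ?T ?T' (2 * n) (2 * m)" "VX ?T (2 * n) = VX ?T' (2 * n)"
      unfolding agr_def V o_apply by blast+
  qed
  have ae: "agr ?T ?T' (2 * n) (Suc (2 * n))" "agr ?T ?T' (Suc (2 * n)) (2 * n)" "VX ?T (Suc (2 * n)) = VX ?T' (Suc (2 * n))" for n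
  proof -
    let ?j = "jn (\<lambda>_. 2 * n) (\<lambda>_. Suc (2 * n)) :: nat \<Rightarrow> nat"
    have j: "?j 0 = 2 * n" "?j (Suc 0) = Suc (2 * n)" by (simp_all add: jn_def)
    have V: "VX (?T \<circ> ?j) = (\<lambda>e. VX ?T (?j e))" "VX (?T' \<circ> ?j) = (\<lambda>e. VX ?T' (?j e))" using T by (auto simp: fr_reindex)
    have "agr (?T \<circ> ?j) (?T' \<circ> ?j) 0 (Suc 0)" "agr (?T \<circ> ?j) (?T' \<circ> ?j) (Suc 0) 0" "VX (?T \<circ> ?j) (Suc 0) = VX (?T' \<circ> ?j) (Suc 0)"
      using e[of n] unfolding usame_def by blast+
    then show "agr ?T ?T' (2 * n) (Suc (2 * n))" "agr ?T ?T' (Suc (2 * n)) (2 * n)" "VX ?T (Suc (2 * n)) = VX ?T' (Suc (2 * n))"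
      unfolding agr_def V o_apply j by blast+
  qed
  have "VX ?T e = VX ?T' e" for e
    using a0(2)[of "e div 2"] ae(3)[of "e div 2"] by (cases "even e") auto
  then have "usame ?T ?T'" by (rule usame_jn[OF T _ a0(1) ae(1,2)])
  then show "urel (jn x y) (jn x' y')" using H(1,2) by (simp add: urel_iff)
qed

lemma dup_urel: "urel x x' \<Longrightarrow> urel (jn x x) (jn x' x')"
  by (rule rel_reI[OF rel_univ, of _ _ _ _ "\<lambda>n. n div 2"]) (auto simp: jn_def)

text \<open>The composite has the elements of \<open>b\<close>, and its frame is that of
  \<open>P\<close> followed by the transport from \<open>a n\<close> to \<open>b n\<close>. These
  transports exist for each \<open>n\<close> but need not be compatible for different
  \<open>n\<close>, since \<open>a\<close> and \<open>b\<close> form cliques along \<open>Q\<close>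
  only. Frames tolerate this.\<close>

lemma cmpok_univ: "cmpok (\<lambda>_. UnivC) (\<lambda>h. urel)"
  unfolding cmpok_def
proof (intro allI impI)
  fix f g Q a b P assume H: "cmp_hyp (\<lambda>h. urel) f g Q a b P"
  define q where "q = sCM (\<lambda>_. UnivC) f g a b P"
  let ?Z = "jn P q"
  have P: "urel P P" and Qc: "\<And>n. (\<lambda>_. n) \<in> Q" 
    and ab: "\<And>r. r \<in> Q \<Longrightarrow> urel (jn (a \<circ> r) (b \<circ> r)) (jn (a \<circ> r) (b \<circ> r))" "\<And>r. r \<in> Q \<Longrightarrow> urel (a \<circ> r) (P \<circ> r)"
    using H unfolding cmp_hyp_def by blast+
  have o: "ord (a n)" "ord (b n)" "ord (P n)" for n using cmp_hyp_ord[OF rel_univ, OF H] by auto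
  have oZ: "ord (?Z n)" for n using o by (auto simp: jn_def q_def sCM_def ord_W)
  have frP: "fr (bs P)" using P by (simp add: urel_def)
  have edge: "fr (jn (\<lambda>_. p1 (a n)) (\<lambda>_. p1 (b n)))" for n
    using ab(1)[OF Qc[of n]] by (simp add: urel_def bs_push) (simp add: bs_def)
  \<comment> \<open>The single edge from \<open>a n\<close> to \<open>b n\<close>, doubled up as a
    clique; it is available because the constant reindexings lie in \<open>Q\<close>.\<close>
  let ?E = "\<lambda>n. jn (\<lambda>_. p1 (a n)) (\<lambda>_. p1 (b n)) :: sq"
  have E: "?E n 0 = p1 (a n)" "?E n (Suc 0) = p1 (b n)" for n by (simp_all add: jn_def)
  have aP: "VX (?E n) 0 = VX (bs P) n" for n
  proof -
    have "usame (bs (a \<circ> (\<lambda>_. n))) (bs (P \<circ> (\<lambda>_. n)))" using ab(2)[OF Qc[of n]] by (simp add: urel_iff)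
    then have "VX (bs (a \<circ> (\<lambda>_. n))) 0 = VX (bs P) n" 
      using fr_reindex(3)[OF frP, of "\<lambda>_. n" 0] by (simp add: usame_def bs_push)
    moreover have "bs (a \<circ> (\<lambda>_. n)) = ?E n \<circ> (*) 2" by (simp add: bs_def)
    ultimately show ?thesis using fr_reindex(3)[OF edge[of n], of "(*) 2" 0] by simp
  qed
  have "\<exists>RY. den uu0 (\<lambda>_. frY (p1 (b n))) RY \<and> rel RY \<and> small RY \<and> VX (?E n) (Suc 0) = vx RY 0" for n
    using frD(4)[OF edge[of n], of "Suc 0"] by (simp add: VX_def E)
  then obtain RB where RB: "\<And>n. den uu0 (\<lambda>_. frY (p1 (b n))) (RB n)" "\<And>n. rel (RB n)" "\<And>n. small (RB n)"
    "\<And>n. VX (?E n) (Suc 0) = vx (RB n) 0" by metis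
  have "\<exists>RY. den uu0 (\<lambda>_. frY (bs P n)) RY \<and> rel RY \<and> small RY \<and> VX (bs P) n = vx RY 0" for n
    using frD(4)[OF frP, of n] by (simp add: VX_def)
  then obtain RP where RP: "\<And>n. den uu0 (\<lambda>_. frY (bs P n)) (RP n)" "\<And>n. rel (RP n)" "\<And>n. small (RP n)"
    "\<And>n. VX (bs P) n = vx (RP n) 0" by metis
  let ?TAB = "\<lambda>n. TRW (p1 (a n)) (p1 (b n))" and ?TBA = "\<lambda>n. TRW (p1 (b n)) (p1 (a n))"
  let ?u = "\<lambda>n. lam (\<lambda>z. TR (p1 (a n)) (p1 (b n)) (fap (frU (p1 (P n))) z))"
  let ?v = "\<lambda>n. lam (\<lambda>z. app (frV (p1 (P n))) (TRW (p1 (b n)) (p1 (a n)) z))"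
  let ?F = "jn (\<lambda>n x. x) ?TAB" and ?G = "jn (\<lambda>n x. x) ?TBA"
  have jn2: "(\<And>n. Pr (2 * n)) \<Longrightarrow> (\<And>n. Pr (Suc (2 * n))) \<Longrightarrow> Pr n" for Pr :: "nat \<Rightarrow> bool" and n
    by (cases "even n") (auto elim!: evenE oddE)
  have d: "(2 * n) div 2 = n" "Suc (2 * n) div 2 = n" for n :: nat by simp_all
  have Tq: "p1 (q n) = Fr (frY (p1 (b n))) (frX (p1 (P n))) (?u n) (?v n)" for n
    unfolding q_def sCM_def CMW_univ(1) ..
  have TZ: "bs ?Z e = Fr (jn (\<lambda>n. frY (bs P n)) (\<lambda>n. frY (p1 (b n))) e) (frX (bs P (e div 2))) (jn (\<lambda>n. frU (bs P n)) ?u e) (jn (\<lambda>n. frV (bs P n)) ?v e)" for e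
  proof (rule jn2[of _ e])
    fix n
    have "\<exists>Y X u v. bs P n = Fr Y X u v" using fr_RF[OF frP] unfolding framed_def by blast
    then have "bs P n = Fr (frY (bs P n)) (frX (bs P n)) (frU (bs P n)) (frV (bs P n))" by (elim exE) (simp only: frame_simps)
    then show "bs ?Z (2 * n) = Fr (jn (\<lambda>n. frY (bs P n)) (\<lambda>n. frY (p1 (b n))) (2 * n)) (frX (bs P (2 * n div 2))) (jn (\<lambda>n. frU (bs P n)) ?u (2 * n)) (jn (\<lambda>n. frV (bs P n)) ?v (2 * n))"
      unfolding bs_push jn_simps d .
    show "bs ?Z (Suc (2 * n)) = Fr (jn (\<lambda>n. frY (bs P n)) (\<lambda>n. frY (p1 (b n))) (Suc (2 * n))) (frX (bs P (Suc (2 * n) div 2))) (jn (\<lambda>n. frU (bs P n)) ?u (Suc (2 * n))) (jn (\<lambda>n. frV (bs P n)) ?v (Suc (2 * n)))"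
      unfolding bs_push jn_simps d by (simp add: bs_def Tq)
  qed
  have iso: "isoF (?F e) (?G e) (VX (bs P) (e div 2)) (vx (jn RP RB e) 0)" for e
  proof (rule jn2[of _ e])
    fix n
    show "isoF (?F (2 * n)) (?G (2 * n)) (VX (bs P) (2 * n div 2)) (vx (jn RP RB (2 * n)) 0)"
      unfolding d jn_simps RP(4)[symmetric] by (simp add: isoF_def)
    show "isoF (?F (Suc (2 * n))) (?G (Suc (2 * n))) (VX (bs P) (Suc (2 * n) div 2)) (vx (jn RP RB (Suc (2 * n))) 0)"
      using iso_tr[OF edge[of n], of 0 "Suc 0"] unfolding d jn_simps RB(4)[symmetric] aP[symmetric] E .
  qed
  have uf: "fap (jn (\<lambda>n. frU (bs P n)) ?u e) z = ?F e (fap (frU (bs P (e div 2))) z)" for e z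
    by (rule jn2[of _ e]) (simp_all only: jn_simps d, simp add: bs_def CMW_univ(2))
  have vf: "fap (jn (\<lambda>n. frV (bs P n)) ?v e) z = fap (frV (bs P (e div 2))) (?G e z)" for e z
    by (rule jn2[of _ e]) (simp_all only: jn_simps d, simp add: bs_def CMW_univ(3))
  have den: "den uu0 (\<lambda>_. jn (\<lambda>n. frY (bs P n)) (\<lambda>n. frY (p1 (b n))) e) (jn RP RB e)" "rel (jn RP RB e)" "small (jn RP RB e)" for e
    using RP RB by (auto simp: jn_def)
  \<comment> \<open>Halving the index lets \<open>P n\<close> and its composite share the inner type
    of \<open>P n\<close>, with the identity as change of frame for the first and the transport
    along the edge for the second.\<close>
  note Z = frame_change[where k = "\<lambda>e. e div 2", OF frP TZ den iso uf vf]
  have VZ: "VX (bs ?Z) (2 * n) = VX (bs P) n" "VX (bs ?Z) (Suc (2 * n)) = VX (?E n) (Suc 0)" for n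
    unfolding Z(2) jn_simps RP(4) RB(4) by auto
  have frZ: "fr (bs ?Z)" by (rule Z(1))
  have 1: "urel ?Z ?Z" using usame_refl[OF frZ] oZ by (simp add: urel_iff)
  have "urel (jn (P \<circ> r) (q \<circ> r)) (jn (a \<circ> r) (b \<circ> r))" if r: "r \<in> Q" for r
  proof -
    let ?j = "jn (\<lambda>n. 2 * r n) (\<lambda>n. Suc (2 * r n)) :: nat \<Rightarrow> nat"
    have jj: "jn x y \<circ> ?j = jn (x \<circ> r) (y \<circ> r)" for x y :: sq
      unfolding jn_o by (rule arg_cong2[of _ _ _ _ jn]) (simp_all add: fun_eq_iff)
    let ?A = "bs (jn (a \<circ> r) (b \<circ> r))" and ?B = "bs ?Z \<circ> ?j"
    have B: "?B = bs (jn (P \<circ> r) (q \<circ> r))" unfolding bs_push jj ..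
    have frA: "fr ?A" using ab(1)[OF r] by (simp add: urel_def)
    have frB: "fr ?B" using fr_reindex(1)[OF frZ] .
    have VB: "VX ?B (2 * n) = VX (bs P) (r n)" "VX ?B (Suc (2 * n)) = VX (?E (r n)) (Suc 0)" for n
      unfolding fr_reindex(3)[OF frZ] jn_simps VZ by auto
    have AE: "?A \<circ> jn (\<lambda>_. 2 * n) (\<lambda>_. Suc (2 * n)) = ?E (r n)" for n
      by (simp add: bs_push jn_o) (simp add: bs_def)
    have VA: "VX ?A (2 * n) = VX (?E (r n)) 0" "VX ?A (Suc (2 * n)) = VX (?E (r n)) (Suc 0)" for n
      using fr_reindex(3)[OF frA, of "jn (\<lambda>_. 2 * n) (\<lambda>_. Suc (2 * n))"] unfolding AE by (simp_all add: jn_def)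
    have V: "VX ?B e = VX ?A e" for e
      by (rule jn2[of _ e]) (simp_all only: VA VB aP)
    have us: "usame (bs a \<circ> r) (bs P \<circ> r)" using ab(2)[OF r] by (simp add: urel_iff bs_push)
    have Ai: "?A (2 * n) = p1 (a (r n))" "?A (Suc (2 * n)) = p1 (b (r n))" for n by (simp_all add: bs_def)
    have Bt: "TRW (?B i) (?B j) w = ?F (?j j) (TRW (bs P (?j i div 2)) (bs P (?j j div 2)) (?G (?j i) w))" for i j w
      using Z(3) by simp
    have "usame ?B ?A"
    proof (rule usame_jn[OF frB frA V])
      fix n m
      have "agr (bs P \<circ> r) (bs a \<circ> r) n m" using usame_sym[OF us] by (auto simp: usame_def)
      then show "agr ?B ?A (2 * n) (2 * m)"
        unfolding agr_def VB Bt Ai fr_reindex(3)[OF frP] unfolding jn_simps d by (simp add: bs_def)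
      have p: "VX (bs P) (r n) x x \<Longrightarrow> VX (bs P) (r n) (TRW (bs P (r n)) (bs P (r n)) x) x" for x
        by (rule tr_id[OF frP])
      show "agr ?B ?A (2 * n) (Suc (2 * n))"
        unfolding agr_def VB Bt Ai fr_reindex(3)[OF frP] unfolding jn_simps d
        using isoFD(1)[OF iso_tr[OF edge[of "r n"], of 0 "Suc 0"], unfolded aP E] p by blast
      show "agr ?B ?A (Suc (2 * n)) (2 * n)"
        unfolding agr_def VB Bt Ai fr_reindex(3)[OF frP] unfolding jn_simps d
        using isoFD(2)[OF iso_tr[OF edge[of "r n"], of 0 "Suc 0"], unfolded aP E] p by blast
    qed
    then show ?thesis
      using o oZ unfolding urel_iff B
      by (auto simp: jn_def q_def sCM_def ord_W)
  qed
  with 1 show "urel (jn P (sCM (\<lambda>_. UnivC) f g a b P)) (jn P (sCM (\<lambda>_. UnivC) f g a b P)) \<and>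
    (\<forall>r\<in>Q. urel (jn (P \<circ> r) (sCM (\<lambda>_. UnivC) f g a b P \<circ> r)) (jn (a \<circ> r) (b \<circ> r)))"
    unfolding q_def by blast
qed

lemma good_univ: "good (\<lambda>_. UnivC) (\<lambda>h. urel)"
proof -
  have t: "sTR (\<lambda>_. UnivC) f g x = x" for f g x by (simp add: sTR_def TRW_univ)
  have "trok (\<lambda>_. UnivC) (\<lambda>_. UnivC) (\<lambda>h. urel)" "trid (\<lambda>_. UnivC) (\<lambda>h. urel)"
    unfolding trok_def trid_def t using dup_urel by blast+
  then show ?thesis using rel_univ cmpok_univ uniq_univ by (simp add: good_def)
qed

section \<open>Equality of types\<close>

definition uu1 :: "sq \<Rightarrow> krel \<Rightarrow> bool" where "uu1 T R \<longleftrightarrow> (\<forall>e. T e = UnivC) \<and> R = (\<lambda>h. urel)"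
text \<open>Large types are those of \<open>uni False\<close>; \<open>uni True\<close> has no universe and gives the small types.\<close>

definition uni :: "bool \<Rightarrow> sq \<Rightarrow> krel \<Rightarrow> bool" where "uni s = (if s then uu0 else uu1)"

lemma den_uni_det: "den (uni s) T R \<Longrightarrow> den (uni s) T R' \<Longrightarrow> R = R'"
  by (erule (1) den_det) (auto simp: uni_def uu0_def uu1_def split: if_splits)
lemma den_uni_reindex: "den (uni s) T R \<Longrightarrow> den (uni s) (T \<circ> h) (\<lambda>k. R (h \<circ> k))"
  by (erule den_reindex) (auto simp: uni_def uu0_def uu1_def split: if_splits)
lemma den_uni_mono: "den (uni s) T R \<Longrightarrow> den (uni False) T R"
  by (erule den_mono) (auto simp: uni_def uu0_def split: if_splits)

text \<open>Equality of types: one common relation, and transports that agree. The flag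
  \<open>s\<close> adds the properties of small types.\<close>

definition teq :: "bool \<Rightarrow> sq \<Rightarrow> sq \<Rightarrow> krel \<Rightarrow> bool" where
  "teq s T T' R \<longleftrightarrow> den (uni s) T R \<and> den (uni s) T' R \<and> good T R \<and> good T' R \<and> trok T T' R \<and> (s \<longrightarrow> small R)"

definition tyeq :: "bool \<Rightarrow> sq \<Rightarrow> sq \<Rightarrow> bool" where "tyeq s T T' \<longleftrightarrow> (\<exists>R. teq s T T' R)"

definition RR :: "sq \<Rightarrow> krel" where "RR T = (THE R. den (uni False) T R)"

lemma RR: "den (uni s) T R \<Longrightarrow> RR T = R"
proof -
  assume H: "den (uni s) T R"
  show "RR T = R" unfolding RR_def
    by (rule the_equality, rule den_uni_mono[OF H], rule den_uni_det[OF _ den_uni_mono[OF H]])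
qed

lemma teq_RR: "teq s T T' R \<Longrightarrow> RR T = R" "teq s T T' R \<Longrightarrow> RR T' = R"
  unfolding teq_def using RR[of s T R] RR[of s T' R] by blast+

lemma tyeq_teq: assumes "tyeq s T T'" shows "teq s T T' (RR T)"
proof -
  obtain R where "teq s T T' R" using assms unfolding tyeq_def by blast
  with teq_RR(1)[OF this] show ?thesis by simp
qed

lemma trok_sym: "rel R \<Longrightarrow> trok T T' R \<Longrightarrow> trok T' T R"
  unfolding trok_def using rel_sym[of R] by metis
lemma trok_trans:
  assumes "rel R" "trok T T' R" "trok T' T'' R" shows "trok T T'' R"
  unfolding trok_def
proof (intro allI impI)
  fix f g x x' assume H: "R f x x'"
  show "R (jn f g) (jn x (sTR T f g x)) (jn x' (sTR T'' f g x'))"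
    using rel_trans[OF assms(1), OF trokD[OF assms(2), OF rel_refl(1)[OF assms(1), OF H]] trokD[OF assms(3), OF H]] .
qed

lemma teq_sym: "teq s T T' R \<Longrightarrow> teq s T' T R"
  unfolding teq_def using trok_sym goodD(1) by blast
lemma teq_trans: "teq s T T' R \<Longrightarrow> teq s T' T'' R' \<Longrightarrow> teq s T T'' R"
  unfolding teq_def using trok_trans goodD(1) den_uni_det by metis
lemma tyeq_sym: "tyeq s T T' \<Longrightarrow> tyeq s T' T" unfolding tyeq_def using teq_sym by blast
lemma tyeq_trans: "tyeq s T T' \<Longrightarrow> tyeq s T' T'' \<Longrightarrow> tyeq s T T''" unfolding tyeq_def using teq_trans by blast
lemma tyeq_refl: "tyeq s T T' \<Longrightarrow> tyeq s T T" "tyeq s T T' \<Longrightarrow> tyeq s T' T'" using tyeq_sym tyeq_trans by blast+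
lemma tyeq_mono: "tyeq s T T' \<Longrightarrow> tyeq False T T'" unfolding tyeq_def teq_def using den_uni_mono by blast

lemma tyeqD:
  assumes "tyeq s T T'"
  shows "den (uni s) T (RR T)" "den (uni s) T' (RR T)" "good T (RR T)" "good T' (RR T)" "trok T T' (RR T)" "s \<Longrightarrow> small (RR T)"
    "RR T' = RR T" "rel (RR T)"
  using tyeq_teq[OF assms] teq_RR(2)[OF tyeq_teq[OF assms]] goodD(1) unfolding teq_def by auto

lemma RR_reindex: "tyeq s T T' \<Longrightarrow> RR (T \<circ> k) = (\<lambda>h. RR T (k \<circ> h))"
  using RR[OF den_uni_reindex[OF tyeqD(1)]] .

lemma trok_reindex: "trok T T' R \<Longrightarrow> trok (T \<circ> k) (T' \<circ> k) (\<lambda>h. R (k \<circ> h))"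
proof -
  have s: "sTR (T \<circ> k) f g x = sTR T (k \<circ> f) (k \<circ> g) x" for f g x T by (simp add: sTR_def)
  show "trok T T' R \<Longrightarrow> trok (T \<circ> k) (T' \<circ> k) (\<lambda>h. R (k \<circ> h))" unfolding trok_def s jn_o by blast
qed

lemma tyeq_reindex: "tyeq s T T' \<Longrightarrow> tyeq s (T \<circ> k) (T' \<circ> k)"
  unfolding tyeq_def teq_def using den_uni_reindex good_reindex trok_reindex small_reindex by metis

text \<open>Elements of a type are the cliques over the identity reindexing.\<close>

definition M :: "sq \<Rightarrow> sq \<Rightarrow> sq \<Rightarrow> bool" where "M T w w' \<longleftrightarrow> RR T (\<lambda>n. n) w w'"

lemma M_sym: "tyeq s T T' \<Longrightarrow> M T w w' \<Longrightarrow> M T w' w"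
  unfolding M_def using rel_sym[OF tyeqD(8)] by blast
lemma M_trans: "tyeq s T T' \<Longrightarrow> M T w w' \<Longrightarrow> M T w' w'' \<Longrightarrow> M T w w''"
  unfolding M_def using rel_trans[OF tyeqD(8)] by blast
lemma M_refl: "tyeq s T T' \<Longrightarrow> M T w w' \<Longrightarrow> M T w w" "tyeq s T T' \<Longrightarrow> M T w w' \<Longrightarrow> M T w' w'"
  using M_sym M_trans by blast+
lemma M_conv: "tyeq s T T' \<Longrightarrow> M T' w w' = M T w w'"
  unfolding M_def using tyeqD(7) by simp
lemma M_re: "tyeq s T T' \<Longrightarrow> M (T \<circ> k) w w' = RR T k w w'"
  unfolding M_def RR_reindex by simp
lemma M_reindex: "tyeq s T T' \<Longrightarrow> M T w w' \<Longrightarrow> M (T \<circ> k) (w \<circ> k) (w' \<circ> k)"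
  unfolding M_re unfolding M_def using rel_re[OF tyeqD(8), of s T T' "\<lambda>n. n" w w' k] by simp
lemma M_deg: "tyeq s T T' \<Longrightarrow> M T w w' \<Longrightarrow> M T (sdeg w) (sdeg w')"
  unfolding M_def using rel_deg[OF tyeqD(8)] by blast
lemma M_ord: "tyeq s T T' \<Longrightarrow> M T w w' \<Longrightarrow> ord (w n) \<and> ord (w' n)"
  unfolding M_def using rel_ord[OF tyeqD(8)] by blast

section \<open>Type formers\<close>

definition wr :: "sq \<Rightarrow> sq" where "wr c = (\<lambda>e. wrap (c e))"

lemma fap_idD [simp]: "fap idD z = z" "app idD z = p2 z"
proof -
  show *: "app idD z = p2 z" for z unfolding idD_def by (rule beta) (intro cont_intros)
  show "fap idD z = z" by (rule dom_eqI) (simp_all add: *)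
qed

text \<open>The trivial frame does not alter transport and composition, so wrapped and raw codes are
  interchangeable.\<close>

lemma s_wr: "sTR (wr c) f g x = sTR c f g x" "sCM (wr c) f g a b P = sCM c f g a b P"
proof -
  have "TRW (wrap a) (wrap b) z = TRW a b z" "CMW (wrap a) (wrap b) x y z = CMW a b x y z" for a b x y z
    by (rule dom_eqI; simp add: wrap_def TR_simps CM_simps)+
  then show "sTR (wr c) f g x = sTR c f g x" "sCM (wr c) f g a b P = sCM c f g a b P"
    by (simp_all add: sTR_def sCM_def wr_def)
qed

lemma den_wr:
  assumes "den (uni s) c R" "rel R" shows "den (uni s) (wr c) R"
proof -
  have "den (uni s) (\<lambda>_. c e) (\<lambda>k. R (\<lambda>_. e))" for e
    using den_uni_reindex[OF assms(1), of "\<lambda>_. e"] by (simp add: o_def)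
  from den_Fr[where T = "wr c" and u = "\<lambda>_. idD" and v = "\<lambda>_. idD", OF _ assms(1) this]
  have "den (uni s) (wr c) (frR R (\<lambda>e k. R (\<lambda>_. e)) (\<lambda>_. idD))" by (simp add: wr_def wrap_def)
  moreover have "frR R (\<lambda>e k. R (\<lambda>_. e)) (\<lambda>_. idD) = R"
  proof (intro ext)
    fix h w w'
    show "frR R (\<lambda>e k. R (\<lambda>_. e)) (\<lambda>_. idD) h w w' = R h w w'"
      unfolding frR_def using rel_re[OF assms(2), of h w w' "\<lambda>_. _"] by auto
  qed
  ultimately show ?thesis by simp
qed

lemma teq_wr: "teq s c c' R \<Longrightarrow> teq s (wr c) (wr c') R"
proof -
  have "good (wr c) R = good c R" "trok (wr c) (wr c') R = trok c c' R" for c c'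
    by (simp_all only: good_def trok_def trid_def cmpok_def s_wr)
  then show "teq s c c' R \<Longrightarrow> teq s (wr c) (wr c') R" 
    unfolding teq_def using den_wr[of s c R] den_wr[of s c' R] goodD(1)[of c R] by simp
qed

text \<open>A small type framed by the identity is a member of the universe: it is its own inner
  type, and entries of a clique are elements of the single codes.\<close>

lemma framed_wr: assumes "teq True c c' R" shows "framed (wr c) R"
proof -
  have c: "den uu0 c R" "good c R" "small R" using assms by (auto simp: teq_def uni_def)
  have f: "frR R (\<lambda>e k. R (\<lambda>_. e)) (\<lambda>_. idD) = R"
  proof (intro ext)
    fix h w w'
    show "frR R (\<lambda>e k. R (\<lambda>_. e)) (\<lambda>_. idD) h w w' = R h w w'"
      unfolding frR_def using rel_re[OF goodD(1)[OF c(2)], of h w w' "\<lambda>_. _"] by auto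
  qed
  have e: "(\<lambda>h. R ((\<lambda>_. e) \<circ> h)) = (\<lambda>k. R (\<lambda>_. e))" for e :: nat by (simp add: o_def)
  have 1: "den uu0 (\<lambda>_. c e) (\<lambda>k. R (\<lambda>_. e))" for e
    using den0_reindex[OF c(1), of "\<lambda>_. e"] by (simp add: o_def)
  have "frame c (\<lambda>_. idD) (\<lambda>_. idD) R (\<lambda>e k. R (\<lambda>_. e))"
    unfolding frame_def isoF_def vx_def using c small_reindex[OF c(3), of "\<lambda>_. _"] rel_reindex[OF goodD(1)[OF c(2)], of "\<lambda>_. _"]
    by (simp add: e)
  then show ?thesis unfolding framed_def using 1 c f
    by (intro exI[of _ c] exI[of _ "\<lambda>_. idD"] exI[of _ R] exI[of _ "\<lambda>e k. R (\<lambda>_. e)"]) (simp add: wr_def wrap_def)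
qed

lemma usame_wr: assumes "teq True c c' R" shows "usame (wr c) (wr c')"
  using framed_wr[OF assms] framed_wr[OF teq_sym[OF assms]] RF teq_wr[OF assms]
  unfolding usame_iff fr_def teq_def by metis

text \<open>Equality in the universe contains the common relation, the agreement of transports and
  smallness, so it yields equality of types.\<close>

lemma usame_tyeq: assumes "usame T T'" shows "tyeq True T T'"
proof -
  have H: "fr T" "fr T'" "RF T' = RF T" "trok T T' (RF T)" using assms unfolding usame_iff by auto
  have "teq True T T' (RF T)"
    using frD(1-3)[OF H(1)] frD(1-3)[OF H(2)] H(4) unfolding H(3) teq_def uni_def by simp
  then show ?thesis unfolding tyeq_def by blast
qed

lemma family_of:
  assumes A: "tyeq s A A'" and B: "\<And>k w w'. RR A k w w' \<Longrightarrow> tyeq s (fib B k w) (fib B' k w')"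
  shows "family A B (RR A) (\<lambda>k w. RR (fib B k w))"
    "\<And>k w w'. RR A k w w' \<Longrightarrow> tyeq s (fib B k w) (fib B k w')"
proof -
  note rA = tyeqD(8)[OF A]
  show BB: "tyeq s (fib B k w) (fib B k w')" if H: "RR A k w w'" for k w w'
  proof -
    have 1: "tyeq s (fib B k w) (fib B' k w)" by (rule B, rule rel_refl(1)[OF rA, OF H])
    have 2: "tyeq s (fib B k w') (fib B' k w)" by (rule B, rule rel_sym[OF rA, OF H])
    from tyeq_trans[OF 1 tyeq_sym[OF 2]] show ?thesis .
  qed
  show "family A B (RR A) (\<lambda>k w. RR (fib B k w))"
  proof
    show "good A (RR A)" using tyeqD(3)[OF A] .
    show "good (fib B k w) (RR (fib B k w))" if "RR A k w w'" for k w w' using tyeqD(3)[OF B[OF that]] .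
    show "trok (fib B k w) (fib B k w') (RR (fib B k w))" if "RR A k w w'" for k w w' using tyeqD(5)[OF BB[OF that]] .
    show "RR (fib B k w) = RR (fib B k w')" if "RR A k w w'" for k w w' using tyeqD(7)[OF BB[OF that]] by simp
    show "RR (fib B (k \<circ> j) (w \<circ> j)) = (\<lambda>l. RR (fib B k w) (j \<circ> l))" if "RR A k w w" for k w j
      using RR_reindex[OF BB[OF that], of j] by (simp add: fib_o)
    show "RR (fib B k (sdeg w)) = RR (fib B k w)" for k w by simp
  qed
qed

text \<open>The second of two equal families is a family over the relations of the first, so that
  both can be interpreted by one relation.\<close>

lemma family_of2:
  assumes A: "tyeq s A A'" and B: "\<And>k w w'. RR A k w w' \<Longrightarrow> tyeq s (fib B k w) (fib B' k w')"
  shows "family A' B' (RR A) (\<lambda>k w. RR (fib B k w))"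
proof -
  note rA = tyeqD(8)[OF A]
  have "family A' B' (RR A') (\<lambda>k w. RR (fib B' k w))"
  proof (rule family_of(1)[OF tyeq_sym[OF A]])
    fix k w w' assume "RR A' k w w'"
    then have "RR A k w w'" by (simp add: tyeqD(7)[OF A])
    from tyeq_sym[OF B[OF rel_sym[OF rA, OF this]]] show "tyeq s (fib B' k w) (fib B k w')" .
  qed
  then have f: "family A' B' (RR A) (\<lambda>k w. RR (fib B' k w))" by (simp add: tyeqD(7)[OF A])
  have e: "RR (fib B' k w) = RR (fib B k w)" if H: "RR A k w w'" for k w w'
    using tyeqD(7)[OF B[OF rel_refl(1)[OF rA, OF H]]] .
  have r: "RR A k w w" if "RR A k w w'" for k w w' using rel_refl(1)[OF rA, OF that] .
  have c: "RR A (k \<circ> j) (w \<circ> j) (w \<circ> j)" if "RR A k w w" for k w j using rel_re[OF rA, OF that] .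
  have d: "RR A k (sdeg w) (sdeg w)" if "RR A k w w" for k w using rel_deg[OF rA, OF that] .
  show ?thesis
  proof
    show "good A' (RR A)" using tyeqD(4)[OF A] .
    show "good (fib B' k w) (RR (fib B k w))" if "RR A k w w'" for k w w'
      using family.gB[OF f, OF that] e[OF that] by simp
    show "trok (fib B' k w) (fib B' k w') (RR (fib B k w))" if "RR A k w w'" for k w w' 
      using family.tB[OF f, OF that] e[OF that] by simp
    show "RR (fib B k w) = RR (fib B k w')" if "RR A k w w'" for k w w' 
      using family.eS[OF f, OF that] e[OF that] e[OF rel_sym[OF rA, OF that]] by simp
    show "RR (fib B (k \<circ> j) (w \<circ> j)) = (\<lambda>l. RR (fib B k w) (j \<circ> l))" if "RR A k w w" for k w j
      using family.cS[OF f, OF that, of j] e[OF that] e[OF c[OF that]] by simp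
    show "RR (fib B k (sdeg w)) = RR (fib B k w)" for k w by simp
  qed
qed

lemma teq_pi:
  assumes A: "tyeq s A A'" and B: "\<And>k w w'. RR A k w w' \<Longrightarrow> tyeq s (fib B k w) (fib B' k w')"
  shows "teq s (\<lambda>e. PiC (A e) (B e)) (\<lambda>e. PiC (A' e) (B' e)) (piR (RR A) (\<lambda>k w. RR (fib B k w)))"
proof -
  have f: "family A B (RR A) (\<lambda>k w. RR (fib B k w))" by (rule family_of(1)[OF A B])
  have f': "family A' B' (RR A) (\<lambda>k w. RR (fib B k w))" by (rule family_of2[OF A B])
  show ?thesis unfolding teq_def
  proof (intro conjI impI)
    show "den (uni s) (\<lambda>e. PiC (A e) (B e)) (piR (RR A) (\<lambda>k w. RR (fib B k w)))"
      by (rule den_Pi[OF refl tyeqD(1)[OF A]]) (rule tyeqD(1)[OF B])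
    show "den (uni s) (\<lambda>e. PiC (A' e) (B' e)) (piR (RR A) (\<lambda>k w. RR (fib B k w)))"
      by (rule den_Pi[OF refl tyeqD(2)[OF A]]) (rule tyeqD(2)[OF B, OF rel_refl(1)[OF tyeqD(8)[OF A]]])
    show "good (\<lambda>e. PiC (A e) (B e)) (piR (RR A) (\<lambda>k w. RR (fib B k w)))" by (rule family.good_pi[OF f])
    show "good (\<lambda>e. PiC (A' e) (B' e)) (piR (RR A) (\<lambda>k w. RR (fib B k w)))" by (rule family.good_pi[OF f'])
    show "trok (\<lambda>e. PiC (A e) (B e)) (\<lambda>e. PiC (A' e) (B' e)) (piR (RR A) (\<lambda>k w. RR (fib B k w)))"
      by (rule family.trok_pi[OF f tyeqD(5)[OF A] tyeqD(5)[OF B]])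
    show "small (piR (RR A) (\<lambda>k w. RR (fib B k w)))" if s
      by (rule family.small_pi[OF f]) (rule tyeqD(6)[OF B that])
  qed
qed

lemma teq_sig:
  assumes A: "tyeq s A A'" and B: "\<And>k w w'. RR A k w w' \<Longrightarrow> tyeq s (fib B k w) (fib B' k w')"
  shows "teq s (\<lambda>e. SigC (A e) (B e)) (\<lambda>e. SigC (A' e) (B' e)) (sigR (RR A) (\<lambda>k w. RR (fib B k w)))"
proof -
  have f: "family A B (RR A) (\<lambda>k w. RR (fib B k w))" by (rule family_of(1)[OF A B])
  have f': "family A' B' (RR A) (\<lambda>k w. RR (fib B k w))" by (rule family_of2[OF A B])
  show ?thesis unfolding teq_def
  proof (intro conjI impI)
    show "den (uni s) (\<lambda>e. SigC (A e) (B e)) (sigR (RR A) (\<lambda>k w. RR (fib B k w)))"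
      by (rule den_Sig[OF refl tyeqD(1)[OF A]]) (rule tyeqD(1)[OF B])
    show "den (uni s) (\<lambda>e. SigC (A' e) (B' e)) (sigR (RR A) (\<lambda>k w. RR (fib B k w)))"
      by (rule den_Sig[OF refl tyeqD(2)[OF A]]) (rule tyeqD(2)[OF B, OF rel_refl(1)[OF tyeqD(8)[OF A]]])
    show "good (\<lambda>e. SigC (A e) (B e)) (sigR (RR A) (\<lambda>k w. RR (fib B k w)))" by (rule family.good_sig[OF f])
    show "good (\<lambda>e. SigC (A' e) (B' e)) (sigR (RR A) (\<lambda>k w. RR (fib B k w)))" by (rule family.good_sig[OF f'])
    show "trok (\<lambda>e. SigC (A e) (B e)) (\<lambda>e. SigC (A' e) (B' e)) (sigR (RR A) (\<lambda>k w. RR (fib B k w)))"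
      by (rule family.trok_sig[OF f tyeqD(5)[OF A] tyeqD(5)[OF B]])
    show "small (sigR (RR A) (\<lambda>k w. RR (fib B k w)))" if s
      by (rule family.small_sig[OF f tyeqD(6)[OF A that]]) (rule tyeqD(6)[OF B that])
  qed
qed

lemma teq_plus:
  assumes A: "tyeq s A A'" and B: "tyeq s B B'"
  shows "teq s (\<lambda>e. PlusC (A e) (B e)) (\<lambda>e. PlusC (A' e) (B' e)) (plusR (RR A) (RR B))"
  unfolding teq_def
proof (intro conjI impI)
  show "den (uni s) (\<lambda>e. PlusC (A e) (B e)) (plusR (RR A) (RR B))"
    by (rule den_Plus[OF refl tyeqD(1)[OF A] tyeqD(1)[OF B]])
  show "den (uni s) (\<lambda>e. PlusC (A' e) (B' e)) (plusR (RR A) (RR B))"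
    by (rule den_Plus[OF refl tyeqD(2)[OF A] tyeqD(2)[OF B]])
  show "small (plusR (RR A) (RR B))" if s using small_plus[OF tyeqD(6)[OF A that] tyeqD(6)[OF B that]] .
qed (rule good_plus trok_plus tyeqD(3-5)[OF A] tyeqD(3-5)[OF B])+

lemma teq_eq:
  assumes A: "tyeq s A A'" and a: "M A (\<lambda>e. dbl (a e)) (\<lambda>e. dbl (a' e))" and b: "M A (\<lambda>e. dbl (b e)) (\<lambda>e. dbl (b' e))"
  shows "teq s (\<lambda>e. EqC (A e) (a e) (b e)) (\<lambda>e. EqC (A' e) (a' e) (b' e)) (eqR (RR A) a b)"
proof -
  note c = M_refl[OF A, OF a] M_refl[OF A, OF b] a b
  have i: "idtype A a b (RR A)" "idtype A' a' b' (RR A)"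
    using c tyeqD[OF A] unfolding idtype_def M_def by simp_all
  note t = trok_eq[OF i, OF a[unfolded M_def] b[unfolded M_def]]
  have d: "den (uni s) (\<lambda>e. EqC (A' e) (a' e) (b' e)) (eqR (RR A) a b)"
    using den_Eq[OF refl tyeqD(2)[OF A], of a' b'] unfolding t(1) .
  have g: "good (\<lambda>e. EqC (A' e) (a' e) (b' e)) (eqR (RR A) a b)"
    using good_eq[OF i(2)] unfolding t(1) .
  show ?thesis
    unfolding teq_def using d g t(2) den_Eq[OF refl tyeqD(1)[OF A], of a b] good_eq[OF i(1)] small_eq[OF i(1)] tyeqD(6)[OF A]
    by blast
qed

lemma teq_ground:
  "teq s (\<lambda>_. OneC) (\<lambda>_. OneC) oneR" "teq s (\<lambda>_. ZeroC) (\<lambda>_. ZeroC) zeroR" "teq s (\<lambda>_. HidC) (\<lambda>_. HidC) hidR"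
  "teq False (\<lambda>_. UnivC) (\<lambda>_. UnivC) (\<lambda>h. urel)"
  unfolding teq_def 
  using den_One[of "\<lambda>_. OneC"] den_Zero[of "\<lambda>_. ZeroC"] den_Hid[of "\<lambda>_. HidC"] good_one[of "\<lambda>_. OneC"] good_zero[of "\<lambda>_. ZeroC"] good_hid[of "\<lambda>_. HidC"]
    small_one small_zero small_hid goodD(2) good_univ den_base[of "uni False" "\<lambda>_. UnivC" "\<lambda>h. urel"]
  by (auto simp: uni_def uu1_def)

section \<open>Contexts and judgments\<close>

type_synonym env = "nat \<Rightarrow> dom"

text \<open>Types are read in degenerate environments, which enforces that they depend on actual
  parts only.\<close>

definition ct :: "tm \<Rightarrow> (nat \<Rightarrow> env) \<Rightarrow> sq" where "ct A \<rho> = (\<lambda>e. cl A (edeg (\<rho> e)))"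
definition vs :: "tm \<Rightarrow> (nat \<Rightarrow> env) \<Rightarrow> sq" where "vs t \<rho> = (\<lambda>e. val t (\<rho> e))"
definition xc :: "sq \<Rightarrow> (nat \<Rightarrow> env) \<Rightarrow> nat \<Rightarrow> env" where "xc w \<rho> = (\<lambda>e. ec (w e) (\<rho> e))"
definition sedeg :: "(nat \<Rightarrow> env) \<Rightarrow> nat \<Rightarrow> env" where "sedeg \<rho> = (\<lambda>e. edeg (\<rho> e))"
definition tl_env :: "(nat \<Rightarrow> env) \<Rightarrow> nat \<Rightarrow> env" where "tl_env \<rho> = (\<lambda>e n. \<rho> e (Suc n))"

text \<open>The empty context still asks for \<open>ord\<close> at every variable, so that each raw
  term has an ordered value, as \<open>vs_ord\<close> says.\<close>

primrec cx :: "tm list \<Rightarrow> (nat \<Rightarrow> env) \<Rightarrow> (nat \<Rightarrow> env) \<Rightarrow> bool" where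
  "cx [] \<rho> \<rho>' \<longleftrightarrow> (\<forall>e n. ord (\<rho> e n) \<and> ord (\<rho>' e n))"
| "cx (A # G) \<rho> \<rho>' \<longleftrightarrow> cx G (tl_env \<rho>) (tl_env \<rho>') \<and> M (ct A (tl_env \<rho>)) (\<lambda>e. \<rho> e 0) (\<lambda>e. \<rho>' e 0)"

definition tys :: "bool \<Rightarrow> tm list \<Rightarrow> tm \<Rightarrow> tm \<Rightarrow> bool" where
  "tys s G A A' \<longleftrightarrow> (\<forall>\<rho> \<rho>'. cx G \<rho> \<rho>' \<longrightarrow> tyeq s (ct A \<rho>) (ct A' \<rho>'))"
definition tms :: "tm list \<Rightarrow> tm \<Rightarrow> tm \<Rightarrow> tm \<Rightarrow> bool" where
  "tms G a b A \<longleftrightarrow> (\<forall>\<rho> \<rho>'. cx G \<rho> \<rho>' \<longrightarrow> M (ct A \<rho>) (vs a \<rho>) (vs b \<rho>'))"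

primrec wfc :: "tm list \<Rightarrow> bool" where
  "wfc [] \<longleftrightarrow> True"
| "wfc (A # G) \<longleftrightarrow> wfc G \<and> tys False G A A"

lemma tysD: "tys s G A A' \<Longrightarrow> cx G \<rho> \<rho>' \<Longrightarrow> tyeq s (ct A \<rho>) (ct A' \<rho>')" unfolding tys_def by blast
lemma tmsD: "tms G a b A \<Longrightarrow> cx G \<rho> \<rho>' \<Longrightarrow> M (ct A \<rho>) (vs a \<rho>) (vs b \<rho>')" unfolding tms_def by blast

lemma env_o: "ct A (\<rho> \<circ> k) = ct A \<rho> \<circ> k" "vs t (\<rho> \<circ> k) = vs t \<rho> \<circ> k" "xc (w \<circ> k) (\<rho> \<circ> k) = xc w \<rho> \<circ> k"
  "tl_env (\<rho> \<circ> k) = tl_env \<rho> \<circ> k" "sedeg (\<rho> \<circ> k) = sedeg \<rho> \<circ> k"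
  by (auto simp: ct_def vs_def xc_def tl_env_def sedeg_def)
lemma env_deg [simp]: "ct A (sedeg \<rho>) = ct A \<rho>" "vs t (sedeg \<rho>) = sdeg (vs t \<rho>)" "xc (sdeg w) (sedeg \<rho>) = sedeg (xc w \<rho>)"
  "ct A (xc (sdeg w) \<rho>) = ct A (xc w \<rho>)" "ct A (xc w (sedeg \<rho>)) = ct A (xc w \<rho>)" "tl_env (sedeg \<rho>) = sedeg (tl_env \<rho>)"
  by (auto simp: ct_def vs_def sedeg_def xc_def sdeg_def tl_env_def fun_eq_iff)
lemma xc_simps [simp]: "tl_env (xc w \<rho>) = \<rho>" "xc w \<rho> e 0 = w e" "xc w \<rho> e (Suc n) = \<rho> e n"
  by (auto simp: tl_env_def xc_def)
lemma cx_xc: "cx (A # G) (xc w \<rho>) (xc w' \<rho>') \<longleftrightarrow> cx G \<rho> \<rho>' \<and> M (ct A \<rho>) w w'"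
  by simp
lemma env_xc: "xc (\<lambda>e. \<rho> e 0) (tl_env \<rho>) = \<rho>"
  by (auto simp: xc_def tl_env_def ec_def fun_eq_iff split: nat.split)

lemma cxE:
  assumes "cx (A # G) \<rho> \<rho>'"
  obtains w w' \<sigma> \<sigma>' where "\<rho> = xc w \<sigma>" "\<rho>' = xc w' \<sigma>'" "cx G \<sigma> \<sigma>'" "M (ct A \<sigma>) w w'"
  using assms env_xc[of \<rho>] env_xc[of \<rho>'] by (metis cx.simps(2))

lemma cx_sym: "wfc G \<Longrightarrow> cx G \<rho> \<rho>' \<Longrightarrow> cx G \<rho>' \<rho>"
proof (induction G arbitrary: \<rho> \<rho>')
  case (Cons A G)
  from Cons.prems(2) obtain w w' \<sigma> \<sigma>' where r: "\<rho> = xc w \<sigma>" "\<rho>' = xc w' \<sigma>'" "cx G \<sigma> \<sigma>'" "M (ct A \<sigma>) w w'" by (rule cxE)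
  have t: "tyeq False (ct A \<sigma>) (ct A \<sigma>')" using Cons.prems(1) tysD[OF _ r(3)] by simp
  show ?case using Cons.prems(1) Cons.IH[OF _ r(3)] M_sym[OF t r(4)] M_conv[OF t] unfolding r cx_xc by simp
qed auto

lemma cx_trans: "wfc G \<Longrightarrow> cx G \<rho> \<rho>' \<Longrightarrow> cx G \<rho>' \<rho>'' \<Longrightarrow> cx G \<rho> \<rho>''"
proof (induction G arbitrary: \<rho> \<rho>' \<rho>'')
  case (Cons A G)
  have w: "wfc G" "tys False G A A" using Cons.prems(1) by auto
  have c: "cx G (tl_env \<rho>) (tl_env \<rho>')" "cx G (tl_env \<rho>') (tl_env \<rho>'')" using Cons.prems(2,3) by auto
  note t = tysD[OF w(2) c(1)]
  have "M (ct A (tl_env \<rho>)) (\<lambda>e. \<rho> e 0) (\<lambda>e. \<rho>'' e 0)"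
    by (rule M_trans[OF t]) (use Cons.prems(2,3) M_conv[OF t] in auto)
  then show ?case using Cons.IH[OF w(1) c] by simp
qed auto

lemma cx_refl: "wfc G \<Longrightarrow> cx G \<rho> \<rho>' \<Longrightarrow> cx G \<rho> \<rho>" "wfc G \<Longrightarrow> cx G \<rho> \<rho>' \<Longrightarrow> cx G \<rho>' \<rho>'"
proof -
  assume G: "wfc G" and c: "cx G \<rho> \<rho>'"
  note c' = cx_sym[OF G c]
  show "cx G \<rho> \<rho>" "cx G \<rho>' \<rho>'" using cx_trans[OF G c c'] cx_trans[OF G c' c] .
qed

lemma cx_reindex: "wfc G \<Longrightarrow> cx G \<rho> \<rho>' \<Longrightarrow> cx G (\<rho> \<circ> k) (\<rho>' \<circ> k)"
proof (induction G arbitrary: \<rho> \<rho>')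
  case (Cons A G)
  from Cons.prems(2) obtain w w' \<sigma> \<sigma>' where r: "\<rho> = xc w \<sigma>" "\<rho>' = xc w' \<sigma>'" "cx G \<sigma> \<sigma>'" "M (ct A \<sigma>) w w'" by (rule cxE)
  have t: "tyeq False (ct A \<sigma>) (ct A \<sigma>')" using Cons.prems(1) tysD[OF _ r(3)] by simp
  show ?case using Cons.prems(1) Cons.IH[OF _ r(3)] M_reindex[OF t r(4), of k]
    unfolding r env_o(3)[symmetric] cx_xc env_o(1) by (simp add: o_def)
qed auto

lemma cx_deg: "wfc G \<Longrightarrow> cx G \<rho> \<rho>' \<Longrightarrow> cx G (sedeg \<rho>) (sedeg \<rho>')"
proof (induction G arbitrary: \<rho> \<rho>')
  case (Cons A G)
  from Cons.prems(2) obtain w w' \<sigma> \<sigma>' where r: "\<rho> = xc w \<sigma>" "\<rho>' = xc w' \<sigma>'" "cx G \<sigma> \<sigma>'" "M (ct A \<sigma>) w w'" by (rule cxE)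
  have t: "tyeq False (ct A \<sigma>) (ct A \<sigma>')" using Cons.prems(1) tysD[OF _ r(3)] by simp
  show ?case using Cons.prems(1) Cons.IH[OF _ r(3)] M_deg[OF t r(4)]
    unfolding r env_deg(3)[symmetric] cx_xc by simp
qed (simp add: sedeg_def)

lemma cx_ord: "wfc G \<Longrightarrow> cx G \<rho> \<rho>' \<Longrightarrow> ord (\<rho> e n) \<and> ord (\<rho>' e n)"
proof (induction G arbitrary: \<rho> \<rho>' n)
  case (Cons A G)
  from Cons.prems(2) obtain w w' \<sigma> \<sigma>' where r: "\<rho> = xc w \<sigma>" "\<rho>' = xc w' \<sigma>'" "cx G \<sigma> \<sigma>'" "M (ct A \<sigma>) w w'" by (rule cxE)
  have t: "tyeq False (ct A \<sigma>) (ct A \<sigma>')" using Cons.prems(1) tysD[OF _ r(3)] by simp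
  show ?case using Cons.prems(1) Cons.IH[OF _ r(3)] M_ord[OF t r(4)] unfolding r by (cases n) auto
qed auto

lemma cx_nil: "wfc G \<Longrightarrow> cx G \<rho> \<rho>' \<Longrightarrow> cx [] \<rho> \<rho>'"
  using cx_ord by simp

lemma vs_ord: "wfc G \<Longrightarrow> cx G \<rho> \<rho>' \<Longrightarrow> ord (vs t \<rho> e) \<and> ord (vs t \<rho>' e)"
  using cx_ord ord_val by (simp add: vs_def)

lemma tys_sym: assumes "wfc G" "tys s G A A'" shows "tys s G A' A"
  unfolding tys_def using tyeq_sym[OF tysD[OF assms(2) cx_sym[OF assms(1)]]] by simp
lemma tys_trans: assumes "wfc G" "tys s G A A'" "tys s G A' A''" shows "tys s G A A''"
  unfolding tys_def using tyeq_trans[OF tysD[OF assms(2) cx_refl(1)[OF assms(1)]] tysD[OF assms(3)]] by simp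
lemma tys_refl: assumes "wfc G" "tys s G A A'" shows "tys s G A A" "tys s G A' A'"
  using tys_trans[OF assms tys_sym[OF assms]] tys_trans[OF assms(1) tys_sym[OF assms] assms(2)] .
lemma tys_mono: "tys s G A A' \<Longrightarrow> tys False G A A'"
  unfolding tys_def using tyeq_mono by metis

lemma tms_sym:
  assumes G: "wfc G" and A: "tys False G A A" and ab: "tms G a b A" shows "tms G b a A"
  unfolding tms_def
proof (intro allI impI)
  fix \<rho> \<rho>' assume c: "cx G \<rho> \<rho>'"
  note t = tysD[OF A c]
  show "M (ct A \<rho>) (vs b \<rho>) (vs a \<rho>')" 
    using M_sym[OF tyeq_sym[OF t] tmsD[OF ab cx_sym[OF G c]]] M_conv[OF t] by simp
qed

lemma tms_trans:
  assumes G: "wfc G" and A: "tys False G A A" and ab: "tms G a b A" and bc: "tms G b c A" shows "tms G a c A"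
  unfolding tms_def
proof (intro allI impI)
  fix \<rho> \<rho>' assume c: "cx G \<rho> \<rho>'"
  show "M (ct A \<rho>) (vs a \<rho>) (vs c \<rho>')" 
    using M_trans[OF tysD[OF A c] tmsD[OF ab cx_refl(1)[OF G c]] tmsD[OF bc c]] .
qed
lemma tms_refl: assumes "wfc G" "tys False G A A" "tms G a b A" shows "tms G a a A" "tms G b b A"
  using tms_trans[OF assms tms_sym[OF assms]] tms_trans[OF assms(1,2) tms_sym[OF assms] assms(3)] .

lemma tms_conv: 
  assumes G: "wfc G" and A: "tys False G A B" and ab: "tms G a b A" shows "tms G a b B"
  unfolding tms_def
proof (intro allI impI)
  fix \<rho> \<rho>' assume c: "cx G \<rho> \<rho>'"
  show "M (ct B \<rho>) (vs a \<rho>) (vs b \<rho>')" 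
    using M_conv[OF tysD[OF A cx_refl(1)[OF G c]]] tmsD[OF ab c] by simp
qed

lemma case_val: "(\<lambda>n. val (case_nat a s n) \<rho>) = ec (val a \<rho>) (\<lambda>n. val (s n) \<rho>)"
  by (auto simp: ec_def fun_eq_iff split: nat.split)

lemma ct_p1: "ct A \<rho> = bs (vs A \<rho>)"
  by (simp add: ct_def vs_def bs_def)

lemma vs_sub: "vs (inst t a) \<rho> = vs t (xc (vs a \<rho>) \<rho>)"
  "vs (inst' t b) (xc w \<rho>) = vs t (xc (vs b (xc w \<rho>)) \<rho>)"
  "vs (inst3 t a b p) \<rho> = vs t (xc (vs p \<rho>) (xc (vs b \<rho>) (xc (vs a \<rho>) \<rho>)))"
  "vs (instd A t) (xc w \<rho>) = vs t (xc (vs (Refl (wk A) (Var 0)) (xc w \<rho>)) (xc w (xc w \<rho>)))"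
  by (simp_all add: vs_def inst_def inst'_def inst3_def instd_def val_sub case_val xc_def val_eqs)

lemma ct_sub: "ct (inst t a) \<rho> = ct t (xc (vs a \<rho>) \<rho>)"
  "ct (inst' t b) (xc w \<rho>) = ct t (xc (vs b (xc w \<rho>)) \<rho>)"
  "ct (inst3 t a b p) \<rho> = ct t (xc (vs p \<rho>) (xc (vs b \<rho>) (xc (vs a \<rho>) \<rho>)))"
  "ct (instd A t) (xc w \<rho>) = ct t (xc (vs (Refl (wk A) (Var 0)) (xc w \<rho>)) (xc w (xc w \<rho>)))"
  unfolding ct_p1 vs_sub by (rule refl)+

lemma vs_ren: "vs (ren r t) \<rho> = vs t (\<lambda>e n. \<rho> e (r n))" by (simp add: vs_def val_ren)
lemma ct_ren: "ct (ren r t) \<rho> = ct t (\<lambda>e n. \<rho> e (r n))" by (simp add: ct_p1 vs_ren)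
lemma wk_simps [simp]: "vs (wk t) (xc w \<rho>) = vs t \<rho>" "ct (wk t) (xc w \<rho>) = ct t \<rho>" 
  "vs (wk1 t) (xc w (xc v \<rho>)) = vs t (xc w \<rho>)" "ct (wk1 t) (xc w (xc v \<rho>)) = ct t (xc w \<rho>)"
proof -
  have "(\<lambda>e n. xc w (xc v \<rho>) e (upr Suc n)) = xc w \<rho>"
    by (auto simp: fun_eq_iff upr_def xc_def ec_def split: nat.split)
  then show "vs (wk t) (xc w \<rho>) = vs t \<rho>" "ct (wk t) (xc w \<rho>) = ct t \<rho>" 
    "vs (wk1 t) (xc w (xc v \<rho>)) = vs t (xc w \<rho>)" "ct (wk1 t) (xc w (xc v \<rho>)) = ct t (xc w \<rho>)"
    by (simp_all add: vs_ren ct_ren)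
qed

lemma vs_simps [simp]: "vs (Var 0) (xc w \<rho>) = w" "vs (Var (Suc n)) (xc w \<rho>) = vs (Var n) \<rho>"
  "vs (App A B f a) \<rho> = sap (vs f \<rho>) (vs a \<rho>)"
  "sfst (vs (MkPair A B a b) \<rho>) = vs a \<rho>" "ssnd (vs (MkPair A B a b) \<rho>) = vs b \<rho>"
  "vs (Proj1 A B p) \<rho> = sfst (vs p \<rho>)" "vs (Proj2 A B p) \<rho> = ssnd (vs p \<rho>)"
  "vs (InL A B a) \<rho> = smk 0 (vs a \<rho>)" "vs (InR A B b) \<rho> = smk 1 (vs b \<rho>)"
  "sap (vs (Lam A B t) \<rho>) w = vs t (xc w \<rho>)"
  by (simp_all add: vs_def val_eqs xc_def seq_defs apW_val_Lam)

lemma tys_inst: "tys s (A # G) B B' \<Longrightarrow> tms G a a' A \<Longrightarrow> tys s G (inst B a) (inst B' a')"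
  unfolding tys_def tms_def ct_sub using cx_xc by blast
lemma tms_inst: "tms (A # G) b b' B \<Longrightarrow> tms G a a' A \<Longrightarrow> tms G (inst b a) (inst b' a') (inst B a)"
  unfolding tms_def ct_sub vs_sub using cx_xc by blast

lemma tms_var: 
  assumes "i < length G" shows "tms G (Var i) (Var i) (ren (\<lambda>n. n + Suc i) (G ! i))"
proof -
  have "M (ct (ren (\<lambda>n. n + Suc i) (G ! i)) \<rho>) (\<lambda>e. \<rho> e i) (\<lambda>e. \<rho>' e i)" if "cx G \<rho> \<rho>'" "i < length G" for \<rho> \<rho>'
    using that
  proof (induction G arbitrary: i \<rho> \<rho>')
    case (Cons A G)
    show ?case
    proof (cases i)
      case 0 then show ?thesis using Cons.prems by (simp add: ct_ren tl_env_def)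
    next
      case (Suc j)
      then show ?thesis using Cons.IH[of "tl_env \<rho>" "tl_env \<rho>'" j] Cons.prems by (simp add: ct_ren tl_env_def)
    qed
  qed simp
  then show ?thesis using assms by (simp add: tms_def vs_def val_eqs)
qed

section \<open>Semantic typing rules\<close>

definition pB :: "tm \<Rightarrow> (nat \<Rightarrow> env) \<Rightarrow> sq" where "pB B \<rho> = (\<lambda>e. lam (\<lambda>z. cl B (ec z (edeg (\<rho> e)))))"

lemma ct_simps: "ct (Pi A B) \<rho> = wr (\<lambda>e. PiC (ct A \<rho> e) (pB B \<rho> e))" "ct (Sig A B) \<rho> = wr (\<lambda>e. SigC (ct A \<rho> e) (pB B \<rho> e))"
  "ct (Plus A B) \<rho> = wr (\<lambda>e. PlusC (ct A \<rho> e) (ct B \<rho> e))" "ct (Eq A a b) \<rho> = wr (\<lambda>e. EqC (ct A \<rho> e) (p1 (vs a \<rho> e)) (p1 (vs b \<rho> e)))"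
  "ct One \<rho> = wr (\<lambda>_. OneC)" "ct Zero \<rho> = wr (\<lambda>_. ZeroC)" "ct Univ \<rho> = wr (\<lambda>_. UnivC)"
  by (simp_all add: ct_def wr_def pB_def vs_def)

lemma fib_pB: "fib (pB B \<rho>) k w = ct B (xc w (\<rho> \<circ> k))"
  by (simp add: fib_def pB_def beta cont_cl_ec ct_def xc_def sdeg_def)

text \<open>Equality of the codes underneath the trivial frame. The rule for types and the rule for
  the universe both follow from it, by \<open>core_tys\<close> and \<open>core_univ\<close>.\<close>

definition core :: "bool \<Rightarrow> tm list \<Rightarrow> tm \<Rightarrow> tm \<Rightarrow> bool" where
  "core s G A A' \<longleftrightarrow> (\<forall>\<rho> \<rho>'. cx G \<rho> \<rho>' \<longrightarrow> (\<exists>c c' R. ct A \<rho> = wr c \<and> ct A' \<rho>' = wr c' \<and> teq s c c' R))"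

lemma core_tys: "core s G A A' \<Longrightarrow> tys s G A A'"
  unfolding core_def tys_def tyeq_def using teq_wr by metis

text \<open>The universe is a type former like the others, with its own trivial frame, and its
  elements are compared by actual parts.\<close>

lemma M_univ: "M (ct Univ \<rho>) w w' \<longleftrightarrow> urel w w'"
  using teq_RR(1)[OF teq_wr[OF teq_ground(4)]] by (simp add: M_def ct_simps)

lemma tms_univ_iff: "wfc G \<Longrightarrow> tms G A A' Univ \<longleftrightarrow> (\<forall>\<rho> \<rho>'. cx G \<rho> \<rho>' \<longrightarrow> usame (ct A \<rho>) (ct A' \<rho>'))"
  unfolding tms_def M_univ urel_iff ct_p1[symmetric] using vs_ord by metis

lemma core_univ: "wfc G \<Longrightarrow> core True G A A' \<Longrightarrow> tms G A A' Univ"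
  unfolding tms_univ_iff core_def using usame_wr by metis
lemma univ_tys: "wfc G \<Longrightarrow> tms G A A' Univ \<Longrightarrow> tys True G A A'"
  unfolding tms_univ_iff tys_def using usame_tyeq by blast

lemma tys_ground: "core s G One One" "core s G Zero Zero" "core False G Univ Univ"
  unfolding core_def ct_simps using teq_ground by blast+

lemma fib_tys:
  assumes G: "wfc G" and A: "tys s' G A A'" and B: "tys s (A # G) B B'" and c: "cx G \<rho> \<rho>'" and w: "RR (ct A \<rho>) k w w'"
  shows "tyeq s (fib (pB B \<rho>) k w) (fib (pB B' \<rho>') k w')"
proof -
  have "M (ct A (\<rho> \<circ> k)) w w'" unfolding env_o M_re[OF tysD[OF A c]] by (rule w)
  with cx_reindex[OF G c, of k] have "cx (A # G) (xc w (\<rho> \<circ> k)) (xc w' (\<rho>' \<circ> k))" unfolding cx_xc by blast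
  from tysD[OF B this] show ?thesis unfolding fib_pB .
qed

lemma core_pi: 
  assumes G: "wfc G" and A: "tys s G A A'" and B: "tys s (A # G) B B'"
  shows "core s G (Pi A B) (Pi A' B')"
  unfolding core_def ct_simps using teq_pi[OF tysD[OF A] fib_tys[OF G A B]] by blast

lemma core_sig: 
  assumes G: "wfc G" and A: "tys s G A A'" and B: "tys s (A # G) B B'"
  shows "core s G (Sig A B) (Sig A' B')"
  unfolding core_def ct_simps using teq_sig[OF tysD[OF A] fib_tys[OF G A B]] by blast

lemma core_plus: "tys s G A A' \<Longrightarrow> tys s G B B' \<Longrightarrow> core s G (Plus A B) (Plus A' B')"
  unfolding core_def ct_simps using teq_plus[OF tysD tysD] by blast

lemma dbl_sdeg: "(\<lambda>e. dbl (p1 (w e))) = sdeg w" by (simp add: sdeg_def)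

lemma core_eq: 
  assumes G: "wfc G" and A: "tys s G A A'" and a: "tms G a a' A" and b: "tms G b b' A"
  shows "core s G (Eq A a b) (Eq A' a' b')"
  unfolding core_def
proof (intro allI impI)
  fix \<rho> \<rho>' assume c: "cx G \<rho> \<rho>'"
  note t = tysD[OF A c]
  have "teq s (\<lambda>e. EqC (ct A \<rho> e) (p1 (vs a \<rho> e)) (p1 (vs b \<rho> e))) (\<lambda>e. EqC (ct A' \<rho>' e) (p1 (vs a' \<rho>' e)) (p1 (vs b' \<rho>' e)))
    (eqR (RR (ct A \<rho>)) (\<lambda>e. p1 (vs a \<rho> e)) (\<lambda>e. p1 (vs b \<rho> e)))"
    by (rule teq_eq[OF t]) (unfold dbl_sdeg, rule M_deg[OF t tmsD[OF a c]], rule M_deg[OF t tmsD[OF b c]])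
  then show "\<exists>c c' R. ct (Eq A a b) \<rho> = wr c \<and> ct (Eq A' a' b') \<rho>' = wr c' \<and> teq s c c' R"
    unfolding ct_simps by blast
qed

lemma M_pi:
  assumes G: "wfc G" and A: "tys False G A A" and B: "tys False (A # G) B B" and c: "cx G \<rho> \<rho>'"
  shows "M (ct (Pi A B) \<rho>) F F' \<longleftrightarrow> (\<forall>n. ord (F n) \<and> ord (F' n)) \<and>
    (\<forall>k w w'. M (ct A (\<rho> \<circ> k)) w w' \<longrightarrow> M (ct B (xc w (\<rho> \<circ> k))) (sap (F \<circ> k) w) (sap (F' \<circ> k) w')) \<and>
    (\<forall>k w w'. M (ct A (\<rho> \<circ> k)) w w' \<longrightarrow> M (ct B (xc w (\<rho> \<circ> k))) (sap (sdeg F \<circ> k) w) (sap (sdeg F' \<circ> k) w'))"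
proof -
  have "RR (ct (Pi A B) \<rho>) = piR (RR (ct A \<rho>)) (\<lambda>k w. RR (fib (pB B \<rho>) k w))"
    unfolding ct_simps by (rule teq_RR(1)[OF teq_wr[OF teq_pi[OF tysD[OF A c] fib_tys[OF G A B c]]]])
  then show ?thesis unfolding M_def[of "ct (Pi A B) \<rho>"] env_o M_re[OF tysD[OF A c]]
    by (simp add: piR_def piH_def M_def fib_pB)
qed

lemma M_piD:
  assumes "wfc G" "tys False G A A" "tys False (A # G) B B" "cx G \<rho> \<rho>'" "M (ct (Pi A B) \<rho>) F F'" "M (ct A \<rho>) w w'"
  shows "M (ct B (xc w \<rho>)) (sap F w) (sap F' w')"
  using assms(5)[unfolded M_pi[OF assms(1-4)], THEN conjunct2, THEN conjunct1, rule_format, of "\<lambda>n. n" w w'] assms(6) by simp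

lemma M_sig:
  assumes G: "wfc G" and A: "tys False G A A" and B: "tys False (A # G) B B" and c: "cx G \<rho> \<rho>'"
  shows "M (ct (Sig A B) \<rho>) w w' \<longleftrightarrow> M (ct A \<rho>) (sfst w) (sfst w') \<and> M (ct B (xc (sfst w) \<rho>)) (ssnd w) (ssnd w')"
proof -
  have "RR (ct (Sig A B) \<rho>) = sigR (RR (ct A \<rho>)) (\<lambda>k w. RR (fib (pB B \<rho>) k w))"
    unfolding ct_simps by (rule teq_RR(1)[OF teq_wr[OF teq_sig[OF tysD[OF A c] fib_tys[OF G A B c]]]])
  then show ?thesis unfolding M_def[of "ct (Sig A B) \<rho>"]
    by (simp add: sigR_def M_def fib_pB)
qed

lemma M_plus:
  assumes A: "tys False G A A" and B: "tys False G B B" and c: "cx G \<rho> \<rho>'"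
  shows "M (ct (Plus A B) \<rho>) w w' \<longleftrightarrow> (\<exists>a a'. w = smk 0 a \<and> w' = smk 0 a' \<and> M (ct A \<rho>) a a') \<or>
     (\<exists>b b'. w = smk 1 b \<and> w' = smk 1 b' \<and> M (ct B \<rho>) b b')"
proof -
  have "RR (ct (Plus A B) \<rho>) = plusR (RR (ct A \<rho>)) (RR (ct B \<rho>))"
    unfolding ct_simps by (rule teq_RR(1)[OF teq_wr[OF teq_plus[OF tysD[OF A c] tysD[OF B c]]]])
  then show ?thesis by (simp add: M_def plusR_def)
qed

text \<open>Stated for semantic data instead of terms, because it is also applied where the end
  points are not given by terms in context.\<close>

lemma M_eq:
  assumes A: "tyeq s T T'" and a: "M T x x" and b: "M T y y"
  shows "M (wr (\<lambda>e. EqC (T e) (p1 (x e)) (p1 (y e)))) w w' \<longleftrightarrow>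
    (\<forall>n. ord (w n) \<and> ord (w' n)) \<and> M T (e0 w) (sdeg x) \<and> M T (e1 w) (sdeg y) \<and> M T (e0 w') (sdeg x) \<and> M T (e1 w') (sdeg y) \<and>
    M (T \<circ> jn (\<lambda>n. n) (\<lambda>n. n)) (jn (e0 w) (e1 w)) (jn (e0 w') (e1 w'))"
proof -
  note t = tyeq_refl(1)[OF A]
  have "teq s (\<lambda>e. EqC (T e) (p1 (x e)) (p1 (y e))) (\<lambda>e. EqC (T e) (p1 (x e)) (p1 (y e)))
    (eqR (RR T) (\<lambda>e. p1 (x e)) (\<lambda>e. p1 (y e)))"
    by (rule teq_eq[OF t]) (unfold dbl_sdeg, rule M_deg[OF t a], rule M_deg[OF t b])
  from teq_RR(1)[OF teq_wr[OF this]] show ?thesis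
    unfolding M_re[OF A] unfolding M_def by (auto simp: eqR_def eqH_def sdeg_def)
qed

lemma M_one: "M (ct One \<rho>) w w' \<longleftrightarrow> (\<forall>n. ord (w n) \<and> ord (w' n))"
  using teq_RR(1)[OF teq_wr[OF teq_ground(1)[of False]]] by (simp add: M_def ct_simps oneR_def)
lemma M_zero: "\<not> M (ct Zero \<rho>) w w'"
  using teq_RR(1)[OF teq_wr[OF teq_ground(2)[of False]]] by (simp add: M_def ct_simps zeroR_def)

section \<open>Soundness\<close>

definition jty :: "tm list \<Rightarrow> tm \<Rightarrow> tm \<Rightarrow> bool" where "jty G A B \<longleftrightarrow> wfc G \<and> tys False G A B"
definition jtm :: "tm list \<Rightarrow> tm \<Rightarrow> tm \<Rightarrow> tm \<Rightarrow> bool" where "jtm G a b A \<longleftrightarrow> wfc G \<and> tys False G A A \<and> tms G a b A"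

lemma jtmI: "jty G A B \<Longrightarrow> tms G a b A \<Longrightarrow> jtm G a b A" using tys_refl(1)[of G False A B] by (simp add: jty_def jtm_def)
lemma jtyD: "jty G A B \<Longrightarrow> wfc G" "jty G A B \<Longrightarrow> tys False G A B" "jty G A B \<Longrightarrow> jty G A A" "jty G A B \<Longrightarrow> jty G B B"
  using tys_refl by (auto simp: jty_def)
lemma jtmD: "jtm G a b A \<Longrightarrow> wfc G" "jtm G a b A \<Longrightarrow> tys False G A A" "jtm G a b A \<Longrightarrow> tms G a b A" "jtm G a b A \<Longrightarrow> jty G A A"
  "jtm G a b A \<Longrightarrow> jtm G a a A"
  using tms_refl by (auto simp: jty_def jtm_def)

lemma j_ctx_cons: "wfc G \<Longrightarrow> jty G A A \<Longrightarrow> wfc (A # G)" by (simp add: jty_def)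
lemma j_var: 
  assumes "wfc G" "i < length G" shows "jtm G (Var i) (Var i) (ren (\<lambda>n. n + Suc i) (G ! i))"
proof -
  have "tys False G (ren (\<lambda>n. n + Suc i) (G ! i)) (ren (\<lambda>n. n + Suc i) (G ! i))"
    using assms
  proof (induction G arbitrary: i)
    case (Cons A G)
    show ?case unfolding tys_def ct_ren
    proof (intro allI impI)
      fix \<rho> \<rho>' assume c: "cx (A # G) \<rho> \<rho>'"
      show "tyeq False (ct ((A # G) ! i) (\<lambda>e n. \<rho> e (n + Suc i))) (ct ((A # G) ! i) (\<lambda>e n. \<rho>' e (n + Suc i)))"
      proof (cases i)
        case 0
        then show ?thesis using tysD[of False G A A "tl_env \<rho>" "tl_env \<rho>'"] Cons.prems c by (simp add: tl_env_def)
      next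
        case (Suc j)
        have "tys False G (ren (\<lambda>n. n + Suc j) (G ! j)) (ren (\<lambda>n. n + Suc j) (G ! j))"
          using Cons.IH[of j] Cons.prems Suc by simp
        from tysD[OF this, of "tl_env \<rho>" "tl_env \<rho>'"] c Suc show ?thesis by (simp add: tl_env_def ct_ren)
      qed
    qed
  qed simp
  then show ?thesis using tms_var[OF assms(2)] assms(1) by (simp add: jtm_def)
qed

lemma j_ty_sym: "jty G A B \<Longrightarrow> jty G B A" using tys_sym by (simp add: jty_def)
lemma j_ty_trans: "jty G A B \<Longrightarrow> jty G B C \<Longrightarrow> jty G A C" unfolding jty_def using tys_trans[of G False A B C] by simp
lemma j_tm_sym: "jtm G a b A \<Longrightarrow> jtm G b a A" using tms_sym by (simp add: jtm_def)
lemma j_tm_trans: "jtm G a b A \<Longrightarrow> jtm G b c A \<Longrightarrow> jtm G a c A" unfolding jtm_def using tms_trans[of G A a b c] by simp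
lemma j_conv: "jtm G a b A \<Longrightarrow> jty G A B \<Longrightarrow> jtm G a b B" 
  unfolding jtm_def jty_def using tms_conv[of G A B a b] tys_refl(2)[of G False A B] by simp
lemma j_univ_ty: "wfc G \<Longrightarrow> jty G Univ Univ" using core_tys[OF tys_ground(3)] by (simp add: jty_def)
lemma j_el: "jtm G A B Univ \<Longrightarrow> jty G A B" 
  unfolding jty_def jtm_def using tys_mono[OF univ_tys[of G A B]] by simp
lemma j_u: assumes "wfc G" "core True G A B" shows "jtm G A B Univ"
  using core_univ[OF assms] j_univ_ty[OF assms(1)] by (simp add: jty_def jtm_def)
lemma j_univ: "jtm G A B Univ \<Longrightarrow> tys True G A B" using univ_tys by (simp add: jtm_def)

lemma j_pi: "jty G A A' \<Longrightarrow> jty (A # G) B B' \<Longrightarrow> jty G (Pi A B) (Pi A' B')"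
  using core_tys[OF core_pi[of G False A A' B B']] by (simp add: jty_def)
lemma j_pi_u: "jtm G A A' Univ \<Longrightarrow> jtm (A # G) B B' Univ \<Longrightarrow> jtm G (Pi A B) (Pi A' B') Univ"
  using j_u[OF _ core_pi, of G A A' B B'] j_univ[of G A A'] j_univ[of "A # G" B B'] jtmD(1) by simp
lemma j_sig: "jty G A A' \<Longrightarrow> jty (A # G) B B' \<Longrightarrow> jty G (Sig A B) (Sig A' B')"
  using core_tys[OF core_sig[of G False A A' B B']] by (simp add: jty_def)
lemma j_sig_u: "jtm G A A' Univ \<Longrightarrow> jtm (A # G) B B' Univ \<Longrightarrow> jtm G (Sig A B) (Sig A' B') Univ"
  using j_u[OF _ core_sig, of G A A' B B'] j_univ[of G A A'] j_univ[of "A # G" B B'] jtmD(1) by simp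
lemma j_plus: "jty G A A' \<Longrightarrow> jty G B B' \<Longrightarrow> jty G (Plus A B) (Plus A' B')"
  using core_tys[OF core_plus[of False G A A' B B']] by (simp add: jty_def)
lemma j_plus_u: "jtm G A A' Univ \<Longrightarrow> jtm G B B' Univ \<Longrightarrow> jtm G (Plus A B) (Plus A' B') Univ"
  using j_u[OF _ core_plus, of G A A' B B'] j_univ[of G A A'] j_univ[of G B B'] jtmD(1) by simp
lemma j_eq: "jty G A A' \<Longrightarrow> jtm G a a' A \<Longrightarrow> jtm G b b' A \<Longrightarrow> jty G (Eq A a b) (Eq A' a' b')"
  using core_tys[OF core_eq[of G False A A' a a' b b']] by (simp add: jty_def jtm_def)
lemma j_eq_u: "jtm G A A' Univ \<Longrightarrow> jtm G a a' A \<Longrightarrow> jtm G b b' A \<Longrightarrow> jtm G (Eq A a b) (Eq A' a' b') Univ"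
  using j_u[OF _ core_eq, of G A A' a a' b b'] j_univ[of G A A'] by (simp add: jtm_def)
lemma j_one: "wfc G \<Longrightarrow> jty G One One" and j_zero: "wfc G \<Longrightarrow> jty G Zero Zero" 
  using core_tys[OF tys_ground(1)] core_tys[OF tys_ground(2)] by (simp_all add: jty_def)
lemma j_one_u: "wfc G \<Longrightarrow> jtm G One One Univ" and j_zero_u: "wfc G \<Longrightarrow> jtm G Zero Zero Univ"
  by (rule j_u tys_ground | assumption)+

text \<open>The clauses on further reindexings and on actual parts follow from the plain one,
  because contexts are closed under reindexing and under passing to actual parts.\<close>

lemma tms_piI:
  assumes A: "jty G A A" and B: "jty (A # G) B B"
    and H: "\<And>\<rho> \<rho>' w w'. cx (A # G) (xc w \<rho>) (xc w' \<rho>') \<Longrightarrow> M (ct B (xc w \<rho>)) (sap (vs f \<rho>) w) (sap (vs g \<rho>') w')"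
  shows "jtm G f g (Pi A B)"
proof (rule jtmI[OF j_pi[OF A B]], unfold tms_def, intro allI impI)
  fix \<rho> \<rho>' assume c: "cx G \<rho> \<rho>'"
  note G = jtyD(1)[OF A]
  have 1: "M (ct B (xc w (\<sigma> \<circ> k))) (sap (vs f \<sigma> \<circ> k) w) (sap (vs g \<sigma>' \<circ> k) w')"
    if "cx G \<sigma> \<sigma>'" "M (ct A (\<sigma> \<circ> k)) w w'" for \<sigma> \<sigma>' k w w'
    using H[of w "\<sigma> \<circ> k" w' "\<sigma>' \<circ> k"] cx_reindex[OF G that(1), of k] that(2) unfolding cx_xc env_o(2) by blast
  have 2: "M (ct B (xc w (\<rho> \<circ> k))) (sap (sdeg (vs f \<rho>) \<circ> k) w) (sap (sdeg (vs g \<rho>') \<circ> k) w')" 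
    if "M (ct A (\<rho> \<circ> k)) w w'" for k w w'
    using 1[OF cx_deg[OF G c], of k w w'] that unfolding env_o(5)[symmetric] env_deg .
  show "M (ct (Pi A B) \<rho>) (vs f \<rho>) (vs g \<rho>')"
    unfolding M_pi[OF G jtyD(2)[OF A] jtyD(2)[OF B] c] using vs_ord[OF G c] 1[OF c] 2 by blast
qed

lemma j_lam: "jty G A A \<Longrightarrow> jty G A A' \<Longrightarrow> jty (A # G) B B' \<Longrightarrow> jtm (A # G) t t' B \<Longrightarrow> jtm G (Lam A B t) (Lam A' B' t') (Pi A B)"
  by (rule tms_piI[OF _ jtyD(3)]) (simp_all only: vs_simps, rule tmsD[OF jtmD(3)])

lemma sap_tms:
  assumes A: "jty G A A" and B: "jty (A # G) B B" and f: "jtm G f f' (Pi A B)" and c: "cx (A # G) (xc w \<rho>) (xc w' \<rho>')"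
  shows "M (ct B (xc w \<rho>)) (sap (vs f \<rho>) w) (sap (vs f' \<rho>') w')"
proof -
  have c': "cx G \<rho> \<rho>'" "M (ct A \<rho>) w w'" using c unfolding cx_xc by auto
  show ?thesis by (rule M_piD[OF jtyD(1)[OF A] jtyD(2)[OF A] jtyD(2)[OF B] c'(1) tmsD[OF jtmD(3)[OF f] c'(1)] c'(2)])
qed

lemma j_inst: "jty (A # G) B B' \<Longrightarrow> jtm G a a' A \<Longrightarrow> jty G (inst B a) (inst B' a')"
  using tys_inst[of False A G B B' a a'] by (simp add: jty_def jtm_def)

lemma j_app: assumes A: "jty G A A" and B: "jty (A # G) B B'" and f: "jtm G f f' (Pi A B)" and a: "jtm G a a' A"
  shows "jtm G (App A B f a) (App A' B' f' a') (inst B a)"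
proof (rule jtmI[OF j_inst[OF jtyD(3)[OF B] a]], unfold tms_def, intro allI impI)
  fix \<rho> \<rho>' assume c: "cx G \<rho> \<rho>'"
  then have "cx (A # G) (xc (vs a \<rho>) \<rho>) (xc (vs a' \<rho>') \<rho>')" using tmsD[OF jtmD(3)[OF a]] unfolding cx_xc by blast
  from sap_tms[OF A jtyD(3)[OF B] f this]
  show "M (ct (inst B a) \<rho>) (vs (App A B f a) \<rho>) (vs (App A' B' f' a') \<rho>')" by (simp add: ct_sub)
qed

lemma j_pi_beta: assumes A: "jty G A A" and B: "jty (A # G) B B" and t: "jtm (A # G) t t B" and a: "jtm G a a A"
  shows "jtm G (App A B (Lam A B t) a) (inst t a) (inst B a)"
  using tms_inst[OF jtmD(3)[OF t] jtmD(3)[OF a]] jtmI[OF j_inst[OF B a]] by (simp add: tms_def vs_sub)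

lemma j_pi_eta: assumes A: "jty G A A" and B: "jty (A # G) B B" and f: "jtm G f f (Pi A B)"
  shows "jtm G f (Lam A B (App (wk A) (wk1 B) (wk f) (Var 0))) (Pi A B)"
  by (rule tms_piI[OF A B]) (simp only: vs_simps wk_simps, rule sap_tms[OF A B f])

lemma j_mkpair: assumes A: "jty G A A" and B: "jty (A # G) B B'" and a: "jtm G a a' A" and b: "jtm G b b' (inst B a)"
  shows "jtm G (MkPair A B a b) (MkPair A' B' a' b') (Sig A B)"
proof (rule jtmI[OF j_sig[OF A jtyD(3)[OF B]]], unfold tms_def, intro allI impI)
  fix \<rho> \<rho>' assume c: "cx G \<rho> \<rho>'"
  show "M (ct (Sig A B) \<rho>) (vs (MkPair A B a b) \<rho>) (vs (MkPair A' B' a' b') \<rho>')"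
    unfolding M_sig[OF jtyD(1,2)[OF A] jtyD(2)[OF jtyD(3)[OF B]] c] using tmsD[OF jtmD(3)[OF a] c] tmsD[OF jtmD(3)[OF b] c] by (simp add: ct_sub)
qed

lemma j_proj1: assumes A: "jty G A A" and B: "jty (A # G) B B'" and p: "jtm G p p' (Sig A B)"
  shows "jtm G (Proj1 A B p) (Proj1 A' B' p') A"
proof (rule jtmI[OF A], unfold tms_def, intro allI impI)
  fix \<rho> \<rho>' assume c: "cx G \<rho> \<rho>'"
  show "M (ct A \<rho>) (vs (Proj1 A B p) \<rho>) (vs (Proj1 A' B' p') \<rho>')"
    using tmsD[OF jtmD(3)[OF p] c] unfolding M_sig[OF jtyD(1,2)[OF A] jtyD(2)[OF jtyD(3)[OF B]] c] by simp
qed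

lemma j_proj2: assumes A: "jty G A A" and B: "jty (A # G) B B'" and p: "jtm G p p' (Sig A B)"
  shows "jtm G (Proj2 A B p) (Proj2 A' B' p') (inst B (Proj1 A B p))"
proof (rule jtmI[OF j_inst[OF jtyD(3)[OF B] j_proj1[OF A B p]]], unfold tms_def, intro allI impI)
  fix \<rho> \<rho>' assume c: "cx G \<rho> \<rho>'"
  show "M (ct (inst B (Proj1 A B p)) \<rho>) (vs (Proj2 A B p) \<rho>) (vs (Proj2 A' B' p') \<rho>')"
    using tmsD[OF jtmD(3)[OF p] c] unfolding M_sig[OF jtyD(1,2)[OF A] jtyD(2)[OF jtyD(3)[OF B]] c] by (simp add: ct_sub)
qed

lemma j_sig_beta1: "jty G A A \<Longrightarrow> jty (A # G) B B \<Longrightarrow> jtm G a a A \<Longrightarrow> jtm G b b (inst B a) \<Longrightarrow> jtm G (Proj1 A B (MkPair A B a b)) a A"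
  by (simp add: jtm_def tms_def)
lemma j_sig_beta2: "jty G A A \<Longrightarrow> jty (A # G) B B \<Longrightarrow> jtm G a a A \<Longrightarrow> jtm G b b (inst B a) \<Longrightarrow> jtm G (Proj2 A B (MkPair A B a b)) b (inst B a)"
  by (simp add: jtm_def tms_def)
lemma j_sig_eta: assumes A: "jty G A A" and B: "jty (A # G) B B" and p: "jtm G p p (Sig A B)"
  shows "jtm G p (MkPair A B (Proj1 A B p) (Proj2 A B p)) (Sig A B)"
proof (rule jtmI[OF j_sig[OF A B]], unfold tms_def, intro allI impI)
  fix \<rho> \<rho>' assume c: "cx G \<rho> \<rho>'"
  show "M (ct (Sig A B) \<rho>) (vs p \<rho>) (vs (MkPair A B (Proj1 A B p) (Proj2 A B p)) \<rho>')"
    using tmsD[OF jtmD(3)[OF p] c] unfolding M_sig[OF jtyD(1,2)[OF A] jtyD(2)[OF B] c] by simp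
qed

lemma j_one_tm: assumes G: "wfc G" shows "jtm G t Star One"
  by (rule jtmI[OF j_one[OF G]]) (use vs_ord[OF G] in \<open>auto simp: tms_def M_one\<close>)
lemma j_star: "wfc G \<Longrightarrow> jtm G Star Star One" by (rule j_one_tm)

lemma j_abort: "jty (Zero # G) C C' \<Longrightarrow> jtm G t t' Zero \<Longrightarrow> jtm G (Abort C t) (Abort C' t') (inst C t)"
  by (rule jtmI[OF j_inst], assumption+) (auto simp: jtm_def tms_def M_zero)

lemma j_inl: assumes A: "jty G A A'" and B: "jty G B B'" and a: "jtm G a a' A" shows "jtm G (InL A B a) (InL A' B' a') (Plus A B)"
proof (rule jtmI[OF j_plus[OF A B]], unfold tms_def, intro allI impI)
  fix \<rho> \<rho>' assume c: "cx G \<rho> \<rho>'"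
  show "M (ct (Plus A B) \<rho>) (vs (InL A B a) \<rho>) (vs (InL A' B' a') \<rho>')"
    using tmsD[OF jtmD(3)[OF a] c] unfolding M_plus[OF jtyD(2)[OF jtyD(3)[OF A]] jtyD(2)[OF jtyD(3)[OF B]] c] by simp
qed
lemma j_inr: assumes A: "jty G A A'" and B: "jty G B B'" and a: "jtm G a a' B" shows "jtm G (InR A B a) (InR A' B' a') (Plus A B)"
proof (rule jtmI[OF j_plus[OF A B]], unfold tms_def, intro allI impI)
  fix \<rho> \<rho>' assume c: "cx G \<rho> \<rho>'"
  show "M (ct (Plus A B) \<rho>) (vs (InR A B a) \<rho>) (vs (InR A' B' a') \<rho>')"
    using tmsD[OF jtmD(3)[OF a] c] unfolding M_plus[OF jtyD(2)[OF jtyD(3)[OF A]] jtyD(2)[OF jtyD(3)[OF B]] c] by simp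
qed

lemma vs_Cases: "vs s \<rho> = smk 0 z \<Longrightarrow> vs (Cases A B C l r s) \<rho> = vs l (xc z \<rho>)"
  "vs s \<rho> = smk 1 z \<Longrightarrow> vs (Cases A B C l r s) \<rho> = vs r (xc z \<rho>)"
  using val_Cases[of s "\<rho> _" _ "z _"] by (auto simp: vs_def smk_def fun_eq_iff xc_def)

lemma j_cases: 
  assumes A: "jty G A A" and B: "jty G B B" and C: "jty (Plus A B # G) C C'"
    and l: "jtm (A # G) l l' (inst' C (InL (wk A) (wk B) (Var 0)))" and r: "jtm (B # G) r r' (inst' C (InR (wk A) (wk B) (Var 0)))"
    and s: "jtm G s s' (Plus A B)"
  shows "jtm G (Cases A B C l r s) (Cases A' B' C' l' r' s') (inst C s)"
proof (rule jtmI[OF j_inst[OF C s]], unfold tms_def, intro allI impI)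
  fix \<rho> \<rho>' assume c: "cx G \<rho> \<rho>'"
  from tmsD[OF jtmD(3)[OF s] c, unfolded M_plus[OF jtyD(2)[OF A] jtyD(2)[OF B] c]]
  consider a a' where "vs s \<rho> = smk 0 a" "vs s' \<rho>' = smk 0 a'" "M (ct A \<rho>) a a'"
    | a a' where "vs s \<rho> = smk 1 a" "vs s' \<rho>' = smk 1 a'" "M (ct B \<rho>) a a'" by blast
  then show "M (ct (inst C s) \<rho>) (vs (Cases A B C l r s) \<rho>) (vs (Cases A' B' C' l' r' s') \<rho>')"
  proof cases
    case 1
    then have "cx (A # G) (xc a \<rho>) (xc a' \<rho>')" using c unfolding cx_xc by blast
    from tmsD[OF jtmD(3)[OF l] this] show ?thesis by (simp add: ct_sub vs_Cases 1)
  next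
    case 2
    then have "cx (B # G) (xc a \<rho>) (xc a' \<rho>')" using c unfolding cx_xc by blast
    from tmsD[OF jtmD(3)[OF r] this] show ?thesis by (simp add: ct_sub vs_Cases(2) 2)
  qed
qed

lemma j_plus_beta1: 
  assumes C: "jty (Plus A B # G) C C" and l: "jtm (A # G) l l (inst' C (InL (wk A) (wk B) (Var 0)))" 
    and A: "jty G A A" and B: "jty G B B" and a: "jtm G a a A"
  shows "jtm G (Cases A B C l r (InL A B a)) (inst l a) (inst C (InL A B a))"
proof (rule jtmI[OF j_inst[OF C j_inl[OF A B a]]], unfold tms_def, intro allI impI)
  fix \<rho> \<rho>' assume c: "cx G \<rho> \<rho>'"
  then have "cx (A # G) (xc (vs a \<rho>) \<rho>) (xc (vs a \<rho>') \<rho>')" using tmsD[OF jtmD(3)[OF a]] unfolding cx_xc by blast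
  from tmsD[OF jtmD(3)[OF l] this] show "M (ct (inst C (InL A B a)) \<rho>) (vs (Cases A B C l r (InL A B a)) \<rho>) (vs (inst l a) \<rho>')" 
    by (simp add: ct_sub vs_sub vs_Cases)
qed
lemma j_plus_beta2: 
  assumes C: "jty (Plus A B # G) C C" and r: "jtm (B # G) r r (inst' C (InR (wk A) (wk B) (Var 0)))" 
    and A: "jty G A A" and B: "jty G B B" and a: "jtm G a a B"
  shows "jtm G (Cases A B C l r (InR A B a)) (inst r a) (inst C (InR A B a))"
proof (rule jtmI[OF j_inst[OF C j_inr[OF A B a]]], unfold tms_def, intro allI impI)
  fix \<rho> \<rho>' assume c: "cx G \<rho> \<rho>'"
  then have "cx (B # G) (xc (vs a \<rho>) \<rho>) (xc (vs a \<rho>') \<rho>')" using tmsD[OF jtmD(3)[OF a]] unfolding cx_xc by blast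
  from tmsD[OF jtmD(3)[OF r] this] show "M (ct (inst C (InR A B a)) \<rho>) (vs (Cases A B C l r (InR A B a)) \<rho>) (vs (inst r a) \<rho>')" 
    by (simp add: ct_sub vs_sub vs_Cases(2))
qed

subsection \<open>Identity types\<close>

lemma val_edeg: "val t (edeg \<rho>) = dbl (cl t (edeg \<rho>))"
  by (simp add: val_def dbl_def)

lemma ct_deep: "ct A (xc v (xc w (sedeg \<rho>))) = ct A (xc v (xc w \<rho>))" "ct A (xc v (xc (sdeg w) \<rho>)) = ct A (xc v (xc w \<rho>))"
  by (auto simp: ct_def sedeg_def xc_def sdeg_def fun_eq_iff)

lemma ends_refl: "e0 (vs (Refl A a) \<rho>) = sdeg (vs a \<rho>)" "e1 (vs (Refl A a) \<rho>) = sdeg (vs a \<rho>)"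
  by (simp_all add: seq_defs vs_def fun_eq_iff val_edeg)

abbreviation dia :: "nat \<Rightarrow> nat" where "dia \<equiv> jn (\<lambda>n. n) (\<lambda>n. n)"
lemma jn_dia: "jn w w = w \<circ> dia" by (simp add: jn_o)

lemma j_rfl: 
  assumes A: "jty G A A'" and a: "jtm G a a' A" shows "jtm G (Refl A a) (Refl A' a') (Eq A a a)"
proof (rule jtmI[OF j_eq[OF A a a]], unfold tms_def, intro allI impI)
  fix \<rho> \<rho>' assume c: "cx G \<rho> \<rho>'"
  note G = jtyD(1)[OF A] and t = tysD[OF jtyD(2)[OF jtyD(3)[OF A]] c]
  note m = tmsD[OF jtmD(3)[OF a] c]
  note d = M_deg[OF t m] and mm = M_refl(1)[OF t m]
  show "M (ct (Eq A a a) \<rho>) (vs (Refl A a) \<rho>) (vs (Refl A' a') \<rho>')"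
    unfolding ct_simps M_eq[OF t mm mm] ends_refl jn_dia[of "sdeg _"]
    using vs_ord[OF G c] M_refl(1)[OF t d] M_sym[OF t d] M_reindex[OF t d, of dia] by simp
qed

lemma J_ctx:
  assumes A: "jty G A A" and c: "cx G \<rho> \<rho>'" and x: "M (ct A \<rho>) x x'" and y: "M (ct A \<rho>) y y'"
    and q: "\<And>n. ord (q n) \<and> ord (q' n)" "M (ct A \<rho>) (e0 q) (sdeg x)" "M (ct A \<rho>) (e1 q) (sdeg y)" 
      "M (ct A \<rho>) (e0 q') (sdeg x)" "M (ct A \<rho>) (e1 q') (sdeg y)"
      "M (ct A \<rho> \<circ> dia) (jn (e0 q) (e1 q)) (jn (e0 q') (e1 q'))"
  shows "cx (Eq (wk (wk A)) (Var 1) (Var 0) # wk A # A # G) (xc q (xc y (xc x \<rho>))) (xc q' (xc y' (xc x' \<rho>')))"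
proof -
  note t = tysD[OF jtyD(2)[OF A] c]
  have "M (ct (Eq (wk (wk A)) (Var 1) (Var 0)) (xc y (xc x \<rho>))) q q'"
    unfolding ct_simps One_nat_def vs_simps wk_simps M_eq[OF t M_refl(1)[OF t x] M_refl(1)[OF t y]] using q by blast
  then show ?thesis using c x y unfolding cx_xc wk_simps by blast
qed

text \<open>The constant path at the first entry of \<open>p\<close>, not at the end point
  \<open>a\<close>: the two are equal, but only the entry is linked to the second entry of
  \<open>p\<close>.\<close>

definition conn :: "sq \<Rightarrow> sq" where "conn p = (\<lambda>n. dbl (dbl (p1 (p1 (p n)))))"

lemma ends_conn: "e0 (conn p) = e0 p" "e1 (conn p) = e0 p" "ord (conn p n)"
  by (simp_all add: conn_def seq_defs)
lemma sdeg_e: "sdeg (conn p) = conn p" "sdeg (e0 p) = e0 p" "sdeg (e1 p) = e1 p"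
  by (simp_all add: conn_def seq_defs)
lemma conn_refl: "conn (vs (Refl A a) \<rho>) = sdeg (vs (Refl A a) \<rho>)"
  by (simp add: conn_def seq_defs vs_def val_edeg fun_eq_iff)

lemma vs_J: "vs (J A C d a b p) \<rho> = (\<lambda>n. TRW
    (ct C (xc (conn (vs p \<rho>)) (xc (e0 (vs p \<rho>)) (xc (vs a \<rho>) \<rho>))) n) (ct C (xc (vs p \<rho>) (xc (e1 (vs p \<rho>)) (xc (vs a \<rho>) \<rho>))) n)
    (vs d (xc (vs a \<rho>) \<rho>) n))"
  by (rule ext, rule dom_eqI) (simp_all add: vs_def ct_def xc_def conn_def seq_defs val_edeg flip: val_def, simp_all add: val_def dbl_def deg_def)

text \<open>Contraction of the singleton: the interleaving of the constant path with
  \<open>p\<close> in the context of the motive. Even positions hold the start, odd positions the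
  path itself, and both halves are linked through the link inside \<open>p\<close>.\<close>

definition kap :: "sq \<Rightarrow> sq \<Rightarrow> (nat \<Rightarrow> env) \<Rightarrow> nat \<Rightarrow> env" where
  "kap p a \<rho> = xc (jn (conn p) (sdeg p)) (xc (jn (e0 p) (e1 p)) (xc (jn (sdeg a) (sdeg a)) (sedeg \<rho> \<circ> dia)))"

lemma kap_sides:
  "kap p a \<rho> \<circ> (*) 2 = xc (conn p) (xc (e0 p) (xc (sdeg a) (sedeg \<rho>)))"
  "kap p a \<rho> \<circ> (\<lambda>n. Suc (2 * n)) = xc (sdeg p) (xc (e1 p) (xc (sdeg a) (sedeg \<rho>)))"
  "ct C (kap p a \<rho>) \<circ> (*) 2 = ct C (xc (conn p) (xc (e0 p) (xc a \<rho>)))"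
  "ct C (kap p a \<rho>) \<circ> (\<lambda>n. Suc (2 * n)) = ct C (xc p (xc (e1 p) (xc a \<rho>)))"
proof -
  show kl: "kap p a \<rho> \<circ> (*) 2 = xc (conn p) (xc (e0 p) (xc (sdeg a) (sedeg \<rho>)))"
        "kap p a \<rho> \<circ> (\<lambda>n. Suc (2 * n)) = xc (sdeg p) (xc (e1 p) (xc (sdeg a) (sedeg \<rho>)))"
    unfolding kap_def by (simp_all add: env_o(3)[symmetric] o_assoc[symmetric] del: env_deg)
  have 1: "xc (conn p) (xc (e0 p) (xc (sdeg a) (sedeg \<rho>))) = sedeg (xc (conn p) (xc (e0 p) (xc a \<rho>)))"
    by (simp only: env_deg(3)[symmetric] sdeg_e)
  have 2: "xc (sdeg p) (xc (e1 p) (xc (sdeg a) (sedeg \<rho>))) = sedeg (xc p (xc (e1 p) (xc a \<rho>)))"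
    by (simp only: env_deg(3)[symmetric] sdeg_e)
  show "ct C (kap p a \<rho>) \<circ> (*) 2 = ct C (xc (conn p) (xc (e0 p) (xc a \<rho>)))"
    "ct C (kap p a \<rho>) \<circ> (\<lambda>n. Suc (2 * n)) = ct C (xc p (xc (e1 p) (xc a \<rho>)))"
    unfolding env_o(1)[symmetric] kl 1 2 by simp_all
qed

text \<open>The base case lives over the even half of the contraction, and the value of
  \<open>J\<close> is its transport to the odd half, which is the motive at \<open>p\<close>. The
  second conclusion, that both form one clique, also describes how terms defined by \<open>J\<close>
  behave along a path.\<close>

lemma J_clique:
  assumes A: "jty G A A" and C: "jty (Eq (wk (wk A)) (Var 1) (Var 0) # wk A # A # G) C C'"
    and d: "jtm (A # G) d d' (instd A C)" and a: "jtm G a a' A" and b: "jtm G b b' A" and p: "jtm G p p' (Eq A a b)"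
    and c: "cx G \<rho> \<rho>'"
  shows "cx (Eq (wk (wk A)) (Var 1) (Var 0) # wk A # A # G) (kap (vs p \<rho>) (vs a \<rho>) \<rho>) (kap (vs p' \<rho>') (vs a' \<rho>') \<rho>')"
    "M (ct C (kap (vs p \<rho>) (vs a \<rho>) \<rho>)) (jn (vs d (xc (vs a \<rho>) \<rho>)) (vs (J A C d a b p) \<rho>))
       (jn (vs d' (xc (vs a' \<rho>') \<rho>')) (vs (J A' C' d' a' b' p') \<rho>'))"
    "tyeq False (ct C (kap (vs p \<rho>) (vs a \<rho>) \<rho>) \<circ> (\<lambda>n. Suc (2 * n))) (ct (inst3 C a b p) \<rho>)"
proof -
  note G = jtyD(1)[OF A] and CC = jtyD(2)[OF jtyD(3)[OF C]]
  let ?a = "vs a \<rho>" and ?a' = "vs a' \<rho>'" and ?b = "vs b \<rho>" and ?b' = "vs b' \<rho>'" and ?p = "vs p \<rho>" and ?p' = "vs p' \<rho>'"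
  note t = tysD[OF jtyD(2)[OF A] c]
  note ma = tmsD[OF jtmD(3)[OF a] c] and mb = tmsD[OF jtmD(3)[OF b] c]
  note mp = tmsD[OF jtmD(3)[OF p] c, unfolded ct_simps M_eq[OF t M_refl(1)[OF t ma] M_refl(1)[OF t mb]]]
  have o: "ord (?p n)" "ord (?p' n)" for n using mp by blast+
  have E: "M (ct A \<rho>) (e0 ?p) (sdeg ?a)" "M (ct A \<rho>) (e1 ?p) (sdeg ?b)" "M (ct A \<rho>) (e0 ?p') (sdeg ?a)" "M (ct A \<rho>) (e1 ?p') (sdeg ?b)"
    and Y: "M (ct A \<rho> \<circ> dia) (jn (e0 ?p) (e1 ?p)) (jn (e0 ?p') (e1 ?p'))" using mp by blast+
  note da = M_deg[OF t ma] and db = M_deg[OF t mb]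
  note daa = M_refl(1)[OF t da] and dbb = M_refl(1)[OF t db]
  have cd: "cx G (sedeg \<rho>) (sedeg \<rho>')" by (rule cx_deg[OF G c])
  have cD: "cx G (sedeg \<rho> \<circ> dia) (sedeg \<rho>' \<circ> dia)" by (rule cx_reindex[OF G cd])
  note tD = tyeq_reindex[OF t, of dia]
  have sj: "sdeg (jn x y) = jn (sdeg x) (sdeg y)" for x y by (rule jn_push(3))
  let ?q = "\<lambda>p. jn (conn p) (sdeg p)" and ?y = "\<lambda>p. jn (e0 p) (e1 p)" and ?x = "\<lambda>a. jn (sdeg a) (sdeg a)"
  have eq: "e0 (?q p) = jn (e0 p) (e0 p)" "e1 (?q p) = ?y p" for p
    by (simp_all add: jn_push ends_conn sdeg_push)
  have sy: "sdeg (?y p) = ?y p" for p by (simp add: jn_push) (simp add: seq_defs)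
  have xx: "M (ct A \<rho> \<circ> dia) (?x ?a) (?x ?a')" unfolding jn_dia[of "sdeg _"] by (rule M_reindex[OF t da])
  have pq: "M (ct A \<rho> \<circ> dia) (jn (e0 ?p) (e0 ?p)) (sdeg (?x ?a))" "M (ct A \<rho> \<circ> dia) (jn (e0 ?p') (e0 ?p')) (sdeg (?x ?a))"
    unfolding jn_dia[of "e0 _"] using M_reindex[OF t E(1), of dia] M_reindex[OF t E(3), of dia] by (simp_all add: jn_push sdeg_push jn_o)
  have kk: "M ((ct A \<rho> \<circ> dia) \<circ> dia) (jn (jn (e0 ?p) (e0 ?p)) (?y ?p)) (jn (jn (e0 ?p') (e0 ?p')) (?y ?p'))"
  proof -
    \<comment> \<open>The square with edges \<open>e0\<close>, \<open>e0\<close> and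
      \<open>e0\<close>, \<open>e1\<close> is the path itself with positions repeated: the first
      half reads the even positions twice, the second half reads all of them.\<close>
    let ?l = "jn (jn ((*) 2) ((*) 2)) (\<lambda>n. n) :: nat \<Rightarrow> nat"
    have l: "jn (jn (e0 p) (e0 p)) (?y p) = ?y p \<circ> ?l" for p by (simp only: jn_o jn_comp)
    have "dia \<circ> ?l = dia \<circ> dia" by (simp only: jn_o jn_comp)
    then show ?thesis unfolding l using M_reindex[OF tD Y, of ?l] by (simp only: o_assoc[symmetric])
  qed
  show K: "cx (Eq (wk (wk A)) (Var 1) (Var 0) # wk A # A # G) (kap ?p ?a \<rho>) (kap ?p' ?a' \<rho>')"
    unfolding kap_def
  proof (rule J_ctx[OF A cD], unfold env_o(1) env_deg(1) eq sy)
    show "ord (?q ?p n) \<and> ord (?q ?p' n)" for n by (simp add: jn_def ends_conn sdeg_def)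
  qed (fact xx Y pq kk M_refl(1)[OF tD Y] M_sym[OF tD Y])+
  let ?T = "ct C (kap ?p ?a \<rho>)" and ?T' = "ct C' (kap ?p' ?a' \<rho>')"
  note T = tysD[OF jtyD(2)[OF C] K]
  let ?d = "vs d (xc ?a \<rho>)" and ?d' = "vs d' (xc ?a' \<rho>')"
  have J: "vs (J A C d a b p) \<rho> = sTR ?T ((*) 2) (\<lambda>n. Suc (2 * n)) ?d" "vs (J A' C' d' a' b' p') \<rho>' = sTR ?T' ((*) 2) (\<lambda>n. Suc (2 * n)) ?d'"
    unfolding vs_J kap_sides(3,4)[symmetric] by (simp_all add: sTR_def)
  have ca: "cx (A # G) (xc ?a \<rho>) (xc ?a' \<rho>')" using c ma unfolding cx_xc by blast
  have cr: "M (ct A \<rho> \<circ> dia) (jn (e0 ?p) (e0 ?p)) (jn (sdeg ?a) (sdeg ?a))"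
    unfolding jn_dia[of "sdeg _"] jn_dia[of "e0 _"] by (rule M_reindex[OF t E(1)])
  \<comment> \<open>The constant path at the first entry of \<open>p\<close> equals reflexivity at
    \<open>a\<close>, so the even half carries the type of the base case.\<close>
  have C0: "cx (Eq (wk (wk A)) (Var 1) (Var 0) # wk A # A # G) (xc (conn ?p) (xc (e0 ?p) (xc (sdeg ?a) (sedeg \<rho>))))
     (xc (sdeg (vs (Refl (wk A) (Var 0)) (xc ?a \<rho>))) (xc (sdeg ?a) (xc (sdeg ?a) (sedeg \<rho>))))"
  proof (rule J_ctx[OF A cx_refl(1)[OF G cd]], unfold env_deg(1) sdeg_push(7,8) ends_refl ends_conn vs_simps sdeg_push(6))
    show "ord (conn ?p n) \<and> ord (sdeg (vs (Refl (wk A) (Var 0)) (xc ?a \<rho>)) n)" for n by (simp add: ends_conn sdeg_def)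
    show "M (ct A \<rho>) (e0 ?p) (sdeg (e0 ?p))" "M (ct A \<rho>) (sdeg ?a) (sdeg (e0 ?p))"
      using M_refl(1)[OF t E(1)] M_sym[OF t E(1)] by (simp_all add: seq_defs)
  qed (fact daa E(1) cr)+
  have c0: "tyeq False (?T \<circ> (*) 2) (ct (instd A C) (xc ?a \<rho>))"
    using tysD[OF CC C0] unfolding env_o(1)[symmetric] kap_sides(1) ct_sub by simp
  have "RR ?T ((*) 2) ?d ?d'"
    using tmsD[OF jtmD(3)[OF d] ca] unfolding M_conv[OF c0] M_re[OF T] .
  from trokD[OF tyeqD(5)[OF T], OF this, of "\<lambda>n. Suc (2 * n)"]
  show "M ?T (jn ?d (vs (J A C d a b p) \<rho>)) (jn ?d' (vs (J A' C' d' a' b' p') \<rho>'))"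
    unfolding J M_def jn_id .
  have C1: "cx (Eq (wk (wk A)) (Var 1) (Var 0) # wk A # A # G) (xc ?p (xc (e1 ?p) (xc (sdeg ?a) (sedeg \<rho>))))
     (xc ?p (xc (sdeg ?b) (xc (sdeg ?a) (sedeg \<rho>))))"
  proof (rule J_ctx[OF A cx_refl(1)[OF G cd]], unfold env_deg(1) sdeg_push(6))
    show "ord (?p n) \<and> ord (?p n)" for n using o by simp
    show "M (ct A \<rho>) (e1 ?p) (sdeg (e1 ?p))" "M (ct A \<rho>) (e1 ?p) (sdeg (e1 ?p))"
      using M_refl(1)[OF t E(2)] by (simp_all add: seq_defs)
  qed (fact daa E(1,2) M_refl(1)[OF tD Y])+
  show "tyeq False (?T \<circ> (\<lambda>n. Suc (2 * n))) (ct (inst3 C a b p) \<rho>)"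
    using tysD[OF CC C1] unfolding kap_sides(4) ct_sub by (simp add: ct_deep)
qed

lemma j_jay:
  assumes A: "jty G A A" and C: "jty (Eq (wk (wk A)) (Var 1) (Var 0) # wk A # A # G) C C'"
    and d: "jtm (A # G) d d' (instd A C)" and a: "jtm G a a' A" and b: "jtm G b b' A" and p: "jtm G p p' (Eq A a b)"
  shows "jtm G (J A C d a b p) (J A' C' d' a' b' p') (inst3 C a b p)"
proof -
  note G = jtyD(1)[OF A] and CC = jtyD(2)[OF jtyD(3)[OF C]]
  have body: "tyeq False (ct (inst3 C a b p) \<rho>) (ct (inst3 C a b p) \<rho>') \<and>
      M (ct (inst3 C a b p) \<rho>) (vs (J A C d a b p) \<rho>) (vs (J A' C' d' a' b' p') \<rho>')" if c: "cx G \<rho> \<rho>'" for \<rho> \<rho>'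
  proof -
    note K = J_clique[OF A C d a b p c]
    from M_reindex[OF tysD[OF jtyD(2)[OF C] K(1)] K(2), of "\<lambda>n. Suc (2 * n)"]
    have J: "M (ct (inst3 C a b p) \<rho>) (vs (J A C d a b p) \<rho>) (vs (J A' C' d' a' b' p') \<rho>')"
      unfolding M_conv[OF K(3)] by simp
    have "cx (Eq (wk (wk A)) (Var 1) (Var 0) # wk A # A # G) (xc (vs p \<rho>) (xc (vs b \<rho>) (xc (vs a \<rho>) \<rho>))) (xc (vs p \<rho>') (xc (vs b \<rho>') (xc (vs a \<rho>') \<rho>')))"
      using c tmsD[OF jtmD(3)[OF jtmD(5)[OF a]] c] tmsD[OF jtmD(3)[OF jtmD(5)[OF b]] c] tmsD[OF jtmD(3)[OF jtmD(5)[OF p]] c]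
      unfolding cx_xc wk_simps ct_simps One_nat_def vs_simps by blast
    from tysD[OF CC this] J show ?thesis unfolding ct_sub by blast
  qed
  then show ?thesis using G unfolding jtm_def tys_def tms_def by blast
qed

text \<open>At reflexivity the motive at the start and at the end of the contraction are the same
  code, since they depend on actual parts only; the transport is then the identity by
  \<open>trid\<close>.\<close>

lemma j_jay_beta:
  assumes A: "jty G A A" and C: "jty (Eq (wk (wk A)) (Var 1) (Var 0) # wk A # A # G) C C"
    and d: "jtm (A # G) d d (instd A C)" and a: "jtm G a a A"
  shows "jtm G (J A C d a a (Refl A a)) (inst d a) (inst3 C a a (Refl A a))"
proof -
  note G = jtyD(1)[OF A]
  have body: "tyeq False (ct (inst3 C a a (Refl A a)) \<rho>) (ct (inst3 C a a (Refl A a)) \<rho>') \<and>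
      M (ct (inst3 C a a (Refl A a)) \<rho>) (vs (J A C d a a (Refl A a)) \<rho>) (vs (inst d a) \<rho>')" if c: "cx G \<rho> \<rho>'" for \<rho> \<rho>'
  proof -
    let ?a = "vs a \<rho>" and ?p = "vs (Refl A a) \<rho>"
    have ca: "cx (A # G) (xc ?a \<rho>) (xc (vs a \<rho>') \<rho>')" using c tmsD[OF jtmD(3)[OF a] c] unfolding cx_xc by blast
    have r: "vs (Refl (wk A) (Var 0)) (xc (vs a \<rho>) \<rho>) = vs (Refl A a) \<rho>" for \<rho> 
      by (simp add: vs_def xc_def val_def)
    have K: "ct (instd A C) (xc (vs a \<rho>) \<rho>) = ct (inst3 C a a (Refl A a)) \<rho>" for \<rho> unfolding ct_sub r ..
    let ?K = "ct (inst3 C a a (Refl A a)) \<rho>" and ?d = "vs d (xc ?a \<rho>)"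
    note T = tysD[OF jtmD(2)[OF d] ca, unfolded K] and m = tmsD[OF jtmD(3)[OF d] ca, unfolded K]
    have "sedeg (xc (conn ?p) (xc (e0 ?p) (xc ?a \<rho>))) = sedeg (xc ?p (xc ?a (xc ?a \<rho>)))"
      "sedeg (xc ?p (xc (e1 ?p) (xc ?a \<rho>))) = sedeg (xc ?p (xc ?a (xc ?a \<rho>)))"
      by (simp_all only: env_deg(3)[symmetric] sdeg_e ends_refl sdeg_push(6) conn_refl)
    then have k: "ct C (xc (conn ?p) (xc (e0 ?p) (xc ?a \<rho>))) = ?K" "ct C (xc ?p (xc (e1 ?p) (xc ?a \<rho>))) = ?K"
      unfolding ct_sub by (metis env_deg(1))+
    have J: "vs (J A C d a a (Refl A a)) \<rho> = sTR ?K (\<lambda>n. n) (\<lambda>n. n) ?d"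
      unfolding vs_J k by (simp add: sTR_def)
    have "RR ?K (\<lambda>n. n) ?d ?d" using M_refl(1)[OF T m] by (simp add: M_def)
    from rel_jn(2)[OF tyeqD(8)[OF T], OF tridD[OF goodD(3)[OF tyeqD(3)[OF T]], OF this]]
    have "M ?K (vs (J A C d a a (Refl A a)) \<rho>) ?d" unfolding J M_def .
    from M_trans[OF T this m] T show ?thesis unfolding vs_sub by blast
  qed
  then show ?thesis using G unfolding jtm_def tys_def tms_def by blast
qed

lemma j_axm:
  assumes ax: "\<And>A. A \<in> T \<Longrightarrow> jty [] A A \<Longrightarrow> tms [] (Axm A) (Axm A) A"
    and G: "wfc G" and A: "A \<in> T" "jty [] A A" 
  shows "jtm G (Axm A) (Axm A) A"
  using ax[OF A] A(2) G cx_nil[OF G] unfolding jtm_def jty_def tys_def tms_def by blast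

text \<open>The rule lemmas are stated for equality judgments. Typing is the case of equal sides, so
  the same lemma serves a rule and its congruence rule.\<close>

lemma soundness:
  assumes ax: "\<And>A. A \<in> T \<Longrightarrow> jty [] A A \<Longrightarrow> tms [] (Axm A) (Axm A) A"
  shows "T \<rhd> G \<turnstile> ctx \<Longrightarrow> wfc G" "T \<rhd> G \<turnstile> A type \<Longrightarrow> jty G A A" "T \<rhd> G \<turnstile> A \<doteq> B type \<Longrightarrow> jty G A B"
    "T \<rhd> G \<turnstile> a \<Colon> A \<Longrightarrow> jtm G a a A" "T \<rhd> G \<turnstile> a \<doteq> b \<Colon> A \<Longrightarrow> jtm G a b A"
  apply (induction rule: is_ctx_is_ty_eq_ty_has_ty_eq_tm.inducts)
  apply simp
  apply (rule j_ctx_cons; assumption)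
  apply (rule j_var; assumption)
  apply (rule j_axm[OF ax]; assumption)
  apply assumption
  apply (rule j_ty_sym; assumption)
  apply (rule j_ty_trans; assumption)
  apply assumption
  apply (rule j_tm_sym; assumption)
  apply (rule j_tm_trans; assumption)
  apply (rule j_conv; assumption)
  apply (rule j_conv; assumption)
  apply (rule j_univ_ty; assumption)
  apply (rule j_el; assumption)
  apply (rule j_el; assumption)
  apply (rule j_pi; assumption)
  apply (rule j_pi_u; assumption)
  apply (rule j_lam; assumption)
  apply (rule j_app; assumption)
  apply (rule j_pi; assumption)
  apply (rule j_pi_u; assumption)
  apply (rule j_lam; assumption)
  apply (rule j_app; assumption)
  apply (rule j_pi_beta; assumption)
  apply (rule j_pi_eta; assumption)
  apply (rule j_sig; assumption)
  apply (rule j_sig_u; assumption)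
  apply (rule j_mkpair; assumption)
  apply (rule j_proj1; assumption)
  apply (rule j_proj2; assumption)
  apply (rule j_sig; assumption)
  apply (rule j_sig_u; assumption)
  apply (rule j_mkpair; assumption)
  apply (rule j_proj1; assumption)
  apply (rule j_proj2; assumption)
  apply (rule j_sig_beta1; assumption)
  apply (rule j_sig_beta2; assumption)
  apply (rule j_sig_eta; assumption)
  apply (rule j_one; assumption)
  apply (rule j_one_u; assumption)
  apply (rule j_star; assumption)
  apply (rule j_one_tm[OF jtmD(1)]; assumption)
  apply (rule j_zero; assumption)
  apply (rule j_zero_u; assumption)
  apply (rule j_abort; assumption)
  apply (rule j_abort; assumption)
  apply (rule j_plus; assumption)
  apply (rule j_plus_u; assumption)
  apply (rule j_inl; assumption)
  apply (rule j_inr; assumption)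
  apply (rule j_cases; assumption)
  apply (rule j_plus; assumption)
  apply (rule j_plus_u; assumption)
  apply (rule j_inl; assumption)
  apply (rule j_inr; assumption)
  apply (rule j_cases; assumption)
  apply (rule j_plus_beta1; assumption)
  apply (rule j_plus_beta2; assumption)
  apply (rule j_eq; assumption)
  apply (rule j_eq_u; assumption)
  apply (rule j_rfl; assumption)
  apply (rule j_jay; assumption)
  apply (rule j_eq; assumption)
  apply (rule j_eq_u; assumption)
  apply (rule j_rfl; assumption)
  apply (rule j_jay; assumption)
  apply (rule j_jay_beta; assumption)
  done

section \<open>Typing of the derived notions\<close>

abbreviation jt :: "tm list \<Rightarrow> tm \<Rightarrow> bool" where "jt G A \<equiv> jty G A A"
abbreviation jm :: "tm list \<Rightarrow> tm \<Rightarrow> tm \<Rightarrow> bool" where "jm G a A \<equiv> jtm G a a A"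

lemma upr_simps: "upr r 0 = 0" "upr r (Suc n) = Suc (r n)" by (simp_all add: upr_def)
lemma ups_simps: "ups s 0 = Var 0" "ups s (Suc n) = wk (s n)" by (simp_all add: ups_def)
lemmas cl_rules = cl_ren cl_sub inst_def inst'_def inst3_def instd_def case_val ec_upr val_eqs val_ren upr_simps ups_simps ec_ups

text \<open>Only the value of a type matters. Laws of substitution for raw syntax are hence replaced
  by computing both sides in the model.\<close>

lemma jtm_cong: "jtm G a b A \<Longrightarrow> cl A = cl A' \<Longrightarrow> jtm G a b A'"
  by (simp add: jtm_def tys_def tms_def ct_def)

lemma jty_wk: assumes B: "jty G B B'" and A: "jt G A" shows "jty (A # G) (wk B) (wk B')"
  unfolding jty_def tys_def
proof (intro conjI allI impI)
  show "wfc (A # G)" using A by (simp add: jty_def)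
  fix \<rho> \<rho>' assume "cx (A # G) \<rho> \<rho>'"
  then show "tyeq False (ct (wk B) \<rho>) (ct (wk B') \<rho>')"
    by (rule cxE) (simp, rule tysD[OF jtyD(2)[OF B]])
qed
lemma jtm_wk: assumes b: "jtm G b b' B" and A: "jt G A" shows "jtm (A # G) (wk b) (wk b') (wk B)"
proof (rule jtmI[OF jty_wk[OF jtmD(4)[OF b] A]], unfold tms_def, intro allI impI)
  fix \<rho> \<rho>' assume "cx (A # G) \<rho> \<rho>'"
  then show "M (ct (wk B) \<rho>) (vs (wk b) \<rho>) (vs (wk b') \<rho>')"
    by (rule cxE) (simp, rule tmsD[OF jtmD(3)[OF b]])
qed
lemma jty_wk1: assumes B: "jty (A # G) B B'" and X: "jt G X" shows "jty (wk A # X # G) (wk1 B) (wk1 B')"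
  unfolding jty_def tys_def
proof (intro conjI allI impI)
  have A: "jt G A" using jtyD(1)[OF B] by (simp add: jty_def)
  show "wfc (wk A # X # G)" using jty_wk[OF A X] by (simp add: jty_def)
  fix \<rho> \<rho>' assume "cx (wk A # X # G) \<rho> \<rho>'"
  then obtain w w' \<sigma> \<sigma>' where 1: "\<rho> = xc w \<sigma>" "\<rho>' = xc w' \<sigma>'" "cx (X # G) \<sigma> \<sigma>'" "M (ct (wk A) \<sigma>) w w'" by (rule cxE)
  from 1(3) obtain v v' \<tau> \<tau>' where 2: "\<sigma> = xc v \<tau>" "\<sigma>' = xc v' \<tau>'" "cx G \<tau> \<tau>'" by (rule cxE)
  have "cx (A # G) (xc w \<tau>) (xc w' \<tau>')" using 1 2 unfolding cx_xc by simp
  from tysD[OF jtyD(2)[OF B] this] show "tyeq False (ct (wk1 B) \<rho>) (ct (wk1 B') \<rho>')" unfolding 1 2 by simp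
qed

lemma t_ctx: "jt G A \<Longrightarrow> wfc (A # G)" by (simp add: jty_def)
lemma t_univ: "jt G A \<Longrightarrow> jt G Univ" by (rule j_univ_ty) (rule jtyD(1))
lemma t_univ': "jt G A \<Longrightarrow> jt (A # G) Univ" by (rule j_univ_ty) (rule t_ctx)

lemma t_var0: assumes A: "jt G A" shows "jm (A # G) (Var 0) (wk A)"
  by (rule jtm_cong[OF j_var[OF t_ctx[OF A], of 0]]) simp_all

lemma t_wk_univ: "jm G A Univ \<Longrightarrow> jt G X \<Longrightarrow> jm (X # G) (wk A) Univ"
  using jtm_wk[of G A A Univ X] by simp

lemma t_arr: assumes A: "jt G A" and B: "jt G B" shows "jt G (arr A B)"
  by (rule j_pi[OF A jty_wk[OF B A]])
lemma t_arr_u: assumes A: "jm G A Univ" and B: "jm G B Univ" shows "jm G (arr A B) Univ"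
  by (rule j_pi_u[OF A t_wk_univ[OF B j_el[OF A]]])
lemma t_times: assumes A: "jt G A" and B: "jt G B" shows "jt G (times A B)"
  by (rule j_sig[OF A jty_wk[OF B A]])
lemma t_times_u: assumes A: "jm G A Univ" and B: "jm G B Univ" shows "jm G (times A B) Univ"
  by (rule j_sig_u[OF A t_wk_univ[OF B j_el[OF A]]])

lemma t_ap: assumes A: "jt G A" and B: "jt G B" and f: "jm G f (arr A B)" and a: "jm G a A" shows "jm G (ap A B f a) B"
  by (rule jtm_cong[OF j_app[OF A jty_wk[OF B A] f a]]) (rule ext, simp add: cl_rules)

lemma t_lam: assumes A: "jt G A" and B: "jt G B" and t: "jm (A # G) t (wk B)" shows "jm G (Lam A (wk B) t) (arr A B)"
  by (rule j_lam[OF A A jty_wk[OF B A] t])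

lemma t_idfun: assumes A: "jt G A" shows "jm G (idfun A) (arr A A)"
  unfolding idfun_def by (rule t_lam[OF A A t_var0[OF A]])

lemma t_wk_arr: assumes f: "jm G f (arr A B)" and X: "jt G X" shows "jm (X # G) (wk f) (arr (wk A) (wk B))"
  by (rule jtm_cong[OF jtm_wk[OF f X]]) (rule ext, simp add: cl_rules)

lemma t_comp: assumes A: "jt G A" and B: "jt G B" and C: "jt G C" and g: "jm G g (arr B C)" and f: "jm G f (arr A B)"
  shows "jm G (comp A B C g f) (arr A C)"
  unfolding comp_def
  by (rule t_lam[OF A C], rule t_ap[OF jty_wk[OF B A] jty_wk[OF C A] t_wk_arr[OF g A]],
      rule t_ap[OF jty_wk[OF A A] jty_wk[OF B A] t_wk_arr[OF f A] t_var0[OF A]])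

lemma t_at: assumes A: "jt G A" and B: "jt (A # G) B" and f: "jm G f (Pi A B)" shows "jm (A # G) (App (wk A) (wk1 B) (wk f) (Var 0)) B"
proof -
  have "jm (A # G) (wk f) (Pi (wk A) (wk1 B))" using jtm_wk[OF f A] by simp
  from j_app[OF jty_wk[OF A A] jty_wk1[OF B A] this t_var0[OF A]]
  have "ec (\<rho> 0) (\<lambda>n. \<rho> (Suc n)) = \<rho>" for \<rho> :: env by (auto simp: ec_def fun_eq_iff split: nat.split)
  then show ?thesis using \<open>jm _ _ (inst _ _)\<close> by - (rule jtm_cong, assumption, rule ext, simp add: cl_rules)
qed

lemma t_htpy: assumes A: "jt G A" and B: "jt (A # G) B" and f: "jm G f (Pi A B)" and g: "jm G g (Pi A B)" shows "jt G (htpy A B f g)"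
  unfolding htpy_def by (rule j_pi[OF A j_eq[OF B t_at[OF A B f] t_at[OF A B g]]])

lemma t_htpy_arr: assumes A: "jt G A" and B: "jt G B" and f: "jm G f (arr A B)" and g: "jm G g (arr A B)" shows "jt G (htpy A (wk B) f g)"
  by (rule t_htpy[OF A jty_wk[OF B A] f g])

lemma t_sec: assumes A: "jt G A" and B: "jt G B" and f: "jm G f (arr A B)"
  shows "jt (arr B A # G) (htpy (wk B) (wk (wk B)) (comp (wk B) (wk A) (wk B) (wk f) (Var 0)) (idfun (wk B)))"
    "jt (arr B A # G) (htpy (wk A) (wk (wk A)) (comp (wk A) (wk B) (wk A) (Var 0) (wk f)) (idfun (wk A)))"
proof -
  have R: "jt G (arr B A)" by (rule t_arr[OF B A])
  note A' = jty_wk[OF A R] and B' = jty_wk[OF B R] and f' = t_wk_arr[OF f R]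
  have v: "jm (arr B A # G) (Var 0) (arr (wk B) (wk A))"
    by (rule jtm_cong[OF t_var0[OF R]]) (rule ext, simp add: cl_rules)
  show "jt (arr B A # G) (htpy (wk B) (wk (wk B)) (comp (wk B) (wk A) (wk B) (wk f) (Var 0)) (idfun (wk B)))"
    by (rule t_htpy_arr[OF B' B' t_comp[OF B' A' B' f' v] t_idfun[OF B']])
  show "jt (arr B A # G) (htpy (wk A) (wk (wk A)) (comp (wk A) (wk B) (wk A) (Var 0) (wk f)) (idfun (wk A)))"
    by (rule t_htpy_arr[OF A' A' t_comp[OF A' B' A' v f'] t_idfun[OF A']])
qed

lemma t_is_equiv: assumes A: "jt G A" and B: "jt G B" and f: "jm G f (arr A B)" shows "jt G (is_equiv A B f)"
  unfolding is_equiv_def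
  by (rule t_times; rule j_sig[OF t_arr[OF B A]]) (rule t_sec[OF A B f])+

lemma t_fam: assumes I: "jm G I Univ" and A: "jm G A (arr I Univ)" shows "jm (I # G) (fam I A) Univ"
proof -
  note iI = j_el[OF I]
  show ?thesis
    by (rule t_ap[OF jty_wk[OF iI iI] t_univ'[OF iI] _ t_var0[OF iI]]) (use t_wk_arr[OF A iI] in simp)
qed

lemma t_hom: assumes I: "jm G I Univ" and A: "jm G A (arr I Univ)" and B: "jm G B (arr I Univ)" shows "jm G (hom I A B) Univ"
  unfolding hom_def by (rule j_pi_u[OF I t_arr_u[OF t_fam[OF I A] t_fam[OF I B]]])

lemma cl_wk_hom: "cl (wk (hom I A B)) = cl (hom (wk I) (wk A) (wk B))"
  by (rule ext) (simp add: cl_rules hom_def)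

lemma t_component: assumes I: "jm G I Univ" and A: "jm G A (arr I Univ)" and B: "jm G B (arr I Univ)" and f: "jm G f (hom I A B)"
  shows "jm (I # G) (component I A B f) (arr (fam I A) (fam I B))"
  by (rule t_at[OF j_el[OF I] j_el[OF t_arr_u[OF t_fam[OF I A] t_fam[OF I B]]] f[unfolded hom_def]])

lemma t_hom_id: assumes I: "jm G I Univ" and A: "jm G A (arr I Univ)" shows "jm G (hom_id I A) (hom I A A)"
proof -
  note F = j_el[OF t_fam[OF I A]]
  show ?thesis unfolding hom_id_def hom_def by (rule j_lam[OF j_el[OF I] j_el[OF I] t_arr[OF F F] t_idfun[OF F]])
qed

lemma t_hom_comp: assumes I: "jm G I Univ" and A: "jm G A (arr I Univ)" and B: "jm G B (arr I Univ)" and C: "jm G C (arr I Univ)"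
    and g: "jm G g (hom I B C)" and f: "jm G f (hom I A B)"
  shows "jm G (hom_comp I A B C g f) (hom I A C)"
proof -
  note FA = j_el[OF t_fam[OF I A]] and FB = j_el[OF t_fam[OF I B]] and FC = j_el[OF t_fam[OF I C]]
  show ?thesis unfolding hom_comp_def hom_def[of I A C]
    by (rule j_lam[OF j_el[OF I] j_el[OF I] t_arr[OF FA FC] t_comp[OF FA FB FC t_component[OF I B C g] t_component[OF I A B f]]])
qed

lemma t_wk_fam: assumes I: "jt G X" and A: "jm G A (arr I Univ)" shows "jm (X # G) (wk A) (arr (wk I) Univ)"
  using t_wk_arr[OF A I] by simp

lemma t_hom_sec_body: assumes I: "jm G I Univ" and A: "jm G A (arr I Univ)" and B: "jm G B (arr I Univ)" and f: "jm G f (hom I A B)"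
  shows "jm (hom I B A # G) (Eq (hom (wk I) (wk B) (wk B)) (hom_comp (wk I) (wk B) (wk A) (wk B) (wk f) (Var 0)) (hom_id (wk I) (wk B))) Univ"
    "jm (hom I B A # G) (Eq (hom (wk I) (wk A) (wk A)) (hom_comp (wk I) (wk A) (wk B) (wk A) (Var 0) (wk f)) (hom_id (wk I) (wk A))) Univ"
proof -
  note X = j_el[OF t_hom[OF I B A]]
  note I' = t_wk_univ[OF I X] and A' = t_wk_fam[OF X A] and B' = t_wk_fam[OF X B]
  have f': "jm (hom I B A # G) (wk f) (hom (wk I) (wk A) (wk B))" by (rule jtm_cong[OF jtm_wk[OF f X] cl_wk_hom])
  have v: "jm (hom I B A # G) (Var 0) (hom (wk I) (wk B) (wk A))" by (rule jtm_cong[OF t_var0[OF X] cl_wk_hom])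
  show "jm (hom I B A # G) (Eq (hom (wk I) (wk B) (wk B)) (hom_comp (wk I) (wk B) (wk A) (wk B) (wk f) (Var 0)) (hom_id (wk I) (wk B))) Univ"
    by (rule j_eq_u[OF t_hom[OF I' B' B'] t_hom_comp[OF I' B' A' B' f' v] t_hom_id[OF I' B']])
  show "jm (hom I B A # G) (Eq (hom (wk I) (wk A) (wk A)) (hom_comp (wk I) (wk A) (wk B) (wk A) (Var 0) (wk f)) (hom_id (wk I) (wk A))) Univ"
    by (rule j_eq_u[OF t_hom[OF I' A' A'] t_hom_comp[OF I' A' B' A' v f'] t_hom_id[OF I' A']])
qed

lemma t_hom_sec: assumes I: "jm G I Univ" and A: "jm G A (arr I Univ)" and B: "jm G B (arr I Univ)" and f: "jm G f (hom I A B)"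
  shows "jm G (hom_sec I A B f) Univ" "jm G (hom_ret I A B f) Univ"
  unfolding hom_sec_def hom_ret_def
  by (rule j_sig_u[OF t_hom[OF I B A]], rule t_hom_sec_body[OF I A B f])+

lemma t_iso_body: assumes I: "jm G I Univ" and A: "jm G A (arr I Univ)" and B: "jm G B (arr I Univ)"
  shows "jm (hom I A B # G) (hom_sec (wk I) (wk A) (wk B) (Var 0)) Univ" "jm (hom I A B # G) (hom_ret (wk I) (wk A) (wk B) (Var 0)) Univ"
proof -
  note X = j_el[OF t_hom[OF I A B]]
  note I' = t_wk_univ[OF I X] and A' = t_wk_fam[OF X A] and B' = t_wk_fam[OF X B]
  have v: "jm (hom I A B # G) (Var 0) (hom (wk I) (wk A) (wk B))" by (rule jtm_cong[OF t_var0[OF X] cl_wk_hom])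
  show "jm (hom I A B # G) (hom_sec (wk I) (wk A) (wk B) (Var 0)) Univ" "jm (hom I A B # G) (hom_ret (wk I) (wk A) (wk B) (Var 0)) Univ"
    by (rule t_hom_sec[OF I' A' B' v])+
qed

lemma t_iso: assumes I: "jm G I Univ" and A: "jm G A (arr I Univ)" and B: "jm G B (arr I Univ)" shows "jm G (iso I A B) Univ"
  unfolding iso_def by (rule j_sig_u[OF t_hom[OF I A B] t_times_u[OF t_iso_body[OF I A B]]])

lemma id_beta: "app (lam (\<lambda>i. lam (\<lambda>z. p2 z))) i = lam (\<lambda>z. p2 z)" "app (lam (\<lambda>z. p2 z)) z = p2 z"
  by (rule beta, intro cont_intros)+

lemma cl_hom_id: "cl (hom_id I A) \<rho> = lam (\<lambda>i. lam (\<lambda>z. p2 z))"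
  by (simp add: hom_id_def idfun_def)

lemma t_id_iso: assumes I: "jm G I Univ" and A: "jm G A (arr I Univ)" shows "jm G (id_iso I A) (iso I A A)"
proof -
  note X = j_el[OF t_hom[OF I A A]] and e = t_hom_id[OF I A]
  note b = t_hom_sec_body[OF I A A e] and s = t_hom_sec[OF I A A e] and t = t_iso_body[OF I A A]
  have 1: "jm G (Refl (hom I A A) (hom_id I A)) (inst (Eq (hom (wk I) (wk A) (wk A)) (hom_comp (wk I) (wk A) (wk A) (wk A) (wk (hom_id I A)) (Var 0)) (hom_id (wk I) (wk A))) (hom_id I A))"
    by (rule jtm_cong[OF j_rfl[OF X e]]) (rule ext, simp add: cl_rules cl_hom_id hom_comp_def comp_def hom_def id_beta)
  have 2: "jm G (Refl (hom I A A) (hom_id I A)) (inst (Eq (hom (wk I) (wk A) (wk A)) (hom_comp (wk I) (wk A) (wk A) (wk A) (Var 0) (wk (hom_id I A))) (hom_id (wk I) (wk A))) (hom_id I A))"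
    by (rule jtm_cong[OF j_rfl[OF X e]]) (rule ext, simp add: cl_rules cl_hom_id hom_comp_def comp_def hom_def id_beta)
  note m = j_mkpair[OF j_el[OF s(1)] jty_wk[OF j_el[OF s(2)] j_el[OF s(1)]] 
      j_mkpair[OF X j_el[OF b(1)] e 1, folded hom_sec_def], OF jtm_cong[OF j_mkpair[OF X j_el[OF b(2)] e 2, folded hom_ret_def]]]
  have 3: "jm G (MkPair (hom_sec I A A (hom_id I A)) (wk (hom_ret I A A (hom_id I A)))
      (MkPair (hom I A A) (Eq (hom (wk I) (wk A) (wk A)) (hom_comp (wk I) (wk A) (wk A) (wk A) (wk (hom_id I A)) (Var 0)) (hom_id (wk I) (wk A))) (hom_id I A) (Refl (hom I A A) (hom_id I A)))
      (MkPair (hom I A A) (Eq (hom (wk I) (wk A) (wk A)) (hom_comp (wk I) (wk A) (wk A) (wk A) (Var 0) (wk (hom_id I A))) (hom_id (wk I) (wk A))) (hom_id I A) (Refl (hom I A A) (hom_id I A))))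
     (inst (times (hom_sec (wk I) (wk A) (wk A) (Var 0)) (hom_ret (wk I) (wk A) (wk A) (Var 0))) (hom_id I A))"
    by (rule jtm_cong[OF m]) (rule ext, simp add: cl_rules cl_hom_id hom_comp_def comp_def hom_def hom_sec_def hom_ret_def)+
  show ?thesis unfolding id_iso_def Let_def iso_def
    by (rule j_mkpair[OF X t_times[OF j_el[OF t(1)] j_el[OF t(2)]] e 3])
qed

text \<open>Kept apart from \<open>t_id_to_iso\<close> since the context of the motive is needed
  again, to see how \<open>id_to_iso\<close> acts.\<close>

lemma t_motive:
  fixes I :: tm
  defines "V \<equiv> wk (arr I Univ)" and "I4 \<equiv> wk (wk (wk (wk I)))" and "Q \<equiv> Eq (wk (wk (wk (arr I Univ)))) (Var 1) (Var 0)"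
  assumes I: "jm G I Univ" and X: "jt G X"
  shows "jt (X # G) V" "jm (Q # wk V # V # X # G) I4 Univ"
    "jm (Q # wk V # V # X # G) (Var 2) (arr I4 Univ)" "jm (Q # wk V # V # X # G) (Var 1) (arr I4 Univ)"
    "jt (Q # wk V # V # X # G) (iso I4 (Var 2) (Var 1))"
    "jm (V # X # G) (id_iso (wk (wk I)) (Var 0)) (instd V (iso I4 (Var 2) (Var 1)))"
proof -
  have V: "jt (X # G) V" unfolding V_def by (rule jty_wk[OF t_arr[OF j_el[OF I] t_univ[OF j_el[OF I]]] X])
  then show "jt (X # G) V" .
  have V': "jt (V # X # G) (wk V)" by (rule jty_wk[OF V V])
  have V'': "jt (wk V # V # X # G) (wk (wk V))" by (rule jty_wk[OF V' V'])
  have v: "jm (wk V # V # X # G) (Var 1) (wk (wk V))" 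
    by (rule jtm_cong[OF j_var[OF t_ctx[OF V'], of 1]]) (simp, rule ext, simp add: cl_rules numeral_eq_Suc)
  have Q: "jt (wk V # V # X # G) Q" unfolding Q_def V_def[symmetric] by (rule j_eq[OF V'' v t_var0[OF V']])
  have I2: "jm (V # X # G) (wk (wk I)) Univ" by (rule t_wk_univ[OF t_wk_univ[OF I X] V])
  show I4: "jm (Q # wk V # V # X # G) I4 Univ" unfolding I4_def by (rule t_wk_univ[OF t_wk_univ[OF I2 V'] Q])
  show x: "jm (Q # wk V # V # X # G) (Var 2) (arr I4 Univ)"
    by (rule jtm_cong[OF j_var[OF t_ctx[OF Q], of 2]]) (simp, rule ext, simp add: cl_rules numeral_eq_Suc V_def I4_def)
  show y: "jm (Q # wk V # V # X # G) (Var 1) (arr I4 Univ)"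
    by (rule jtm_cong[OF j_var[OF t_ctx[OF Q], of 1]]) (simp, rule ext, simp add: cl_rules numeral_eq_Suc V_def I4_def)
  show C: "jt (Q # wk V # V # X # G) (iso I4 (Var 2) (Var 1))" by (rule j_el[OF t_iso[OF I4 x y]])
  have a: "jm (V # X # G) (Var 0) (arr (wk (wk I)) Univ)"
    by (rule jtm_cong[OF t_var0[OF V]]) (rule ext, simp add: cl_rules V_def)
  show d: "jm (V # X # G) (id_iso (wk (wk I)) (Var 0)) (instd V (iso I4 (Var 2) (Var 1)))"
    by (rule jtm_cong[OF t_id_iso[OF I2 a]]) 
       (rule ext, simp add: V_def I4_def cl_rules iso_def hom_sec_def hom_ret_def hom_comp_def hom_id_def hom_def comp_def idfun_def numeral_eq_Suc)
qed

lemma t_id_to_iso: assumes I: "jm G I Univ" and A: "jm G A (arr I Univ)" and B: "jm G B (arr I Univ)"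
  shows "jm G (id_to_iso I A B) (arr (Eq (arr I Univ) A B) (iso I A B))"
proof -
  let ?W = "arr I Univ"
  have W: "jt G ?W" by (rule t_arr[OF j_el[OF I] t_univ[OF j_el[OF I]]])
  have E: "jt G (Eq ?W A B)" by (rule j_eq[OF W A B])
  have p: "jm (Eq ?W A B # G) (Var 0) (Eq (wk ?W) (wk A) (wk B))" using t_var0[OF E] by simp
  note m = t_motive[OF I E]
  have J: "jm (Eq ?W A B # G) (J (wk ?W) (iso (wk (wk (wk (wk I)))) (Var 2) (Var 1)) (id_iso (wk (wk I)) (Var 0)) (wk A) (wk B) (Var 0)) (wk (iso I A B))"
    by (rule jtm_cong[OF j_jay[OF m(1,5,6) jtm_wk[OF A E] jtm_wk[OF B E] p]])
       (rule ext, simp add: cl_rules iso_def hom_sec_def hom_ret_def hom_comp_def hom_id_def hom_def comp_def idfun_def numeral_eq_Suc)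
  show ?thesis unfolding id_to_iso_def
    by (rule t_lam[OF E j_el[OF t_iso[OF I A B]] J])
qed

lemma t_happly: assumes A: "jt G A" and B: "jt (A # G) B" and f: "jm G f (Pi A B)" and g: "jm G g (Pi A B)"
  shows "jm G (happly A B f g) (arr (Eq (Pi A B) f g) (htpy A B f g))"
proof -
  let ?W = "Pi A B"
  have W: "jt G ?W" by (rule j_pi[OF A B])
  have E: "jt G (Eq ?W f g)" by (rule j_eq[OF W f g])
  let ?G = "Eq ?W f g # G" and ?V = "wk ?W"
  have V: "jt ?G ?V" by (rule jty_wk[OF W E])
  have V': "jt (?V # ?G) (wk ?V)" by (rule jty_wk[OF V V])
  have V'': "jt (wk ?V # ?V # ?G) (wk (wk ?V))" by (rule jty_wk[OF V' V'])
  let ?Q = "Eq (wk (wk ?V)) (Var 1) (Var 0)" and ?K = "wk ?V # ?V # ?G"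
  have v: "jm ?K (Var 1) (wk (wk ?V))" 
    by (rule jtm_cong[OF j_var[OF t_ctx[OF V'], of 1]]) (simp, rule ext, simp add: cl_rules numeral_eq_Suc)
  have Q: "jt ?K ?Q" by (rule j_eq[OF V'' v t_var0[OF V']])
  let ?A4 = "wk (wk (wk (wk A)))" and ?B4 = "wk1 (wk1 (wk1 (wk1 B)))"
  note A1 = jty_wk[OF A E] and B1 = jty_wk1[OF B E]
  note A2 = jty_wk[OF A1 V] and B2 = jty_wk1[OF B1 V]
  note A3 = jty_wk[OF A2 V'] and B3 = jty_wk1[OF B2 V']
  note A4 = jty_wk[OF A3 Q] and B4 = jty_wk1[OF B3 Q]
  have x: "jm (?Q # ?K) (Var 2) (Pi ?A4 ?B4)"
    by (rule jtm_cong[OF j_var[OF t_ctx[OF Q], of 2]]) (simp, rule ext, simp add: cl_rules numeral_eq_Suc)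
  have y: "jm (?Q # ?K) (Var 1) (Pi ?A4 ?B4)"
    by (rule jtm_cong[OF j_var[OF t_ctx[OF Q], of 1]]) (simp, rule ext, simp add: cl_rules numeral_eq_Suc)
  have C: "jt (?Q # ?K) (htpy ?A4 ?B4 (Var 2) (Var 1))" by (rule t_htpy[OF A4 B4 x y])
  have a: "jm (?V # ?G) (Var 0) (Pi (wk (wk A)) (wk1 (wk1 B)))" using t_var0[OF V] by simp
  note at = t_at[OF A2 B2 a]
  let ?app = "App (wk (wk (wk A))) (wk1 (wk1 (wk1 B))) (Var 1) (Var 0)"
  have at': "jm (wk (wk A) # ?V # ?G) ?app (wk1 (wk1 B))" using at by simp
  have d: "jm (?V # ?G) (Lam (wk (wk A)) (Eq (wk1 (wk1 B)) ?app ?app) (Refl (wk1 (wk1 B)) ?app)) (instd ?V (htpy ?A4 ?B4 (Var 2) (Var 1)))"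
    by (rule jtm_cong[OF j_lam[OF A2 A2 j_eq[OF B2 at' at'] j_rfl[OF B2 at']]])
       (rule ext, simp add: cl_rules htpy_def numeral_eq_Suc)
  have p: "jm ?G (Var 0) (Eq ?V (wk f) (wk g))" using t_var0[OF E] by simp
  have J: "jm ?G (J ?V (htpy ?A4 ?B4 (Var 2) (Var 1)) (Lam (wk (wk A)) (Eq (wk1 (wk1 B)) ?app ?app) (Refl (wk1 (wk1 B)) ?app)) (wk f) (wk g) (Var 0)) (wk (htpy A B f g))"
    by (rule jtm_cong[OF j_jay[OF V C d jtm_wk[OF f E] jtm_wk[OF g E] p]])
       (rule ext, simp add: cl_rules htpy_def numeral_eq_Suc)
  show ?thesis unfolding happly_def
    by (rule t_lam[OF E t_htpy[OF A B f g] J])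
qed

section \<open>Function extensionality fails\<close>

lemma t_var: "wfc G \<Longrightarrow> i < length G \<Longrightarrow> cl (ren (\<lambda>n. n + Suc i) (G ! i)) = cl A \<Longrightarrow> jm G (Var i) A"
  by (rule jtm_cong[OF j_var])

lemma M_arr:
  assumes A: "jt G A" and B: "jt G B" and c: "cx G \<rho> \<rho>'" and F: "M (ct (arr A B) \<rho>) F F'" and w: "M (ct A \<rho>) w w'"
  shows "M (ct B \<rho>) (sap F w) (sap F' w')"
  using M_piD[OF jtyD(1)[OF A] jtyD(2)[OF A] jtyD(2)[OF jty_wk[OF B A]] c F w] by simp

lemma RR_hid: "RR (wr (\<lambda>_. HidC)) = hidR"
  by (rule teq_RR(1)[OF teq_wr[OF teq_ground(3)[of False]]])

lemma wr_const: "wr (\<lambda>_. HidC) = (\<lambda>_. wrap HidC)" by (simp add: wr_def)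

lemma app_lam_const: "app (lam (\<lambda>_. c)) z = c" by (rule beta) (intro cont_intros)

lemma sap_const: "sap (\<lambda>_. dbl (lam (\<lambda>_. c))) w = (\<lambda>_. dbl c)"
  by (rule ext, rule dom_eqI) (simp_all add: sap_def app_lam_const)

lemma sap_idD: "sap (\<lambda>_. dbl idD) w = w"
  by (rule ext, rule dom_eqI) (simp_all add: sap_def)

text \<open>The section of the canonical map would turn a homotopy from the identity to a constant
  function into a path. The type with two dual elements is named by no term; it enters as the value
  of the quantified variable \<open>A\<close>.\<close>

lemma not_FE_U: assumes t: "jm [] t FE_U" shows False
proof -
  let ?G1 = "[Univ]"
  let ?T2 = "arr (Var 0) Univ" let ?G2 = "?T2 # ?G1"
  let ?T3 = "Pi (Var (Suc 0)) (fam (Var (Suc 0)) (Var 0))" let ?G3 = "?T3 # ?G2"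
  let ?T4 = "Pi (Var (Suc (Suc 0))) (fam (Var (Suc (Suc 0))) (Var (Suc 0)))" let ?G4 = "?T4 # ?G3"
  let ?A = "Var (Suc (Suc (Suc 0)))" and ?B = "fam (Var (Suc (Suc (Suc 0)))) (Var (Suc (Suc 0)))" and ?f = "Var (Suc 0)" and ?g = "Var 0"
  let ?X = "Eq (Pi ?A ?B) ?f ?g" and ?H = "htpy ?A ?B ?f ?g"
  let ?E = "is_equiv ?X ?H (happly ?A ?B ?f ?g)"
  note cr = cl_rules numeral_eq_Suc
  have U: "jt [] Univ" by (rule j_univ_ty) simp
  note w1 = t_ctx[OF U]
  have T2: "jt ?G1 ?T2" by (rule t_arr[OF j_el[OF t_var[OF w1]] j_univ_ty[OF w1]]) simp_all
  note w2 = t_ctx[OF T2]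
  have T3: "jt ?G2 ?T3"
    by (rule j_pi, rule j_el[OF t_var[OF w2]], simp, simp, rule j_el[OF t_fam]; rule t_var[OF w2], simp, rule ext, simp add: cr)
  note w3 = t_ctx[OF T3]
  have T4: "jt ?G3 ?T4"
    by (rule j_pi, rule j_el[OF t_var[OF w3]], simp, simp, rule j_el[OF t_fam]; rule t_var[OF w3], simp, rule ext, simp add: cr)
  note w4 = t_ctx[OF T4]
  have A: "jm ?G4 ?A Univ" by (rule t_var[OF w4], simp, rule ext, simp add: cr)
  have F: "jm ?G4 (Var (Suc (Suc 0))) (arr ?A Univ)" by (rule t_var[OF w4], simp, rule ext, simp add: cr)
  note Au = j_el[OF A] and B = j_el[OF t_fam[OF A F]]
  have f: "jm ?G4 ?f (Pi ?A ?B)" "jm ?G4 ?g (Pi ?A ?B)" by (rule t_var[OF w4], simp, rule ext, simp add: cr)+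
  have P: "jt ?G4 (Pi ?A ?B)" by (rule j_pi[OF Au B])
  have X: "jt ?G4 ?X" by (rule j_eq[OF P f])
  have H: "jt ?G4 ?H" by (rule t_htpy[OF Au B f])
  have h: "jm ?G4 (happly ?A ?B ?f ?g) (arr ?X ?H)" by (rule t_happly[OF Au B f])
  have E: "jt ?G4 ?E" by (rule t_is_equiv[OF X H h])
  note E3 = j_pi[OF T4 E] note E2 = j_pi[OF T3 E3] note E1 = j_pi[OF T2 E2]
  have FE: "FE_U = Pi Univ (Pi ?T2 (Pi ?T3 (Pi ?T4 ?E)))" by (simp add: FE_U_def Let_def numeral_eq_Suc)

  define \<rho>0 :: "nat \<Rightarrow> env" where "\<rho>0 = (\<lambda>_ _. {})"
  let ?a = "\<lambda>_::nat. dbl (wrap HidC)" and ?F = "\<lambda>_::nat. dbl (lam (\<lambda>_. wrap HidC))"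
  let ?id = "\<lambda>_::nat. dbl idD" and ?c = "\<lambda>_::nat. dbl (lam (\<lambda>_. {}))"
  \<comment> \<open>The values of \<open>A\<close>, the family, \<open>f\<close> and
    \<open>g\<close>, in this order: the type with the hidden bit, the constant family on it, the
    identity, and the constant function at the empty set.\<close>
  let ?r1 = "xc ?a \<rho>0" let ?r2 = "xc ?F ?r1" let ?r3 = "xc ?id ?r2" let ?r4 = "xc ?c ?r3"
  have c0: "cx [] \<rho>0 \<rho>0" by (simp add: \<rho>0_def ord_def)
  have bsa: "bs (\<lambda>_. dbl z) = (\<lambda>_. z)" for z by (simp add: bs_def)
  have ua: "urel ?a ?a"
    unfolding urel_iff bsa using usame_wr[OF teq_ground(3)[of True]] by (simp add: wr_const)
  have c1: "cx ?G1 ?r1 ?r1" unfolding cx_xc M_univ using c0 ua by simp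
  have ctA: "ct (Var 0) ?r1 = (\<lambda>_. wrap HidC)" by (simp add: ct_p1 bsa)
  have dd: "sdeg (\<lambda>_. dbl z) = (\<lambda>_. dbl z)" for z by (simp add: sdeg_def)
  have kd: "(\<lambda>_. z) \<circ> k = (\<lambda>_. z)" for z :: 'a and k :: "nat \<Rightarrow> nat" by auto
  have v0: "jt ?G1 (Var 0)" by (rule j_el[OF t_var[OF w1]]) simp_all
  have c2: "cx ?G2 ?r2 ?r2"
    unfolding cx_xc M_pi[OF w1 jtyD(2)[OF v0] jtyD(2)[OF jty_wk[OF j_univ_ty[OF w1] v0]] c1] dd kd sap_const
    using c1 ua by (simp add: M_univ)
  have ctF: "ct (fam (Var (Suc n)) (Var m)) (xc x \<rho>) = (\<lambda>_. wrap HidC)" if "vs (Var m) \<rho> = ?F" for n m x \<rho>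
    using that by (simp add: ct_p1 sap_const bsa)
  have Mh: "M (\<lambda>_. wrap HidC) w w' \<longleftrightarrow> hidR (\<lambda>n. n) w w'" for w w' unfolding M_def RR_hid[unfolded wr_const] ..
  have hid0: "hidR k (\<lambda>_. dbl {}) (\<lambda>_. dbl {})" for k by (auto simp: hidR_def)
  have Mpi: "M (ct (Pi (Var i) (fam (Var (Suc n)) (Var m))) \<rho>) w w' \<longleftrightarrow> (\<forall>n. ord (w n) \<and> ord (w' n)) \<and>
       (\<forall>k x x'. hidR (\<lambda>n. n) x x' \<longrightarrow> hidR (\<lambda>n. n) (sap (w \<circ> k) x) (sap (w' \<circ> k) x')) \<and>
       (\<forall>k x x'. hidR (\<lambda>n. n) x x' \<longrightarrow> hidR (\<lambda>n. n) (sap (sdeg w \<circ> k) x) (sap (sdeg w' \<circ> k) x'))"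
    if "wfc G" "jt G (Var i)" "jt (Var i # G) (fam (Var (Suc n)) (Var m))" "cx G \<rho> \<rho>" "vs (Var m) \<rho> = ?F" "vs (Var i) \<rho> = ?a" for G i n m \<rho> w w'
  proof -
    have "vs (Var m) (\<rho> \<circ> k) = ?F" "ct (Var i) (\<rho> \<circ> k) = (\<lambda>_. wrap HidC)" for k
      using that(5,6) by (simp_all add: env_o ct_p1 kd bsa)
    then have c: "ct (fam (Var (Suc n)) (Var m)) (xc x (\<rho> \<circ> k)) = (\<lambda>_. wrap HidC)" "ct (Var i) (\<rho> \<circ> k) = (\<lambda>_. wrap HidC)" for x k
      using ctF by blast+
    show ?thesis unfolding M_pi[OF that(1) jtyD(2)[OF that(2)] jtyD(2)[OF that(3)] that(4)] c Mh ..
  qed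
  have vv: "jt ?G2 (Var (Suc 0))" "jt (Var (Suc 0) # ?G2) (fam (Var (Suc 0)) (Var 0))" "jt ?G3 (Var (Suc (Suc 0)))" "jt (Var (Suc (Suc 0)) # ?G3) (fam (Var (Suc (Suc 0))) (Var (Suc 0)))"
  proof -
    show "jt ?G2 (Var (Suc 0))" by (rule j_el[OF t_var[OF w2]]) simp_all
    show "jt (Var (Suc 0) # ?G2) (fam (Var (Suc 0)) (Var 0))"
      by (rule j_el[OF t_fam]; rule t_var[OF w2], simp, rule ext, simp add: cr)
    show "jt ?G3 (Var (Suc (Suc 0)))" by (rule j_el[OF t_var[OF w3]]) simp_all
    show "jt (Var (Suc (Suc 0)) # ?G3) (fam (Var (Suc (Suc 0))) (Var (Suc 0)))"
      by (rule j_el[OF t_fam]; rule t_var[OF w3], simp, rule ext, simp add: cr)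
  qed
  have c3: "cx ?G3 ?r3 ?r3"

    by (rule cx_xc[THEN iffD2], rule conjI[OF c2], subst Mpi[OF w2 vv(1,2) c2]) (simp_all add: dd kd sap_idD c2 del: cx.simps)
  have c4: "cx ?G4 ?r4 ?r4"

    by (rule cx_xc[THEN iffD2], rule conjI[OF c3], subst Mpi[OF w3 vv(3,4) c3]) (simp_all add: dd kd sap_const c3 hid0 del: cx.simps)
  let ?e = "sap (sap (sap (sap (vs t \<rho>0) ?a) ?F) ?id) ?c"
  have e: "M (ct ?E ?r4) ?e ?e"
  proof -
    have D: "M (ct B (xc w \<rho>)) (sap F w) (sap F w)" if "jt G A" "jt (A # G) B" "cx (A # G) (xc w \<rho>) (xc w \<rho>)" "M (ct (Pi A B) \<rho>) F F" for G A B w \<rho> F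
      using M_piD[OF jtyD(1)[OF that(1)] jtyD(2)[OF that(1)] jtyD(2)[OF that(2)] _ that(4), of \<rho> w w] that(3) unfolding cx_xc by blast
    have "M (ct FE_U \<rho>0) (vs t \<rho>0) (vs t \<rho>0)" by (rule tmsD[OF jtmD(3)[OF t] c0])
    from D[OF U E1 c1 this[unfolded FE]] have "M (ct (Pi ?T2 (Pi ?T3 (Pi ?T4 ?E))) ?r1) (sap (vs t \<rho>0) ?a) (sap (vs t \<rho>0) ?a)" .
    from D[OF T4 E c4 D[OF T3 E3 c3 D[OF T2 E2 c2 this]]] show ?thesis .
  qed
  \<comment> \<open>The section, and the homotopy it is applied to: the constant path at the empty
    set, for every argument.\<close>
  let ?s = "sfst (sfst ?e)" and ?h = "\<lambda>_::nat. dbl (lam (\<lambda>_. dbl {}))"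
  have S: "jt ?G4 (Sig (arr ?H ?X) (htpy (wk ?H) (wk (wk ?H)) (comp (wk ?H) (wk ?X) (wk ?H) (wk (happly ?A ?B ?f ?g)) (Var 0)) (idfun (wk ?H))))"
    by (rule j_sig[OF t_arr[OF H X] t_sec(1)[OF X H h]])
  have S': "jt ?G4 (Sig (arr ?H ?X) (htpy (wk ?X) (wk (wk ?X)) (comp (wk ?X) (wk ?H) (wk ?X) (Var 0) (wk (happly ?A ?B ?f ?g))) (idfun (wk ?X))))"
    by (rule j_sig[OF t_arr[OF H X] t_sec(2)[OF X H h]])
  have s: "M (ct (arr ?H ?X) ?r4) ?s ?s"
    using e[unfolded is_equiv_def M_sig[OF w4 jtyD(2)[OF S] jtyD(2)[OF jty_wk[OF S' S]] c4], THEN conjunct1,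
        unfolded M_sig[OF w4 jtyD(2)[OF t_arr[OF H X]] jtyD(2)[OF t_sec(1)[OF X H h]] c4]] by blast
  have r4: "vs ?A ?r4 = ?a" "vs (Var (Suc (Suc 0))) ?r4 = ?F" "vs ?f ?r4 = ?id" "vs ?g ?r4 = ?c" by (simp_all add: numeral_eq_Suc)
  have PB: "M (ct (Pi ?A ?B) ?r4) w w' \<longleftrightarrow> (\<forall>n. ord (w n) \<and> ord (w' n)) \<and>
       (\<forall>k x x'. hidR (\<lambda>n. n) x x' \<longrightarrow> hidR (\<lambda>n. n) (sap (w \<circ> k) x) (sap (w' \<circ> k) x')) \<and>
       (\<forall>k x x'. hidR (\<lambda>n. n) x x' \<longrightarrow> hidR (\<lambda>n. n) (sap (sdeg w \<circ> k) x) (sap (sdeg w' \<circ> k) x'))" for w w'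
    using Mpi[OF w4 Au, of "Suc (Suc 0)" "Suc (Suc 0)" ?r4 w w'] B c4 r4 by (simp add: numeral_3_eq_3 numeral_2_eq_2)
  \<comment> \<open>At any argument the end points of the required path are the actual parts of the
    argument and of the empty set. Both lack the bit, hence they are equal.\<close>
  have hH: "M (ct ?H ?r4) ?h ?h"
  proof -
    have 1: "M (ct (Eq ?B (App (wk ?A) (wk1 ?B) (wk ?f) (Var 0)) (App (wk ?A) (wk1 ?B) (wk ?g) (Var 0))) (xc x (?r4 \<circ> k))) (\<lambda>_. dbl (dbl {})) (\<lambda>_. dbl (dbl {}))"
      if x: "M (ct ?A (?r4 \<circ> k)) x x'" for k x x'
    proof -
      have r: "?r4 \<circ> k = ?r4" by (simp add: xc_def \<rho>0_def fun_eq_iff)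
      have "hidR (\<lambda>n. n) x x'" using x unfolding r by (simp add: ct_p1 r4 bsa Mh)
      then have hx: "hidR (\<lambda>n. n) x x" "hidR l (\<lambda>_. dbl {}) (sdeg x)" for l by (auto simp: hidR_def sdeg_def)
      have b: "ct ?B (xc x ?r4) = (\<lambda>_. wrap HidC)" by (simp add: ct_p1 r4 sap_const bsa)
      have v: "vs (App (wk ?A) (wk1 ?B) (wk ?f) (Var 0)) (xc x ?r4) = x" "vs (App (wk ?A) (wk1 ?B) (wk ?g) (Var 0)) (xc x ?r4) = (\<lambda>_. dbl {})"
        using r4 by (simp_all add: sap_idD sap_const del: One_nat_def)
      have ty: "tyeq False (\<lambda>_. wrap HidC) (\<lambda>_. wrap HidC)" 
        using teq_wr[OF teq_ground(3)[of False]] unfolding tyeq_def wr_const by blast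
      have "e0 (\<lambda>_. dbl (dbl {})) = (\<lambda>_. dbl {})" "e1 (\<lambda>_. dbl (dbl {})) = (\<lambda>_. dbl {})" "jn (\<lambda>_. dbl {}) (\<lambda>_. dbl {}) = (\<lambda>_. dbl {})"
        by (simp_all add: seq_defs fun_eq_iff)
      then show ?thesis unfolding r ct_simps b v
        by (subst M_eq[OF ty]) (simp_all add: Mh hx hid0 kd dd)
    qed
    show ?thesis unfolding htpy_def
      by (subst M_pi[OF w4 jtyD(2)[OF Au] jtyD(2)[OF j_eq[OF B t_at[OF Au B f(1)] t_at[OF Au B f(2)]]] c4])
         (use 1 in \<open>simp add: dd kd sap_const\<close>)
  qed
  let ?p = "sap ?s ?h"
  have p: "M (ct ?X ?r4) ?p ?p" by (rule M_arr[OF H X c4 s hH])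
  note tP = tysD[OF jtyD(2)[OF P] c4]
  note q = p[unfolded ct_simps(4) M_eq[OF tP tmsD[OF jtmD(3)[OF f(1)] c4] tmsD[OF jtmD(3)[OF f(2)] c4]], unfolded r4 dd]
  define p where "p = ?p"
  have PBD: "hidR (\<lambda>n. n) (sap w x) (sap w' x')" if "M (ct (Pi ?A ?B) ?r4) w w'" "hidR (\<lambda>n. n) x x'" for w w' x x'
    using that(1)[unfolded PB, THEN conjunct2, THEN conjunct1, rule_format, of x x' "\<lambda>n. n"] that(2) by simp
  have d: "ct (Pi ?A ?B) ?r4 \<circ> dia = ct (Pi ?A ?B) ?r4" by (simp add: ct_def xc_def \<rho>0_def fun_eq_iff)
  have q: "M (ct (Pi ?A ?B) ?r4) (e0 p) ?id" "M (ct (Pi ?A ?B) ?r4) (e1 p) ?c" "M (ct (Pi ?A ?B) ?r4) (jn (e0 p) (e1 p)) (jn (e0 p) (e1 p))"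
    using q[folded p_def, unfolded d] by auto
  \<comment> \<open>The element whose actual part is empty and whose dual part carries the bit. The
    identity keeps the bit and the constant function drops it, but a path between them would give
    one clique, in which the bit is the same at all entries.\<close>
  let ?z = "\<lambda>_::nat. pr {} {0}"
  have hz: "hidR k ?z ?z" for k by (auto simp: hidR_def ord_def)
  have 1: "hidR (\<lambda>n. n) (sap (e0 p) ?z) ?z" "hidR (\<lambda>n. n) (sap (e1 p) ?z) (\<lambda>_. dbl {})" 
    using PBD[OF q(1) hz] PBD[OF q(2) hz] by (simp_all add: sap_idD sap_const)
  have zz: "jn ?z ?z = ?z" by (simp add: jn_def fun_eq_iff)
  have "hidR (\<lambda>n. n) (jn (sap (e0 p) ?z) (sap (e1 p) ?z)) (jn (sap (e0 p) ?z) (sap (e1 p) ?z))"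
    using PBD[OF q(3) hz] unfolding jn_push(4)[of _ _ ?z ?z, unfolded zz] .
  then obtain b where b: "\<And>n. (0 \<in> p2 (jn (sap (e0 p) ?z) (sap (e1 p) ?z) n)) = b" unfolding hidR_def by blast
  from b[of 0] b[of 1] have "(0 \<in> p2 (sap (e0 p) ?z 0)) = b" "(0 \<in> p2 (sap (e1 p) ?z 0)) = b"
    by (simp_all add: jn_def)
  with 1 show False unfolding hidR_def by (metis deg_simps(6) emptyE p2_pr singletonI)
qed

section \<open>Morphisms of families\<close>

lemma RR_fr: "fr T \<Longrightarrow> RR T = RF T"
  using RR[of True T "RF T"] frD(1)[of T] by (simp add: uni_def)

lemma fr_tyeq: "fr T \<Longrightarrow> tyeq True T T"
  by (rule usame_tyeq[OF usame_refl])

lemma M_fr: "fr T \<Longrightarrow> M T x x' = RF T (\<lambda>n. n) x x'"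
  by (simp add: M_def RR_fr)
lemma M_vx: "fr T \<Longrightarrow> M (T \<circ> (\<lambda>_. n)) (\<lambda>_. x) (\<lambda>_. x') = VX T n x x'"
  unfolding M_re[OF fr_tyeq] by (simp add: RR_fr VX_def vx_def)

lemma M_vertI:
  assumes T: "fr T" and x: "M T x x" and v: "\<And>n. VX T n (x n) (y n)" shows "M T x y"
  unfolding M_fr[OF T] by (rule vertD[OF frD(3)[OF T], OF x[unfolded M_fr[OF T]]]) (use v in \<open>simp add: VX_def vx_def\<close>)

lemma bs_sap_deg: "bs (sap (sdeg F) i) = bs (sap F i)" "bs (sap F (sdeg i)) = bs (sap F i)"
  by (simp_all add: bs_def seq_defs)

text \<open>The clause on actual parts of a family is absorbed, since equality in the universe looks
  at actual parts only.\<close>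

lemma M_arrU:
  assumes I: "jm G I Univ" and c: "cx G \<rho> \<rho>'"
  shows "M (ct (arr I Univ) \<rho>) F F' \<longleftrightarrow> (\<forall>n. ord (F n) \<and> ord (F' n)) \<and>
    (\<forall>k i i'. M (ct I (\<rho> \<circ> k)) i i' \<longrightarrow> usame (bs (sap (F \<circ> k) i)) (bs (sap (F' \<circ> k) i')))" (is "?L \<longleftrightarrow> ?R")
proof -
  note iI = j_el[OF I]
  have d: "bs (sap (sdeg F \<circ> k) i) = bs (sap (F \<circ> k) i)" for F i and k :: "nat \<Rightarrow> nat"
    using bs_sap_deg(1)[of "F \<circ> k" i] by (simp add: o_push)
  have iff: "?L \<longleftrightarrow> (\<forall>n. ord (F n) \<and> ord (F' n)) \<and>
    (\<forall>k i i'. M (ct I (\<rho> \<circ> k)) i i' \<longrightarrow> urel (sap (F \<circ> k) i) (sap (F' \<circ> k) i')) \<and>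
    (\<forall>k i i'. M (ct I (\<rho> \<circ> k)) i i' \<longrightarrow> urel (sap (sdeg F \<circ> k) i) (sap (sdeg F' \<circ> k) i'))"
    unfolding M_pi[OF jtyD(1)[OF iI] jtyD(2)[OF iI] jtyD(2)[OF jty_wk[OF t_univ[OF iI] iI]] c] by (simp add: M_univ)
  show ?thesis
  proof
    assume ?L then show ?R unfolding iff urel_iff by blast
  next
    assume R: ?R
    have o: "ord (sap (F \<circ> k) i n) \<and> ord (sap (F' \<circ> k) i' n)" "ord (sap (sdeg F \<circ> k) i n) \<and> ord (sap (sdeg F' \<circ> k) i' n)" 
      if "M (ct I (\<rho> \<circ> k)) i i'" for k i i' n
    proof -
      have "tyeq False (ct I (\<rho> \<circ> k)) (ct I (\<rho>' \<circ> k))" using tyeq_reindex[OF tysD[OF jtyD(2)[OF iI] c]] by (simp only: env_o)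
      from M_ord[OF this that] R show "ord (sap (F \<circ> k) i n) \<and> ord (sap (F' \<circ> k) i' n)" "ord (sap (sdeg F \<circ> k) i n) \<and> ord (sap (sdeg F' \<circ> k) i' n)"
        by (simp_all add: sap_def ord_W sdeg_def)
    qed
    show ?L unfolding iff urel_iff d using R o by blast
  qed
qed

lemma fam_usame:
  assumes I: "jm G I Univ" and A: "jm G A (arr I Univ)" and c: "cx G \<rho> \<rho>'" and i: "M (ct I \<rho>) i i'"
  shows "usame (bs (sap (vs A \<rho>) i)) (bs (sap (vs A \<rho>') i'))"
  using tmsD[OF jtmD(3)[OF A] c, unfolded M_arrU[OF I c], THEN conjunct2, rule_format, of "\<lambda>n. n" i i'] i by simp

lemma fam_ct: "ct (fam I A) (xc i \<rho>) = bs (sap (vs A \<rho>) i)"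
  by (simp add: ct_p1)

abbreviation ac :: "sq \<Rightarrow> sq \<Rightarrow> sq \<Rightarrow> sq" where "ac f i x \<equiv> sap (sap f i) x"

lemma hom_app:
  assumes I: "jm G I Univ" and A: "jm G A (arr I Univ)" and B: "jm G B (arr I Univ)" and c: "cx G \<rho> \<rho>'"
    and f: "M (ct (hom I A B) \<rho>) f f'" and i: "M (ct I \<rho>) i i'" and x: "M (bs (sap (vs A \<rho>) i)) x x'"
  shows "M (bs (sap (vs B \<rho>) i)) (ac f i x) (ac f' i' x')"
proof -
  note iI = j_el[OF I] and FA = j_el[OF t_fam[OF I A]] and FB = j_el[OF t_fam[OF I B]]
  have ci: "cx (I # G) (xc i \<rho>) (xc i' \<rho>')" using c i unfolding cx_xc by blast
  have 1: "M (ct (arr (fam I A) (fam I B)) (xc i \<rho>)) (sap f i) (sap f' i')"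
    by (rule M_piD[OF jtyD(1)[OF iI] jtyD(2)[OF iI] jtyD(2)[OF t_arr[OF FA FB]] c f[unfolded hom_def] i])
  show ?thesis
    using M_piD[OF jtyD(1)[OF FA] jtyD(2)[OF FA] jtyD(2)[OF jty_wk[OF FB FA]] ci 1, unfolded fam_ct, OF x]
    unfolding wk_simps(2) fam_ct .
qed

text \<open>For a degenerate morphism all clauses of the two nested function types are instances of
  one condition, taken at the index or at its actual part.\<close>

lemma hom_degI:
  assumes I: "jm G I Univ" and A: "jm G A (arr I Univ)" and B: "jm G B (arr I Univ)" and c: "cx G \<rho> \<rho>'"
    and o: "\<And>n. ord (f n) \<and> ord (f' n)"
    and H: "\<And>k i i' x x'. M (ct I (\<rho> \<circ> k)) i i' \<Longrightarrow> M (bs (sap (vs A (\<rho> \<circ> k)) i)) x x' \<Longrightarrow>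
      M (bs (sap (vs B (\<rho> \<circ> k)) i)) (ac (sdeg f \<circ> k) i x) (ac (sdeg f' \<circ> k) i' x')"
  shows "M (ct (hom I A B) \<rho>) (sdeg f) (sdeg f')"
proof -
  note iI = j_el[OF I] and FA = j_el[OF t_fam[OF I A]] and FB = j_el[OF t_fam[OF I B]]
  note t = tysD[OF jtyD(2)[OF iI] c]
  have main: "M (ct (arr (fam I A) (fam I B)) (xc i (\<rho> \<circ> k))) (sap (sdeg f \<circ> k) i) (sap (sdeg f' \<circ> k) i')"
    if i: "M (ct I (\<rho> \<circ> k)) i i'" for k i i'
  proof -
    have ci: "cx (I # G) (xc i (\<rho> \<circ> k)) (xc i' (\<rho>' \<circ> k))" using cx_reindex[OF jtyD(1)[OF iI] c] i unfolding cx_xc by blast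
    have ti: "tyeq False (ct I (\<rho> \<circ> k)) (ct I (\<rho>' \<circ> k))" using tyeq_reindex[OF t] by (simp only: env_o)
    have oi: "ord (i n) \<and> ord (i' n)" for n by (rule M_ord[OF ti i])
    have of: "ord (sap (sdeg f \<circ> k) i n) \<and> ord (sap (sdeg f' \<circ> k) i' n)" for n using oi by (simp add: sap_def ord_W sdeg_def)
    have xo: "xc i (\<rho> \<circ> k) \<circ> l = xc (i \<circ> l) (\<rho> \<circ> (k \<circ> l))" for l :: "nat \<Rightarrow> nat" by (simp add: env_o(3)[symmetric] o_assoc)
    have il: "M (ct I (\<rho> \<circ> (k \<circ> l))) (i \<circ> l) (i' \<circ> l)" for l
      using M_reindex[OF ti i, of l] by (simp add: env_o o_assoc)
    have sl: "sap (g \<circ> k) j \<circ> l = sap (g \<circ> (k \<circ> l)) (j \<circ> l)" for g j and l :: "nat \<Rightarrow> nat" by (simp add: o_push(4)[symmetric] o_assoc)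
    have dl: "M (ct I (\<rho> \<circ> (k \<circ> l))) (sdeg i \<circ> l) (sdeg i' \<circ> l)" for l
      using M_reindex[OF ti M_deg[OF ti i], of l] by (simp add: env_o o_assoc)
    have sd: "sdeg (sap (sdeg g \<circ> k) j) = sap (sdeg g \<circ> k) (sdeg j)" for g j by (simp add: sdeg_push o_push(3)[symmetric])
    have bd: "bs (sap F (sdeg i \<circ> l)) = bs (sap F (i \<circ> l))" for F and l :: "nat \<Rightarrow> nat" by (simp add: o_push(3)[symmetric] bs_sap_deg)
    have wkB: "ct (wk (fam I B)) (xc x \<sigma>) = ct (fam I B) \<sigma>" for x \<sigma> by (rule wk_simps)
    show ?thesis
      unfolding M_pi[OF jtyD(1)[OF FA] jtyD(2)[OF FA] jtyD(2)[OF jty_wk[OF FB FA]] ci] xo wkB fam_ct sl sd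
      using of H[OF il] H[OF dl] unfolding bd by blast
  qed
  show ?thesis
    unfolding hom_def M_pi[OF jtyD(1)[OF iI] jtyD(2)[OF iI] jtyD(2)[OF t_arr[OF FA FB]] c] sdeg_push(6)
    using main by (simp add: sdeg_def)
qed

section \<open>Identity types of small types\<close>

text \<open>A small type is discrete, so the two entries of a path in it are equal. This yields
  equality of the actual parts of the ends, and uniqueness of paths. At function types, actual parts
  act on dual arguments as well, so a path says more than a homotopy.\<close>

lemma small_eqD:
  assumes T: "tyeq True T T" and a: "M T a a" and b: "M T b b" and w: "M (wr (\<lambda>e. EqC (T e) (p1 (a e)) (p1 (b e)))) w w"
  shows "M T (sdeg a) (sdeg b)"
    "M (wr (\<lambda>e. EqC (T e) (p1 (a e)) (p1 (b e)))) w' w' \<Longrightarrow> M (wr (\<lambda>e. EqC (T e) (p1 (a e)) (p1 (b e)))) w w'"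
proof -
  note s = tyeqD(6)[OF T TrueI] and r = tyeqD(8)[OF T]
  note W = w[unfolded M_eq[OF T a b]]
  have e: "M T (e0 w) (sdeg a)" "M T (e1 w) (sdeg b)" "RR T dia (jn (e0 w) (e1 w)) (jn (e0 w) (e1 w))"
    using W unfolding M_re[OF T] by auto
  have 1: "RR T (\<lambda>n. n) (e0 w) (e0 w)" using M_refl(1)[OF T e(1)] by (simp add: M_def)
  have "RR T dia (jn (e0 w) (e1 w)) (jn (e0 w) (e0 w))"
    by (rule discD[OF s, OF e(3), of _ 0]) 
       (use rel_re[OF r, OF 1, of dia] rel_re[OF r, OF 1, of "\<lambda>_. 0"] in \<open>simp_all add: jn_dia[of "e0 w"] del: jn_comp\<close>, simp_all add: jn_def o_def)
  from rel_jn(2)[OF r, OF this] have "M T (e1 w) (e0 w)" by (simp add: M_def)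
  with M_trans[OF T M_sym[OF T e(1)] M_trans[OF T M_sym[OF T this] e(2)]] show "M T (sdeg a) (sdeg b)" by blast
  assume "M (wr (\<lambda>e. EqC (T e) (p1 (a e)) (p1 (b e)))) w' w'"
  note W' = this[unfolded M_eq[OF T a b]]
  have e': "M T (e0 w') (sdeg a)" "RR T dia (jn (e0 w') (e1 w')) (jn (e0 w') (e1 w'))" using W' unfolding M_re[OF T] by auto
  have 2: "RR T (\<lambda>n. n) (e0 w) (e0 w')" using M_trans[OF T e(1) M_sym[OF T e'(1)]] by (simp add: M_def)
  have "RR T dia (jn (e0 w) (e1 w)) (jn (e0 w') (e1 w'))"
    by (rule discD[OF s, OF e(3) e'(2), of 0]) (use rel_re[OF r, OF 2, of "\<lambda>_. 0"] in \<open>simp add: jn_def o_def\<close>)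
  then show "M (wr (\<lambda>e. EqC (T e) (p1 (a e)) (p1 (b e)))) w w'"
    unfolding M_eq[OF T a b] M_re[OF T] using W W' by blast
qed

section \<open>Paths between families\<close>

text \<open>The frame of the path is that of \<open>TA\<close> followed by \<open>F\<close>. As in
  the composition in the universe, halving the index lets both halves share one inner type, and
  \<open>F\<close> need not be natural.\<close>

lemma path_frame:
  assumes TA: "fr TA" and TB: "fr TB" and iso: "\<And>e. isoF (F e) (S e) (VX TA e) (VX TB e)"
    and TP: "\<And>e. TP e = Fr (frY (TB e)) (frX (TA e)) (u e) (v e)"
    and u: "\<And>e z. fap (u e) z = F e (fap (frU (TA e)) z)" and v: "\<And>e z. fap (v e) z = fap (frV (TA e)) (S e z)"
  shows "fr (jn TA TP)" "VX (jn TA TP) (2 * n) = VX TA n" "VX (jn TA TP) (Suc (2 * n)) = VX TB n"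
    "TRW (jn TA TP i) (jn TA TP j) x =
       jn (\<lambda>n x. x) F j (TRW (TA (i div 2)) (TA (j div 2)) (jn (\<lambda>n x. x) S i x))"
proof -
  have d: "(2 * n) div 2 = n" "Suc (2 * n) div 2 = n" for n :: nat by simp_all
  have jn2: "(\<And>n. Pr (2 * n)) \<Longrightarrow> (\<And>n. Pr (Suc (2 * n))) \<Longrightarrow> Pr n" for Pr :: "nat \<Rightarrow> bool" and n
    by (cases "even n") (auto elim!: evenE oddE)
  have "\<exists>RY. den uu0 (\<lambda>_. frY (T n)) RY \<and> rel RY \<and> small RY \<and> VX T n = vx RY 0" if "fr T" for T n
    using frD(4)[OF that, of n] by (simp add: VX_def)
  then obtain RA RB where RA: "\<And>n. den uu0 (\<lambda>_. frY (TA n)) (RA n)" "\<And>n. rel (RA n)" "\<And>n. small (RA n)" "\<And>n. VX TA n = vx (RA n) 0"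
    and RB: "\<And>n. den uu0 (\<lambda>_. frY (TB n)) (RB n)" "\<And>n. rel (RB n)" "\<And>n. small (RB n)" "\<And>n. VX TB n = vx (RB n) 0"
    using TA TB by metis
  have TJ: "jn TA TP e = Fr (jn (\<lambda>n. frY (TA n)) (\<lambda>n. frY (TB n)) e) (frX (TA (e div 2))) (jn (\<lambda>n. frU (TA n)) u e) (jn (\<lambda>n. frV (TA n)) v e)" for e
  proof (rule jn2[of _ e])
    fix n
    have "\<exists>Y X u v. TA n = Fr Y X u v" using fr_RF[OF TA] unfolding framed_def by blast
    then have "TA n = Fr (frY (TA n)) (frX (TA n)) (frU (TA n)) (frV (TA n))" by (elim exE) (simp only: frame_simps)
    then show "jn TA TP (2 * n) = Fr (jn (\<lambda>n. frY (TA n)) (\<lambda>n. frY (TB n)) (2 * n)) (frX (TA (2 * n div 2))) (jn (\<lambda>n. frU (TA n)) u (2 * n)) (jn (\<lambda>n. frV (TA n)) v (2 * n))"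
      unfolding jn_simps d .
    show "jn TA TP (Suc (2 * n)) = Fr (jn (\<lambda>n. frY (TA n)) (\<lambda>n. frY (TB n)) (Suc (2 * n))) (frX (TA (Suc (2 * n) div 2))) (jn (\<lambda>n. frU (TA n)) u (Suc (2 * n))) (jn (\<lambda>n. frV (TA n)) v (Suc (2 * n)))"
      unfolding jn_simps d by (rule TP)
  qed
  have iso': "isoF (jn (\<lambda>n x. x) F e) (jn (\<lambda>n x. x) S e) (VX TA (e div 2)) (vx (jn RA RB e) 0)" for e
  proof (rule jn2[of _ e])
    fix n
    show "isoF (jn (\<lambda>n x. x) F (2 * n)) (jn (\<lambda>n x. x) S (2 * n)) (VX TA (2 * n div 2)) (vx (jn RA RB (2 * n)) 0)"
      unfolding d jn_simps RA(4)[symmetric] by (simp add: isoF_def)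
    show "isoF (jn (\<lambda>n x. x) F (Suc (2 * n))) (jn (\<lambda>n x. x) S (Suc (2 * n))) (VX TA (Suc (2 * n) div 2)) (vx (jn RA RB (Suc (2 * n))) 0)"
      unfolding d jn_simps RB(4)[symmetric] by (rule iso)
  qed
  have uf: "fap (jn (\<lambda>n. frU (TA n)) u e) z = jn (\<lambda>n x. x) F e (fap (frU (TA (e div 2))) z)" for e z
    by (rule jn2[of _ e]) (simp_all only: jn_simps d u)
  have vf: "fap (jn (\<lambda>n. frV (TA n)) v e) z = fap (frV (TA (e div 2))) (jn (\<lambda>n x. x) S e z)" for e z
    by (rule jn2[of _ e]) (simp_all only: jn_simps d v)
  have den: "den uu0 (\<lambda>_. jn (\<lambda>n. frY (TA n)) (\<lambda>n. frY (TB n)) e) (jn RA RB e)" "rel (jn RA RB e)" "small (jn RA RB e)" for e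
    using RA RB by (auto simp: jn_def)
  note Z = frame_change[where k = "\<lambda>e. e div 2", OF TA TJ den iso' uf vf]
  show "fr (jn TA TP)" by (rule Z(1))
  show "VX (jn TA TP) (2 * n) = VX TA n" "VX (jn TA TP) (Suc (2 * n)) = VX TB n"
    unfolding Z(2) jn_simps RA(4) RB(4) by auto
  show "TRW (jn TA TP i) (jn TA TP j) x =
       jn (\<lambda>n x. x) F j (TRW (TA (i div 2)) (TA (j div 2)) (jn (\<lambda>n x. x) S i x))" by (rule Z(3))
qed

text \<open>Within the first half the transports are those of \<open>TA\<close>, and along a rung
  they are \<open>F\<close> and its inverse. Any other connection with the same rungs therefore
  equals this one.\<close>

lemma path_usame:
  assumes TA: "fr TA" and TB: "fr TB" and iso: "\<And>e. isoF (F e) (S e) (VX TA e) (VX TB e)"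
    and TP: "\<And>e. TP e = Fr (frY (TB e)) (frX (TA e)) (u e) (v e)"
    and u: "\<And>e z. fap (u e) z = F e (fap (frU (TA e)) z)" and v: "\<And>e z. fap (v e) z = fap (frV (TA e)) (S e z)"
    and L: "fr (jn L0 L1)" and L0: "usame TA L0" and L1: "usame TB L1"
    and tr: "\<And>n x. VX TA n x x \<Longrightarrow> VX TB n (F n x) (TRW (L0 n) (L1 n) x)"
  shows "usame (jn TA TP) (jn L0 L1)"
proof -
  note P = path_frame[OF TA TB iso TP u v]
  have d: "(2 * n) div 2 = n" "Suc (2 * n) div 2 = n" for n :: nat by simp_all
  have VL: "VX (jn L0 L1) (2 * n) = VX TA n" "VX (jn L0 L1) (Suc (2 * n)) = VX TB n" for n
    using fr_reindex(3)[OF L, of "(*) 2" n] fr_reindex(3)[OF L, of "\<lambda>n. Suc (2 * n)" n] L0 L1 by (simp_all add: usame_def)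
  have jn2: "(\<And>n. Pr (2 * n)) \<Longrightarrow> (\<And>n. Pr (Suc (2 * n))) \<Longrightarrow> Pr n" for Pr :: "nat \<Rightarrow> bool" and n
    by (cases "even n") (auto elim!: evenE oddE)
  have V: "VX (jn TA TP) e = VX (jn L0 L1) e" for e by (rule jn2[of _ e]) (simp_all only: P(2,3) VL)
  show ?thesis
  proof (rule usame_jn[OF P(1) L V])
    fix n m
    show "agr (jn TA TP) (jn L0 L1) (2 * n) (2 * m)"
      using L0 unfolding agr_def usame_def P(2,3,4) jn_simps d by blast
    show "agr (jn TA TP) (jn L0 L1) (2 * n) (Suc (2 * n))"
      unfolding agr_def P(2,3,4) unfolding jn_simps d
    proof (intro allI impI)
      fix x assume x: "VX TA n x x"
      show "VX TB n (F n (TRW (TA n) (TA n) x)) (TRW (L0 n) (L1 n) x)"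
        using VX_PER(2)[OF TB isoFD(1)[OF iso, OF tr_id[OF TA x]] tr[OF x]] .
    qed
    show "agr (jn TA TP) (jn L0 L1) (Suc (2 * n)) (2 * n)"
      unfolding agr_def P(2,3,4) unfolding jn_simps d
    proof (intro allI impI)
      fix y assume y: "VX TB n y y"
      let ?x = "S n y" and ?t = "TRW (L1 n) (L0 n)"
      have x: "VX TA n ?x ?x" by (rule isoFD(2)[OF iso, OF y])
      have tL: "VX TB n z z' \<Longrightarrow> VX TA n (?t z) (?t z')" "VX TA n z z \<Longrightarrow> VX TA n (?t (TRW (L0 n) (L1 n) z)) z" for z z'
        using isoFD(2,3)[OF iso_tr[OF L, of "2 * n" "Suc (2 * n)"]] unfolding VL jn_simps by blast+
      have "VX TB n y (TRW (L0 n) (L1 n) ?x)"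
        by (rule VX_PER(2)[OF TB VX_PER(1)[OF TB isoFD(4)[OF iso, OF y]] tr[OF x]])
      from VX_PER(2)[OF TA tL(1)[OF this] tL(2)[OF x]] have "VX TA n (?t y) ?x" .
      then show "VX TA n (TRW (TA n) (TA n) ?x) (?t y)"
        using VX_PER(2)[OF TA tr_id[OF TA x]] VX_PER(1)[OF TA] by blast
    qed
  qed
qed

section \<open>Isomorphisms of families\<close>

lemma ac_comp: "ac (vs (hom_comp I A B C g f) \<rho>) i x = ac (vs g \<rho>) i (ac (vs f \<rho>) i x)"
  by (simp add: hom_comp_def comp_def)
lemma ac_id: "ac (vs (hom_id I A) \<rho>) i x = x"
  by (simp add: hom_id_def idfun_def)

lemma ct_wk_hom: "ct (hom (wk I) (wk A) (wk B)) (xc w \<rho>) = ct (hom I A B) \<rho>"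
proof -
  have "ct (hom (wk I) (wk A) (wk B)) (xc w \<rho>) = ct (wk (hom I A B)) (xc w \<rho>)" by (simp only: ct_def cl_wk_hom)
  then show ?thesis by simp
qed

lemma M_univ_ty: "jm G A Univ \<Longrightarrow> cx G \<rho> \<rho>' \<Longrightarrow> tyeq True (ct A \<rho>) (ct A \<rho>')"
  using tysD[OF univ_tys[OF jtmD(1) jtmD(3)]] .

lemma cx_ext: "cx G \<rho> \<rho>' \<Longrightarrow> M (ct A \<rho>) w w' \<Longrightarrow> cx (A # G) (xc w \<rho>) (xc w' \<rho>')"
  unfolding cx_xc by blast

text \<open>Here it matters that the composite is the identity by a path. \<open>small_eqD\<close>
  makes the actual parts of both sides equal as morphisms, hence on arguments \<open>x\<close> with
  a dual part too.\<close>

lemma sec_law: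
  assumes I: "jm G I Univ" and A: "jm G A (arr I Univ)" and B: "jm G B (arr I Univ)" and f: "jm G f (hom I A B)"
    and c: "cx G \<rho> \<rho>" and i: "M (ct I \<rho>) i i"
  shows "M (ct (hom_sec I A B f) \<rho>) w w \<Longrightarrow> M (ct (hom I B A) \<rho>) (sfst w) (sfst w)"
    "M (ct (hom_sec I A B f) \<rho>) w w \<Longrightarrow> M (bs (sap (vs B \<rho>) i)) x x' \<Longrightarrow>
       M (bs (sap (vs B \<rho>) i)) (ac (sdeg (vs f \<rho>)) i (ac (sdeg (sfst w)) i x)) x'"
    "M (ct (hom_ret I A B f) \<rho>) w w \<Longrightarrow> M (ct (hom I B A) \<rho>) (sfst w) (sfst w)"
    "M (ct (hom_ret I A B f) \<rho>) w w \<Longrightarrow> M (bs (sap (vs A \<rho>) i)) x x' \<Longrightarrow>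
       M (bs (sap (vs A \<rho>) i)) (ac (sdeg (sfst w)) i (ac (sdeg (vs f \<rho>)) i x)) x'"
proof -
  have X: "jt G (hom I B A)" by (rule j_el[OF t_hom[OF I B A]])
  note b = t_hom_sec_body[OF I A B f] and W = jtyD(1)[OF X]
  note sec = M_sig[OF W jtyD(2)[OF X] jtyD(2)[OF j_el[OF b(1)]] c, folded hom_sec_def]
    and ret = M_sig[OF W jtyD(2)[OF X] jtyD(2)[OF j_el[OF b(2)]] c, folded hom_ret_def]
  note I' = t_wk_univ[OF I X] and A' = t_wk_fam[OF X A] and B' = t_wk_fam[OF X B]
  have f': "jm (hom I B A # G) (wk f) (hom (wk I) (wk A) (wk B))" by (rule jtm_cong[OF jtm_wk[OF f X] cl_wk_hom])
  have v: "jm (hom I B A # G) (Var 0) (hom (wk I) (wk B) (wk A))" by (rule jtm_cong[OF t_var0[OF X] cl_wk_hom])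
  have ed: "vs t (xc (sdeg w) (sedeg \<rho>)) = sdeg (vs t (xc w \<rho>))" for t w by simp
  have fd: "vs f (sedeg \<rho>) = sdeg (vs f \<rho>)" by simp
  {
    assume w: "M (ct (hom_sec I A B f) \<rho>) w w"
    show s: "M (ct (hom I B A) \<rho>) (sfst w) (sfst w)" using w unfolding sec by blast
    have cs: "cx (hom I B A # G) (xc (sfst w) \<rho>) (xc (sfst w) \<rho>)" by (rule cx_ext[OF c s])
    have "M (ct (hom I B B) \<rho>) (sdeg (vs (hom_comp (wk I) (wk B) (wk A) (wk B) (wk f) (Var 0)) (xc (sfst w) \<rho>)))
       (sdeg (vs (hom_id (wk I) (wk B)) (xc (sfst w) \<rho>)))"
      using small_eqD(1)[OF M_univ_ty[OF t_hom[OF I' B' B'] cs] tmsD[OF jtmD(3)[OF t_hom_comp[OF I' B' A' B' f' v]] cs]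
          tmsD[OF jtmD(3)[OF t_hom_id[OF I' B']] cs], folded ct_simps(4)] w unfolding sec ct_wk_hom by blast
    from hom_app[OF I B B c this i] show "M (bs (sap (vs B \<rho>) i)) x x' \<Longrightarrow>
       M (bs (sap (vs B \<rho>) i)) (ac (sdeg (vs f \<rho>)) i (ac (sdeg (sfst w)) i x)) x'"
      unfolding ed[symmetric] ac_comp ac_id wk_simps vs_simps fd .
  next
    assume w: "M (ct (hom_ret I A B f) \<rho>) w w"
    show s: "M (ct (hom I B A) \<rho>) (sfst w) (sfst w)" using w unfolding ret by blast
    have cs: "cx (hom I B A # G) (xc (sfst w) \<rho>) (xc (sfst w) \<rho>)" by (rule cx_ext[OF c s])
    have "M (ct (hom I A A) \<rho>) (sdeg (vs (hom_comp (wk I) (wk A) (wk B) (wk A) (Var 0) (wk f)) (xc (sfst w) \<rho>)))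
       (sdeg (vs (hom_id (wk I) (wk A)) (xc (sfst w) \<rho>)))"
      using small_eqD(1)[OF M_univ_ty[OF t_hom[OF I' A' A'] cs] tmsD[OF jtmD(3)[OF t_hom_comp[OF I' A' B' A' v f']] cs]
          tmsD[OF jtmD(3)[OF t_hom_id[OF I' A']] cs], folded ct_simps(4)] w unfolding ret ct_wk_hom by blast
    from hom_app[OF I A A c this i] show "M (bs (sap (vs A \<rho>) i)) x x' \<Longrightarrow>
       M (bs (sap (vs A \<rho>) i)) (ac (sdeg (sfst w)) i (ac (sdeg (vs f \<rho>)) i x)) x'"
      unfolding ed[symmetric] ac_comp ac_id wk_simps vs_simps fd .
  }
qed

definition mF :: "sq \<Rightarrow> sq" where "mF w = sfst w"
definition mS :: "sq \<Rightarrow> sq" where "mS w = sfst (sfst (ssnd w))"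
definition mR :: "sq \<Rightarrow> sq" where "mR w = sfst (ssnd (ssnd w))"

lemma m_o: "mF (w \<circ> k) = mF w \<circ> k" "mS (w \<circ> k) = mS w \<circ> k" "mR (w \<circ> k) = mR w \<circ> k"
  by (simp_all add: mF_def mS_def mR_def o_push)
lemma m_deg: "mF (sdeg w) = sdeg (mF w)" "mS (sdeg w) = sdeg (mS w)" "mR (sdeg w) = sdeg (mR w)"
  by (simp_all add: mF_def mS_def mR_def sdeg_push)

locale famcat =
  fixes G :: "tm list" and I A B :: tm
  assumes I: "jm G I Univ" and A: "jm G A (arr I Univ)" and B: "jm G B (arr I Univ)"
begin

lemmas iI = j_el[OF I]
lemmas wG = jtyD(1)[OF iI]
lemma tI: "cx G \<rho> \<rho>' \<Longrightarrow> tyeq False (ct I \<rho>) (ct I \<rho>')" by (rule tysD[OF jtyD(2)[OF iI]])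
lemma Iso: "jm G (iso I A B) Univ" by (rule t_iso[OF I A B])
lemma tIso: "cx G \<rho> \<rho>' \<Longrightarrow> tyeq True (ct (iso I A B) \<rho>) (ct (iso I A B) \<rho>')" by (rule M_univ_ty[OF Iso])
lemma W: "jt G (arr I Univ)" by (rule t_arr[OF iI t_univ[OF iI]])

abbreviation TA where "TA \<rho> i \<equiv> bs (sap (vs A \<rho>) i)"
abbreviation TB where "TB \<rho> i \<equiv> bs (sap (vs B \<rho>) i)"

lemma frA: "cx G \<rho> \<rho>' \<Longrightarrow> M (ct I \<rho>) i i' \<Longrightarrow> fr (TA \<rho> i)" using fam_usame[OF I A] by (simp add: usame_def)
lemma frB: "cx G \<rho> \<rho>' \<Longrightarrow> M (ct I \<rho>) i i' \<Longrightarrow> fr (TB \<rho> i)" using fam_usame[OF I B] by (simp add: usame_def)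

abbreviation "G1 \<equiv> hom I A B # G"
abbreviation "secT \<equiv> hom_sec (wk I) (wk A) (wk B) (Var 0)"
abbreviation "retT \<equiv> hom_ret (wk I) (wk A) (wk B) (Var 0)"

lemma H: "jt G (hom I A B)" by (rule j_el[OF t_hom[OF I A B]])
lemma I1: "jm G1 (wk I) Univ" and A1: "jm G1 (wk A) (arr (wk I) Univ)" and B1: "jm G1 (wk B) (arr (wk I) Univ)"
  and v1: "jm G1 (Var 0) (hom (wk I) (wk A) (wk B))"
  by (rule t_wk_univ[OF I H], rule t_wk_fam[OF H A], rule t_wk_fam[OF H B], rule jtm_cong[OF t_var0[OF H] cl_wk_hom])
lemmas secU = t_hom_sec[OF I1 A1 B1 v1]

lemma M_iso:
  assumes c: "cx G \<rho> \<rho>'" and w: "M (ct (hom I A B) \<rho>) (mF w) (mF w')"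
  shows "M (ct (iso I A B) \<rho>) w w' \<longleftrightarrow> M (ct secT (xc (mF w) \<rho>)) (sfst (ssnd w)) (sfst (ssnd w')) \<and>
    M (ct retT (xc (mF w) \<rho>)) (ssnd (ssnd w)) (ssnd (ssnd w'))"
proof -
  note tt = j_el[OF t_times_u[OF secU]]
  have c1: "cx G1 (xc (mF w) \<rho>) (xc (mF w') \<rho>')" by (rule cx_ext[OF c w])
  show ?thesis using w
    unfolding iso_def M_sig[OF wG jtyD(2)[OF H] jtyD(2)[OF tt] c] mF_def[symmetric]
      M_sig[OF jtyD(1)[OF tt] jtyD(2)[OF j_el[OF secU(1)]] jtyD(2)[OF jty_wk[OF j_el[OF secU(2)] j_el[OF secU(1)]]] c1] wk_simps by blast
qed

lemma iso_F: assumes c: "cx G \<rho> \<rho>'" and w: "M (ct (iso I A B) \<rho>) w w'" shows "M (ct (hom I A B) \<rho>) (mF w) (mF w')"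
  using w unfolding iso_def M_sig[OF wG jtyD(2)[OF H] jtyD(2)[OF j_el[OF t_times_u[OF secU]]] c] mF_def by blast

lemma iso_re: "cx G \<rho> \<rho>' \<Longrightarrow> M (ct (iso I A B) \<rho>) w w' \<Longrightarrow> M (ct (iso I A B) (\<rho> \<circ> k)) (w \<circ> k) (w' \<circ> k)"
  unfolding env_o(1) using M_reindex[OF tIso] .

lemma iso_S: 
  assumes c: "cx G \<rho> \<rho>'" and w: "M (ct (iso I A B) \<rho>) w w'" 
  shows "M (ct (hom I B A) \<rho>) (mS w) (mS w')" "M (ct (hom I B A) \<rho>) (mR w) (mR w')"
proof -
  note f = iso_F[OF c w] note P = w[unfolded M_iso[OF c f]]
  have c1: "cx G1 (xc (mF w) \<rho>) (xc (mF w') \<rho>')" by (rule cx_ext[OF c f])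
  note X = j_el[OF t_hom[OF I1 B1 A1]] and b = t_hom_sec_body[OF I1 A1 B1 v1]
  show "M (ct (hom I B A) \<rho>) (mS w) (mS w')"
    using P unfolding hom_sec_def M_sig[OF jtyD(1,2)[OF X] jtyD(2)[OF j_el[OF b(1)]] c1] ct_wk_hom mS_def by blast
  show "M (ct (hom I B A) \<rho>) (mR w) (mR w')"
    using P unfolding hom_ret_def M_sig[OF jtyD(1,2)[OF X] jtyD(2)[OF j_el[OF b(2)]] c1] ct_wk_hom mR_def by blast
qed

text \<open>The third law is the usual argument that a section and a retraction agree, as in
  \<open>s = r f s = r\<close>, carried out on elements.\<close>

lemma iso_laws:
  assumes c: "cx G \<rho> \<rho>" and w: "M (ct (iso I A B) \<rho>) w w" and i: "M (ct I \<rho>) i i"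
  shows "M (TB \<rho> i) x x' \<Longrightarrow> M (TB \<rho> i) (ac (sdeg (mF w)) i (ac (sdeg (mS w)) i x)) x'"
    "M (TA \<rho> i) y y' \<Longrightarrow> M (TA \<rho> i) (ac (sdeg (mR w)) i (ac (sdeg (mF w)) i y)) y'"
    "M (TA \<rho> i) y y' \<Longrightarrow> M (TA \<rho> i) (ac (sdeg (mS w)) i (ac (sdeg (mF w)) i y)) y'"
proof -
  note f = iso_F[OF c w] note P = w[unfolded M_iso[OF c f]]
  have c1: "cx G1 (xc (mF w) \<rho>) (xc (mF w) \<rho>)" by (rule cx_ext[OF c f])
  have i1: "M (ct (wk I) (xc (mF w) \<rho>)) i i" using i by simp
  note L = sec_law[OF I1 A1 B1 v1 c1 i1, unfolded wk_simps vs_simps]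
  show fs: "M (TB \<rho> i) (ac (sdeg (mF w)) i (ac (sdeg (mS w)) i x)) x'" if "M (TB \<rho> i) x x'" for x x'
    using L(2) P that unfolding mS_def by blast
  show rf: "M (TA \<rho> i) (ac (sdeg (mR w)) i (ac (sdeg (mF w)) i y)) y'" if "M (TA \<rho> i) y y'" for y y'
    using L(4) P that unfolding mR_def by blast
  have T: "tyeq True (TA \<rho> i) (TA \<rho> i)" "tyeq True (TB \<rho> i) (TB \<rho> i)" using fr_tyeq frA[OF c i] frB[OF c i] by auto
  note df = M_deg[OF M_univ_ty[OF t_hom[OF I A B] c] f] and ds = M_deg[OF M_univ_ty[OF t_hom[OF I B A] c] iso_S(1)[OF c w]] 
    and dr = M_deg[OF M_univ_ty[OF t_hom[OF I B A] c] iso_S(2)[OF c w]]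
  assume y: "M (TA \<rho> i) y y'"
  note fy = hom_app[OF I A B c df i M_refl(1)[OF T(1) y]]
  note sfy = hom_app[OF I B A c ds i fy]
  note rfsf = hom_app[OF I B A c dr i fs[OF fy]]
  show "M (TA \<rho> i) (ac (sdeg (mS w)) i (ac (sdeg (mF w)) i y)) y'"
    by (rule M_trans[OF T(1) M_sym[OF T(1) rf[OF sfy]] M_trans[OF T(1) rfsf rf[OF y]]])
qed

text \<open>The action of an isomorphism does not depend on the dual part of the index: if \<open>S\<close> and \<open>F\<close> are
  inverse to each other, and so are \<open>S0 \<le> S\<close> and \<open>F0 \<le> F\<close>, then \<open>x = S0 (F0 x) \<le> S (F0 x) \<le> S (F x) = x\<close>, hence
  \<open>S (F0 x) = x\<close> by convexity.\<close>

lemma iso_index: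
  assumes c: "cx G \<rho> \<rho>" and w: "M (ct (iso I A B) \<rho>) w w" and i: "M (ct I \<rho>) i i" and x: "M (TA \<rho> i) x x"
  shows "M (TB \<rho> i) (ac (sdeg (mF w)) i x) (ac (sdeg (mF w)) (sdeg i) x)"
proof -
  have T: "tyeq True (TA \<rho> i) (TA \<rho> i)" "tyeq True (TB \<rho> i) (TB \<rho> i)" using fr_tyeq frA[OF c i] frB[OF c i] by auto
  note di = M_deg[OF tI[OF c] i]
  let ?f = "sdeg (mF w)" and ?s = "sdeg (mS w)"
  let ?F = "ac ?f i" and ?Fz = "ac ?f (sdeg i)" and ?S = "ac ?s i" and ?Sz = "ac ?s (sdeg i)"
  note df = M_deg[OF M_univ_ty[OF t_hom[OF I A B] c] iso_F[OF c w]] and ds = M_deg[OF M_univ_ty[OF t_hom[OF I B A] c] iso_S(1)[OF c w]] 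
  have oi: "ord (i n)" for n using M_ord[OF tI[OF c] i] by blast
  have le: "le (deg (i n)) (i n)" for n using oi[of n] by (simp add: le_def ord_p)
  note L = iso_laws[OF c w i] and L0 = iso_laws[OF c w di, unfolded bs_sap_deg]
  have F0x: "M (TB \<rho> i) (?Fz x) (?Fz x)" using hom_app[OF I A B c df di, unfolded bs_sap_deg, OF x] .
  have SF0: "M (TA \<rho> i) (?S (?Fz x)) (?S (?Fz x))" by (rule hom_app[OF I B A c ds i F0x])
  have S0: "M (TA \<rho> i) (?Sz (?Fz x)) x" using L0(3) x by blast
  have 1: "M (TA \<rho> i) (?Sz (?Fz x)) (?S (?F x))" 
    by (rule M_trans[OF T(1) S0 M_sym[OF T(1) L(3)[OF x]]])
  have "M (TA \<rho> i) (?Sz (?Fz x)) (?S (?Fz x))"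
    unfolding M_def
    by (rule convD[OF tyeqD(6)[OF T(1) TrueI], OF 1[unfolded M_def] SF0[unfolded M_def]])
       (simp_all add: sap_def sdeg_def le_W le)
  then have "M (TA \<rho> i) x (?S (?Fz x))" by (rule M_trans[OF T(1) M_sym[OF T(1) S0]])
  from M_trans[OF T(2) hom_app[OF I A B c df i this] L(1)[OF F0x]] show ?thesis .
qed

lemma at_const: "TA (\<rho> \<circ> k) (i \<circ> k) = TA \<rho> i \<circ> k" "TB (\<rho> \<circ> k) (i \<circ> k) = TB \<rho> i \<circ> k" for \<rho> i and k :: "nat \<Rightarrow> nat"
  by (simp_all only: env_o o_push bs_push)

lemma hom_vx:
  assumes "jm G A' (arr I Univ)" "jm G B' (arr I Univ)" and c: "cx G \<rho> \<rho>'" and f: "M (ct (hom I A' B') \<rho>) f f'" and i: "M (ct I \<rho>) i i'"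
    and x: "VX (bs (sap (vs A' \<rho>) i)) n x x'"
  shows "VX (bs (sap (vs B' \<rho>) i)) n (apW (apW (f n) (i n)) x) (apW (apW (f' n) (i' n)) x')"
proof -
  let ?k = "\<lambda>_::nat. n"
  have fa: "fr (bs (sap (vs A' \<rho>) i))" "fr (bs (sap (vs B' \<rho>) i))"
    using fam_usame[OF I assms(1) c i] fam_usame[OF I assms(2) c i] by (auto simp: usame_def)
  have b: "bs (sap (vs A' (\<rho> \<circ> ?k)) (i \<circ> ?k)) = bs (sap (vs A' \<rho>) i) \<circ> ?k" "bs (sap (vs B' (\<rho> \<circ> ?k)) (i \<circ> ?k)) = bs (sap (vs B' \<rho>) i) \<circ> ?k"
    by (simp_all only: env_o o_push bs_push)
  have f': "M (ct (hom I A' B') (\<rho> \<circ> ?k)) (f \<circ> ?k) (f' \<circ> ?k)" unfolding env_o(1) by (rule M_reindex[OF M_univ_ty[OF t_hom[OF I assms(1,2)] c] f])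
  have i': "M (ct I (\<rho> \<circ> ?k)) (i \<circ> ?k) (i' \<circ> ?k)" unfolding env_o(1) by (rule M_reindex[OF tI[OF c] i])
  have "M (bs (sap (vs A' (\<rho> \<circ> ?k)) (i \<circ> ?k))) (\<lambda>_. x) (\<lambda>_. x')" unfolding b M_vx[OF fa(1)] by (rule x)
  from hom_app[OF I assms(1,2) cx_reindex[OF wG c] f' i' this]
  have "M (bs (sap (vs B' \<rho>) i) \<circ> ?k) (\<lambda>_. apW (apW (f n) (i n)) x) (\<lambda>_. apW (apW (f' n) (i' n)) x')"
    unfolding b by (simp add: sap_def)
  then show ?thesis unfolding M_vx[OF fa(2)] .
qed

text \<open>The action of the actual part of an isomorphism at the actual part of the index, on one
  entry. This is the map that the code of the path can use.\<close>

abbreviation "vF w i \<equiv> \<lambda>n. apW (apW (deg (mF w n)) (deg (i n)))"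
abbreviation "vS w i \<equiv> \<lambda>n. apW (apW (deg (mS w n)) (deg (i n)))"

lemma ac_vF: "ac (sdeg (mF w)) (sdeg i) x n = vF w i n (x n)" "ac (sdeg (mS w)) (sdeg i) x n = vS w i n (x n)"
  by (simp_all add: sap_def sdeg_def)

lemma vF_rel:
  assumes c: "cx G \<rho> \<rho>'" and w: "M (ct (iso I A B) \<rho>) w w'" and i: "M (ct I \<rho>) i i'"
  shows "VX (TA \<rho> i) n x x' \<Longrightarrow> VX (TB \<rho> i) n (vF w i n x) (vF w' i' n x')" 
    "VX (TB \<rho> i) n x x' \<Longrightarrow> VX (TA \<rho> i) n (vS w i n x) (vS w' i' n x')"
proof -
  note di = M_deg[OF tI[OF c] i]
  note df = M_deg[OF M_univ_ty[OF t_hom[OF I A B] c] iso_F[OF c w]] and ds = M_deg[OF M_univ_ty[OF t_hom[OF I B A] c] iso_S(1)[OF c w]] 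
  show "VX (TA \<rho> i) n x x' \<Longrightarrow> VX (TB \<rho> i) n (vF w i n x) (vF w' i' n x')"
    using hom_vx[OF A B c df di, unfolded bs_sap_deg, of n x x'] by (simp add: sdeg_def)
  show "VX (TB \<rho> i) n x x' \<Longrightarrow> VX (TA \<rho> i) n (vS w i n x) (vS w' i' n x')"
    using hom_vx[OF B A c ds di, unfolded bs_sap_deg, of n x x'] by (simp add: sdeg_def)
qed

lemma iso_vx:
  assumes c: "cx G \<rho> \<rho>" and w: "M (ct (iso I A B) \<rho>) w w" and i: "M (ct I \<rho>) i i"
  shows "isoF (vF w i n) (vS w i n) (VX (TA \<rho> i) n) (VX (TB \<rho> i) n)"
proof -
  let ?k = "\<lambda>_::nat. n"
  note a = frA[OF c i] and b = frB[OF c i]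
  have i': "M (ct I (\<rho> \<circ> ?k)) (sdeg i \<circ> ?k) (sdeg i \<circ> ?k)" unfolding env_o(1) by (rule M_reindex[OF tI[OF c] M_deg[OF tI[OF c] i]])
  note L = iso_laws[OF cx_reindex[OF wG c] iso_re[OF c w] i', unfolded at_const bs_sap_deg]
  have e: "ac (sdeg (mF (w \<circ> ?k))) (sdeg i \<circ> ?k) (ac (sdeg (mS (w \<circ> ?k))) (sdeg i \<circ> ?k) (\<lambda>_. x)) = (\<lambda>_. vF w i n (vS w i n x))"
    "ac (sdeg (mS (w \<circ> ?k))) (sdeg i \<circ> ?k) (ac (sdeg (mF (w \<circ> ?k))) (sdeg i \<circ> ?k) (\<lambda>_. x)) = (\<lambda>_. vS w i n (vF w i n x))" for x
    unfolding m_o by (simp_all add: sap_def sdeg_def)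
  have "VX (TB \<rho> i) n (vF w i n (vS w i n y)) y" if "VX (TB \<rho> i) n y y" for y
    using L(1)[of "\<lambda>_. y" "\<lambda>_. y"] that unfolding M_vx[OF b] e .
  moreover have "VX (TA \<rho> i) n (vS w i n (vF w i n y)) y" if "VX (TA \<rho> i) n y y" for y
    using L(3)[of "\<lambda>_. y" "\<lambda>_. y"] that unfolding M_vx[OF a] e .
  ultimately show ?thesis unfolding isoF_def using vF_rel[OF c w i] by blast
qed

text \<open>All transports of \<open>y\<close> form one clique, and a morphism of families maps
  cliques to cliques; naturality is read off by \<open>RF_edge\<close>.\<close>

lemma iso_nat:
  assumes c: "cx G \<rho> \<rho>" and w: "M (ct (iso I A B) \<rho>) w w" and i: "M (ct I \<rho>) i i" and y: "VX (TA \<rho> i) m y y"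
  shows "VX (TB \<rho> i) n (vF w i n (TRW (TA \<rho> i m) (TA \<rho> i n) y)) (TRW (TB \<rho> i m) (TB \<rho> i n) (vF w i m y))"
proof -
  note a = frA[OF c i] and b = frB[OF c i]
  let ?T = "TA \<rho> i" let ?x = "sTR ?T (\<lambda>_. m) (\<lambda>n. n) (\<lambda>_. y)"
  have "RF ?T (\<lambda>_. m) (\<lambda>_. y) (\<lambda>_. y)" using y by (simp add: VX_def vx_def)
  from rel_jn(2)[OF goodD(1)[OF frD(2)[OF a]], OF trokD[OF goodD(2)[OF frD(2)[OF a]], OF this]]
  have x: "M ?T ?x ?x" unfolding M_fr[OF a] .
  note df = M_deg[OF M_univ_ty[OF t_hom[OF I A B] c] iso_F[OF c w]]
  have "M (TB \<rho> i) (ac (sdeg (mF w)) (sdeg i) ?x) (ac (sdeg (mF w)) (sdeg i) ?x)"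
    using hom_app[OF I A B c df M_deg[OF tI[OF c] i], unfolded bs_sap_deg, OF x] .
  from RF_edge[OF b this[unfolded M_fr[OF b]], of n m]
  have 1: "VX (TB \<rho> i) n (TRW (TB \<rho> i m) (TB \<rho> i n) (vF w i m (TRW (?T m) (?T m) y))) (vF w i n (TRW (?T m) (?T n) y))"
    unfolding ac_vF by (simp add: sTR_def)
  note 2 = tr_VX[OF b vF_rel(1)[OF c w i tr_id[OF a y]], of n]
  show ?thesis using VX_PER(2)[OF b VX_PER(1)[OF b 1] 2] .
qed

text \<open>A clique of indices over the doubled context is one over \<open>hf k\<close>, at which
  both families can be evaluated; the parity of \<open>k\<close> then selects the entry.\<close>

lemma arrU_jn:
  assumes c: "cx G \<rho> \<rho>'" and o: "\<And>n. ord (x n) \<and> ord (y n) \<and> ord (x' n) \<and> ord (y' n)"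
    and H: "\<And>k i i'. M (ct I (\<rho> \<circ> k)) i i' \<Longrightarrow> usame (jn (bs (sap (x \<circ> k) i)) (bs (sap (y \<circ> k) i))) (jn (bs (sap (x' \<circ> k) i')) (bs (sap (y' \<circ> k) i')))"
  shows "M (ct (arr I Univ) \<rho> \<circ> dia) (jn x y) (jn x' y')"
  unfolding env_o(1)[symmetric] M_arrU[OF I cx_reindex[OF wG c]]
proof (intro conjI allI impI)
  show "ord (jn x y n)" "ord (jn x' y' n)" for n using o by (auto simp: jn_def)
  fix k i i' assume i: "M (ct I (\<rho> \<circ> dia \<circ> k)) i i'"
  have d: "\<rho> \<circ> dia \<circ> k = \<rho> \<circ> hf k" by (simp add: fun_eq_iff hf_def jn_diag)
  let ?p = "\<lambda>n. if even (k n) then 2 * n else Suc (2 * n)"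
  have "jn (bs (sap (x \<circ> hf k) i)) (bs (sap (y \<circ> hf k) i)) \<circ> ?p = bs (sap (jn x y \<circ> k) i)" for x y i
    by (auto simp: fun_eq_iff bs_def sap_def jn_k[of _ _ k] hf_def)
  then show "usame (bs (sap (jn x y \<circ> k) i)) (bs (sap (jn x' y' \<circ> k) i'))"
    using usame_reindex[OF H[OF i[unfolded d]], of ?p] by simp
qed

definition path :: "sq \<Rightarrow> sq \<Rightarrow> sq \<Rightarrow> sq" where
  "path \<alpha> \<beta> w = (\<lambda>e. pr (iso_path (deg (\<alpha> e)) (deg (\<beta> e)) (deg (w e))) (iso_path (\<alpha> e) (\<beta> e) (w e)))"

lemma path_push: "path \<alpha> \<beta> w \<circ> k = path (\<alpha> \<circ> k) (\<beta> \<circ> k) (w \<circ> k)" "e0 (path \<alpha> \<beta> w) = sdeg \<alpha>"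
    "sdeg (path \<alpha> \<beta> w) = path (sdeg \<alpha>) (sdeg \<beta>) (sdeg w)"
  by (simp_all add: path_def fun_eq_iff seq_defs iso_path_def) (simp_all add: deg_def dbl_def)

lemma ord_path: assumes "ord (\<alpha> n)" "ord (\<beta> n)" "ord (w n)" shows "ord (path \<alpha> \<beta> w n)"
proof -
  \<comment> \<open>The token 0 switches from the degenerate to the full values, so that continuity
    in one variable compares the two parts of the path.\<close>
  let ?G = "\<lambda>z x. guard 0 x z \<union> deg z"
  have "iso_path (?G (\<alpha> n) {}) (?G (\<beta> n) {}) (?G (w n) {}) \<subseteq> iso_path (?G (\<alpha> n) {0}) (?G (\<beta> n) {0}) (?G (w n) {0})"
    by (intro cont_mono[of "\<lambda>x. iso_path (?G (\<alpha> n) x) (?G (\<beta> n) x) (?G (w n) x)"] cont_iso_path cont_intros) simp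
  moreover have "?G z {} = deg z" "ord z \<Longrightarrow> ?G z {0} = z" for z using ord_p(2)[of z] by (auto simp: guard_def)
  ultimately show ?thesis using assms by (simp add: path_def ord_def)
qed

text \<open>At an index, the second entry of the path has the elements of \<open>B\<close>, the
  inner type of \<open>A\<close>, and the frame of \<open>A\<close> followed by the
  isomorphism.\<close>

lemma path_code:
  "\<exists>u v. (\<forall>n. bs (sap (e1 (path \<alpha> \<beta> w)) i) n = Fr (frY (bs (sap \<beta> i) n)) (frX (bs (sap \<alpha> i) n)) (u n) (v n)) \<and>
     (\<forall>n z. fap (u n) z = vF w i n (fap (frU (bs (sap \<alpha> i) n)) z)) \<and>
     (\<forall>n z. fap (v n) z = fap (frV (bs (sap \<alpha> i) n)) (vS w i n z))"
proof -
  let ?u = "\<lambda>a f j. lam (\<lambda>z. app (app f j) (fap (frU (app a j)) z))"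
  let ?v = "\<lambda>a g j. lam (\<lambda>z. app (frV (app a j)) (fap (app g j) z))"
  let ?f = "\<lambda>n. p1 (p1 (w n))" and ?g = "\<lambda>n. p1 (p1 (p2 (p1 (w n))))"
  have c: "cont (\<lambda>i. Fr (frY (app b i)) (frX (app a i)) (?u a f i) (?v a g i))" for a b f g
    by (intro cont_Fr cont_intros cont_W)
  have cu: "cont (\<lambda>z. app f (fap g z))" for f g by (intro cont_intros cont_W)
  have bu: "fap (lam (\<lambda>z. app f (fap g z))) z = fap f (fap g z)" for f g z
    by (rule dom_eqI) (simp_all add: beta cu)
  have code: "bs (sap (e1 (path \<alpha> \<beta> w)) i) n = Fr (frY (bs (sap \<beta> i) n)) (frX (bs (sap \<alpha> i) n)) 
     (?u (p1 (\<alpha> n)) (?f n) (deg (i n))) (?v (p1 (\<alpha> n)) (?g n) (deg (i n)))" for n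
    by (simp add: bs_def sap_def e1_def path_def iso_path_def beta c)
  have f: "fap (app (?f n) (deg (i n))) z = vF w i n z" 
    "fap (app (?g n) (deg (i n))) z = vS w i n z" for n z
    by (rule dom_eqI; simp add: mF_def mS_def seq_defs)+
  have bsap: "app (p1 (\<alpha> n)) (deg (i n)) = bs (sap \<alpha> i) n" for n by (simp add: bs_def sap_def)
  show ?thesis
    by (rule exI[of _ "\<lambda>n. ?u (p1 (\<alpha> n)) (?f n) (deg (i n))"], rule exI[of _ "\<lambda>n. ?v (p1 (\<alpha> n)) (?g n) (deg (i n))"],
        simp only: code bu) (simp only: f bsap simp_thms)
qed

abbreviation "TP \<rho> w i \<equiv> bs (sap (e1 (path (vs A \<rho>) (vs B \<rho>) w)) i)"

text \<open>The copy of \<open>B\<close> is transported by conjugating the transport of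
  \<open>A\<close> with the isomorphism. By naturality this is the transport of \<open>B\<close>, so
  the copy equals \<open>B\<close> in the universe, and the rung from \<open>A\<close> to the copy
  is the isomorphism itself.\<close>

lemma path_fr:
  assumes c: "cx G \<rho> \<rho>" and w: "M (ct (iso I A B) \<rho>) w w" and i: "M (ct I \<rho>) i i"
  shows "fr (jn (TA \<rho> i) (TP \<rho> w i))" "VX (jn (TA \<rho> i) (TP \<rho> w i)) (Suc (2 * n)) = VX (TB \<rho> i) n"
    "usame (TB \<rho> i) (TP \<rho> w i)"
    "VX (TA \<rho> i) n x x \<Longrightarrow> VX (TB \<rho> i) n (vF w i n x) (TRW (TA \<rho> i n) (TP \<rho> w i n) x)"
proof -
  note a = frA[OF c i] and b = frB[OF c i] and F = iso_vx[OF c w i]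
  obtain u v where TP: "\<And>n. TP \<rho> w i n = Fr (frY (TB \<rho> i n)) (frX (TA \<rho> i n)) (u n) (v n)"
    and u: "\<And>n z. fap (u n) z = vF w i n (fap (frU (TA \<rho> i n)) z)" and v: "\<And>n z. fap (v n) z = fap (frV (TA \<rho> i n)) (vS w i n z)"
    using path_code[of "vs A \<rho>" "vs B \<rho>" w i] by blast
  note P = path_frame[OF a b F TP u v]
  have d: "(2 * n) div 2 = n" "Suc (2 * n) div 2 = n" for n :: nat by simp_all
  show fP: "fr (jn (TA \<rho> i) (TP \<rho> w i))" by (rule P(1))
  show VP: "VX (jn (TA \<rho> i) (TP \<rho> w i)) (Suc (2 * n)) = VX (TB \<rho> i) n" for n by (rule P(3))
  have tr: "TRW (TP \<rho> w i m) (TP \<rho> w i n) x = vF w i n (TRW (TA \<rho> i m) (TA \<rho> i n) (vS w i m x))" for m n x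
    using P(4)[of "Suc (2 * m)" "Suc (2 * n)" x] unfolding jn_simps d .
  have tr0: "TRW (TA \<rho> i m) (TP \<rho> w i n) x = vF w i n (TRW (TA \<rho> i m) (TA \<rho> i n) x)" for m n x
    using P(4)[of "2 * m" "Suc (2 * n)" x] unfolding jn_simps d .
  show "VX (TB \<rho> i) n (vF w i n x) (TRW (TA \<rho> i n) (TP \<rho> w i n) x)" if "VX (TA \<rho> i) n x x"
    unfolding tr0 by (rule VX_PER(1)[OF b vF_rel(1)[OF c w i tr_id[OF a that]]])
  have f1: "fr (TP \<rho> w i)" "VX (TP \<rho> w i) e = VX (TB \<rho> i) e" for e
    using fr_reindex(1,3)[OF fP, of "\<lambda>n. Suc (2 * n)"] VP by simp_all
  have "agr (TB \<rho> i) (TP \<rho> w i) m n" for m n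
    unfolding agr_def tr
  proof (intro allI impI)
    fix x assume x: "VX (TB \<rho> i) m x x"
    note sx = vF_rel(2)[OF c w i x]
    have "VX (TB \<rho> i) n (TRW (TB \<rho> i m) (TB \<rho> i n) x) (TRW (TB \<rho> i m) (TB \<rho> i n) (vF w i m (vS w i m x)))"
      by (rule tr_VX[OF b VX_PER(1)[OF b isoFD(4)[OF F, OF x]]])
    from VX_PER(2)[OF b this VX_PER(1)[OF b iso_nat[OF c w i sx]]]
    show "VX (TB \<rho> i) n (TRW (TB \<rho> i m) (TB \<rho> i n) x) (vF w i n (TRW (TA \<rho> i m) (TA \<rho> i n) (vS w i m x)))" .
  qed
  then show "usame (TB \<rho> i) (TP \<rho> w i)" using b f1 by (simp add: usame_def)
qed

lemma path_L:
  assumes c: "cx G \<rho> \<rho>" and w: "M (ct (iso I A B) \<rho>) w w" and i: "M (ct I \<rho>) i i"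
    and L: "fr (jn L0 L1)" "usame (TA \<rho> i) L0" "usame (TB \<rho> i) L1"
    and tr: "\<And>n x. VX (TA \<rho> i) n x x \<Longrightarrow> VX (TB \<rho> i) n (vF w i n x) (TRW (L0 n) (L1 n) x)"
  shows "usame (jn (TA \<rho> i) (TP \<rho> w i)) (jn L0 L1)"
proof -
  note a = frA[OF c i] and b = frB[OF c i] and F = iso_vx[OF c w i]
  obtain u v where TP: "\<And>n. TP \<rho> w i n = Fr (frY (TB \<rho> i n)) (frX (TA \<rho> i n)) (u n) (v n)"
    and u: "\<And>n z. fap (u n) z = vF w i n (fap (frU (TA \<rho> i n)) z)" and v: "\<And>n z. fap (v n) z = fap (frV (TA \<rho> i n)) (vS w i n z)"
    using path_code[of "vs A \<rho>" "vs B \<rho>" w i] by blast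
  show ?thesis by (rule path_usame[OF a b F TP u v L tr])
qed

text \<open>The first entry is \<open>A\<close> itself and the second equals \<open>B\<close> by
  \<open>path_fr\<close>. Equal isomorphisms give equal rungs, and \<open>path_L\<close> turns this
  into equality of the paths.\<close>

lemma path_type:
  assumes c: "cx G \<rho> \<rho>'" and w: "M (ct (iso I A B) \<rho>) w w'"
  shows "M (ct (Eq (arr I Univ) A B) \<rho>) (path (vs A \<rho>) (vs B \<rho>) w) (path (vs A \<rho>') (vs B \<rho>') w')"
proof -
  let ?P = "path (vs A \<rho>) (vs B \<rho>) w" and ?P' = "path (vs A \<rho>') (vs B \<rho>') w'"
  note c1 = cx_refl(1)[OF wG c] and c2 = cx_refl(2)[OF wG c]
  note t = tysD[OF jtyD(2)[OF W] c] and tw = tIso[OF c]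
  note ma = tmsD[OF jtmD(3)[OF A] c] and mb = tmsD[OF jtmD(3)[OF B] c]
  note w1 = M_refl(1)[OF tw w] and w2 = M_refl(2)[OF tw w, folded M_conv[OF tw]]
  have ow: "ord (w n) \<and> ord (w' n)" for n by (rule M_ord[OF tw w])
  have o: "ord (?P n) \<and> ord (?P' n)" for n using ow vs_ord[OF wG c] by (simp add: ord_path)
  have e1: "M (ct (arr I Univ) \<sigma>) (e1 (path (vs A \<sigma>) (vs B \<sigma>) v)) (sdeg (vs B \<sigma>))" if cs: "cx G \<sigma> \<sigma>" and v: "M (ct (iso I A B) \<sigma>) v v" for \<sigma> v
    unfolding M_arrU[OF I cs]
  proof (intro conjI allI impI)
    show "ord (e1 (path (vs A \<sigma>) (vs B \<sigma>) v) n)" "ord (sdeg (vs B \<sigma>) n)" for n by (simp_all add: e1_def sdeg_def)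
    fix k i i' assume i: "M (ct I (\<sigma> \<circ> k)) i i'"
    note ck = cx_reindex[OF wG cs, of k]
    have "usame (TB (\<sigma> \<circ> k) i) (TP (\<sigma> \<circ> k) (v \<circ> k) i)" 
      by (rule path_fr(3)[OF ck iso_re[OF cs v] M_refl(1)[OF tI[OF ck] i]])
    from usame_trans[OF usame_sym[OF this] fam_usame[OF I B ck i]]
    show "usame (bs (sap (e1 (path (vs A \<sigma>) (vs B \<sigma>) v) \<circ> k) i)) (bs (sap (sdeg (vs B \<sigma>) \<circ> k) i'))"
      by (simp add: o_push(7)[symmetric] o_push(3)[symmetric] path_push(1) env_o bs_sap_deg)
  qed
  have J: "M (ct (arr I Univ) \<rho> \<circ> dia) (jn (e0 ?P) (e1 ?P)) (jn (e0 ?P') (e1 ?P'))"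
  proof (rule arrU_jn[OF c])
    show "ord (e0 ?P n) \<and> ord (e1 ?P n) \<and> ord (e0 ?P' n) \<and> ord (e1 ?P' n)" for n by (simp add: e0_def e1_def)
    fix k i i' assume i: "M (ct I (\<rho> \<circ> k)) i i'"
    note ck = cx_reindex[OF wG c, of k] and ck1 = cx_reindex[OF wG c1, of k] and ck2 = cx_reindex[OF wG c2, of k]
    note i1 = M_refl(1)[OF tI[OF ck] i] and i2 = M_refl(2)[OF tI[OF ck] i, folded M_conv[OF tI[OF ck]]]
    note wk = iso_re[OF c w, of k] and wk1 = iso_re[OF c1 w1, of k] and wk2 = iso_re[OF c2 w2, of k]
    note uA = fam_usame[OF I A ck i] and uB = fam_usame[OF I B ck i]
    note Q = path_fr[OF ck2 wk2 i2]
    note b = frB[OF ck1 i1]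
    have "usame (jn (TA (\<rho> \<circ> k) i) (TP (\<rho> \<circ> k) (w \<circ> k) i)) (jn (TA (\<rho>' \<circ> k) i') (TP (\<rho>' \<circ> k) (w' \<circ> k) i'))"
    proof (rule path_L[OF ck1 wk1 i1 Q(1) uA usame_trans[OF uB Q(3)]])
      fix n x assume x: "VX (TA (\<rho> \<circ> k) i) n x x"
      have V: "VX (TA (\<rho>' \<circ> k) i') n = VX (TA (\<rho> \<circ> k) i) n" "VX (TB (\<rho>' \<circ> k) i') n = VX (TB (\<rho> \<circ> k) i) n"
        using uA uB by (auto simp: usame_def)
      show "VX (TB (\<rho> \<circ> k) i) n (vF (w \<circ> k) i n x) (TRW (TA (\<rho>' \<circ> k) i' n) (TP (\<rho>' \<circ> k) (w' \<circ> k) i' n) x)"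
        by (rule VX_PER(2)[OF b vF_rel(1)[OF ck wk i x] Q(4)[of n x, unfolded V, OF x]])
    qed
    then show "usame (jn (bs (sap (e0 ?P \<circ> k) i)) (bs (sap (e1 ?P \<circ> k) i))) (jn (bs (sap (e0 ?P' \<circ> k) i')) (bs (sap (e1 ?P' \<circ> k) i')))"
      by (simp add: o_push(6,7)[symmetric] o_push(3)[symmetric] path_push(1,2) env_o bs_sap_deg)
  qed
  show ?thesis
    unfolding ct_simps(4) M_eq[OF t M_refl(1)[OF t ma] M_refl(1)[OF t mb]] path_push(2)
    using o M_refl(1)[OF t M_deg[OF t ma]] e1[OF c1 w1] M_sym[OF t M_deg[OF t ma]] 
      M_trans[OF t e1[OF c2 w2, unfolded M_conv[OF t]] M_sym[OF t M_deg[OF t mb]]] J[unfolded path_push(2)] by blast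
qed

end

section \<open>Familial categorical univalence holds\<close>

text \<open>The second component is a path in a small type, hence unique, so sections and
  retractions are compared by their maps.\<close>

lemma sec_eq:
  assumes I: "jm G I Univ" and A: "jm G A (arr I Univ)" and B: "jm G B (arr I Univ)" and f: "jm G f (hom I A B)"
    and c: "cx G \<rho> \<rho>'" and s: "M (ct (hom I B A) \<rho>) (sfst u) (sfst v)"
  shows "M (ct (hom_sec I A B f) \<rho>) u u \<Longrightarrow> M (ct (hom_sec I A B f) \<rho>') v v \<Longrightarrow> M (ct (hom_sec I A B f) \<rho>) u v"
    "M (ct (hom_ret I A B f) \<rho>) u u \<Longrightarrow> M (ct (hom_ret I A B f) \<rho>') v v \<Longrightarrow> M (ct (hom_ret I A B f) \<rho>) u v"
proof -
  have X: "jt G (hom I B A)" by (rule j_el[OF t_hom[OF I B A]])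
  note b = t_hom_sec_body[OF I A B f] and W = jtyD(1)[OF X]
  note sec = M_sig[OF W jtyD(2)[OF X] jtyD(2)[OF j_el[OF b(1)]], folded hom_sec_def]
    and ret = M_sig[OF W jtyD(2)[OF X] jtyD(2)[OF j_el[OF b(2)]], folded hom_ret_def]
  note I' = t_wk_univ[OF I X] and A' = t_wk_fam[OF X A] and B' = t_wk_fam[OF X B]
  have f': "jm (hom I B A # G) (wk f) (hom (wk I) (wk A) (wk B))" by (rule jtm_cong[OF jtm_wk[OF f X] cl_wk_hom])
  have v: "jm (hom I B A # G) (Var 0) (hom (wk I) (wk B) (wk A))" by (rule jtm_cong[OF t_var0[OF X] cl_wk_hom])
  note c1 = cx_refl(1)[OF W c] and c2 = cx_refl(2)[OF W c]
  have cs: "cx (hom I B A # G) (xc (sfst u) \<rho>) (xc (sfst v) \<rho>')" by (rule cx_ext[OF c s])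
  note cu = cx_refl(1)[OF t_ctx[OF X] cs]
  {
    assume u: "M (ct (hom_sec I A B f) \<rho>) u u" and v': "M (ct (hom_sec I A B f) \<rho>') v v"
    note t = tysD[OF jtyD(2)[OF j_el[OF b(1)]] cs]
    show "M (ct (hom_sec I A B f) \<rho>) u v"
      using u v' s small_eqD(2)[OF M_univ_ty[OF t_hom[OF I' B' B'] cu] tmsD[OF jtmD(3)[OF t_hom_comp[OF I' B' A' B' f' v]] cu]
          tmsD[OF jtmD(3)[OF t_hom_id[OF I' B']] cu], folded ct_simps(4)]
      unfolding sec[OF c] sec[OF c1] sec[OF c2] M_conv[OF t] by blast
  next
    assume u: "M (ct (hom_ret I A B f) \<rho>) u u" and v': "M (ct (hom_ret I A B f) \<rho>') v v"
    note t = tysD[OF jtyD(2)[OF j_el[OF b(2)]] cs]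
    show "M (ct (hom_ret I A B f) \<rho>) u v"
      using u v' s small_eqD(2)[OF M_univ_ty[OF t_hom[OF I' A' A'] cu] tmsD[OF jtmD(3)[OF t_hom_comp[OF I' A' B' A' v f']] cu]
          tmsD[OF jtmD(3)[OF t_hom_id[OF I' A']] cu], folded ct_simps(4)]
      unfolding ret[OF c] ret[OF c1] ret[OF c2] M_conv[OF t] by blast
  }
qed

context famcat
begin

lemma tH: "cx G \<rho> \<rho>' \<Longrightarrow> tyeq True (ct (hom I A B) \<rho>) (ct (hom I A B) \<rho>')" 
    "cx G \<rho> \<rho>' \<Longrightarrow> tyeq True (ct (hom I B A) \<rho>) (ct (hom I B A) \<rho>')"
  by (rule M_univ_ty[OF t_hom[OF I A B]] M_univ_ty[OF t_hom[OF I B A]], assumption)+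

text \<open>Inverses of equal maps are equal. Only actual parts of the maps are compared, but on
  arguments with dual parts, where \<open>iso_laws\<close> still holds.\<close>

lemma iso_inv_unique:
  assumes c: "cx G \<rho> \<rho>" and w: "M (ct (iso I A B) \<rho>) w w" and z: "M (ct (iso I A B) \<rho>) z z"
    and F: "M (ct (hom I A B) \<rho>) (sdeg (mF w)) (sdeg (mF z))"
  shows "M (ct (hom I B A) \<rho>) (sdeg (mS w)) (sdeg (mS z))" "M (ct (hom I B A) \<rho>) (sdeg (mR w)) (sdeg (mR z))"
proof -
  have main: "M (TA (\<rho> \<circ> k) i) (ac (sdeg (mS w) \<circ> k) i x) (ac (sdeg (mS z) \<circ> k) i' x')"
    "M (TA (\<rho> \<circ> k) i) (ac (sdeg (mR w) \<circ> k) i x) (ac (sdeg (mR z) \<circ> k) i' x')"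
    if i: "M (ct I (\<rho> \<circ> k)) i i'" and x: "M (TB (\<rho> \<circ> k) i) x x'" for k i i' x x'
  proof -
    note ck = cx_reindex[OF wG c, of k] and wk = iso_re[OF c w, of k] and zk = iso_re[OF c z, of k]
    note i1 = M_refl(1)[OF tI[OF ck] i]
    have T: "tyeq True (TA (\<rho> \<circ> k) i) (TA (\<rho> \<circ> k) i)" "tyeq True (TB (\<rho> \<circ> k) i) (TB (\<rho> \<circ> k) i)" 
      using fr_tyeq frA[OF ck i1] frB[OF ck i1] by auto
    note x1 = M_refl(1)[OF T(2) x]
    note sz = M_deg[OF tH(2)[OF ck] iso_S(1)[OF ck zk]] and rz = M_deg[OF tH(2)[OF ck] iso_S(2)[OF ck zk]]
      and sw = M_deg[OF tH(2)[OF ck] iso_S(1)[OF ck wk]] and rw = M_deg[OF tH(2)[OF ck] iso_S(2)[OF ck wk]]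
    have Fk: "M (ct (hom I A B) (\<rho> \<circ> k)) (sdeg (mF (w \<circ> k))) (sdeg (mF (z \<circ> k)))"
      using M_reindex[OF tH(1)[OF c] F, of k] by (simp add: m_o o_push env_o)
    note Lw = iso_laws[OF ck wk i1] and Lz = iso_laws[OF ck zk i1]
    let ?s = "ac (sdeg (mS (z \<circ> k))) i x"
    note szx = hom_app[OF I B A ck sz i1 x1]
    have "M (TB (\<rho> \<circ> k) i) (ac (sdeg (mF (w \<circ> k))) i ?s) (ac (sdeg (mF (z \<circ> k))) i ?s)" by (rule hom_app[OF I A B ck Fk i1 szx])
    from M_trans[OF T(2) this Lz(1)[OF x1]]
    have wz: "M (TB (\<rho> \<circ> k) i) x (ac (sdeg (mF (w \<circ> k))) i ?s)" by (rule M_sym[OF T(2)])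
    have 1: "M (TA (\<rho> \<circ> k) i) (ac (sdeg (mS (w \<circ> k))) i x) ?s" "M (TA (\<rho> \<circ> k) i) (ac (sdeg (mR (w \<circ> k))) i x) ?s"
      using M_trans[OF T(1) hom_app[OF I B A ck sw i1 wz] Lw(3)[OF szx]] M_trans[OF T(1) hom_app[OF I B A ck rw i1 wz] Lw(2)[OF szx]] .
    have 2: "M (TA (\<rho> \<circ> k) i) (ac (sdeg (mR (z \<circ> k))) i x) ?s"
      by (rule M_trans[OF T(1) hom_app[OF I B A ck rz i1 M_sym[OF T(2) Lz(1)[OF x1]]] Lz(2)[OF szx]])
    have 3: "M (TA (\<rho> \<circ> k) i) ?s (ac (sdeg (mS (z \<circ> k))) i' x')" by (rule hom_app[OF I B A ck sz i x])
    have 4: "M (TA (\<rho> \<circ> k) i) (ac (sdeg (mR (z \<circ> k))) i x) (ac (sdeg (mR (z \<circ> k))) i' x')" by (rule hom_app[OF I B A ck rz i x])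
    show "M (TA (\<rho> \<circ> k) i) (ac (sdeg (mS w) \<circ> k) i x) (ac (sdeg (mS z) \<circ> k) i' x')"
      using M_trans[OF T(1) 1(1) 3] by (simp add: m_o o_push)
    show "M (TA (\<rho> \<circ> k) i) (ac (sdeg (mR w) \<circ> k) i x) (ac (sdeg (mR z) \<circ> k) i' x')"
      using M_trans[OF T(1) M_trans[OF T(1) 1(2) M_sym[OF T(1) 2]] 4] by (simp add: m_o o_push)
  qed
  have o: "ord (mS w n) \<and> ord (mS z n)" "ord (mR w n) \<and> ord (mR z n)" for n
    using M_ord[OF tH(2)[OF c] iso_S(1)[OF c w], of n] M_ord[OF tH(2)[OF c] iso_S(1)[OF c z], of n]
      M_ord[OF tH(2)[OF c] iso_S(2)[OF c w], of n] M_ord[OF tH(2)[OF c] iso_S(2)[OF c z], of n] by auto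
  show "M (ct (hom I B A) \<rho>) (sdeg (mS w)) (sdeg (mS z))" by (rule hom_degI[OF I B A c o(1) main(1)])
  show "M (ct (hom I B A) \<rho>) (sdeg (mR w)) (sdeg (mR z))" by (rule hom_degI[OF I B A c o(2) main(2)])
qed

lemma iso_eqI:
  assumes c: "cx G \<rho> \<rho>" and w: "M (ct (iso I A B) \<rho>) w w" and z: "M (ct (iso I A B) \<rho>) z z"
    and F: "M (ct (hom I A B) \<rho>) (sdeg (mF w)) (sdeg (mF z))"
  shows "M (ct (iso I A B) \<rho>) (sdeg w) (sdeg z)"
proof -
  note SR = iso_inv_unique[OF c w z F]
  note dw = M_deg[OF tIso[OF c] w] and dz = M_deg[OF tIso[OF c] z]
  have F': "M (ct (hom I A B) \<rho>) (mF (sdeg w)) (mF (sdeg z))" using F by (simp add: m_deg)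
  note Pw = dw[unfolded M_iso[OF c iso_F[OF c dw]]] and Pz = dz[unfolded M_iso[OF c iso_F[OF c dz]]]
  have c1: "cx G1 (xc (mF (sdeg w)) \<rho>) (xc (mF (sdeg z)) \<rho>)" by (rule cx_ext[OF c F'])
  have S: "M (ct (hom (wk I) (wk B) (wk A)) (xc (mF (sdeg w)) \<rho>)) (sfst (sfst (ssnd (sdeg w)))) (sfst (sfst (ssnd (sdeg z))))"
    "M (ct (hom (wk I) (wk B) (wk A)) (xc (mF (sdeg w)) \<rho>)) (sfst (ssnd (ssnd (sdeg w)))) (sfst (ssnd (ssnd (sdeg z))))"
    unfolding ct_wk_hom mS_def[symmetric] mR_def[symmetric] m_deg using SR by auto
  show ?thesis
    unfolding M_iso[OF c F'] using sec_eq(1)[OF I1 A1 B1 v1 c1 S(1)] sec_eq(2)[OF I1 A1 B1 v1 c1 S(2)] Pw Pz by blast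
qed

abbreviation "X \<equiv> Eq (arr I Univ) A B"
abbreviation "Y \<equiv> iso I A B"
abbreviation "K \<equiv> id_to_iso I A B"

lemma jX: "jt G X" by (rule j_eq[OF W A B])
lemmas jY = j_el[OF Iso]
lemmas jK = t_id_to_iso[OF I A B]
lemma tX: "cx G \<rho> \<rho>' \<Longrightarrow> tyeq False (ct X \<rho>) (ct X \<rho>')" by (rule tysD[OF jtyD(2)[OF jX]])
lemma tW: "cx G \<rho> \<rho>' \<Longrightarrow> tyeq False (ct (arr I Univ) \<rho>) (ct (arr I Univ) \<rho>')" by (rule tysD[OF jtyD(2)[OF W]])

lemma M_X:
  assumes c: "cx G \<rho> \<rho>"
  shows "M (ct X \<rho>) p p' \<longleftrightarrow> (\<forall>n. ord (p n) \<and> ord (p' n)) \<and> M (ct (arr I Univ) \<rho>) (e0 p) (sdeg (vs A \<rho>)) \<and> M (ct (arr I Univ) \<rho>) (e1 p) (sdeg (vs B \<rho>)) \<and>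
    M (ct (arr I Univ) \<rho>) (e0 p') (sdeg (vs A \<rho>)) \<and> M (ct (arr I Univ) \<rho>) (e1 p') (sdeg (vs B \<rho>)) \<and>
    M (ct (arr I Univ) \<rho> \<circ> dia) (jn (e0 p) (e1 p)) (jn (e0 p') (e1 p'))"
  unfolding ct_simps(4) by (rule M_eq[OF tW[OF c] tmsD[OF jtmD(3)[OF A] c] tmsD[OF jtmD(3)[OF B] c]])

lemma X_fib:
  assumes c: "cx G \<rho> \<rho>" and p: "M (ct X \<rho>) p p" and i: "M (ct I \<rho>) i i'"
  shows "usame (TA \<rho> i) (bs (sap (e0 p) i))" "usame (TB \<rho> i) (bs (sap (e1 p) i))"
    "usame (jn (bs (sap (e0 p) i)) (bs (sap (e1 p) i))) (jn (bs (sap (e0 p) i')) (bs (sap (e1 p) i')))"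
proof -
  note P = p[unfolded M_X[OF c]]
  have U: "usame (bs (sap F j)) (bs (sap F' j'))" if "cx G \<sigma> \<sigma>" "M (ct (arr I Univ) \<sigma>) F F'" "M (ct I \<sigma>) j j'" for F F' j j' \<sigma>
    using that(2)[unfolded M_arrU[OF I that(1)], THEN conjunct2, rule_format, of "\<lambda>n. n" j j'] that(3) by simp
  note i1 = M_refl(1)[OF tI[OF c] i]
  have P1: "M (ct (arr I Univ) \<rho>) (e0 p) (sdeg (vs A \<rho>))" "M (ct (arr I Univ) \<rho>) (e1 p) (sdeg (vs B \<rho>))"
    "M (ct (arr I Univ) (\<rho> \<circ> dia)) (jn (e0 p) (e1 p)) (jn (e0 p) (e1 p))"
    using P unfolding env_o(1) by blast+
  show "usame (TA \<rho> i) (bs (sap (e0 p) i))" "usame (TB \<rho> i) (bs (sap (e1 p) i))"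
    using U[OF c M_sym[OF tW[OF c] P1(1)] i1] U[OF c M_sym[OF tW[OF c] P1(2)] i1] unfolding bs_sap_deg .
  have "M (ct I (\<rho> \<circ> dia)) (jn i i) (jn i' i')" unfolding env_o(1) jn_dia[of i] jn_dia[of i'] by (rule M_reindex[OF tI[OF c] i])
  from U[OF cx_reindex[OF wG c] P1(3) this]
  show "usame (jn (bs (sap (e0 p) i)) (bs (sap (e1 p) i))) (jn (bs (sap (e0 p) i')) (bs (sap (e1 p) i')))"
    by (simp add: jn_push bs_push)
qed

text \<open>\<open>id_to_iso\<close> acts as transport along the path. By \<open>J_clique\<close>
  the identity isomorphism and the isomorphism obtained from \<open>p\<close> form one clique over
  the contraction; applied to \<open>x\<close> in both halves, it gives a clique from
  \<open>x\<close> to its image, and \<open>RF_edge\<close> reads this as a transport.\<close>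

lemma K_transport:
  assumes c: "cx G \<rho> \<rho>" and p: "M (ct X \<rho>) p p" and i: "M (ct I \<rho>) i i" and x: "M (TA \<rho> i) x x"
  shows "VX (TB \<rho> i) n (TRW (bs (sap (e0 p) i) n) (bs (sap (e1 p) i) n) (x n)) (ac (mF (sap (vs K \<rho>) p)) i x n)"
proof -
  let ?L = "jn (bs (sap (e0 p) i)) (bs (sap (e1 p) i))"
  note m = t_motive[OF I jX]
  have pv: "jm (X # G) (Var 0) (Eq (wk (arr I Univ)) (wk A) (wk B))" using t_var0[OF jX] by simp
  have cp: "cx (X # G) (xc p \<rho>) (xc p \<rho>)" by (rule cx_ext[OF c p])
  let ?k = "kap p (vs A \<rho>) (xc p \<rho>)" and ?I = "wk (wk (wk (wk I)))"
  let ?d = "vs (id_iso (wk (wk I)) (Var 0)) (xc (vs A \<rho>) (xc p \<rho>))"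
  let ?J = "sap (vs K \<rho>) p"
  note C = J_clique(1)[OF m(1,5,6) jtm_wk[OF A jX] jtm_wk[OF B jX] pv cp, unfolded vs_simps wk_simps]
    J_clique(2)[where A' = "wk (arr I Univ)", OF m(1,5,6) jtm_wk[OF A jX] jtm_wk[OF B jX] pv cp, unfolded vs_simps wk_simps]
  have J: "vs (J (wk (arr I Univ)) (iso ?I (Var 2) (Var 1)) (id_iso (wk (wk I)) (Var 0)) (wk A) (wk B) (Var 0)) (xc p \<rho>) = ?J"
    unfolding id_to_iso_def vs_simps ..
  have f: "M (ct (hom ?I (Var 2) (Var 1)) ?k) (mF (jn ?d ?J)) (mF (jn ?d ?J))"
    using famcat.iso_F[OF famcat.intro[OF m(2,3,4)] C(1) C(2)[unfolded J]] .
  have k: "ct ?I ?k = ct I \<rho> \<circ> dia" "vs (Var 2) ?k = jn (sdeg (vs A \<rho>)) (sdeg (vs A \<rho>))" "vs (Var 1) ?k = jn (e0 p) (e1 p)"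
    unfolding kap_def by (simp_all add: env_o numeral_2_eq_2)
  have i': "M (ct ?I ?k) (jn i i) (jn i i)" unfolding k jn_dia[of i] by (rule M_reindex[OF tI[OF c] i])
  have a: "bs (sap (vs (Var 2) ?k) (jn i i)) = TA \<rho> i \<circ> dia"
    unfolding k jn_push[symmetric] bs_push bs_sap_deg jn_dia[of "bs _"] by (simp add: jn_push bs_push bs_sap_deg jn_o)
  have x': "M (bs (sap (vs (Var 2) ?k) (jn i i))) (jn x x) (jn x x)" 
    unfolding a jn_dia[of x] by (rule M_reindex[OF fr_tyeq[OF frA[OF c i]] x])
  have b: "bs (sap (vs (Var 1) ?k) (jn i i)) = ?L" unfolding k by (simp add: jn_push bs_push)
  have "mF (jn ?d ?J) = jn (mF ?d) (mF ?J)" by (simp add: mF_def jn_push)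
  moreover have "ac (mF ?d) i x = x" unfolding mF_def id_iso_def Let_def vs_simps ac_id ..
  ultimately have ac: "ac (mF (jn ?d ?J)) (jn i i) (jn x x) = jn x (ac (mF ?J) i x)" by (simp add: jn_push)
  have L: "fr ?L" using X_fib(3)[OF c p i] by (simp add: usame_def)
  have "M ?L (jn x (ac (mF ?J) i x)) (jn x (ac (mF ?J) i x))"
    using hom_app[OF m(2,3,4) C(1) f i' x'] unfolding b ac .
  from RF_edge[OF L this[unfolded M_fr[OF L]], of "Suc (2 * n)" "2 * n"]
  have "VX ?L (Suc (2 * n)) (TRW (bs (sap (e0 p) i) n) (bs (sap (e1 p) i) n) (x n)) (ac (mF ?J) i x n)" by simp
  moreover have "VX ?L (Suc (2 * n)) = VX (TB \<rho> i) n"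
    using fr_reindex(3)[OF L, of "\<lambda>n. Suc (2 * n)" n] X_fib(2)[OF c p i] by (simp add: usame_def)
  ultimately show ?thesis by simp
qed

lemma K_type: "cx G \<rho> \<rho>' \<Longrightarrow> M (ct X \<rho>) p p' \<Longrightarrow> M (ct Y \<rho>) (sap (vs K \<rho>) p) (sap (vs K \<rho>') p')"
  by (rule M_arr[OF jX jY _ tmsD[OF jtmD(3)[OF jK]]])

lemma K_deg: "sap (sdeg (vs K \<rho>)) (sdeg p) = sdeg (sap (vs K \<rho>) p)" by (simp add: sdeg_push)

text \<open>The path only knows the action at the actual part of the index. \<open>iso_index\<close>
  passes from the given index to that part, and from there \<open>path_fr\<close> and
  \<open>K_transport\<close> identify both sides with the same transport.\<close>

lemma K_path_F:
  assumes c: "cx G \<rho> \<rho>" and w: "M (ct Y \<rho>) w w" and i: "M (ct I \<rho>) i i" and x: "M (TA \<rho> i) x x"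
  shows "M (TB \<rho> i) (ac (sdeg (mF w)) i x) (ac (sdeg (mF (sap (vs K \<rho>) (path (vs A \<rho>) (vs B \<rho>) w)))) i x)"
proof -
  let ?P = "path (vs A \<rho>) (vs B \<rho>) w" let ?y = "ac (sdeg (mF w)) (sdeg i) x"
  note cd = cx_deg[OF wG c] and b = frB[OF c i]
  have p: "M (ct X (sedeg \<rho>)) (sdeg ?P) (sdeg ?P)" using M_deg[OF tX[OF c] path_type[OF c w]] by simp
  have i': "M (ct I (sedeg \<rho>)) i i" using i by simp
  have x': "M (TA (sedeg \<rho>) i) x x" using x by (simp add: bs_sap_deg)
  have V: "VX (TB \<rho> i) n (TRW (TA \<rho> i n) (TP \<rho> w i n) (x n)) (ac (sdeg (mF (sap (vs K \<rho>) ?P))) i x n)" for n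
    using K_transport[OF cd p i' x', of n] unfolding K_deg m_deg sdeg_push(7,8) path_push(2) env_deg bs_sap_deg .
  have xn: "VX (TA \<rho> i) n (x n) (x n)" for n using RF_VX[OF frA[OF c i]] x unfolding M_fr[OF frA[OF c i]] .
  have vx: "VX (TB \<rho> i) n (?y n) (ac (sdeg (mF (sap (vs K \<rho>) ?P))) i x n)" for n
    unfolding ac_vF by (rule VX_PER(2)[OF b path_fr(4)[OF c w i xn] V])
  have y: "M (TB \<rho> i) (ac (sdeg (mF w)) i x) ?y" by (rule iso_index[OF c w i x])
  show ?thesis
    by (rule M_trans[OF fr_tyeq[OF b] y M_vertI[OF b M_refl(2)[OF fr_tyeq[OF b] y] vx]])
qed

lemma K_path:
  assumes c: "cx G \<rho> \<rho>" and w: "M (ct Y \<rho>) w w"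
  shows "M (ct Y \<rho>) (sdeg w) (sdeg (sap (vs K \<rho>) (path (vs A \<rho>) (vs B \<rho>) w)))"
proof -
  let ?Z = "sap (vs K \<rho>) (path (vs A \<rho>) (vs B \<rho>) w)"
  have z: "M (ct Y \<rho>) ?Z ?Z" by (rule K_type[OF c path_type[OF c w]])
  show ?thesis
  proof (rule iso_eqI[OF c w z], rule hom_degI[OF I A B c])
    show "ord (mF w n) \<and> ord (mF ?Z n)" for n using M_ord[OF tH(1)[OF c] iso_F[OF c w], of n] M_ord[OF tH(1)[OF c] iso_F[OF c z], of n] by simp
    fix k i i' x x' assume i: "M (ct I (\<rho> \<circ> k)) i i'" and x: "M (TA (\<rho> \<circ> k) i) x x'"
    note ck = cx_reindex[OF wG c, of k] and wk = iso_re[OF c w, of k]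
    note i1 = M_refl(1)[OF tI[OF ck] i]
    note x1 = M_refl(1)[OF fr_tyeq[OF frA[OF ck i1]] x]
    have zk: "sap (vs K (\<rho> \<circ> k)) (path (vs A (\<rho> \<circ> k)) (vs B (\<rho> \<circ> k)) (w \<circ> k)) = ?Z \<circ> k" by (simp add: env_o o_push[symmetric] path_push)
    have "M (TB (\<rho> \<circ> k) i) (ac (sdeg (mF (w \<circ> k))) i x) (ac (sdeg (mF (?Z \<circ> k))) i x)"
      using K_path_F[OF ck wk i1 x1] unfolding zk .
    from M_trans[OF fr_tyeq[OF frB[OF ck i1]] this hom_app[OF I A B ck M_deg[OF tH(1)[OF ck] iso_F[OF ck iso_re[OF c z]]] i x]]
    show "M (TB (\<rho> \<circ> k) i) (ac (sdeg (mF w) \<circ> k) i x) (ac (sdeg (mF ?Z) \<circ> k) i' x')" by (simp add: m_o o_push)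
  qed
qed

text \<open>A path of families is determined by its ends and its rungs. Along each rung, the path
  rebuilt from the isomorphism acts by that isomorphism, which is transport along the original
  path.\<close>

lemma path_K:
  assumes c: "cx G \<rho> \<rho>" and p: "M (ct X \<rho>) p p"
  shows "M (ct X \<rho>) (sdeg p) (sdeg (path (vs A \<rho>) (vs B \<rho>) (sap (vs K \<rho>) p)))"
proof -
  let ?w = "sap (vs K \<rho>) p" let ?P = "path (vs A \<rho>) (vs B \<rho>) ?w"
  have w: "M (ct Y \<rho>) ?w ?w" by (rule K_type[OF c p])
  note P = path_type[OF c w, unfolded M_X[OF c]] and p' = p[unfolded M_X[OF c]]
  have "M (ct (arr I Univ) \<rho> \<circ> dia) (jn (e0 p) (e1 p)) (jn (e0 ?P) (e1 ?P))"
  proof (rule arrU_jn[OF c])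
    show "ord (e0 p n) \<and> ord (e1 p n) \<and> ord (e0 ?P n) \<and> ord (e1 ?P n)" for n by (simp add: e0_def e1_def)
    fix k i i' assume i: "M (ct I (\<rho> \<circ> k)) i i'"
    note ck = cx_reindex[OF wG c, of k] and wk = iso_re[OF c w, of k]
    note i2 = M_refl(2)[OF tI[OF ck] i]
    have pk: "M (ct X (\<rho> \<circ> k)) (p \<circ> k) (p \<circ> k)" unfolding env_o(1) by (rule M_reindex[OF tX[OF c] p])
    let ?p = "p \<circ> k" let ?L = "bs (sap (e0 ?p) i')" and ?R = "bs (sap (e1 ?p) i')"
    note Xf = X_fib[OF ck pk i2] and a = frA[OF ck i2] and b = frB[OF ck i2]
    have fL: "fr (jn ?L ?R)" using Xf(3) by (simp add: usame_def)
    have VL: "VX (jn ?L ?R) (2 * n) = VX (TA (\<rho> \<circ> k) i') n" "VX (jn ?L ?R) (Suc (2 * n)) = VX (TB (\<rho> \<circ> k) i') n" for n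
      using fr_reindex(3)[OF fL, of "(*) 2" n] fr_reindex(3)[OF fL, of "\<lambda>n. Suc (2 * n)" n] Xf(1,2) by (simp_all add: usame_def)
    have "usame (jn (TA (\<rho> \<circ> k) i') (TP (\<rho> \<circ> k) (?w \<circ> k) i')) (jn ?L ?R)"
    proof (rule path_L[OF ck wk i2 fL Xf(1,2)])
      fix n x assume x: "VX (TA (\<rho> \<circ> k) i') n x x"
      \<comment> \<open>\<open>K_transport\<close> needs a clique of elements over all entries, so
        \<open>x\<close> is extended by its transports. At entry \<open>n\<close> itself this
        changes \<open>x\<close> only up to equality.\<close>
      let ?T = "TA (\<rho> \<circ> k) i'" let ?x = "sTR ?T (\<lambda>_. n) (\<lambda>n. n) (\<lambda>_. x)"
      have "RF ?T (\<lambda>_. n) (\<lambda>_. x) (\<lambda>_. x)" using x by (simp add: VX_def vx_def)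
      from rel_jn(2)[OF goodD(1)[OF frD(2)[OF a]], OF trokD[OF goodD(2)[OF frD(2)[OF a]], OF this]]
      have x': "M ?T ?x ?x" unfolding M_fr[OF a] .
      have xn: "VX ?T n (?x n) x" using tr_id[OF a x] by (simp add: sTR_def)
      have d: "M (ct X (sedeg (\<rho> \<circ> k))) (sdeg ?p) (sdeg ?p)" "M (ct I (sedeg (\<rho> \<circ> k))) (sdeg i') (sdeg i')" "M (TA (sedeg (\<rho> \<circ> k)) (sdeg i')) ?x ?x"
        using M_deg[OF tX[OF ck] pk] M_deg[OF tI[OF ck] i2] x' by (simp_all add: bs_sap_deg)
      have Zk: "sap (vs K (\<rho> \<circ> k)) ?p = ?w \<circ> k" by (simp add: env_o o_push[symmetric])
      have 1: "VX (TB (\<rho> \<circ> k) i') n (TRW (?L n) (?R n) (?x n)) (vF (?w \<circ> k) i' n (?x n))"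
        using K_transport[OF cx_deg[OF wG ck] d, of n] unfolding K_deg m_deg sdeg_push(7,8) env_deg bs_sap_deg Zk ac_vF .
      have 2: "VX (TB (\<rho> \<circ> k) i') n (TRW (?L n) (?R n) (?x n)) (TRW (?L n) (?R n) x)"
        using tr_VX[OF fL, of "2 * n" "?x n" x "Suc (2 * n)"] xn unfolding VL jn_simps by blast
      have 3: "VX (TB (\<rho> \<circ> k) i') n (vF (?w \<circ> k) i' n x) (vF (?w \<circ> k) i' n (?x n))"
        by (rule vF_rel(1)[OF ck wk i2 VX_PER(1)[OF a xn]])
      show "VX (TB (\<rho> \<circ> k) i') n (vF (?w \<circ> k) i' n x) (TRW (?L n) (?R n) x)"
        by (rule VX_PER(2)[OF b 3 VX_PER(2)[OF b VX_PER(1)[OF b 1] 2]])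
    qed
    from usame_trans[OF X_fib(3)[OF ck pk i] usame_sym[OF this]]
    show "usame (jn (bs (sap (e0 p \<circ> k) i)) (bs (sap (e1 p \<circ> k) i))) (jn (bs (sap (e0 ?P \<circ> k) i')) (bs (sap (e1 ?P \<circ> k) i')))"
      by (simp add: o_push(3,6,7)[symmetric] path_push(1,2) env_o bs_sap_deg)
  qed
  then show ?thesis unfolding M_X[OF c] sdeg_push(7,8) using P p' by (simp add: sdeg_def)
qed

end

lemma jm_sigI:
  assumes A: "jt G A" and B: "jt (A # G) B" and p: "jm G (Proj1 A B t) A" and q: "jm G (Proj2 A B t) (inst B (Proj1 A B t))"
  shows "jm G t (Sig A B)"
proof (rule jtmI[OF j_sig[OF A B]], unfold tms_def, intro allI impI)
  fix \<rho> \<rho>' assume c: "cx G \<rho> \<rho>'"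
  show "M (ct (Sig A B) \<rho>) (vs t \<rho>) (vs t \<rho>')"
    unfolding M_sig[OF jtyD(1,2)[OF A] jtyD(2)[OF B] c]
    using tmsD[OF jtmD(3)[OF p] c] tmsD[OF jtmD(3)[OF q] c] by (simp add: ct_sub)
qed

text \<open>A homotopy to the identity compares actual parts at each argument. If these are equal
  for \<open>w\<close> and its image, the constant path at \<open>w\<close> has the right
  ends.\<close>

lemma htpy_idI:
  assumes Y: "jt G Y" and u: "jm G u (arr Y Y)" and r: "\<And>\<rho> w. sap (vs r \<rho>) w = (\<lambda>e. dbl (dbl (p1 (w e))))"
    and H: "\<And>\<rho> w. cx G \<rho> \<rho> \<Longrightarrow> M (ct Y \<rho>) w w \<Longrightarrow> M (ct Y \<rho>) (sdeg w) (sdeg (sap (vs u \<rho>) w))"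
  shows "jm G r (htpy Y (wk Y) u (idfun Y))"
  unfolding htpy_def
proof (rule tms_piI[OF Y])
  note yY = jty_wk[OF Y Y] and i = t_idfun[OF Y] and G = jtyD(1)[OF Y]
  show "jt (Y # G) (Eq (wk Y) (App (wk Y) (wk1 (wk Y)) (wk u) (Var 0)) (App (wk Y) (wk1 (wk Y)) (wk (idfun Y)) (Var 0)))"
    by (rule j_eq[OF yY t_at[OF Y yY u] t_at[OF Y yY i]])
  fix \<rho> \<rho>' w w' assume cw: "cx (Y # G) (xc w \<rho>) (xc w' \<rho>')"
  then have c: "cx G \<rho> \<rho>'" and w: "M (ct Y \<rho>) w w'" unfolding cx_xc by auto
  note c1 = cx_refl(1)[OF G c]
  note t = tysD[OF jtyD(2)[OF Y] c]
  note w1 = M_refl(1)[OF t w] and d = M_deg[OF t w]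
  have idf: "sap (vs (idfun Y) \<rho>) w = w" by (simp add: idfun_def)
  have uw: "M (ct Y \<rho>) (sap (vs u \<rho>) w) (sap (vs u \<rho>) w)" by (rule M_arr[OF Y Y c1 tmsD[OF jtmD(3)[OF u] c1] w1])
  have v: "vs (App (wk Y) (wk1 (wk Y)) (wk u) (Var 0)) (xc w \<rho>) = sap (vs u \<rho>) w"
    "vs (App (wk Y) (wk1 (wk Y)) (wk (idfun Y)) (Var 0)) (xc w \<rho>) = w"
    using idf by (simp_all only: vs_simps wk_simps)
  have e: "e0 (\<lambda>e. dbl (dbl (p1 (w e)))) = sdeg w" "e1 (\<lambda>e. dbl (dbl (p1 (w e)))) = sdeg w" for w by (simp_all add: seq_defs)
  note H = H[OF c1 w1]
  show "M (ct (Eq (wk Y) (App (wk Y) (wk1 (wk Y)) (wk u) (Var 0)) (App (wk Y) (wk1 (wk Y)) (wk (idfun Y)) (Var 0))) (xc w \<rho>)) (sap (vs r \<rho>) w) (sap (vs r \<rho>') w')"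
    unfolding ct_simps v wk_simps M_eq[OF t uw w1] r e jn_dia[of "sdeg _"]
    using H M_refl(1)[OF t d] M_trans[OF t M_sym[OF t d] H] M_sym[OF t d] M_reindex[OF t d, of dia] by simp
qed

definition axb :: "dom \<Rightarrow> dom \<Rightarrow> dom" where
  "axb A B = pr (pr (lam (iso_path A B)) reflD) (pr (lam (iso_path A B)) reflD)"

lemma app_axD: "app (app (app axD x) y) z = axb y z"
proof -
  have 1: "cont (\<lambda>A. lam (\<lambda>B. axb A B))" "cont (\<lambda>I. lam (\<lambda>A. lam (\<lambda>B. axb A B)))" "cont (\<lambda>B. axb A B)" for A
    unfolding axb_def by (intro cont_intros cont_iso_path)+
  have a: "axD = lam (\<lambda>I. lam (\<lambda>A. lam (\<lambda>B. axb A B)))" by (simp add: axD_def axb_def)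
  show ?thesis unfolding a beta[OF 1(2)] beta[OF 1(1)] beta[OF 1(3)] ..
qed

lemma cont_iso_path1: "cont (iso_path A B)"
  using cont_iso_path[of "\<lambda>_. A" "\<lambda>_. B" "\<lambda>x. x"] by (simp add: cont_intros)

lemma app_reflD: "app reflD w = dbl (p1 w)"
  unfolding reflD_def by (rule beta) (intro cont_intros cont_W)

context famcat
begin

text \<open>The annotations are placeholders: the value of an application is computed from the
  function and its argument.\<close>

abbreviation "ax \<equiv> App One One (App One One (App One One (Axm FamCUA_U) I) A) B"

lemma vs_ax: "vs ax \<rho> = (\<lambda>n. pr (axb (deg (vs A \<rho> n)) (deg (vs B \<rho> n))) (axb (vs A \<rho> n) (vs B \<rho> n)))"
  by (rule ext, rule dom_eqI) (simp_all add: sap_def app_axD, simp_all add: vs_def app_axD)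

lemma ax_parts:
  "sap (sfst (sfst (vs ax \<rho>))) w = path (vs A \<rho>) (vs B \<rho>) w" "sap (sfst (ssnd (vs ax \<rho>))) w = path (vs A \<rho>) (vs B \<rho>) w"
  "sap (ssnd (sfst (vs ax \<rho>))) w = (\<lambda>e. dbl (dbl (p1 (w e))))" "sap (ssnd (ssnd (vs ax \<rho>))) w = (\<lambda>e. dbl (dbl (p1 (w e))))"
  unfolding vs_ax
  by (rule ext, rule dom_eqI; simp add: sap_def sfst_def ssnd_def axb_def path_def beta cont_iso_path1 app_reflD)+

lemma t_path: "(\<And>\<rho> w. sap (vs t \<rho>) w = path (vs A \<rho>) (vs B \<rho>) w) \<Longrightarrow> jm G t (arr Y X)"
  by (rule tms_piI[OF jY jty_wk[OF jX jY]]) (simp only: wk_simps cx_xc, rule path_type, blast+)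

lemma sap_comp: "sap (vs (comp A' B' C' g f) \<rho>) w = sap (vs g \<rho>) (sap (vs f \<rho>) w)"
  by (simp add: comp_def)

text \<open>The same map \<open>iso_path\<close> serves as section and as retraction, and the
  constant paths as both homotopies: \<open>K_path\<close> supplies one round trip and
  \<open>path_K\<close> the other.\<close>

lemma is_equiv_ax: "jm G ax (is_equiv X Y K)"
proof -
  let ?b1 = "htpy (wk Y) (wk (wk Y)) (comp (wk Y) (wk X) (wk Y) (wk K) (Var 0)) (idfun (wk Y))"
  let ?b2 = "htpy (wk X) (wk (wk X)) (comp (wk X) (wk Y) (wk X) (Var 0) (wk K)) (idfun (wk X))"
  let ?S = "Sig (arr Y X) ?b1" and ?R = "Sig (arr Y X) ?b2"
  note YX = t_arr[OF jY jX] and b = t_sec[OF jX jY jK]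
  have S: "jt G ?S" by (rule j_sig[OF YX b(1)])
  have R: "jt G ?R" by (rule j_sig[OF YX b(2)])
  have tS: "jm G t ?S" if t1: "\<And>\<rho>. sfst (vs t \<rho>) = sfst (sfst (vs ax \<rho>))" and t2: "\<And>\<rho>. ssnd (vs t \<rho>) = ssnd (sfst (vs ax \<rho>))" for t
  proof -
    let ?i = "Proj1 (arr Y X) ?b1 t"
    have i: "jm G ?i (arr Y X)" by (rule t_path) (simp only: vs_simps(6,7) t1 ax_parts)
    have h: "jm G (Proj2 (arr Y X) ?b1 t) (htpy Y (wk Y) (comp Y X Y K ?i) (idfun Y))"
    proof (rule htpy_idI[OF jY t_comp[OF jY jX jY jK i]], unfold vs_simps(6,7) t2 ax_parts, rule refl)
      fix \<rho> w assume c: "cx G \<rho> \<rho>" and w: "M (ct Y \<rho>) w w"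
      show "M (ct Y \<rho>) (sdeg w) (sdeg (sap (vs (comp Y X Y K ?i) \<rho>) w))"
        using K_path[OF c w] unfolding sap_comp vs_simps(6,7) t1 ax_parts .
    qed
    show ?thesis
      by (rule jm_sigI[OF YX b(1) i jtm_cong[OF h]]) (rule ext, simp add: cl_rules htpy_def comp_def idfun_def)
  qed
  have tR: "jm G t ?R" if t1: "\<And>\<rho>. sfst (vs t \<rho>) = sfst (ssnd (vs ax \<rho>))" and t2: "\<And>\<rho>. ssnd (vs t \<rho>) = ssnd (ssnd (vs ax \<rho>))" for t
  proof -
    let ?i = "Proj1 (arr Y X) ?b2 t"
    have i: "jm G ?i (arr Y X)" by (rule t_path) (simp only: vs_simps(6,7) t1 ax_parts)
    have h: "jm G (Proj2 (arr Y X) ?b2 t) (htpy X (wk X) (comp X Y X ?i K) (idfun X))"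
    proof (rule htpy_idI[OF jX t_comp[OF jX jY jX i jK]], unfold vs_simps(6,7) t2 ax_parts, rule refl)
      fix \<rho> w assume c: "cx G \<rho> \<rho>" and w: "M (ct X \<rho>) w w"
      show "M (ct X \<rho>) (sdeg w) (sdeg (sap (vs (comp X Y X ?i K) \<rho>) w))"
        using path_K[OF c w] unfolding sap_comp vs_simps(6,7) t1 ax_parts .
    qed
    show ?thesis
      by (rule jm_sigI[OF YX b(2) i jtm_cong[OF h]]) (rule ext, simp add: cl_rules htpy_def comp_def idfun_def)
  qed
  have p: "jm G (Proj1 ?S (wk ?R) ax) ?S" by (rule tS) (simp_all only: vs_simps)
  have q: "jm G (Proj2 ?S (wk ?R) ax) ?R" by (rule tR) (simp_all only: vs_simps)
  show ?thesis unfolding is_equiv_def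
    by (rule jm_sigI[OF S jty_wk[OF R S] p jtm_cong[OF q]]) (rule ext, simp only: inst_def cl_sub cl_ren case_val, simp add: val_eqs)
qed

end

lemma jm_piI:
  assumes A: "jt G A" and f: "jm (A # G) (App C D (wk f) (Var 0)) B" shows "jm G f (Pi A B)"
  by (rule tms_piI[OF A jtmD(4)[OF f]]) (drule tmsD[OF jtmD(3)[OF f]], simp only: vs_simps wk_simps)

lemma FamCUA_axiom: "jm [] (Axm FamCUA_U) FamCUA_U"
proof -
  let ?a = "Axm FamCUA_U"
  note cr = cl_rules numeral_eq_Suc
  have U: "jt [] Univ" by (rule j_univ_ty) simp
  note w1 = t_ctx[OF U]
  have var: "jm G (Var i) A" if "wfc G" "i < length G" "cl (ren (\<lambda>n. n + Suc i) (G ! i)) = cl A" for G i A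
    using jtm_cong[OF j_var[OF that(1,2)] that(3)] .
  let ?T2 = "arr (Var 0) Univ" let ?G2 = "[?T2, Univ]"
  let ?T3 = "arr (Var (Suc 0)) Univ" let ?G3 = "[?T3, ?T2, Univ]"
  have T2: "jt [Univ] ?T2" by (rule t_arr[OF j_el[OF var[OF w1]] j_univ_ty[OF w1]]) simp_all
  note w2 = t_ctx[OF T2]
  have T3: "jt ?G2 ?T3" by (rule t_arr[OF j_el[OF var[OF w2]] j_univ_ty[OF w2]]) simp_all
  note w3 = t_ctx[OF T3]
  interpret famcat ?G3 "Var (Suc (Suc 0))" "Var (Suc 0)" "Var 0"
    by unfold_locales (rule var[OF w3], simp, rule ext, simp add: cr)+
  let ?E = "is_equiv X Y K"
  have 3: "jm ?G2 (App One One (App One One ?a (Var (Suc 0))) (Var 0)) (Pi ?T3 ?E)"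
    by (rule jm_piI[OF T3]) (use is_equiv_ax in simp)
  have 2: "jm [Univ] (App One One ?a (Var 0)) (Pi ?T2 (Pi ?T3 ?E))"
    by (rule jm_piI[OF T2]) (use 3 in simp)
  have "jm [] ?a (Pi Univ (Pi ?T2 (Pi ?T3 ?E)))"
    by (rule jm_piI[OF U]) (use 2 in simp)
  then show ?thesis by (simp add: FamCUA_U_def Let_def numeral_eq_Suc)
qed

theorem theorem5p5:
  shows "\<not> provable {FamCUA_U} FE_U"
proof
  assume "provable {FamCUA_U} FE_U"
  then obtain t where t: "{FamCUA_U} \<rhd> [] \<turnstile> t \<Colon> FE_U" unfolding provable_def by blast
  have "jm [] t FE_U"
    by (rule soundness(4)[OF _ t]) (use jtmD(3)[OF FamCUA_axiom] in simp)
  then show False by (rule not_FE_U)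
qed

end
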